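(* Let $(M^n,g)$ be a spin Riemannian manifold of dimension $n$, $H$ a real 3-form on $M^n$, $k_1,k_2\in\mathbb{C}$, and $\hat\nabla_X=\nabla_X+k_1\,\mathrm{cl}(H)\cdot\mathrm{cl}(X)+k_2\,\mathrm{cl}(i_XH)$. Let $\epsilon$ be a spinor with $\hat\nabla\epsilon=0$, and define $$\chi_p(X_1,\dots,X_p)=\frac{i^{[p/2]}}{p!}\sum_\sigma(-1)^{|\sigma|}\langle\epsilon,\mathrm{cl}(X_{\sigma(1)})\cdot\mathrm{cl}(X_{\sigma(2)})\cdots\mathrm{cl}(X_{\sigma(p)})\epsilon\rangle .$$ Then the forms $\chi_p$ form a covariant form hierarchy twisted with $H$, described for every $p$ and every vector field $Y$ by $$\begin{aligned} &\nabla_Y\chi_p+4\,\mathrm{Im}(k_2+6k_1)\,i_YH\vee\chi_{p+2}-4\,\mathrm{Re}(k_2+6k_1)\,i_{i_YH}\chi_p+4\,\mathrm{Im}(k_2+6k_1)\,i_YH\wedge\chi_{p-2}\\ &=\frac1{p+1}\,i_Y\Big(d\chi_p+4\,\mathrm{Im}(k_2+6k_1)\,i^\dagger_H\chi_{p+2}+8\,\mathrm{Re}(k_2+6k_1)\,i_H\chi_p+12\,\mathrm{Im}(k_2+6k_1)\,H\wedge\chi_{p-2}\Big)\\ &\quad-\frac1{n-p+1}\,\alpha_Y\wedge\Big(\delta\chi_p-12\,\mathrm{Im}(k_2+6k_1)\,H\vee\chi_{p+2}+8\,\mathrm{Re}(k_2+6k_1)\,i^\dagger_H\chi_p-4\,\mathrm{Im}(k_2+6k_1)\,i_H\chi_{p-2}\Big).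 \end{aligned}$$
   Context: $\nabla$ is the Levi-Civita connection, also acting on sections of the complex spinor bundle $S$. Clifford conventions: $\mathrm{cl}(X)$ denotes Clifford multiplication by $X$, $\mathrm{cl}(X)\cdot\mathrm{cl}(Y)+\mathrm{cl}(Y)\cdot\mathrm{cl}(X)=2g(X,Y)1$; $S$ carries a pointwise Spin-invariant Hermitian inner product $\langle\cdot,\cdot\rangle$ (linear in the second slot) with $\langle\mathrm{cl}(X)\eta,\epsilon\rangle=\langle\eta,\mathrm{cl}(X)\epsilon\rangle$ for real $X$. With orthonormal coframe $e^i$ and Clifford elements $\Gamma^i$: $\mathrm{cl}(H)=H_{ijk}\Gamma^i\Gamma^j\Gamma^k$, $\mathrm{cl}(i_XH)=X^iH_{ijk}\Gamma^j\Gamma^k$ (for $H=\frac1{3!}H_{ijk}e^i\wedge e^j\wedge e^k$). The sum defining $\chi_p$ is over permutations $\sigma$ with sign $(-1)^{|\sigma|}$; $[\cdot]$ is the integer part; forms of degree outside $0,\dots,n$ are zero. $\alpha_Y(X)=g(Y,X)$. $\delta$ is the formal adjoint of $d$ ($(\delta\chi)_{i_2\dots i_p}=-\nabla^{i_1}\chi_{i_1i_2\dots i_p}$). For an $\ell$-form $\chi$ and a $p$-form $\omega$, $$i_\chi\omega=\frac{p}{p!(\ell-1)!}\chi^k{}_{i_1\dots i_{\ell-1}}\omega_{ki_\ell\dots i_{p+\ell-2}}e^{i_1}\wedge\dots\wedge e^{i_{p+\ell-2}}.$$ The pointwise inner product of $p$-forms is $\langle\chi,\omega\rangle=\frac1{p!}\chi_{i_1\dots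 i_p}\omega^{i_1\dots i_p}$. The adjoint $i^\dagger_\chi$ is defined by $\langle\phi,i_\chi^\dagger\omega\rangle=\langle i_\chi\phi,\omega\rangle$ for all forms $\phi$ of the appropriate degree, and $\vee$ is the adjoint of $\wedge$: $\langle\phi,\omega\vee\chi\rangle=\langle\omega\wedge\phi,\chi\rangle$ for all $\phi$ (zero if $\deg\chi<\deg\omega$). Definition: a covariant form hierarchy twisted with a multi-form $F$ is a collection of forms $\chi_p$ satisfying $\nabla^F_Y(\{\chi_p\})=i_Y\mathcal P(F,\{\chi_p\})+\alpha_Y\wedge\mathcal Q(F,\{\chi_p\})$, where $\mathcal P,\mathcal Q$ are form-valued and depend on $F$ and $\{\chi_p\}$, and $\nabla^F$ is a (not necessarily degree preserving) connection on (sums of copies of) $\Lambda^*(M)$ built from the Levi-Civita connection and $F$. Here $F=H$. *)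

theory Defs
  imports "HOL-Analysis.Analysis" "HOL-Combinatorics.Permutations"
begin

section \<open>Smooth manifolds\<close>

text \<open>The derivative is taken at interior points, so the predicates below are used on open sets only.\<close>

fun Ck_on :: "nat \<Rightarrow> 'a::real_normed_vector set \<Rightarrow> ('a \<Rightarrow> 'b::real_normed_vector) \<Rightarrow> bool" where
  "Ck_on 0 S f \<longleftrightarrow> continuous_on S f"
| "Ck_on (Suc k) S f \<longleftrightarrow>
     (\<forall>x\<in>S. f differentiable (at x)) \<and> (\<forall>v. Ck_on k S (\<lambda>x. frechet_derivative f (at x) v))"

definition smooth_on :: "'a::real_normed_vector set \<Rightarrow> ('a \<Rightarrow> 'b::real_normed_vector) \<Rightarrow> bool" where
  "smooth_on S f \<longleftrightarrow> (\<forall>k. Ck_on k S f)"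

text \<open>The manifold is the whole type \<open>'m\<close>; its dimension is \<open>n = CARD('n)\<close>. A chart is a pair of
  a domain and a coordinate map, whose values outside the domain are irrelevant.\<close>

type_synonym ('m, 'n) chart = "'m set \<times> ('m \<Rightarrow> real ^ 'n)"

definition in_chart :: "('m, 'n::finite) chart \<Rightarrow> ('m \<Rightarrow> 'b) \<Rightarrow> real ^ 'n \<Rightarrow> 'b" where
  "in_chart c f = f \<circ> inv_into (fst c) (snd c)"

definition smooth_in :: "('m, 'n::finite) chart \<Rightarrow> 'm set \<Rightarrow> ('m \<Rightarrow> 'b::real_normed_vector) \<Rightarrow> bool" where
  "smooth_in c W f \<longleftrightarrow> smooth_on (snd c ` (W \<inter> fst c)) (in_chart c f)"

definition deriv_in :: "('m, 'n::finite) chart \<Rightarrow> ('m \<Rightarrow> 'b::real_normed_vector) \<Rightarrow> 'm \<Rightarrow> real ^ 'n \<Rightarrow> 'b" where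
  "deriv_in c f x v = frechet_derivative (in_chart c f) (at (snd c x)) v"

definition smooth_atlas ::
  "('m::{t2_space, second_countable_topology}, 'n::finite) chart set \<Rightarrow> bool" where
  "smooth_atlas A \<longleftrightarrow>
     (\<Union>c\<in>A. fst c) = UNIV \<and>
     (\<forall>c\<in>A. open (fst c) \<and> open (snd c ` fst c) \<and>
        homeomorphism (fst c) (snd c ` fst c) (snd c) (inv_into (fst c) (snd c))) \<and>
     (\<forall>c\<in>A. \<forall>c'\<in>A. smooth_in c (fst c') (snd c'))"

definition jacobian :: "('m, 'n::finite) chart \<Rightarrow> ('m, 'n) chart \<Rightarrow> 'm \<Rightarrow> real ^ 'n \<Rightarrow> real ^ 'n" where
  "jacobian c c' x = deriv_in c (snd c') x"

definition smooth_function ::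
  "('m, 'n::finite) chart set \<Rightarrow> ('m \<Rightarrow> 'b::real_normed_vector) \<Rightarrow> bool" where
  "smooth_function A f \<longleftrightarrow> (\<forall>c\<in>A. smooth_in c UNIV f)"

text \<open>Tensor fields are families of components, one for each chart, related by the Jacobians of the
  changes of coordinates; \<open>X c x\<close> is relevant for \<open>x\<close> in the domain of \<open>c\<close> only.\<close>

type_synonym ('m, 'n) vfield = "('m, 'n) chart \<Rightarrow> 'm \<Rightarrow> real ^ 'n"

definition vector_field_on ::
  "('m, 'n::finite) chart set \<Rightarrow> 'm set \<Rightarrow> ('m, 'n) vfield \<Rightarrow> bool" where
  "vector_field_on A W X \<longleftrightarrow>
     (\<forall>c\<in>A. smooth_in c W (X c)) \<and>
     (\<forall>c\<in>A. \<forall>c'\<in>A. \<forall>x\<in>W \<inter> fst c \<inter> fst c'. X c' x = jacobian c c' x (X c x))"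

abbreviation vector_field :: "('m, 'n::finite) chart set \<Rightarrow> ('m, 'n) vfield \<Rightarrow> bool" where
  "vector_field A X \<equiv> vector_field_on A UNIV X"

definition bil :: "real ^ 'n ^ 'n \<Rightarrow> real ^ 'n::finite \<Rightarrow> real ^ 'n \<Rightarrow> real" where
  "bil G u v = (\<Sum>i\<in>UNIV. \<Sum>j\<in>UNIV. G $ i $ j * u $ i * v $ j)"

type_synonym ('m, 'n) metric = "('m, 'n) chart \<Rightarrow> 'm \<Rightarrow> real ^ 'n ^ 'n"

definition riemannian_metric :: "('m, 'n::finite) chart set \<Rightarrow> ('m, 'n) metric \<Rightarrow> bool" where
  "riemannian_metric A g \<longleftrightarrow>
     (\<forall>c\<in>A. smooth_in c UNIV (g c)) \<and>
     (\<forall>c\<in>A. \<forall>x\<in>fst c. (\<forall>u v. bil (g c x) u v = bil (g c x) v u) \<and>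
                         (\<forall>v. v \<noteq> 0 \<longrightarrow> bil (g c x) v v > 0)) \<and>
     (\<forall>c\<in>A. \<forall>c'\<in>A. \<forall>x\<in>fst c \<inter> fst c'. \<forall>u v.
        bil (g c x) u v = bil (g c' x) (jacobian c c' x u) (jacobian c c' x v))"


section \<open>Exterior algebra of a Euclidean vector space\<close>

text \<open>Forms at a point are complex valued (a real form is one with real values). A \<open>p\<close>-form is a
  function on lists of vectors that vanishes on lists of length other than \<open>p\<close>; with this
  normalisation there is a single zero form in all degrees. The inner product of the vector space
  has Gram matrix \<open>G\<close> in the coordinate basis, and it is extended to complex forms bilinearly.\<close>

type_synonym 'n aform = "(real ^ 'n) list \<Rightarrow> complex"

definition alt_form :: "nat \<Rightarrow> 'n::finite aform \<Rightarrow> bool" where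
  "alt_form p \<omega> \<longleftrightarrow>
     (\<forall>vs. length vs \<noteq> p \<longrightarrow> \<omega> vs = 0) \<and>
     (\<forall>vs i. length vs = p \<longrightarrow> i < p \<longrightarrow> linear (\<lambda>v. \<omega> (vs[i := v]))) \<and>
     (\<forall>vs i j. length vs = p \<longrightarrow> i < j \<longrightarrow> j < p \<longrightarrow> vs ! i = vs ! j \<longrightarrow> \<omega> vs = 0)"

definition idx :: "nat \<Rightarrow> 'n::finite list set" where
  "idx p = {is. length is = p}"

definition component :: "'n::finite aform \<Rightarrow> 'n list \<Rightarrow> complex" where
  "component \<omega> is = \<omega> (map (\<lambda>i. axis i 1) is)"

definition basis_form :: "'n::finite list \<Rightarrow> 'n aform" where
  \<comment> \<open>\<open>e\<^sup>i\<^sup>1 \<and> \<dots> \<and> e\<^sup>i\<^sup>m\<close>, with the convention that it takes the value 1 on \<open>(e\<^sub>i\<^sub>1, \<dots>, e\<^sub>i\<^sub>m)\<close>\<close>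
  "basis_form is vs = (if length vs = length is
     then (\<Sum>\<sigma> | \<sigma> permutes {..<length is}.
             of_int (sign \<sigma>) * of_real (\<Prod>k<length is. vs ! \<sigma> k $ (is ! k)))
     else 0)"

definition contract :: "real ^ 'n \<Rightarrow> 'n::finite aform \<Rightarrow> 'n aform" where
  "contract v \<omega> vs = \<omega> (v # vs)"

definition wedge :: "nat \<Rightarrow> nat \<Rightarrow> 'n::finite aform \<Rightarrow> 'n aform \<Rightarrow> 'n aform" where
  "wedge k q \<omega> chi vs = (if length vs = k + q
     then (\<Sum>\<sigma> | \<sigma> permutes {..<k + q}. of_int (sign \<sigma>) *
             \<omega> (take k (permute_list \<sigma> vs)) * chi (drop k (permute_list \<sigma> vs))) / (fact k * fact q)
     else 0)"

definition lower :: "real ^ 'n ^ 'n \<Rightarrow> real ^ 'n \<Rightarrow> 'n::finite aform" where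
  \<comment> \<open>the 1-form \<open>\<alpha>\<^sub>Y\<close>\<close>
  "lower G Y vs = (case vs of [v] \<Rightarrow> of_real (bil G Y v) | _ \<Rightarrow> 0)"

definition form_inner :: "real ^ 'n ^ 'n \<Rightarrow> nat \<Rightarrow> 'n::finite aform \<Rightarrow> 'n aform \<Rightarrow> complex" where
  "form_inner G p chi \<omega> = (\<Sum>is\<in>idx p. \<Sum>js\<in>idx p.
     of_real (\<Prod>k<p. matrix_inv G $ (is ! k) $ (js ! k)) * component chi is * component \<omega> js) / fact p"

definition int_form :: "real ^ 'n ^ 'n \<Rightarrow> nat \<Rightarrow> nat \<Rightarrow> 'n::finite aform \<Rightarrow> 'n aform \<Rightarrow> 'n aform" where
  \<comment> \<open>\<open>i\<^sub>\<chi> \<omega>\<close> for an \<open>l\<close>-form \<open>\<chi>\<close>, \<open>l \<ge> 2\<close>, and a \<open>p\<close>-form \<open>\<omega>\<close>; it is zero for \<open>p = 0\<close>\<close>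
  "int_form G l p chi \<omega> vs =
     of_nat p / (fact p * fact (l - 1)) *
     (\<Sum>is\<in>idx (p + l - 2).
        (\<Sum>k\<in>UNIV. \<Sum>m\<in>UNIV. of_real (matrix_inv G $ k $ m) *
           component chi (m # take (l - 1) is) * component \<omega> (k # drop (l - 1) is)) * basis_form is vs)"

text \<open>The adjoints are specified by their defining property, which determines them because the
  pairing of forms is nondegenerate.\<close>

definition int_form_adj :: "real ^ 'n ^ 'n \<Rightarrow> nat \<Rightarrow> nat \<Rightarrow> 'n::finite aform \<Rightarrow> 'n aform \<Rightarrow> 'n aform" where
  \<comment> \<open>\<open>i\<^sup>\<dagger>\<^sub>\<chi> \<omega>\<close> for an \<open>l\<close>-form \<open>\<chi>\<close> and an \<open>r\<close>-form \<open>\<omega>\<close>\<close>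
  "int_form_adj G l r chi \<omega> = (if r + 2 < l then (\<lambda>vs. 0)
     else (THE \<psi>. alt_form (r + 2 - l) \<psi> \<and>
             (\<forall>\<phi>. alt_form (r + 2 - l) \<phi> \<longrightarrow>
                form_inner G (r + 2 - l) \<phi> \<psi> = form_inner G r (int_form G l (r + 2 - l) chi \<phi>) \<omega>)))"

definition vee :: "real ^ 'n ^ 'n \<Rightarrow> nat \<Rightarrow> nat \<Rightarrow> 'n::finite aform \<Rightarrow> 'n aform \<Rightarrow> 'n aform" where
  \<comment> \<open>\<open>\<omega> \<or> \<chi>\<close> for a \<open>k\<close>-form \<open>\<omega>\<close> and a \<open>q\<close>-form \<open>\<chi>\<close>\<close>
  "vee G k q \<omega> chi = (if q < k then (\<lambda>vs. 0)
     else (THE \<psi>. alt_form (q - k) \<psi> \<and>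
             (\<forall>\<phi>. alt_form (q - k) \<phi> \<longrightarrow>
                form_inner G (q - k) \<phi> \<psi> = form_inner G q (wedge k (q - k) \<omega> \<phi>) chi)))"


section \<open>Differential forms\<close>

type_synonym ('m, 'n) form = "('m, 'n) chart \<Rightarrow> 'm \<Rightarrow> 'n aform"

definition is_form :: "('m, 'n::finite) chart set \<Rightarrow> nat \<Rightarrow> ('m, 'n) form \<Rightarrow> bool" where
  "is_form A p \<omega> \<longleftrightarrow>
     (\<forall>c\<in>A. \<forall>x\<in>fst c. alt_form p (\<omega> c x)) \<and>
     (\<forall>c\<in>A. \<forall>vs. smooth_in c UNIV (\<lambda>x. \<omega> c x vs)) \<and>
     (\<forall>c\<in>A. \<forall>c'\<in>A. \<forall>x\<in>fst c \<inter> fst c'. \<forall>vs. \<omega> c x vs = \<omega> c' x (map (jacobian c c' x) vs))"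

definition is_real_form :: "('m, 'n::finite) chart set \<Rightarrow> nat \<Rightarrow> ('m, 'n) form \<Rightarrow> bool" where
  "is_real_form A p \<omega> \<longleftrightarrow> is_form A p \<omega> \<and> (\<forall>c\<in>A. \<forall>x\<in>fst c. \<forall>vs. \<omega> c x vs \<in> \<real>)"

definition ext_d :: "('m, 'n::finite) form \<Rightarrow> ('m, 'n) form" where
  "ext_d chi c x vs = (\<Sum>j<length vs.
     (- 1) ^ j * deriv_in c (\<lambda>y. chi c y (take j vs @ drop (Suc j) vs)) x (vs ! j))"

definition christoffel :: "('m, 'n::finite) metric \<Rightarrow> ('m, 'n) chart \<Rightarrow> 'm \<Rightarrow> real ^ 'n \<Rightarrow> real ^ 'n \<Rightarrow> real ^ 'n" where
  \<comment> \<open>the vector with components \<open>\<Gamma>\<^sup>l\<^sub>k\<^sub>i u\<^sup>k v\<^sup>i\<close> for the Levi-Civita connection\<close>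
  "christoffel g c x u v = (\<chi> l. \<Sum>k\<in>UNIV. \<Sum>i\<in>UNIV. \<Sum>m\<in>UNIV.
     1 / 2 * matrix_inv (g c x) $ l $ m *
       (deriv_in c (\<lambda>y. g c y $ m $ i) x (axis k 1)
        + deriv_in c (\<lambda>y. g c y $ m $ k) x (axis i 1)
        - deriv_in c (\<lambda>y. g c y $ k $ i) x (axis m 1)) * u $ k * v $ i)"

definition nabla_vec :: "('m, 'n::finite) metric \<Rightarrow> ('m, 'n) chart \<Rightarrow> 'm \<Rightarrow> real ^ 'n \<Rightarrow> ('m, 'n) vfield \<Rightarrow> real ^ 'n" where
  "nabla_vec g c x v X = deriv_in c (X c) x v + christoffel g c x v (X c x)"

definition nabla_form :: "('m, 'n::finite) metric \<Rightarrow> ('m, 'n) chart \<Rightarrow> 'm \<Rightarrow> real ^ 'n \<Rightarrow> ('m, 'n) form \<Rightarrow> 'n aform" where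
  "nabla_form g c x v chi vs = deriv_in c (\<lambda>y. chi c y vs) x v
     - (\<Sum>j<length vs. chi c x (vs[j := christoffel g c x v (vs ! j)]))"

definition codiff :: "('m, 'n::finite) metric \<Rightarrow> ('m, 'n) form \<Rightarrow> ('m, 'n) form" where
  "codiff g chi c x vs = - (\<Sum>j\<in>UNIV. \<Sum>k\<in>UNIV.
     of_real (matrix_inv (g c x) $ j $ k) * nabla_form g c x (axis j 1) chi (axis k 1 # vs))"


section \<open>Covariant form hierarchies\<close>

text \<open>A multi-form is given by its homogeneous components, indexed by the degree.\<close>

type_synonym ('m, 'n) mform = "nat \<Rightarrow> ('m, 'n) form"

definition multi_form :: "('m, 'n::finite) chart set \<Rightarrow> ('m, 'n) mform \<Rightarrow> bool" where
  "multi_form A \<phi> \<longleftrightarrow> (\<forall>p. is_form A p (\<phi> p))"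

definition form_connection ::
  "('m, 'n::finite) chart set \<Rightarrow> (('m, 'n) vfield \<Rightarrow> ('m, 'n) mform \<Rightarrow> ('m, 'n) mform) \<Rightarrow> bool" where
  "form_connection A D \<longleftrightarrow>
     (\<forall>Y \<phi>. vector_field A Y \<longrightarrow> multi_form A \<phi> \<longrightarrow> multi_form A (D Y \<phi>)) \<and>
     (\<forall>Y \<phi> \<psi>. vector_field A Y \<longrightarrow> multi_form A \<phi> \<longrightarrow> multi_form A \<psi> \<longrightarrow>
        (\<forall>c\<in>A. \<forall>x\<in>fst c. \<forall>p vs.
           D Y (\<lambda>p c x vs. \<phi> p c x vs + \<psi> p c x vs) p c x vs = D Y \<phi> p c x vs + D Y \<psi> p c x vs)) \<and>
     (\<forall>Y \<phi> f. vector_field A Y \<longrightarrow> multi_form A \<phi> \<longrightarrow> smooth_function A (f :: 'm \<Rightarrow> complex) \<longrightarrow>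
        (\<forall>c\<in>A. \<forall>x\<in>fst c. \<forall>p vs.
           D Y (\<lambda>p c x vs. f x * \<phi> p c x vs) p c x vs
             = deriv_in c f x (Y c x) * \<phi> p c x vs + f x * D Y \<phi> p c x vs)) \<and>
     (\<forall>Y Z \<phi> h. vector_field A Y \<longrightarrow> vector_field A Z \<longrightarrow> multi_form A \<phi> \<longrightarrow>
        smooth_function A (h :: 'm \<Rightarrow> real) \<longrightarrow>
        (\<forall>c\<in>A. \<forall>x\<in>fst c. \<forall>p vs.
           D (\<lambda>c x. h x *\<^sub>R Y c x + Z c x) \<phi> p c x vs
             = of_real (h x) * D Y \<phi> p c x vs + D Z \<phi> p c x vs))"

text \<open>In the equation of degree \<open>p\<close>, \<open>P F \<phi> p\<close> is the form of degree \<open>p + 1\<close> and \<open>Q F \<phi> p\<close> is the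
  form of degree \<open>p - 1\<close>; the latter is absent for \<open>p = 0\<close>.\<close>

definition covariant_form_hierarchy ::
  "('m, 'n::finite) chart set \<Rightarrow> ('m, 'n) metric \<Rightarrow> 'f \<Rightarrow>
   ('f \<Rightarrow> ('m, 'n) vfield \<Rightarrow> ('m, 'n) mform \<Rightarrow> ('m, 'n) mform) \<Rightarrow>
   ('f \<Rightarrow> ('m, 'n) mform \<Rightarrow> ('m, 'n) mform) \<Rightarrow>
   ('f \<Rightarrow> ('m, 'n) mform \<Rightarrow> ('m, 'n) mform) \<Rightarrow> ('m, 'n) mform \<Rightarrow> bool" where
  "covariant_form_hierarchy A g F D P Q chi \<longleftrightarrow>
     multi_form A chi \<and>
     form_connection A (D F) \<and>
     (\<forall>\<phi>. multi_form A \<phi> \<longrightarrow>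
        (\<forall>p. is_form A (Suc p) (P F \<phi> p)) \<and> (\<forall>p. is_form A p (Q F \<phi> (Suc p)))) \<and>
     (\<forall>Y. vector_field A Y \<longrightarrow> (\<forall>p. \<forall>c\<in>A. \<forall>x\<in>fst c. \<forall>vs.
        D F Y chi p c x vs =
          contract (Y c x) (P F chi p c x) vs +
          (if p = 0 then 0 else wedge 1 (p - 1) (lower (g c x) (Y c x)) (Q F chi p c x) vs)))"


section \<open>Spinors\<close>

definition herm :: "complex ^ 's \<Rightarrow> complex ^ 's::finite \<Rightarrow> complex" where
  "herm u v = (\<Sum>s\<in>UNIV. cnj (u $ s) * v $ s)"

text \<open>The Hermitian generators \<open>\<Gamma> i\<close> of an irreducible complex module of the Clifford algebra of
  \<open>\<real>\<^sup>n\<close>; irreducibility is the condition on the dimension.\<close>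

definition clifford_rep :: "('n::finite \<Rightarrow> complex ^ 's ^ 's::finite) \<Rightarrow> bool" where
  "clifford_rep \<Gamma> \<longleftrightarrow>
     CARD('s) = 2 ^ (CARD('n) div 2) \<and>
     (\<forall>i j. \<Gamma> i ** \<Gamma> j + \<Gamma> j ** \<Gamma> i = mat (if i = j then 2 else 0)) \<and>
     (\<forall>i u v. herm (\<Gamma> i *v u) v = herm u (\<Gamma> i *v v))"

definition cvec :: "('n::finite \<Rightarrow> complex ^ 's ^ 's::finite) \<Rightarrow> real ^ 'n \<Rightarrow> complex ^ 's ^ 's" where
  "cvec \<Gamma> w = (\<Sum>i\<in>UNIV. w $ i *\<^sub>R \<Gamma> i)"

text \<open>\<open>Spin(n)\<close>, consisting of the products of an even number of unit vectors; it acts faithfully on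
  the module.\<close>

definition spin_group :: "('n::finite \<Rightarrow> complex ^ 's ^ 's::finite) \<Rightarrow> (complex ^ 's ^ 's) set" where
  "spin_group \<Gamma> =
     {foldr (\<lambda>w M. cvec \<Gamma> w ** M) ws (mat 1) | ws. even (length ws) \<and> (\<forall>w\<in>set ws. norm w = 1)}"

type_synonym ('a, 'm, 'n) frames = "'a \<Rightarrow> 'n \<Rightarrow> ('m, 'n) vfield"

definition frame_coords ::
  "('m, 'n::finite) metric \<Rightarrow> ('a, 'm, 'n) frames \<Rightarrow> 'a \<Rightarrow> ('m, 'n) chart \<Rightarrow> 'm \<Rightarrow> real ^ 'n \<Rightarrow> real ^ 'n" where
  "frame_coords g E a c x v = (\<chi> i. bil (g c x) (E a i c x) v)"

text \<open>A spin structure, given by local trivialisations: orthonormal frames \<open>E a\<close> on an open cover \<open>U\<close>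
  indexed by \<open>I\<close>, and a cocycle \<open>t\<close> with values in \<open>Spin(n)\<close> that lifts the transition functions of
  the frames. The lift exists only if the latter take values in \<open>SO(n)\<close>, so the frames orient the
  manifold.\<close>

definition spin_structure ::
  "('m::{t2_space, second_countable_topology}, 'n::finite) chart set \<Rightarrow> ('m, 'n) metric \<Rightarrow>
   ('n \<Rightarrow> complex ^ 's ^ 's::finite) \<Rightarrow> 'a set \<Rightarrow> ('a \<Rightarrow> 'm set) \<Rightarrow> ('a, 'm, 'n) frames \<Rightarrow>
   ('a \<Rightarrow> 'a \<Rightarrow> 'm \<Rightarrow> complex ^ 's ^ 's) \<Rightarrow> bool" where
  "spin_structure A g \<Gamma> I U E t \<longleftrightarrow>
     (\<forall>a\<in>I. open (U a)) \<and> (\<Union>a\<in>I. U a) = UNIV \<and>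
     (\<forall>a\<in>I. \<forall>i. vector_field_on A (U a) (E a i)) \<and>
     (\<forall>a\<in>I. \<forall>c\<in>A. \<forall>x\<in>U a \<inter> fst c. \<forall>i j.
        bil (g c x) (E a i c x) (E a j c x) = (if i = j then 1 else 0)) \<and>
     (\<forall>a\<in>I. \<forall>b\<in>I. \<forall>c\<in>A. smooth_in c (U a \<inter> U b) (t a b)) \<and>
     (\<forall>a\<in>I. \<forall>b\<in>I. \<forall>x\<in>U a \<inter> U b. t a b x \<in> spin_group \<Gamma>) \<and>
     (\<forall>a\<in>I. \<forall>b\<in>I. \<forall>c\<in>A. \<forall>x\<in>U a \<inter> U b \<inter> fst c. \<forall>j.
        cvec \<Gamma> (frame_coords g E a c x (E b j c x)) ** t a b x = t a b x ** \<Gamma> j) \<and>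
     (\<forall>a\<in>I. \<forall>b\<in>I. \<forall>d\<in>I. \<forall>x\<in>U a \<inter> U b \<inter> U d. t a b x ** t b d x = t a d x)"

text \<open>Sections of the associated spinor bundle, given by their components in the trivialisations.\<close>

type_synonym ('a, 'm, 's) spinor = "'a \<Rightarrow> 'm \<Rightarrow> complex ^ 's"

definition spinor_field ::
  "('m, 'n::finite) chart set \<Rightarrow> 'a set \<Rightarrow> ('a \<Rightarrow> 'm set) \<Rightarrow> ('a \<Rightarrow> 'a \<Rightarrow> 'm \<Rightarrow> complex ^ 's ^ 's) \<Rightarrow>
   ('a, 'm, 's::finite) spinor \<Rightarrow> bool" where
  "spinor_field A I U t \<psi> \<longleftrightarrow>
     (\<forall>a\<in>I. \<forall>c\<in>A. smooth_in c (U a) (\<psi> a)) \<and>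
     (\<forall>a\<in>I. \<forall>b\<in>I. \<forall>x\<in>U a \<inter> U b. \<psi> a x = t a b x *v \<psi> b x)"

text \<open>The Levi-Civita connection on spinors is \<open>v(\<psi>) + 1/4 \<omega>\<^sub>i\<^sub>j(v) \<Gamma>\<^sup>i \<Gamma>\<^sup>j \<psi>\<close> with
  \<open>\<omega>\<^sub>i\<^sub>j(v) = g(E\<^sub>i, \<nabla>\<^sub>v E\<^sub>j)\<close>. The sign is fixed by the Clifford relation \<open>X Y + Y X = 2 g(X, Y)\<close> and the
  Leibniz rule for Clifford multiplication.\<close>

definition nabla_spin ::
  "('m, 'n::finite) metric \<Rightarrow> ('n \<Rightarrow> complex ^ 's ^ 's) \<Rightarrow> ('a, 'm, 'n) frames \<Rightarrow> 'a \<Rightarrow>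
   ('m, 'n) chart \<Rightarrow> 'm \<Rightarrow> real ^ 'n \<Rightarrow> ('a, 'm, 's::finite) spinor \<Rightarrow> complex ^ 's" where
  "nabla_spin g \<Gamma> E a c x v \<psi> = deriv_in c (\<psi> a) x v +
     (\<Sum>i\<in>UNIV. \<Sum>j\<in>UNIV. (1 / 4 * bil (g c x) (E a i c x) (nabla_vec g c x v (E a j))) *\<^sub>R
        (\<Gamma> i *v (\<Gamma> j *v \<psi> a x)))"

definition cl ::
  "('m, 'n::finite) metric \<Rightarrow> ('n \<Rightarrow> complex ^ 's ^ 's) \<Rightarrow> ('a, 'm, 'n) frames \<Rightarrow> 'a \<Rightarrow>
   ('m, 'n) chart \<Rightarrow> 'm \<Rightarrow> real ^ 'n \<Rightarrow> complex ^ 's \<Rightarrow> complex ^ 's::finite" where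
  "cl g \<Gamma> E a c x v \<eta> = cvec \<Gamma> (frame_coords g E a c x v) *v \<eta>"

text \<open>Clifford action of 2-forms and 3-forms, normalised as the full contraction of the components
  with products of the \<open>\<Gamma>\<close>'s, without factorials.\<close>

definition cl2 ::
  "('n::finite \<Rightarrow> complex ^ 's ^ 's) \<Rightarrow> ('a, 'm, 'n) frames \<Rightarrow> 'a \<Rightarrow>
   ('m, 'n) chart \<Rightarrow> 'm \<Rightarrow> 'n aform \<Rightarrow> complex ^ 's \<Rightarrow> complex ^ 's::finite" where
  "cl2 \<Gamma> E a c x \<omega> \<eta> = (\<Sum>j\<in>UNIV. \<Sum>k\<in>UNIV. \<omega> [E a j c x, E a k c x] *s (\<Gamma> j *v (\<Gamma> k *v \<eta>)))"

definition cl3 ::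
  "('n::finite \<Rightarrow> complex ^ 's ^ 's) \<Rightarrow> ('a, 'm, 'n) frames \<Rightarrow> 'a \<Rightarrow>
   ('m, 'n) chart \<Rightarrow> 'm \<Rightarrow> 'n aform \<Rightarrow> complex ^ 's \<Rightarrow> complex ^ 's::finite" where
  "cl3 \<Gamma> E a c x \<omega> \<eta> = (\<Sum>i\<in>UNIV. \<Sum>j\<in>UNIV. \<Sum>k\<in>UNIV.
     \<omega> [E a i c x, E a j c x, E a k c x] *s (\<Gamma> i *v (\<Gamma> j *v (\<Gamma> k *v \<eta>))))"

definition nabla_hat ::
  "('m, 'n::finite) metric \<Rightarrow> ('n \<Rightarrow> complex ^ 's ^ 's) \<Rightarrow> ('a, 'm, 'n) frames \<Rightarrow>
   complex \<Rightarrow> complex \<Rightarrow> ('m, 'n) form \<Rightarrow> 'a \<Rightarrow>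
   ('m, 'n) chart \<Rightarrow> 'm \<Rightarrow> real ^ 'n \<Rightarrow> ('a, 'm, 's::finite) spinor \<Rightarrow> complex ^ 's" where
  "nabla_hat g \<Gamma> E k1 k2 H a c x v \<psi> =
     nabla_spin g \<Gamma> E a c x v \<psi>
     + k1 *s cl3 \<Gamma> E a c x (H c x) (cl g \<Gamma> E a c x v (\<psi> a x))
     + k2 *s cl2 \<Gamma> E a c x (contract v (H c x)) (\<psi> a x)"

text \<open>The bilinears \<open>\<chi>\<^sub>p\<close>. The value does not depend on the trivialisation \<open>a\<close> in which it is computed,
  since the cocycle is unitary and intertwines the Clifford multiplications.\<close>

definition spinor_bilinear ::
  "('m, 'n::finite) metric \<Rightarrow> ('n \<Rightarrow> complex ^ 's ^ 's) \<Rightarrow> 'a set \<Rightarrow> ('a \<Rightarrow> 'm set) \<Rightarrow> ('a, 'm, 'n) frames \<Rightarrow>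
   ('a, 'm, 's::finite) spinor \<Rightarrow> ('m, 'n) mform" where
  "spinor_bilinear g \<Gamma> I U E \<epsilon> p c x vs = (if length vs = p
     then let a = (SOME a. a \<in> I \<and> x \<in> U a) in
       \<i> ^ (p div 2) / fact p *
       (\<Sum>\<sigma> | \<sigma> permutes {..<p}. of_int (sign \<sigma>) *
          herm (\<epsilon> a x) (foldr (cl g \<Gamma> E a c x) (permute_list \<sigma> vs) (\<epsilon> a x)))
     else 0)"


section \<open>The operators of the hierarchy\<close>

definition minus2 :: "('m, 'n::finite) mform \<Rightarrow> ('m, 'n) mform" where
  \<comment> \<open>\<open>\<phi>\<^sub>p\<^sub>-\<^sub>2\<close>, with \<open>\<phi>\<^sub>-\<^sub>1 = \<phi>\<^sub>-\<^sub>2 = 0\<close>\<close>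
  "minus2 \<phi> p = (if p < 2 then (\<lambda>c x vs. 0) else \<phi> (p - 2))"

definition hierarchy_nabla ::
  "('m, 'n::finite) metric \<Rightarrow> complex \<Rightarrow> ('m, 'n) form \<Rightarrow> ('m, 'n) vfield \<Rightarrow> ('m, 'n) mform \<Rightarrow> ('m, 'n) mform" where
  "hierarchy_nabla g \<kappa> H Y \<phi> p c x vs =
     nabla_form g c x (Y c x) (\<phi> p) vs
     + 4 * of_real (Im \<kappa>) * vee (g c x) 2 (p + 2) (contract (Y c x) (H c x)) (\<phi> (p + 2) c x) vs
     - 4 * of_real (Re \<kappa>) * int_form (g c x) 2 p (contract (Y c x) (H c x)) (\<phi> p c x) vs
     + 4 * of_real (Im \<kappa>) * wedge 2 (p - 2) (contract (Y c x) (H c x)) (minus2 \<phi> p c x) vs"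

definition hierarchy_P ::
  "('m, 'n::finite) metric \<Rightarrow> complex \<Rightarrow> ('m, 'n) form \<Rightarrow> ('m, 'n) mform \<Rightarrow> ('m, 'n) mform" where
  "hierarchy_P g \<kappa> H \<phi> p c x vs = 1 / (of_nat p + 1) *
     (ext_d (\<phi> p) c x vs
      + 4 * of_real (Im \<kappa>) * int_form_adj (g c x) 3 (p + 2) (H c x) (\<phi> (p + 2) c x) vs
      + 8 * of_real (Re \<kappa>) * int_form (g c x) 3 p (H c x) (\<phi> p c x) vs
      + 12 * of_real (Im \<kappa>) * wedge 3 (p - 2) (H c x) (minus2 \<phi> p c x) vs)"

text \<open>The prefactor has a vanishing denominator only for \<open>p = n + 1\<close>, where all forms in the equation
  of degree \<open>p\<close> are zero.\<close>

definition hierarchy_Q ::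
  "('m, 'n::finite) metric \<Rightarrow> complex \<Rightarrow> ('m, 'n) form \<Rightarrow> ('m, 'n) mform \<Rightarrow> ('m, 'n) mform" where
  "hierarchy_Q g \<kappa> H \<phi> p c x vs = - (1 / (of_nat CARD('n) - of_nat p + 1)) *
     (codiff g (\<phi> p) c x vs
      - 12 * of_real (Im \<kappa>) * vee (g c x) 3 (p + 2) (H c x) (\<phi> (p + 2) c x) vs
      + 8 * of_real (Re \<kappa>) * int_form_adj (g c x) 3 p (H c x) (\<phi> p c x) vs
      - 4 * of_real (Im \<kappa>) * int_form (g c x) 3 (p - 2) (H c x) (minus2 \<phi> p c x) vs)"

end

theory Submission
  imports Defs
begin

text \<open>Since \<open>cl(H) cl(X) + cl(X) cl(H) = 6 cl(i\<^sub>X H)\<close>, a spinor that is parallel for the twisted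
  connection satisfies \<open>\<nabla>\<^sub>X \<epsilon> = cl(X) \<eta> - \<kappa> cl(i\<^sub>X H) \<epsilon>\<close> with \<open>\<eta> = k\<^sub>1 cl(H) \<epsilon>\<close> and \<open>\<kappa> = k\<^sub>2 + 6 k\<^sub>1\<close>.
  In the derivative of the bilinear \<open>\<chi>\<^sub>p\<close>, the left and right actions of the 2-form \<open>i\<^sub>X H\<close> on
  antisymmetrised Clifford products produce the three algebraic terms on the left-hand side of the
  hierarchy, whereas the twistor term \<open>cl(X) \<eta>\<close> contributes \<open>i\<^sub>X A + \<alpha>\<^sub>X \<and> B\<close> for a \<open>(p+1)\<close>-form \<open>A\<close> and
  a \<open>(p-1)\<close>-form \<open>B\<close>. Alternation and metric trace over \<open>X\<close> recover this pair: \<open>(p + 1) A\<close> is the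
  exterior derivative of \<open>\<chi>\<^sub>p\<close> and \<open>(n - p + 1) B\<close> is minus its codifferential, up to the alternation
  and the trace of the algebraic terms.\<close>

section \<open>Alternation over lists\<close>

text \<open>The left and right actions of a 2-form on a \<open>p\<close>-fold antisymmetrised
  product agree in the parts of degree \<open>p + 2\<close> and \<open>p - 2\<close> and are
  opposite in the part of degree \<open>p\<close>. Taking the 2-form across the Hermitian pairing
  conjugates \<kappa> and reverses a sign. The outer degrees therefore carry
  \<open>cnj \<kappa> - \<kappa>\<close>, hence Im \<kappa>, and the middle degree carries
  \<open>cnj \<kappa> + \<kappa>\<close>, hence Re \<kappa>; the factor i left over in the outer
  degrees is absorbed by i^[p/2], which changes by i when \<open>p\<close> changes by 2. The pair
  \<open>A\<close>, \<open>B\<close> built from \<eta> is never evaluated: only its degrees matter.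
  The obstacle is that the adjoints \<open>vee\<close> and \<open>int_form_adj\<close> are definite
  descriptions, so nothing can be computed with them until they are identified with explicit
  iterated metric contractions. The algebraic identities are then inductions on the list of
  arguments, one vector being split off at a time. Derivatives of bilinears are taken in one
  trivialisation, where the connection matrix is antisymmetric and acts on spinors by anti-Hermitian
  operators; the cocycle guarantees that the choice is irrelevant.\<close>

definition alternator :: "'v list \<Rightarrow> ('v list \<Rightarrow> 'b::real_vector) \<Rightarrow> 'b" where
  "alternator vs f = (\<Sum>\<sigma> | \<sigma> permutes {..<length vs}. of_int (sign \<sigma>) *\<^sub>R f (permute_list \<sigma> vs))"

definition omit :: "nat \<Rightarrow> 'v list \<Rightarrow> 'v list" where
  "omit a vs = take a vs @ drop (Suc a) vs"

definition insert_at :: "nat \<Rightarrow> 'v \<Rightarrow> 'v list \<Rightarrow> 'v list" where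
  "insert_at j v ws = take j ws @ v # drop j ws"

lemma omit_0 [simp]: "omit 0 (v # vs) = vs"
  by (simp add: omit_def)

lemma omit_Suc [simp]: "omit (Suc a) (v # vs) = v # omit a vs"
  by (simp add: omit_def)

lemma length_omit: "a < length vs \<Longrightarrow> length (omit a vs) = length vs - 1"
  by (simp add: omit_def)

lemma map_omit: "map f (omit a vs) = omit a (map f vs)"
  by (simp add: omit_def take_map drop_map)

lemma insert_at_0 [simp]: "insert_at 0 v ws = v # ws"
  by (simp add: insert_at_def)

lemma insert_at_Suc [simp]: "insert_at (Suc j) v (w # ws) = w # insert_at j v ws"
  by (simp add: insert_at_def)

lemma length_insert_at [simp]: "length (insert_at j v ws) = Suc (length ws)"
  by (simp add: insert_at_def)

lemma sum_Suc_length_Cons: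
  fixes f :: "nat \<Rightarrow> 'b::comm_monoid_add"
  shows "(\<Sum>a<length (v # vs). f a) = f 0 + (\<Sum>a<length vs. f (Suc a))"
  by (simp only: length_Cons sum.lessThan_Suc_shift)

section \<open>Factoring a permutation by the preimage of the first position\<close>

definition cycle_fun :: "nat \<Rightarrow> nat \<Rightarrow> nat" where
  "cycle_fun j i = (if i < j then Suc i else if i = j then 0 else i)"

text \<open>One adjacent transposition more per step, so that the permutation property and the sign
  of the cycle (0 1 ... j) follow by induction.\<close>

lemma cycle_fun_Suc: "cycle_fun (Suc j) = cycle_fun j \<circ> Transposition.transpose j (Suc j)"
  by (auto simp: fun_eq_iff cycle_fun_def Transposition.transpose_def)

lemma cycle_fun_0: "cycle_fun 0 = id"
  by (auto simp: fun_eq_iff cycle_fun_def)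

lemma cycle_fun_permutes: "cycle_fun j permutes {..<Suc j}"
proof (induction j)
  case 0
  show ?case unfolding cycle_fun_0 by (rule permutes_id)
next
  case (Suc j)
  have "cycle_fun j permutes {..<Suc (Suc j)}"
    using Suc by (rule permutes_subset) auto
  then show ?case
    unfolding cycle_fun_Suc by (intro permutes_compose permutes_swap_id) auto
qed

lemma sign_cycle_fun: "sign (cycle_fun j) = (-1) ^ j"
proof (induction j)
  case 0
  then show ?case by (simp add: cycle_fun_0)
next
  case (Suc j)
  have "permutation (cycle_fun j)"
    using cycle_fun_permutes permutation_permutes by blast
  then show ?case
    unfolding cycle_fun_Suc
    by (subst sign_compose) (simp_all add: permutation_swap_id sign_swap_id Suc del: comp_apply)
qed

text \<open>The embedding of the permutations of \<open>N\<close> points as the stabiliser of 0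
  among those of \<open>N + 1\<close> points.\<close>

definition lift_perm :: "(nat \<Rightarrow> nat) \<Rightarrow> nat \<Rightarrow> nat" where
  "lift_perm \<tau> i = (case i of 0 \<Rightarrow> 0 | Suc k \<Rightarrow> Suc (\<tau> k))"

text \<open>Seen as a relabelling along \<open>Suc\<close>, the shift inherits the permutation
  property and the sign.\<close>

lemma lift_perm_eq:
  assumes "\<tau> permutes {..<N}"
  shows "lift_perm \<tau> = map_permutation {..<N} Suc \<tau>"
proof
  fix i
  show "lift_perm \<tau> i = map_permutation {..<N} Suc \<tau> i"
  proof (cases "i \<in> Suc ` {..<N}")
    case True
    then obtain k where k: "k < N" "i = Suc k" by auto
    then show ?thesis
      by (simp add: lift_perm_def map_permutation_apply)
  next
    case False
    then have "map_permutation {..<N} Suc \<tau> i = i"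
      by (simp add: map_permutation_def)
    moreover have "lift_perm \<tau> i = i"
      using False permutes_not_in[OF assms] by (cases i) (auto simp: lift_perm_def image_iff)
    ultimately show ?thesis by simp
  qed
qed

lemma lift_perm_permutes:
  assumes "\<tau> permutes {..<N}"
  shows "lift_perm \<tau> permutes {..<Suc N}"
proof -
  have "map_permutation {..<N} Suc \<tau> permutes (Suc ` {..<N})"
    using assms by (intro map_permutation_permutes) (auto simp: bij_betw_def)
  then show ?thesis
    unfolding lift_perm_eq[OF assms] by (rule permutes_subset) auto
qed

lemma sign_lift_perm:
  assumes "\<tau> permutes {..<N}"
  shows "sign (lift_perm \<tau>) = sign \<tau>"
  unfolding lift_perm_eq[OF assms] using assms by (intro sign_map_permutation) auto

lemma permute_list_cycle_fun:
  assumes "j \<le> length ws"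
  shows "permute_list (cycle_fun j) (v # ws) = insert_at j v ws"
proof (rule nth_equalityI)
  show "length (permute_list (cycle_fun j) (v # ws)) = length (insert_at j v ws)"
    by simp
  fix i assume "i < length (permute_list (cycle_fun j) (v # ws))"
  then have i: "i < Suc (length ws)" by simp
  have "cycle_fun j permutes {..<length (v # ws)}"
    using cycle_fun_permutes by (rule permutes_subset) (use assms in auto)
  from permute_list_nth[OF this] i
  show "permute_list (cycle_fun j) (v # ws) ! i = insert_at j v ws ! i"
    using assms by (auto simp: cycle_fun_def insert_at_def nth_append nth_Cons' min_def)
qed

lemma permute_list_lift_perm:
  assumes "\<tau> permutes {..<length ws}"
  shows "permute_list (lift_perm \<tau>) (v # ws) = v # permute_list \<tau> ws"
proof (rule nth_equalityI)
  fix i assume "i < length (permute_list (lift_perm \<tau>) (v # ws))"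
  then have i: "i < Suc (length ws)" by simp
  have "lift_perm \<tau> permutes {..<length (v # ws)}"
    using lift_perm_permutes[OF assms] by simp
  from permute_list_nth[OF this] i permute_list_nth[OF assms]
  show "permute_list (lift_perm \<tau>) (v # ws) ! i = (v # permute_list \<tau> ws) ! i"
    by (cases i) (auto simp: lift_perm_def)
qed simp

text \<open>Coset decomposition with respect to the stabiliser of 0: \<open>j\<close> is the
  position that the permutation sends to 0, and \<open>\<tau>\<close> is what remains after the
  cycle is undone.\<close>

lemma bij_lift_cycle:
  "bij_betw (\<lambda>(j, \<tau>). lift_perm \<tau> \<circ> cycle_fun j) ({..N} \<times> {\<tau>. \<tau> permutes {..<N}})
     {\<sigma>. \<sigma> permutes {..<Suc N}}"
proof -
  let ?h = "\<lambda>(j, \<tau>). lift_perm \<tau> \<circ> cycle_fun j"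
  let ?S = "{..N} \<times> {\<tau>. \<tau> permutes {..<N}}" and ?T = "{\<sigma>. \<sigma> permutes {..<Suc N}}"
  have sub: "?h ` ?S \<subseteq> ?T"
  proof clarsimp
    fix j \<tau> assume j: "j \<le> N" and \<tau>: "\<tau> permutes {..<N}"
    have "cycle_fun j permutes {..<Suc N}"
      using cycle_fun_permutes by (rule permutes_subset) (use j in auto)
    then show "lift_perm \<tau> \<circ> cycle_fun j permutes {..<Suc N}"
      using lift_perm_permutes[OF \<tau>] by (rule permutes_compose)
  qed
  have inj: "inj_on ?h ?S"
  proof (rule inj_onI, clarify)
    fix j \<tau> j' \<tau>'
    assume *: "\<tau> permutes {..<N}" "\<tau>' permutes {..<N}"
      and eq: "lift_perm \<tau> \<circ> cycle_fun j = lift_perm \<tau>' \<circ> cycle_fun j'"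
    have z: "lift_perm \<rho> i = 0 \<longleftrightarrow> i = 0" for \<rho> i
      by (cases i) (auto simp: lift_perm_def)
    \<comment> \<open>Both factorisations must send the same position to 0, which forces
      \<open>j = j'\<close>; the cycle can then be cancelled.\<close>
    have "(lift_perm \<tau> \<circ> cycle_fun j) j = 0" by (simp add: lift_perm_def cycle_fun_def)
    then have "lift_perm \<tau>' (cycle_fun j' j) = 0" by (simp add: eq)
    then have jj: "j = j'" by (simp add: z cycle_fun_def split: if_splits)
    have "bij (cycle_fun j)" using cycle_fun_permutes permutes_bij by blast
    then have "lift_perm \<tau> = lift_perm \<tau>'"
      using eq unfolding jj by (metis bij_betw_imp_surj comp_assoc comp_id surj_iff)
    then have "lift_perm \<tau> (Suc k) = lift_perm \<tau>' (Suc k)" for k by simp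
    then show "j = j' \<and> \<tau> = \<tau>'" using jj by (auto simp: lift_perm_def fun_eq_iff)
  qed
  \<comment> \<open>Surjectivity by counting: (N + 1) N! = (N + 1)!.\<close>
  have "card (?h ` ?S) = card ?S" by (rule card_image[OF inj])
  also have "\<dots> = card ?T"
    by (simp add: card_cartesian_product card_permutations[OF refl])
  finally have "?h ` ?S = ?T"
    by (intro card_subset_eq sub) (simp_all add: finite_permutations)
  with inj show ?thesis by (simp add: bij_betw_def)
qed

lemma alternator_Nil [simp]: "alternator [] f = f []"
  by (simp add: alternator_def)

text \<open>Laplace expansion along the head, sorted by the position \<open>j\<close> to which
  \<open>v\<close> is moved; the sign is that of the cycle. This recursion makes alternation
  accessible to induction on lists.\<close>

lemma alternator_Cons:
  "alternator (v # vs) f =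
     (\<Sum>j\<le>length vs. (- 1) ^ j *\<^sub>R alternator vs (\<lambda>ws. f (insert_at j v ws)))"
proof -
  let ?N = "length vs"
  have summand: "of_int (sign (lift_perm \<tau> \<circ> cycle_fun j)) *\<^sub>R
        f (permute_list (lift_perm \<tau> \<circ> cycle_fun j) (v # vs)) =
      (- 1) ^ j *\<^sub>R of_int (sign \<tau>) *\<^sub>R f (insert_at j v (permute_list \<tau> vs))"
    if "j \<le> ?N" "\<tau> permutes {..<?N}" for j \<tau>
  proof -
    have c: "cycle_fun j permutes {..<Suc ?N}"
      using cycle_fun_permutes by (rule permutes_subset) (use that in auto)
    have l: "lift_perm \<tau> permutes {..<Suc ?N}" by (rule lift_perm_permutes[OF that(2)])
    have "sign (lift_perm \<tau> \<circ> cycle_fun j) = sign \<tau> * (- 1) ^ j"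
      using c l permutation_permutes
      by (subst sign_compose) (auto simp: sign_cycle_fun sign_lift_perm[OF that(2)])
    moreover have "permute_list (lift_perm \<tau> \<circ> cycle_fun j) (v # vs) = insert_at j v (permute_list \<tau> vs)"
      using c that by (subst permute_list_compose) (auto simp: permute_list_lift_perm permute_list_cycle_fun)
    ultimately show ?thesis by (simp add: mult.commute)
  qed
  have "alternator (v # vs) f =
      (\<Sum>(j, \<tau>)\<in>{..?N} \<times> {\<tau>. \<tau> permutes {..<?N}}.
        of_int (sign (lift_perm \<tau> \<circ> cycle_fun j)) *\<^sub>R f (permute_list (lift_perm \<tau> \<circ> cycle_fun j) (v # vs)))"
    unfolding alternator_def length_Cons
    by (subst sum.reindex_bij_betw[OF bij_lift_cycle, symmetric]) (simp add: case_prod_beta)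
  also have "\<dots> = (\<Sum>j\<le>?N. \<Sum>\<tau> | \<tau> permutes {..<?N}.
      (- 1) ^ j *\<^sub>R of_int (sign \<tau>) *\<^sub>R f (insert_at j v (permute_list \<tau> vs)))"
    by (subst sum.cartesian_product[symmetric]) (intro sum.cong refl, simp add: summand)
  finally show ?thesis by (simp add: alternator_def scaleR_sum_right)
qed

lemma alternator_cong:
  "(\<And>ws. length ws = length vs \<Longrightarrow> f ws = h ws) \<Longrightarrow> alternator vs f = alternator vs h"
  by (simp add: alternator_def)

lemma alternator_linear:
  assumes "linear h"
  shows "h (alternator vs f) = alternator vs (\<lambda>ws. h (f ws))"
  using assms by (simp add: alternator_def linear_sum linear_cmul)

lemma alternator_scaleR: "alternator vs (\<lambda>ws. c *\<^sub>R f ws) = c *\<^sub>R alternator vs f"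
  by (simp add: alternator_def scaleR_sum_right mult.commute)

lemma alternator_mult:
  fixes f :: "'v list \<Rightarrow> complex"
  shows "alternator vs (\<lambda>ws. c * f ws) = c * alternator vs f"
  by (simp add: alternator_def sum_distrib_left)

lemma alternator_add: "alternator vs (\<lambda>ws. f ws + h ws) = alternator vs f + alternator vs h"
  by (simp add: alternator_def sum.distrib scaleR_add_right)

lemma alternator_diff: "alternator vs (\<lambda>ws. f ws - h ws) = alternator vs f - alternator vs h"
  by (simp add: alternator_def sum_subtractf scaleR_diff_right)

lemma alternator_zero [simp]: "alternator vs (\<lambda>ws. 0) = 0"
  by (simp add: alternator_def)

lemma alternator_sum: "alternator vs (\<lambda>ws. \<Sum>i\<in>S. f i ws) = (\<Sum>i\<in>S. alternator vs (f i))"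
  unfolding alternator_def scaleR_sum_right by (rule sum.swap)

lemma alternator_map: "alternator (map h vs) f = alternator vs (\<lambda>ws. f (map h ws))"
  unfolding alternator_def by (auto intro!: sum.cong simp: permute_list_map)

text \<open>Reindexing the sum by left translation with \<open>\<rho>\<close>.\<close>

lemma alternator_permute_list:
  assumes "\<rho> permutes {..<length vs}"
  shows "alternator (permute_list \<rho> vs) f = of_int (sign \<rho>) *\<^sub>R alternator vs f"
proof -
  have "alternator vs f = (\<Sum>\<sigma> | \<sigma> permutes {..<length vs}.
      of_int (sign (\<rho> \<circ> \<sigma>)) *\<^sub>R f (permute_list (\<rho> \<circ> \<sigma>) vs))"
    unfolding alternator_def by (rule setum_permutations_compose_left[OF assms])
  also have "\<dots> = of_int (sign \<rho>) *\<^sub>R alternator (permute_list \<rho> vs) f"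
    unfolding alternator_def scaleR_sum_right
  proof (intro sum.cong)
    fix \<sigma> assume "\<sigma> \<in> {\<sigma>. \<sigma> permutes {..<length (permute_list \<rho> vs)}}"
    then have \<sigma>: "\<sigma> permutes {..<length vs}" by simp
    then show "of_int (sign (\<rho> \<circ> \<sigma>)) *\<^sub>R f (permute_list (\<rho> \<circ> \<sigma>) vs) =
        of_int (sign \<rho>) *\<^sub>R of_int (sign \<sigma>) *\<^sub>R f (permute_list \<sigma> (permute_list \<rho> vs))"
      using assms permutation_permutes
      by (subst sign_compose) (auto simp: permute_list_compose)
  qed simp
  finally show ?thesis
    by (metis (no_types, lifting) of_int_1 of_int_mult scaleR_one scaleR_scaleR sign_idempotent)
qed

text \<open>The counterpart with right translation: the permutation acts on the slots of
  \<open>f\<close> instead of the entries of the list. It serves to bring a distinguished slot to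
  the front.\<close>

lemma alternator_permuted_arg:
  assumes "\<rho> permutes {..<length vs}"
  shows "alternator vs (\<lambda>ws. f (permute_list \<rho> ws)) = of_int (sign \<rho>) *\<^sub>R alternator vs f"
proof -
  have "alternator vs f = (\<Sum>\<sigma> | \<sigma> permutes {..<length vs}.
      of_int (sign (\<sigma> \<circ> \<rho>)) *\<^sub>R f (permute_list (\<sigma> \<circ> \<rho>) vs))"
    unfolding alternator_def by (rule sum_permutations_compose_right[OF assms])
  also have "\<dots> = of_int (sign \<rho>) *\<^sub>R alternator vs (\<lambda>ws. f (permute_list \<rho> ws))"
    unfolding alternator_def scaleR_sum_right
  proof (intro sum.cong)
    fix \<sigma> assume "\<sigma> \<in> {\<sigma>. \<sigma> permutes {..<length vs}}"
    then have \<sigma>: "\<sigma> permutes {..<length vs}" by simp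
    then show "of_int (sign (\<sigma> \<circ> \<rho>)) *\<^sub>R f (permute_list (\<sigma> \<circ> \<rho>) vs) =
        of_int (sign \<rho>) *\<^sub>R of_int (sign \<sigma>) *\<^sub>R f (permute_list \<rho> (permute_list \<sigma> vs))"
      using assms permutation_permutes
      by (subst sign_compose) (auto simp: permute_list_compose mult.commute)
  qed simp
  finally show ?thesis
    by (metis (no_types, lifting) of_int_1 of_int_mult scaleR_one scaleR_scaleR sign_idempotent)
qed

text \<open>The operator \<open>T \<mapsto> \<Sum>\<^sub>i e\<^sup>i \<and> T(e\<^sub>i)\<close>, which requires no metric.\<close>

definition esum :: "('v \<Rightarrow> 'v list \<Rightarrow> 'b::real_vector) \<Rightarrow> 'v list \<Rightarrow> 'b" where
  "esum T vs = (\<Sum>a<length vs. (- 1) ^ a *\<^sub>R T (vs ! a) (omit a vs))"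

lemma esum_Nil [simp]: "esum T [] = 0"
  by (simp add: esum_def)

text \<open>The minus sign arises because an entry behind \<open>v\<close> sits one position earlier
  in \<open>vs\<close>.\<close>

lemma esum_Cons: "esum T (v # vs) = T v vs - esum (\<lambda>u ws. T u (v # ws)) vs"
  unfolding esum_def sum_Suc_length_Cons by (simp add: sum_negf)

lemma esum_cong:
  "(\<And>u ws. Suc (length ws) = length vs \<Longrightarrow> T u ws = S u ws) \<Longrightarrow> esum T vs = esum S vs"
  unfolding esum_def by (intro sum.cong refl) (auto simp: length_omit)

lemma esum_add: "esum (\<lambda>u ws. S u ws + T u ws) vs = esum S vs + esum T vs"
  by (simp add: esum_def sum.distrib scaleR_add_right)

lemma esum_diff: "esum (\<lambda>u ws. S u ws - T u ws) vs = esum S vs - esum T vs"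
  by (simp add: esum_def sum_subtractf scaleR_diff_right)

lemma esum_minus: "esum (\<lambda>u ws. - T u ws) vs = - esum T vs"
  by (simp add: esum_def sum_negf)

lemma esum_linear:
  assumes "linear h"
  shows "h (esum T vs) = esum (\<lambda>u ws. h (T u ws)) vs"
  using assms by (simp add: esum_def linear_sum linear_cmul)

lemma esum_scaleR: "esum (\<lambda>u ws. c *\<^sub>R T u ws) vs = c *\<^sub>R esum T vs"
  by (simp add: esum_def scaleR_sum_right mult.commute)

lemma esum_mult:
  fixes T :: "'v \<Rightarrow> 'v list \<Rightarrow> complex"
  shows "esum (\<lambda>u ws. c * T u ws) vs = c * esum T vs"
  by (simp add: esum_def sum_distrib_left)

lemma esum_sum: "esum (\<lambda>u ws. \<Sum>i\<in>S. T i u ws) vs = (\<Sum>i\<in>S. esum (T i) vs)"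
  unfolding esum_def scaleR_sum_right by (rule sum.swap)

lemma esum_zero [simp]: "esum (\<lambda>u ws. 0) vs = 0"
  by (simp add: esum_def)

lemma esum_map: "esum T (map f vs) = esum (\<lambda>u ws. T (f u) (map f ws)) vs"
  unfolding esum_def by (intro sum.cong) (auto simp: map_omit)

text \<open>The summands in which \<open>v\<close> is removed first and second carry opposite signs
  and cancel by symmetry; the rest is the induction hypothesis. In other words, e^i \<and> e^j kills
  symmetric coefficients. This disposes of the Christoffel terms in the exterior derivative and of
  \<alpha>_u \<and> B under alternation.\<close>

lemma esum_symmetric:
  "(\<And>u v ws. T u v ws = T v u ws) \<Longrightarrow> esum (\<lambda>u. esum (T u)) vs = 0"
proof (induction vs arbitrary: T)
  case (Cons v vs)
  have "esum (\<lambda>u. esum (\<lambda>w ws. T u w (v # ws))) vs = 0"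
    by (rule Cons.IH) (rule Cons.prems)
  moreover have "esum (\<lambda>u ws. T u v ws) vs = esum (T v) vs"
    by (intro esum_cong) (rule Cons.prems)
  ultimately show ?case
    by (simp add: esum_Cons esum_diff)
qed simp

text \<open>Alternating a tensor product of \<alpha> and \<open>f\<close> gives their wedge product
  without its factorials. In the expansion along \<open>v\<close>, position 0 puts \<open>v\<close>
  into \<alpha>; a position \<open>Suc j\<close> leaves the head alone and inserts \<open>v\<close>
  at \<open>j\<close> in the tail, so that the induction hypothesis applies to \<open>f\<close> with
  \<open>v\<close> inserted.\<close>

lemma alternator_hd_tl:
  fixes \<alpha> :: "'v \<Rightarrow> real"
  assumes "vs \<noteq> []"
  shows "alternator vs (\<lambda>ws. \<alpha> (hd ws) *\<^sub>R f (tl ws)) = esum (\<lambda>u ws. \<alpha> u *\<^sub>R alternator ws f) vs"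
  using assms
proof (induction vs arbitrary: f)
  case (Cons v vs)
  show ?case
  proof (cases "vs = []")
    case True
    then show ?thesis by (simp add: alternator_Cons esum_Cons)
  next
    case False
    then obtain m where m: "length vs = Suc m" by (cases vs) auto
    have step: "alternator vs (\<lambda>ws. \<alpha> (hd (insert_at (Suc j) v ws)) *\<^sub>R f (tl (insert_at (Suc j) v ws))) =
        esum (\<lambda>u ws. \<alpha> u *\<^sub>R alternator ws (\<lambda>ws. f (insert_at j v ws))) vs" for j
    proof -
      have "alternator vs (\<lambda>ws. \<alpha> (hd (insert_at (Suc j) v ws)) *\<^sub>R f (tl (insert_at (Suc j) v ws))) =
        alternator vs (\<lambda>ws. \<alpha> (hd ws) *\<^sub>R f (insert_at j v (tl ws)))"
      proof (rule alternator_cong)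
        fix ws :: "'v list" assume "length ws = length vs"
        with False obtain x xs where "ws = x # xs" by (cases ws) auto
        then show "\<alpha> (hd (insert_at (Suc j) v ws)) *\<^sub>R f (tl (insert_at (Suc j) v ws)) =
          \<alpha> (hd ws) *\<^sub>R f (insert_at j v (tl ws))" by simp
      qed
      then show ?thesis using Cons.IH[OF False, of "\<lambda>ws. f (insert_at j v ws)"] by simp
    qed
    have "alternator (v # vs) (\<lambda>ws. \<alpha> (hd ws) *\<^sub>R f (tl ws)) =
        \<alpha> v *\<^sub>R alternator vs f -
        (\<Sum>j\<le>m. (- 1) ^ j *\<^sub>R esum (\<lambda>u ws. \<alpha> u *\<^sub>R alternator ws (\<lambda>ws. f (insert_at j v ws))) vs)"
      unfolding alternator_Cons m sum.atMost_Suc_shift using step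
      by (simp add: alternator_scaleR sum_negf)
    also have "(\<Sum>j\<le>m. (- 1) ^ j *\<^sub>R esum (\<lambda>u ws. \<alpha> u *\<^sub>R alternator ws (\<lambda>ws. f (insert_at j v ws))) vs) =
        esum (\<lambda>u ws. \<alpha> u *\<^sub>R alternator (v # ws) f) vs"
      unfolding esum_scaleR[symmetric] esum_sum[symmetric]
      by (intro esum_cong) (simp add: alternator_Cons m scaleR_sum_right mult.commute)
    finally show ?thesis by (simp add: esum_Cons)
  qed
qed simp

section \<open>Alternating forms and the wedge product\<close>

text \<open>Splitting a list at the varying slot, instead of updating at an index, fits the
  induction on lists. Lists of length other than \<open>p\<close> are unconstrained, so that
  functions which are not cut off outside degree \<open>p\<close> are covered.\<close>

definition multilinear_list :: "nat \<Rightarrow> ('v::real_vector list \<Rightarrow> 'b::real_vector) \<Rightarrow> bool" where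
  "multilinear_list p f \<longleftrightarrow>
     (\<forall>xs ys. Suc (length xs + length ys) = p \<longrightarrow> linear (\<lambda>v. f (xs @ v # ys)))"

lemma multilinear_listD:
  "multilinear_list p f \<Longrightarrow> Suc (length xs + length ys) = p \<Longrightarrow> linear (\<lambda>v. f (xs @ v # ys))"
  by (simp add: multilinear_list_def)

lemma insert_at_append:
  "insert_at j x (as @ v # bs) =
     (if j \<le> length as then insert_at j x as @ v # bs else as @ v # insert_at (j - Suc (length as)) x bs)"
proof (cases "j \<le> length as")
  case False
  then obtain d where "j = Suc (length as) + d"
    using less_imp_Suc_add[of "length as" j] by auto
  then show ?thesis by (simp add: insert_at_def)
qed (simp add: insert_at_def)

lemma multilinear_list_insert_at:
  assumes "multilinear_list (Suc p) f"
  shows "multilinear_list p (\<lambda>ws. f (insert_at j x ws))"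
  unfolding multilinear_list_def
proof (intro allI impI)
  fix xs ys :: "'a list" assume "Suc (length xs + length ys) = p"
  then show "linear (\<lambda>v. f (insert_at j x (xs @ v # ys)))"
    using assms by (cases "j \<le> length xs") (auto simp: insert_at_append intro!: multilinear_listD)
qed

lemma linear_alternator:
  assumes "\<And>ws. length ws = length vs \<Longrightarrow> linear (\<lambda>v. F v ws)"
  shows "linear (\<lambda>v. alternator vs (F v))"
proof (rule linearI)
  show "alternator vs (F (x + y)) = alternator vs (F x) + alternator vs (F y)" for x y
    unfolding alternator_add[symmetric] by (intro alternator_cong linear_add assms)
  show "alternator vs (F (r *\<^sub>R x)) = r *\<^sub>R alternator vs (F x)" for r x
    unfolding alternator_scaleR[symmetric] by (intro alternator_cong linear_cmul assms)
qed

text \<open>If the varying slot is the head, each summand of the expansion is linear since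
  \<open>f\<close> is linear in the inserted vector. Otherwise the head is frozen by inserting it
  into \<open>f\<close>, and the induction hypothesis covers the shorter alternation.\<close>

lemma multilinear_alternator:
  "multilinear_list p f \<Longrightarrow> multilinear_list p (\<lambda>vs. alternator vs f)"
proof (induction p arbitrary: f)
  case (Suc p)
  show ?case
    unfolding multilinear_list_def
  proof (intro allI impI)
    fix xs ys :: "'a list" assume len: "Suc (length xs + length ys) = Suc p"
    show "linear (\<lambda>v. alternator (xs @ v # ys) f)"
    proof (cases xs)
      case Nil
      have "linear (\<lambda>v. f (insert_at j v ws))" if "length ws = p" "j \<le> p" for j and ws :: "'a list"
        unfolding insert_at_def using Suc.prems by (rule multilinear_listD) (use that in auto)
      then show ?thesis
        using len unfolding Nil append_Nil alternator_Cons
        by (intro linear_compose_sum ballI linear_compose_scale_right linear_alternator) auto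
    next
      case (Cons x xs')
      have "linear (\<lambda>v. alternator (xs' @ v # ys) (\<lambda>ws. f (insert_at j x ws)))" for j
        using len Cons by (intro multilinear_listD[OF Suc.IH[OF multilinear_list_insert_at[OF Suc.prems]]]) simp
      then show ?thesis
        unfolding Cons append_Cons alternator_Cons length_append length_Cons
        by (intro linear_compose_sum ballI linear_compose_scale_right) auto
    qed
  qed
qed (simp add: multilinear_list_def)

text \<open>The transposition of the two equal positions fixes the list and reverses the
  sign.\<close>

lemma alternator_repeated:
  fixes f :: "'v list \<Rightarrow> 'b::real_vector"
  shows "alternator (xs @ u # ys @ u # zs) f = 0"
proof -
  let ?vs = "xs @ u # ys @ u # zs" and ?i = "length xs" and ?j = "Suc (length xs + length ys)"
  have perm: "Transposition.transpose ?i ?j permutes {..<length ?vs}"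
    by (rule permutes_swap_id) auto
  have "permute_list (Transposition.transpose ?i ?j) ?vs = ?vs"
  proof (rule nth_equalityI)
    fix k assume "k < length (permute_list (Transposition.transpose ?i ?j) ?vs)"
    then show "permute_list (Transposition.transpose ?i ?j) ?vs ! k = ?vs ! k"
      using permute_list_nth[OF perm, of k]
      by (auto simp: Transposition.transpose_def nth_append)
  qed simp
  then have "alternator ?vs f = - alternator ?vs f"
    using alternator_permute_list[OF perm, of f] by (simp add: sign_swap_id)
  then have "2 *\<^sub>R alternator ?vs f = 0"
    unfolding scaleR_2 by (metis add.right_inverse)
  then show ?thesis by simp
qed

text \<open>Replaces the indices in \<open>alt_form\<close> by list splittings: two positions
  \<open>i < j\<close> cut a list into three pieces.\<close>

lemma alt_formI:
  assumes "\<And>vs. length vs \<noteq> p \<Longrightarrow> \<omega> vs = 0"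
    and "multilinear_list p \<omega>"
    and "\<And>xs u ys zs. length xs + length ys + length zs + 2 = p \<Longrightarrow> \<omega> (xs @ u # ys @ u # zs) = 0"
  shows "alt_form p \<omega>"
  unfolding alt_form_def
proof (intro conjI allI impI)
  fix vs :: "(real ^ 'a) list" and i assume "length vs = p" "i < p"
  then show "linear (\<lambda>v. \<omega> (vs[i := v]))"
    using multilinear_listD[OF assms(2), of "take i vs" "drop (Suc i) vs"]
    by (simp add: upd_conv_take_nth_drop)
next
  fix vs :: "(real ^ 'a) list" and i j
  assume *: "length vs = p" "i < j" "j < p" "vs ! i = vs ! j"
  have "vs = take i vs @ vs ! i # drop (Suc i) vs"
    using * by (intro id_take_nth_drop) simp
  moreover have "drop (Suc i) vs = take (j - Suc i) (drop (Suc i) vs) @ vs ! j # drop (Suc j) vs"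
    using * id_take_nth_drop[of "j - Suc i" "drop (Suc i) vs"] by simp
  ultimately have "vs = take i vs @ vs ! j # take (j - Suc i) (drop (Suc i) vs) @ vs ! j # drop (Suc j) vs"
    using *(4) by metis
  then show "\<omega> vs = 0"
    using assms(3)[of "take i vs" "take (j - Suc i) (drop (Suc i) vs)" "drop (Suc j) vs" "vs ! j"] *
    by simp
qed (use assms in auto)

lemma alt_form_length: "alt_form p \<omega> \<Longrightarrow> length vs \<noteq> p \<Longrightarrow> \<omega> vs = 0"
  by (simp add: alt_form_def)

text \<open>Holds for lists of every length, because off its degree a form is constantly zero. This
  keeps degree conditions out of later proofs.\<close>

lemma linear_alt_form:
  assumes "alt_form p \<omega>"
  shows "linear (\<lambda>v. \<omega> (xs @ v # ys))"
proof (cases "Suc (length xs + length ys) = p")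
  case True
  then have "linear (\<lambda>v. \<omega> ((xs @ undefined # ys)[length xs := v]))"
    using assms unfolding alt_form_def by (metis length_append length_Cons add_Suc_right less_add_Suc1)
  then show ?thesis by simp
next
  case False
  then have "(\<lambda>v. \<omega> (xs @ v # ys)) = (\<lambda>v. 0)"
    using assms by (auto simp: alt_form_def)
  then show ?thesis by (simp add: linear_iff)
qed

lemma multilinear_alt_form: "alt_form p \<omega> \<Longrightarrow> multilinear_list p \<omega>"
  by (simp add: multilinear_list_def linear_alt_form)

lemma alt_form_repeated:
  assumes "alt_form p \<omega>"
  shows "\<omega> (xs @ u # ys @ u # zs) = 0"
proof (cases "length (xs @ u # ys @ u # zs) = p")
  case True
  have "(xs @ u # ys @ u # zs) ! length xs = (xs @ u # ys @ u # zs) ! Suc (length xs + length ys)"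
    by (simp add: nth_append)
  then show ?thesis
    using assms True unfolding alt_form_def
    by (metis (no_types, lifting) Suc_le_eq add_Suc_right le_add1 length_Cons length_append
        less_add_Suc1 less_add_same_cancel1 zero_less_Suc add_less_cancel_left not_less_eq)
qed (use assms alt_form_length in blast)

lemma alt_form_swap:
  assumes "alt_form p \<omega>"
  shows "\<omega> (xs @ u # v # ys) = - \<omega> (xs @ v # u # ys)"
proof -
  have l1: "\<omega> (xs @ (a + b) # zs) = \<omega> (xs @ a # zs) + \<omega> (xs @ b # zs)" for a b zs
    using linear_add[OF linear_alt_form[OF assms]] .
  have l2: "\<omega> (xs @ c # (a + b) # zs) = \<omega> (xs @ c # a # zs) + \<omega> (xs @ c # b # zs)" for a b c zs
    using linear_add[OF linear_alt_form[OF assms, of "xs @ [c]" zs], of a b] by simp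
  have z: "\<omega> (xs @ a # a # ys) = 0" for a
    using alt_form_repeated[OF assms, of xs a "[]" ys] by simp
  have "\<omega> (xs @ (u + v) # (u + v) # ys) = 0" by (rule z)
  then show ?thesis
    unfolding l1 l2 by (simp add: z add_eq_0_iff)
qed

text \<open>Each neighbour that \<open>v\<close> passes costs a sign.\<close>

lemma alt_form_front:
  assumes "alt_form p \<omega>"
  shows "\<omega> (xs @ v # ys) = (- 1) ^ length xs * \<omega> (v # xs @ ys)"
proof (induction xs arbitrary: ys rule: rev_induct)
  case (snoc x xs)
  have "\<omega> ((xs @ [x]) @ v # ys) = - \<omega> (xs @ v # x # ys)"
    using alt_form_swap[OF assms, of xs x v ys] by simp
  then show ?case using snoc by simp
qed simp

lemma alt_form_insert_at:
  assumes "alt_form p \<omega>" "j \<le> length ws"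
  shows "\<omega> (insert_at j v ws) = (- 1) ^ j * \<omega> (v # ws)"
  unfolding insert_at_def alt_form_front[OF assms(1)] using assms(2) by simp

lemma alt_form_Cons_Cons: "alt_form p \<omega> \<Longrightarrow> \<omega> (u # v # ys) = - \<omega> (v # u # ys)"
  using alt_form_swap[of p \<omega> "[]" u v ys] unfolding append_Nil .

lemma alt_form_zero [simp]: "alt_form p (\<lambda>vs. 0)"
  by (rule alt_formI) (simp_all add: multilinear_list_def linear_iff)

lemma alt_form_add:
  assumes "alt_form p \<omega>" "alt_form p \<psi>"
  shows "alt_form p (\<lambda>vs. \<omega> vs + \<psi> vs)"
proof (rule alt_formI)
  show "multilinear_list p (\<lambda>vs. \<omega> vs + \<psi> vs)"
    unfolding multilinear_list_def
    by (intro allI impI linear_compose_add linear_alt_form[OF assms(1)] linear_alt_form[OF assms(2)])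
qed (simp_all add: assms alt_form_length[OF assms(1)] alt_form_length[OF assms(2)]
    alt_form_repeated[OF assms(1)] alt_form_repeated[OF assms(2)])

lemma alt_form_scaled:
  assumes "alt_form p \<omega>"
  shows "alt_form p (\<lambda>vs. a * \<omega> vs)"
proof (rule alt_formI)
  show "multilinear_list p (\<lambda>vs. a * \<omega> vs)"
    unfolding multilinear_list_def
    using linear_compose[OF linear_alt_form[OF assms] bounded_linear.linear[OF bounded_linear_mult_right[of a]]]
    by (simp add: o_def)
qed (use assms in \<open>auto simp: alt_form_length alt_form_repeated\<close>)

lemma alt_form_diff: "alt_form p \<omega> \<Longrightarrow> alt_form p \<psi> \<Longrightarrow> alt_form p (\<lambda>vs. \<omega> vs - \<psi> vs)"
  using alt_form_add[of p \<omega> "\<lambda>vs. (- 1) * \<psi> vs"] alt_form_scaled[of p \<psi> "- 1"] by simp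

lemma alt_form_scaleR: "alt_form p \<omega> \<Longrightarrow> alt_form p (\<lambda>vs. r *\<^sub>R \<omega> vs)"
  using alt_form_scaled[of p \<omega> "of_real r"] by (simp add: scaleR_conv_of_real)

lemma alt_form_sum: "(\<And>i. i \<in> S \<Longrightarrow> alt_form p (\<omega> i)) \<Longrightarrow> alt_form p (\<lambda>vs. \<Sum>i\<in>S. \<omega> i vs)"
  by (induction S rule: infinite_finite_induct) (auto intro: alt_form_add)

lemma alt_form_alternator:
  fixes f :: "(real ^ 'n) list \<Rightarrow> complex"
  assumes "multilinear_list p f"
  shows "alt_form p (\<lambda>vs. if length vs = p then alternator vs f else 0)"
proof (rule alt_formI)
  show "multilinear_list p (\<lambda>vs. if length vs = p then alternator vs f else 0)"
    using multilinear_alternator[OF assms] by (simp add: multilinear_list_def)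
qed (simp_all add: alternator_repeated)

lemma alt_form_contract:
  assumes "alt_form p \<omega>"
  shows "alt_form (p - 1) (contract v \<omega>)"
proof (rule alt_formI)
  show "contract v \<omega> vs = 0" if "length vs \<noteq> p - 1" for vs
    using that assms by (simp add: contract_def alt_form_length)
  show "multilinear_list (p - 1) (contract v \<omega>)"
    unfolding multilinear_list_def contract_def using linear_alt_form[OF assms, of "v # _"] by simp
  show "contract v \<omega> (xs @ u # ys @ u # zs) = 0" for xs u ys zs
    unfolding contract_def using alt_form_repeated[OF assms, of "v # xs"] by simp
qed

lemma alt_form_contract_Suc: "alt_form (Suc p) \<omega> \<Longrightarrow> alt_form p (contract v \<omega>)"
  using alt_form_contract[of "Suc p"] by simp

lemma contract_0form: "alt_form 0 \<omega> \<Longrightarrow> contract v \<omega> = (\<lambda>vs. 0)"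
  by (auto simp: contract_def alt_form_length)

lemma contract_linear: "alt_form p \<omega> \<Longrightarrow> linear (\<lambda>v. contract v \<omega> vs)"
  using linear_alt_form[of p \<omega> "[]"] by (simp add: contract_def)

lemma contract_contract:
  "alt_form p \<omega> \<Longrightarrow> contract u (contract v \<omega>) = (\<lambda>vs. - contract v (contract u \<omega>) vs)"
  by (rule ext) (simp add: contract_def alt_form_Cons_Cons[of p \<omega> v u])

lemma contract_add: "contract v (\<lambda>vs. \<omega> vs + \<psi> vs) = (\<lambda>vs. contract v \<omega> vs + contract v \<psi> vs)"
  by (auto simp: contract_def)

lemma contract_mult: "contract v (\<lambda>vs. a * \<omega> vs) = (\<lambda>vs. a * contract v \<omega> vs)"
  by (auto simp: contract_def)

lemma contract_zero [simp]: "contract v (\<lambda>vs. 0) = (\<lambda>vs. 0)"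
  by (auto simp: contract_def)

section \<open>Wedge products and their contractions\<close>

lemma wedge_alternator:
  "wedge k q \<omega> \<psi> vs = (if length vs = k + q
     then alternator vs (\<lambda>ws. \<omega> (take k ws) * \<psi> (drop k ws)) / (fact k * fact q) else 0)"
  by (simp add: wedge_def alternator_def scaleR_conv_of_real mult.assoc)

lemma wedge_zero_left [simp]: "wedge k q (\<lambda>vs. 0) \<psi> = (\<lambda>vs. 0)"
  by (auto simp: wedge_alternator)

lemma wedge_zero_right [simp]: "wedge k q \<omega> (\<lambda>vs. 0) = (\<lambda>vs. 0)"
  by (auto simp: wedge_alternator)

lemma multilinear_list_take_drop:
  assumes "alt_form k \<omega>" "alt_form q \<psi>"
  shows "multilinear_list (k + q) (\<lambda>ws. \<omega> (take k ws) * \<psi> (drop k ws))"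
  unfolding multilinear_list_def
proof (intro allI impI)
  fix xs ys :: "(real ^ 'a) list"
  assume len: "Suc (length xs + length ys) = k + q"
  show "linear (\<lambda>v. \<omega> (take k (xs @ v # ys)) * \<psi> (drop k (xs @ v # ys)))"
  proof (cases "length xs < k")
    case True
    then obtain d where d: "k = Suc (length xs + d)" using less_iff_Suc_add by blast
    have "linear (\<lambda>v. \<omega> (xs @ v # take d ys) * \<psi> (drop d ys))"
      using linear_compose[OF linear_alt_form[OF assms(1), of xs "take d ys"]
          bounded_linear.linear[OF bounded_linear_mult_left[of "\<psi> (drop d ys)"]]]
      by (simp add: o_def)
    then show ?thesis by (simp add: d)
  next
    case False
    then obtain d where d: "length xs = k + d" using le_Suc_ex[of k "length xs"] by auto
    have "linear (\<lambda>v. \<omega> (take k xs) * \<psi> (drop k xs @ v # ys))"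
      using linear_compose[OF linear_alt_form[OF assms(2), of "drop k xs" ys]
          bounded_linear.linear[OF bounded_linear_mult_right[of "\<omega> (take k xs)"]]]
      by (simp add: o_def)
    then show ?thesis by (simp add: d)
  qed
qed

lemma alt_form_wedge:
  assumes "alt_form k \<omega>" "alt_form q \<psi>"
  shows "alt_form (k + q) (wedge k q \<omega> \<psi>)"
proof -
  have "wedge k q \<omega> \<psi> = (\<lambda>vs. (1 / (fact k * fact q)) *
      (if length vs = k + q then alternator vs (\<lambda>ws. \<omega> (take k ws) * \<psi> (drop k ws)) else 0))"
    by (auto simp: wedge_alternator)
  then show ?thesis
    by (simp only: alt_form_scaled[OF alt_form_alternator[OF multilinear_list_take_drop[OF assms]]])
qed

lemma take_insert_at: "k \<le> j \<Longrightarrow> j \<le> length ws \<Longrightarrow> take k (insert_at j v ws) = take k ws"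
  by (simp add: insert_at_def min_def)

lemma drop_insert_at:
  "k \<le> j \<Longrightarrow> j \<le> length ws \<Longrightarrow> drop k (insert_at j v ws) = insert_at (j - k) v (drop k ws)"
  by (simp add: insert_at_def drop_take min_def)

lemma take_insert_at_less:
  "j < k \<Longrightarrow> j \<le> length ws \<Longrightarrow> take k (insert_at j v ws) = insert_at j v (take (k - 1) ws)"
  by (cases k) (auto simp: insert_at_def drop_take min_def Suc_diff_le)

lemma drop_insert_at_less:
  "j < k \<Longrightarrow> j \<le> length ws \<Longrightarrow> drop k (insert_at j v ws) = drop (k - 1) ws"
  by (simp add: insert_at_def min_def drop_Cons')

text \<open>The expansion along \<open>v\<close> is sorted by the block that receives it. The
  \<open>k\<close> positions in the first block give equal terms, because the sign of position
  \<open>j\<close> is undone by moving \<open>v\<close> to the front of \<omega>; the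
  \<open>q\<close> positions in the second block agree likewise, up to (-1)^k for passing the first
  block.\<close>

lemma alternator_take_drop_Cons:
  assumes \<omega>: "alt_form k \<omega>" and \<psi>: "alt_form q \<psi>" and len: "Suc (length vs) = k + q"
  shows "alternator (v # vs) (\<lambda>ws. \<omega> (take k ws) * \<psi> (drop k ws)) =
     of_nat k * alternator vs (\<lambda>ws. \<omega> (v # take (k - 1) ws) * \<psi> (drop (k - 1) ws)) +
     (- 1) ^ k * of_nat q * alternator vs (\<lambda>ws. \<omega> (take k ws) * \<psi> (v # drop k ws))"
proof -
  let ?f = "\<lambda>ws. \<omega> (take k ws) * \<psi> (drop k ws)"
  have low: "(- 1) ^ j *\<^sub>R alternator vs (\<lambda>ws. ?f (insert_at j v ws)) =
      alternator vs (\<lambda>ws. \<omega> (v # take (k - 1) ws) * \<psi> (drop (k - 1) ws))" if "j < k" for j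
    unfolding alternator_scaleR[symmetric]
  proof (rule alternator_cong)
    fix ws :: "(real ^ 'a) list" assume ws: "length ws = length vs"
    have j: "j \<le> length ws" using that len ws by simp
    show "(- 1) ^ j *\<^sub>R ?f (insert_at j v ws) = \<omega> (v # take (k - 1) ws) * \<psi> (drop (k - 1) ws)"
      using j that
      by (simp add: take_insert_at_less drop_insert_at_less alt_form_insert_at[OF \<omega>] scaleR_conv_of_real)
  qed
  have high: "(- 1) ^ j *\<^sub>R alternator vs (\<lambda>ws. ?f (insert_at j v ws)) =
      (- 1) ^ k * alternator vs (\<lambda>ws. \<omega> (take k ws) * \<psi> (v # drop k ws))"
    if "k \<le> j" "j < k + q" for j
    unfolding alternator_scaleR[symmetric] alternator_mult[symmetric]
  proof (rule alternator_cong)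
    fix ws :: "(real ^ 'a) list" assume ws: "length ws = length vs"
    from \<open>k \<le> j\<close> obtain d where d: "j = k + d" using le_Suc_ex by auto
    have j: "j \<le> length ws" using that len ws by simp
    have "(- 1) ^ j *\<^sub>R (\<omega> (take k ws) * \<psi> (insert_at d v (drop k ws))) =
        (- 1) ^ k * (\<omega> (take k ws) * \<psi> (v # drop k ws))"
      using j d by (subst alt_form_insert_at[OF \<psi>]) (simp_all add: scaleR_conv_of_real power_add)
    then show "(- 1) ^ j *\<^sub>R ?f (insert_at j v ws) = (- 1) ^ k * (\<omega> (take k ws) * \<psi> (v # drop k ws))"
      using j that d by (simp add: take_insert_at drop_insert_at)
  qed
  have "alternator (v # vs) ?f = (\<Sum>j<k + q. (- 1) ^ j *\<^sub>R alternator vs (\<lambda>ws. ?f (insert_at j v ws)))"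
    unfolding alternator_Cons by (simp add: lessThan_Suc_atMost flip: len)
  also have "{..<k + q} = {..<k} \<union> {k..<k + q}" by auto
  also have "(\<Sum>j\<in>{..<k} \<union> {k..<k + q}. (- 1) ^ j *\<^sub>R alternator vs (\<lambda>ws. ?f (insert_at j v ws))) =
      (\<Sum>j\<in>{..<k}. (- 1) ^ j *\<^sub>R alternator vs (\<lambda>ws. ?f (insert_at j v ws))) +
      (\<Sum>j\<in>{k..<k + q}. (- 1) ^ j *\<^sub>R alternator vs (\<lambda>ws. ?f (insert_at j v ws)))"
    by (rule sum.union_disjoint) auto
  finally show ?thesis by (simp add: low high)
qed

text \<open>Trades the multiplicity of equal terms against the factorial in the normalisation of the
  wedge product.\<close>

lemma Suc_mult_divide_fact:
  "of_nat (Suc m) * x / (fact (Suc m) * y) = (x / (fact m * y) :: 'a::field_char_0)"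
  unfolding fact_Suc mult.assoc by (rule mult_divide_mult_cancel_left) (simp del: of_nat_Suc)

lemma Suc_mult_divide_fact':
  "of_nat (Suc m) * x / (y * fact (Suc m)) = (x / (y * fact m) :: 'a::field_char_0)"
  using Suc_mult_divide_fact[of m x y] by (simp only: mult.commute[of y])

text \<open>This covers \<open>k = 0\<close> and \<open>q = 0\<close>, where the contraction of a 0-form is zero and the truncated
  degree of the corresponding factor is irrelevant.\<close>

lemma contract_wedge:
  assumes \<omega>: "alt_form k \<omega>" and \<psi>: "alt_form q \<psi>"
  shows "contract v (wedge k q \<omega> \<psi>) =
    (\<lambda>vs. wedge (k - 1) q (contract v \<omega>) \<psi> vs + (- 1) ^ k * wedge k (q - 1) \<omega> (contract v \<psi>) vs)"
proof
  fix vs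
  show "contract v (wedge k q \<omega> \<psi>) vs =
    wedge (k - 1) q (contract v \<omega>) \<psi> vs + (- 1) ^ k * wedge k (q - 1) \<omega> (contract v \<psi>) vs"
  proof (cases "Suc (length vs) = k + q")
    case len: True
    have 1: "of_nat k * alternator vs (\<lambda>ws. \<omega> (v # take (k - 1) ws) * \<psi> (drop (k - 1) ws)) / (fact k * fact q) =
        wedge (k - 1) q (contract v \<omega>) \<psi> vs"
    proof (cases k)
      case 0
      show ?thesis unfolding 0 by (simp add: contract_0form[OF \<omega>[unfolded 0]])
    next
      case (Suc m)
      then show ?thesis
        using len unfolding Suc by (subst Suc_mult_divide_fact) (simp add: wedge_alternator contract_def)
    qed
    have 2: "of_nat q * alternator vs (\<lambda>ws. \<omega> (take k ws) * \<psi> (v # drop k ws)) / (fact k * fact q) =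
        wedge k (q - 1) \<omega> (contract v \<psi>) vs"
    proof (cases q)
      case 0
      show ?thesis unfolding 0 by (simp add: contract_0form[OF \<psi>[unfolded 0]])
    next
      case (Suc m)
      then show ?thesis
        using len unfolding Suc by (subst Suc_mult_divide_fact') (simp add: wedge_alternator contract_def)
    qed
    have "contract v (wedge k q \<omega> \<psi>) vs =
        of_nat k * alternator vs (\<lambda>ws. \<omega> (v # take (k - 1) ws) * \<psi> (drop (k - 1) ws)) / (fact k * fact q) +
        (- 1) ^ k * (of_nat q * alternator vs (\<lambda>ws. \<omega> (take k ws) * \<psi> (v # drop k ws)) / (fact k * fact q))"
      unfolding contract_def wedge_alternator length_Cons
      by (simp only: len refl if_True simp_thms alternator_take_drop_Cons[OF \<omega> \<psi> len] add_divide_distrib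
          times_divide_eq_right mult.assoc)
    then show ?thesis unfolding 1 2 .
  next
    case False
    have "wedge (k - 1) q (contract v \<omega>) \<psi> vs = 0"
    proof (cases k)
      case 0
      show ?thesis by (simp add: contract_0form[OF \<omega>[unfolded 0]])
    qed (use False in \<open>simp add: wedge_alternator\<close>)
    moreover have "wedge k (q - 1) \<omega> (contract v \<psi>) vs = 0"
    proof (cases q)
      case 0
      show ?thesis by (simp add: contract_0form[OF \<psi>[unfolded 0]])
    qed (use False in \<open>simp add: wedge_alternator\<close>)
    ultimately show ?thesis
      using False by (simp add: contract_def wedge_alternator)
  qed
qed

lemma wedge_Cons:
  assumes "alt_form k \<omega>" "alt_form q \<psi>"
  shows "wedge k q \<omega> \<psi> (v # vs) =
    wedge (k - 1) q (contract v \<omega>) \<psi> vs + (- 1) ^ k * wedge k (q - 1) \<omega> (contract v \<psi>) vs"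
  using contract_wedge[OF assms, of v] by (simp add: contract_def fun_eq_iff)

lemma wedge_add_left: "wedge k q (\<lambda>vs. \<omega> vs + \<omega>' vs) \<psi> vs = wedge k q \<omega> \<psi> vs + wedge k q \<omega>' \<psi> vs"
  by (simp add: wedge_alternator distrib_right alternator_add add_divide_distrib)

lemma wedge_add_right: "wedge k q \<omega> (\<lambda>vs. \<psi> vs + \<psi>' vs) vs = wedge k q \<omega> \<psi> vs + wedge k q \<omega> \<psi>' vs"
  by (simp add: wedge_alternator distrib_left alternator_add add_divide_distrib)

lemma wedge_mult_left: "wedge k q (\<lambda>vs. a * \<omega> vs) \<psi> vs = a * wedge k q \<omega> \<psi> vs"
  by (simp add: wedge_alternator mult.assoc alternator_mult)

lemma wedge_mult_right: "wedge k q \<omega> (\<lambda>vs. a * \<psi> vs) vs = a * wedge k q \<omega> \<psi> vs"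
  by (simp add: wedge_alternator mult.left_commute alternator_mult)

lemma wedge_minus_left: "wedge k q (\<lambda>vs. - \<omega> vs) \<psi> vs = - wedge k q \<omega> \<psi> vs"
  using wedge_mult_left[of k q "- 1"] by simp

lemma wedge_0form:
  assumes "alt_form 0 c" "alt_form q \<psi>"
  shows "wedge 0 q c \<psi> vs = c [] * \<psi> vs"
  using assms(2)
proof (induction vs arbitrary: q \<psi>)
  case Nil
  then show ?case by (auto simp: wedge_alternator alt_form_length)
next
  case (Cons v vs)
  then show ?case
    using alt_form_contract[OF Cons.prems, of v]
    by (simp add: wedge_Cons[OF assms(1) Cons.prems] contract_0form[OF assms(1)] Cons.IH)
      (simp add: contract_def)
qed

lemma wedge_1form:
  assumes "alt_form 1 \<alpha>" "alt_form q \<psi>"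
  shows "wedge 1 q \<alpha> \<psi> vs = esum (\<lambda>u ws. \<alpha> [u] * \<psi> ws) vs"
  using assms(2)
proof (induction vs arbitrary: q \<psi>)
  case Nil
  then show ?case by (simp add: wedge_alternator)
next
  case (Cons v vs)
  have "alt_form 0 (contract v \<alpha>)" using alt_form_contract[OF assms(1), of v] by simp
  then have "wedge 0 q (contract v \<alpha>) \<psi> vs = \<alpha> [v] * \<psi> vs"
    using wedge_0form[of "contract v \<alpha>" q \<psi> vs] Cons.prems by (simp add: contract_def)
  moreover have "wedge 1 (q - 1) \<alpha> (contract v \<psi>) vs = esum (\<lambda>u ws. \<alpha> [u] * \<psi> (v # ws)) vs"
    by (subst Cons.IH[OF alt_form_contract[OF Cons.prems]]) (simp add: contract_def)
  ultimately show ?case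
    unfolding wedge_Cons[OF assms(1) Cons.prems] esum_Cons by simp
qed

text \<open>The sum of e^i \<and> i_{e_i} is the number operator, which multiplies a
  \<open>k\<close>-form by \<open>k\<close>. Splitting off \<open>v\<close> gives one term in which
  \<open>v\<close> is the removed vector and terms in which it stays; as contractions anticommute,
  the latter reduce to the induction hypothesis with weights \<open>k\<close> and
  \<open>k - 1\<close>. For k = 2 and k = 3 this produces the coefficients of the terms in
  \<open>H\<close> under alternation.\<close>

lemma esum_wedge_contract:
  assumes "alt_form k \<omega>" "alt_form q \<psi>"
  shows "esum (\<lambda>u. wedge (k - 1) q (contract u \<omega>) \<psi>) vs = of_nat k * wedge k q \<omega> \<psi> vs"
  using assms
proof (induction vs arbitrary: k q \<omega> \<psi>)
  case Nil
  then show ?case by (cases k) (auto simp: wedge_alternator)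
next
  case (Cons v vs)
  note \<omega> = Cons.prems(1) and \<psi> = Cons.prems(2)
  show ?case
  proof (cases k)
    case 0
    then show ?thesis using \<omega> by (simp add: contract_0form)
  next
    case (Suc m)
    have "wedge (k - 1) q (contract u \<omega>) \<psi> (v # ws) =
        (- 1) ^ m * wedge (k - 1) (q - 1) (contract u \<omega>) (contract v \<psi>) ws -
        wedge (k - 1 - 1) q (contract u (contract v \<omega>)) \<psi> ws" for u ws
      unfolding wedge_Cons[OF alt_form_contract[OF \<omega>] \<psi>]
      using contract_contract[OF \<omega>, of v u] by (simp add: wedge_minus_left Suc)
    then have "esum (\<lambda>u. wedge (k - 1) q (contract u \<omega>) \<psi>) (v # vs) =
        wedge (k - 1) q (contract v \<omega>) \<psi> vs -
        ((- 1) ^ m * (of_nat k * wedge k (q - 1) \<omega> (contract v \<psi>) vs) -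
         of_nat (k - 1) * wedge (k - 1) q (contract v \<omega>) \<psi> vs)"
      using Cons.IH[OF \<omega> alt_form_contract[OF \<psi>]] Cons.IH[OF alt_form_contract[OF \<omega>] \<psi>]
      by (simp add: esum_Cons esum_diff esum_mult)
    then show ?thesis
      unfolding wedge_Cons[OF \<omega> \<psi>] by (simp add: Suc algebra_simps)
  qed
qed

text \<open>The same count for a single form: each summand equals \<omega> once the removed vector
  is moved back to its place.\<close>

lemma esum_contract:
  assumes "alt_form p \<omega>"
  shows "esum (\<lambda>u. contract u \<omega>) vs = of_nat (length vs) * \<omega> vs"
proof -
  have "(- 1) ^ a *\<^sub>R contract (vs ! a) \<omega> (omit a vs) = \<omega> vs" if "a < length vs" for a
  proof -
    have "\<omega> vs = \<omega> (take a vs @ vs ! a # drop (Suc a) vs)"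
      by (subst id_take_nth_drop[OF that, symmetric]) (rule refl)
    also have "\<dots> = (- 1) ^ a * \<omega> (vs ! a # take a vs @ drop (Suc a) vs)"
      using that by (subst alt_form_front[OF assms]) simp
    finally show ?thesis
      unfolding contract_def omit_def by (simp only: scaleR_conv_of_real of_real_power of_real_minus of_real_1)
  qed
  then have "esum (\<lambda>u. contract u \<omega>) vs = (\<Sum>a<length vs. \<omega> vs)"
    unfolding esum_def by (intro sum.cong) auto
  then show ?thesis by simp
qed

lemma wedge_map:
  "wedge k q \<omega> \<psi> (map J vs) = wedge k q (\<lambda>ws. \<omega> (map J ws)) (\<lambda>ws. \<psi> (map J ws)) vs"
  unfolding wedge_alternator length_map alternator_map take_map drop_map ..

section \<open>Components\<close>

lemma idx_0 [simp]: "idx 0 = {[]}"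
  by (auto simp: idx_def)

lemma idx_Suc: "idx (Suc p) = (\<lambda>(i, is). i # is) ` (UNIV \<times> idx p)"
proof (rule set_eqI)
  show "is \<in> idx (Suc p) \<longleftrightarrow> is \<in> (\<lambda>(i, is). i # is) ` (UNIV \<times> idx p)" for "is" :: "'a list"
    by (cases "is") (auto simp: idx_def)
qed

lemma sum_idx_Suc: "(\<Sum>is\<in>idx (Suc p). h is) = (\<Sum>i\<in>UNIV. \<Sum>is\<in>idx p. h (i # is))"
proof -
  have inj: "inj_on (\<lambda>(i, is). i # is) (UNIV \<times> idx p)" by (auto simp: inj_on_def)
  show ?thesis
    unfolding idx_Suc sum.reindex[OF inj] by (simp add: sum.cartesian_product case_prod_beta)
qed

lemma linear_expand:
  fixes f :: "real ^ 'n \<Rightarrow> 'b::real_vector"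
  assumes "linear f"
  shows "f v = (\<Sum>i\<in>UNIV. v $ i *\<^sub>R f (axis i 1))"
proof -
  have "f v = f (\<Sum>i\<in>UNIV. v $ i *\<^sub>R axis i 1)"
    using basis_expansion[of v] by (simp add: scalar_mult_eq_scaleR)
  then show ?thesis using assms by (simp add: linear_sum linear_cmul)
qed

lemma multilinear_expand:
  fixes f :: "(real ^ 'n) list \<Rightarrow> 'b::real_vector"
  assumes "multilinear_list p f" "length vs = p"
  shows "f vs = (\<Sum>is\<in>idx p. (\<Prod>k<p. vs ! k $ (is ! k)) *\<^sub>R f (map (\<lambda>i. axis i 1) is))"
  using assms
proof (induction p arbitrary: f vs)
  case (Suc p)
  then obtain v ws where vs: "vs = v # ws" "length ws = p" by (auto simp: length_Suc_conv)
  have lin: "linear (\<lambda>v. f (v # ws))"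
    using multilinear_listD[OF Suc.prems(1), of "[]" ws] vs by simp
  have "multilinear_list p (\<lambda>ws. f (axis i 1 # ws))" for i
    using multilinear_list_insert_at[OF Suc.prems(1), of 0 "axis i 1"] by simp
  from Suc.IH[OF this vs(2)]
  have "f (axis i 1 # ws) =
      (\<Sum>is\<in>idx p. (\<Prod>k<p. ws ! k $ (is ! k)) *\<^sub>R f (axis i 1 # map (\<lambda>i. axis i 1) is))" for i .
  then show ?case
    unfolding vs(1) linear_expand[OF lin, of v] sum_idx_Suc
    by (simp add: scaleR_sum_right prod.lessThan_Suc_shift del: prod.lessThan_Suc)
qed simp

text \<open>All index lists are summed, not only the increasing ones, so basis forms weighted by
  components give the alternation without a factor 1/p!. The normalisation of
  \<open>int_form\<close> is matched with that of the wedge product through this identity.\<close>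

lemma sum_basis_form:
  assumes "multilinear_list p f" "length vs = p"
  shows "(\<Sum>is\<in>idx p. f (map (\<lambda>i. axis i 1) is) * basis_form is vs) = alternator vs f"
proof -
  have "(\<Sum>is\<in>idx p. f (map (\<lambda>i. axis i 1) is) * basis_form is vs) =
     (\<Sum>is\<in>idx p. \<Sum>\<sigma> | \<sigma> permutes {..<p}. of_int (sign \<sigma>) *\<^sub>R
        ((\<Prod>k<p. permute_list \<sigma> vs ! k $ (is ! k)) *\<^sub>R f (map (\<lambda>i. axis i 1) is)))"
  proof (rule sum.cong[OF refl])
    fix "is" :: "'a list" assume "is \<in> idx p"
    then have l: "length is = p" by (simp add: idx_def)
    have "(\<Prod>k<p. vs ! \<sigma> k $ (is ! k)) = (\<Prod>k<p. permute_list \<sigma> vs ! k $ (is ! k))"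
      if "\<sigma> permutes {..<p}" for \<sigma>
      using that assms(2) by (intro prod.cong) (auto simp: permute_list_nth)
    then show "f (map (\<lambda>i. axis i 1) is) * basis_form is vs =
      (\<Sum>\<sigma> | \<sigma> permutes {..<p}. of_int (sign \<sigma>) *\<^sub>R
        ((\<Prod>k<p. permute_list \<sigma> vs ! k $ (is ! k)) *\<^sub>R f (map (\<lambda>i. axis i 1) is)))"
      unfolding basis_form_def using l assms(2)
      by (simp add: sum_distrib_left scaleR_conv_of_real mult_ac)
  qed
  also have "\<dots> = (\<Sum>\<sigma> | \<sigma> permutes {..<p}. of_int (sign \<sigma>) *\<^sub>R f (permute_list \<sigma> vs))"
    using assms by (subst sum.swap) (simp add: multilinear_expand[OF assms(1)] scaleR_sum_right)
  finally show ?thesis using assms(2) by (simp add: alternator_def)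
qed

text \<open>Pigeonhole: a list of more than \<open>n\<close> basis indices repeats one of them. This
  settles the degree \<open>p = n + 1\<close>, where the trace gives no information.\<close>

lemma alt_form_degree_gt:
  fixes \<omega> :: "'n::finite aform"
  assumes "alt_form p \<omega>" "CARD('n) < p"
  shows "\<omega> = (\<lambda>vs. 0)"
proof
  fix vs
  have "\<omega> (map (\<lambda>i. axis i 1) is) = 0" if "is \<in> idx p" for "is"
  proof -
    have "card (set is) \<le> CARD('n)" by (intro card_mono) auto
    then have "\<not> distinct is" using that assms(2) distinct_card[of "is"] by (auto simp: idx_def)
    then obtain xs ys zs y where "is = xs @ [y] @ ys @ [y] @ zs"
      using not_distinct_decomp by blast
    then show ?thesis using alt_form_repeated[OF assms(1)] by simp
  qed
  then show "\<omega> vs = 0"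
    using multilinear_expand[OF multilinear_alt_form[OF assms(1)], of vs] alt_form_length[OF assms(1)]
    by (cases "length vs = p") simp_all
qed

section \<open>Contraction with a metric\<close>

definition gram :: "real ^ 'n ^ 'n::finite \<Rightarrow> bool" where
  "gram G \<longleftrightarrow> (\<forall>u v. bil G u v = bil G v u) \<and> (\<forall>v. v \<noteq> 0 \<longrightarrow> bil G v v > 0)"

lemma bil_inner: "bil G u v = u \<bullet> (G *v v)"
  by (simp add: bil_def inner_vec_def matrix_vector_mult_def sum_distrib_left mult_ac)

lemma linear_bil_right: "linear (bil G u)"
  unfolding bil_inner
  by (simp add: linear_iff matrix_vector_right_distrib inner_add_right matrix_vector_mult_scaleR)

lemma linear_bil_left: "linear (\<lambda>u. bil G u v)"
  unfolding bil_inner by (simp add: linear_iff inner_add_left)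

lemma bil_axis_left: "bil G (axis i 1) v = (G *v v) $ i"
  unfolding bil_inner by (simp add: inner_axis' inner_real_def)

lemma bil_axis_axis: "bil G (axis i 1) (axis j 1) = G $ i $ j"
  unfolding bil_axis_left matrix_vector_mul_component by (simp add: inner_axis)

lemma bil_mat_1: "bil (mat 1) u v = u \<bullet> v"
  by (simp add: bil_inner)

lemma gram_sym: "gram G \<Longrightarrow> bil G u v = bil G v u"
  by (simp add: gram_def)

lemma gram_transpose: "gram G \<Longrightarrow> transpose G = G"
  using gram_sym[of G "axis _ 1" "axis _ 1"] by (simp add: bil_axis_axis transpose_def vec_eq_iff)

lemma gram_nondegenerate: "gram G \<Longrightarrow> (\<And>w. bil G u w = bil G v w) \<Longrightarrow> u = v"
  using linear_diff[OF linear_bil_left, of G] unfolding gram_def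
  by (metis diff_self eq_iff_diff_eq_0 less_irrefl)

lemma gram_invertible:
  assumes "gram G"
  shows "invertible G"
proof -
  have "v = 0" if "G *v v = 0" for v
    using assms that unfolding gram_def bil_inner by (metis inner_zero_right less_irrefl)
  then show ?thesis
    unfolding invertible_left_inverse matrix_left_invertible_ker by blast
qed

lemma matrix_inv_works:
  assumes "invertible (G :: real ^ 'n ^ 'n)"
  shows "G ** matrix_inv G = mat 1" "matrix_inv G ** G = mat 1"
  using assms unfolding invertible_def matrix_inv_def by (metis (mono_tags, lifting) someI_ex)+

lemma matrix_inv_sym:
  assumes "gram G"
  shows "matrix_inv G $ i $ j = matrix_inv G $ j $ i"
proof -
  note inv = matrix_inv_works[OF gram_invertible[OF assms]]
  have "transpose (matrix_inv G) ** G = mat 1"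
    using arg_cong[OF inv(1), of transpose] by (simp add: matrix_transpose_mul gram_transpose[OF assms] transpose_mat)
  then have "transpose (matrix_inv G) ** G ** matrix_inv G = matrix_inv G" by simp
  then have "transpose (matrix_inv G) = matrix_inv G"
    by (simp add: inv(1) flip: matrix_mul_assoc)
  then have "transpose (matrix_inv G) $ i $ j = matrix_inv G $ i $ j" by simp
  then show ?thesis by (simp add: transpose_def)
qed

lemma gram_mat_1 [simp]: "gram (mat 1)"
  by (simp add: gram_def bil_mat_1 inner_commute)

lemma matrix_inv_mat_1 [simp]: "matrix_inv (mat 1 :: real ^ 'n ^ 'n) = mat 1"
  using matrix_inv_works(1)[OF gram_invertible[OF gram_mat_1]] by simp

section \<open>Metric traces\<close>

definition mtrace :: "real ^ 'n ^ 'n \<Rightarrow> (real ^ 'n \<Rightarrow> real ^ 'n \<Rightarrow> 'b::real_vector) \<Rightarrow> 'b" where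
  "mtrace G B = (\<Sum>i\<in>UNIV. \<Sum>j\<in>UNIV. matrix_inv G $ i $ j *\<^sub>R B (axis i 1) (axis j 1))"

lemma mtrace_add: "mtrace G (\<lambda>u w. B u w + C u w) = mtrace G B + mtrace G C"
  by (simp add: mtrace_def sum.distrib scaleR_add_right)

lemma mtrace_diff: "mtrace G (\<lambda>u w. B u w - C u w) = mtrace G B - mtrace G C"
  by (simp add: mtrace_def sum_subtractf scaleR_diff_right)

lemma mtrace_minus: "mtrace G (\<lambda>u w. - B u w) = - mtrace G B"
  by (simp add: mtrace_def sum_negf)

lemma mtrace_scaleR: "mtrace G (\<lambda>u w. c *\<^sub>R B u w) = c *\<^sub>R mtrace G B"
  by (simp add: mtrace_def scaleR_sum_right mult.commute)

lemma mtrace_mult: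
  fixes B :: "_ \<Rightarrow> _ \<Rightarrow> complex"
  shows "mtrace G (\<lambda>u w. c * B u w) = c * mtrace G B"
  by (simp add: mtrace_def sum_distrib_left)

lemma mtrace_mult_right:
  fixes B :: "_ \<Rightarrow> _ \<Rightarrow> complex"
  shows "mtrace G (\<lambda>u w. B u w * c) = mtrace G B * c"
  by (simp add: mtrace_def sum_distrib_right)

lemma mtrace_zero [simp]: "mtrace G (\<lambda>u w. 0) = 0"
  by (simp add: mtrace_def)

lemma mtrace_linear:
  assumes "linear h"
  shows "h (mtrace G B) = mtrace G (\<lambda>u w. h (B u w))"
  using assms by (simp add: mtrace_def linear_sum linear_cmul)

lemma mtrace_sum: "mtrace G (\<lambda>u w. \<Sum>i\<in>S. B i u w) = (\<Sum>i\<in>S. mtrace G (B i))"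
  by (induction S rule: infinite_finite_induct) (simp_all add: mtrace_add)

lemma mtrace_swap:
  "mtrace G (\<lambda>u w. mtrace G' (\<lambda>a b. F u w a b)) = mtrace G' (\<lambda>a b. mtrace G (\<lambda>u w. F u w a b))"
proof -
  have "mtrace G' (\<lambda>a b. mtrace G (\<lambda>u w. F u w a b)) =
      (\<Sum>i\<in>UNIV. \<Sum>j\<in>UNIV. matrix_inv G $ i $ j *\<^sub>R mtrace G' (\<lambda>a b. F (axis i 1) (axis j 1) a b))"
    unfolding mtrace_def[of G] mtrace_sum mtrace_scaleR ..
  then show ?thesis by (simp add: mtrace_def[of G])
qed

lemma mtrace_commute:
  assumes "gram G"
  shows "mtrace G (\<lambda>u w. B w u) = mtrace G B"
  unfolding mtrace_def by (subst sum.swap) (simp add: matrix_inv_sym[OF assms])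

lemma mtrace_antisym:
  assumes "gram G" "\<And>u w. B u w = - B w u"
  shows "mtrace G B = 0"
proof -
  have "mtrace G B = mtrace G (\<lambda>u w. - B w u)"
    unfolding mtrace_def by (intro sum.cong refl arg_cong[where f = "scaleR _"] assms(2))
  also have "\<dots> = - mtrace G B"
    using mtrace_minus[of G "\<lambda>u w. B w u"] mtrace_commute[OF assms(1), of B] by simp
  finally have "2 *\<^sub>R mtrace G B = 0"
    unfolding scaleR_2 by (metis add.right_inverse)
  then show ?thesis by simp
qed

text \<open>Lowering and raising an index: g^{ij} g(e_i, v) f(e_j) = f(v). Traces are evaluated
  through this identity whenever possible, instead of in components.\<close>

lemma mtrace_reproduce:
  assumes "gram G" "linear f"
  shows "mtrace G (\<lambda>u w. bil G u v *\<^sub>R f w) = f v"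
proof -
  note inv = matrix_inv_works[OF gram_invertible[OF assms(1)]]
  have "mtrace G (\<lambda>u w. bil G u v *\<^sub>R f w) =
      (\<Sum>j\<in>UNIV. (\<Sum>i\<in>UNIV. matrix_inv G $ j $ i * (G *v v) $ i) *\<^sub>R f (axis j 1))"
    unfolding mtrace_def bil_axis_left
    by (subst sum.swap) (simp add: scaleR_sum_left matrix_inv_sym[OF assms(1)])
  also have "\<dots> = (\<Sum>j\<in>UNIV. (matrix_inv G *v (G *v v)) $ j *\<^sub>R f (axis j 1))"
    by (simp add: matrix_vector_mult_def)
  also have "\<dots> = f v"
    by (simp add: matrix_vector_mul_assoc inv flip: linear_expand[OF assms(2)])
  finally show ?thesis .
qed

lemma mtrace_reproduce':
  assumes "gram G" "linear f"
  shows "mtrace G (\<lambda>u w. bil G w v *\<^sub>R f u) = f v"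
  using mtrace_reproduce[OF assms, of v] mtrace_commute[OF assms(1), of "\<lambda>u w. bil G u v *\<^sub>R f w"] by simp

lemma mtrace_bil:
  fixes G :: "real ^ 'n ^ 'n"
  assumes "gram G"
  shows "mtrace G (bil G) = real CARD('n)"
proof -
  have "mtrace G (bil G) = (\<Sum>i\<in>UNIV. (matrix_inv G ** G) $ i $ i)"
    unfolding mtrace_def bil_axis_axis
    using gram_sym[OF assms, of "axis _ 1" "axis _ 1"] by (simp add: matrix_matrix_mult_def bil_axis_axis)
  then show ?thesis
    by (simp add: matrix_inv_works[OF gram_invertible[OF assms]] mat_def)
qed

text \<open>Independence of the trace from coordinates. One slot of \<open>B\<close> is written
  through the reproducing identity of \<open>G'\<close>, the two traces are exchanged, and the
  isometry lets the reproducing identity of \<open>G\<close> remove the inner one. Positive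
  definiteness makes \<open>J\<close> injective, hence onto, which provides the preimages
  \<open>K a\<close>.\<close>

lemma mtrace_isometry:
  fixes J :: "real ^ 'n \<Rightarrow> real ^ 'n"
  assumes G: "gram G" and G': "gram G'" and J: "linear J" and iso: "\<And>u v. bil G u v = bil G' (J u) (J v)"
    and B: "\<And>u. linear (\<lambda>w. B u w)" "\<And>w. linear (\<lambda>u. B u w)"
  shows "mtrace G (\<lambda>u w. B (J u) (J w)) = mtrace G' B"
proof -
  have "inj J"
    unfolding linear_injective_0[OF J]
  proof (intro allI impI)
    fix v assume "J v = 0"
    then have "bil G v v = 0" using iso[of v v] by (simp add: linear_0[OF linear_bil_left])
    then show "v = 0" using G unfolding gram_def by force
  qed
  then have "surj J" using linear_injective_imp_surjective[OF J] by simp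
  then obtain K where K: "J (K a) = a" for a by (metis surj_f_inv_f)
  have "mtrace G (\<lambda>u w. B (J u) (J w)) =
      mtrace G (\<lambda>u w. mtrace G' (\<lambda>a b. bil G' a (J u) *\<^sub>R B b (J w)))"
    using mtrace_reproduce[OF G' B(2)] by simp
  also have "\<dots> = mtrace G' (\<lambda>a b. mtrace G (\<lambda>u w. bil G u (K a) *\<^sub>R B b (J w)))"
    by (subst mtrace_swap) (simp add: iso K gram_sym[OF G'])
  also have "\<dots> = mtrace G' (\<lambda>a b. B b (J (K a)))"
    using mtrace_reproduce[OF G linear_compose[OF J B(1)]] by (simp add: o_def)
  also have "\<dots> = mtrace G' B"
    unfolding K by (rule mtrace_commute[OF G'])
  finally show ?thesis .
qed

text \<open>Isometry invariance for the map \<open>J\<close> from Euclidean space that sends the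
  coordinate basis to the frame.\<close>

lemma mtrace_orthonormal:
  fixes E :: "'n::finite \<Rightarrow> real ^ 'n"
  assumes G: "gram G" and E: "\<And>i j. bil G (E i) (E j) = (if i = j then 1 else 0)"
    and B: "\<And>u. linear (\<lambda>w. B u w)" "\<And>w. linear (\<lambda>u. B u w)"
  shows "mtrace G B = (\<Sum>i\<in>UNIV. B (E i) (E i))"
proof -
  define J where "J v = (\<Sum>i\<in>UNIV. v $ i *\<^sub>R E i)" for v :: "real ^ 'n"
  have J: "linear J"
    by (rule linearI) (simp_all add: J_def scaleR_add_left sum.distrib scaleR_sum_right)
  have J_axis: "J (axis i 1) = E i" for i
    unfolding J_def axis_def by (simp add: if_distrib[of "\<lambda>c. c *\<^sub>R _"] cong: if_cong)
  have "bil (mat 1) u v = bil G (J u) (J v)" for u v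
    unfolding J_def bil_mat_1 inner_vec_def
    by (simp add: linear_sum[OF linear_bil_left] linear_sum[OF linear_bil_right] linear_cmul[OF linear_bil_left]
        linear_cmul[OF linear_bil_right] E if_distrib[of "\<lambda>c. _ * c"] mult.commute cong: if_cong)
  from mtrace_isometry[OF gram_mat_1 G J this B]
  have "mtrace G B = mtrace (mat 1) (\<lambda>u w. B (J u) (J w))" by simp
  also have "\<dots> = (\<Sum>i\<in>UNIV. B (E i) (E i))"
    by (simp add: mtrace_def J_axis) (simp add: mat_def if_distrib[of "\<lambda>c. c *\<^sub>R _"] cong: if_cong)
  finally show ?thesis .
qed

text \<open>Contraction of the first \<open>k\<close> slots of both forms, one pair at a time. The
  prefactors accumulate to 1/k!, the normalisation of the pointwise inner product, so the same
  recursion computes \<open>form_inner\<close> (on the empty list) and \<open>vee\<close>.\<close>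

primrec ctr :: "real ^ 'n ^ 'n \<Rightarrow> nat \<Rightarrow> 'n::finite aform \<Rightarrow> 'n aform \<Rightarrow> 'n aform" where
  "ctr G 0 \<omega> \<psi> = (\<lambda>vs. \<omega> [] * \<psi> vs)"
| "ctr G (Suc k) \<omega> \<psi> =
     (\<lambda>vs. 1 / of_nat (Suc k) * mtrace G (\<lambda>u w. ctr G k (contract u \<omega>) (contract w \<psi>) vs))"

lemma contract_mtrace:
  "contract v (\<lambda>vs. mtrace G (\<lambda>a b. \<omega> a b vs)) = (\<lambda>vs. mtrace G (\<lambda>a b. contract v (\<omega> a b) vs))"
  by (auto simp: contract_def)

lemma esum_mtrace:
  "esum (\<lambda>u ws. mtrace G (\<lambda>a b. T u a b ws)) vs = mtrace G (\<lambda>a b. esum (\<lambda>u. T u a b) vs)"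
  by (simp add: mtrace_def esum_sum esum_scaleR)

lemma alt_form_mtrace:
  "(\<And>u w. alt_form p (B u w)) \<Longrightarrow> alt_form p (\<lambda>vs. mtrace G (\<lambda>u w. B u w vs))"
  unfolding mtrace_def by (intro alt_form_sum alt_form_scaleR)

lemma linear_mtrace:
  assumes "\<And>a b. linear (\<lambda>u. B u a b)"
  shows "linear (\<lambda>u. mtrace G (B u))"
  unfolding mtrace_def by (intro linear_compose_sum ballI linear_compose_scale_right assms)

lemma linear_cmult: "linear f \<Longrightarrow> linear (\<lambda>u. c * f u :: complex)"
  using linear_compose[of f "(*) c"] bounded_linear.linear[OF bounded_linear_mult_right[of c]]
  by (simp add: o_def)

lemma ctr_zero_left [simp]: "ctr G k (\<lambda>vs. 0) \<psi> = (\<lambda>vs. 0)"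
  by (induction k arbitrary: \<psi>) auto

lemma ctr_zero_right [simp]: "ctr G k \<omega> (\<lambda>vs. 0) = (\<lambda>vs. 0)"
  by (induction k arbitrary: \<omega>) auto

lemma ctr_mult_right: "ctr G k \<omega> (\<lambda>vs. a * \<psi> vs) vs = a * ctr G k \<omega> \<psi> vs"
  by (induction k arbitrary: \<omega> \<psi>) (simp_all add: contract_mult mtrace_mult mult.left_commute del: of_nat_Suc)

lemma ctr_mult_left: "ctr G k (\<lambda>vs. a * \<omega> vs) \<psi> vs = a * ctr G k \<omega> \<psi> vs"
  by (induction k arbitrary: \<omega> \<psi>)
    (simp_all add: contract_mult mtrace_mult mult.left_commute mult.assoc del: of_nat_Suc)

lemma ctr_minus_right: "ctr G k \<omega> (\<lambda>vs. - \<psi> vs) vs = - ctr G k \<omega> \<psi> vs"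
  using ctr_mult_right[of G k \<omega> "- 1" \<psi> vs] by simp

lemma ctr_add_left: "ctr G k (\<lambda>vs. \<omega> vs + \<omega>' vs) \<psi> vs = ctr G k \<omega> \<psi> vs + ctr G k \<omega>' \<psi> vs"
  by (induction k arbitrary: \<omega> \<omega>' \<psi>)
    (simp_all add: contract_add mtrace_add distrib_left distrib_right add_divide_distrib del: of_nat_Suc)

lemma ctr_add_right: "ctr G k \<omega> (\<lambda>vs. \<psi> vs + \<psi>' vs) vs = ctr G k \<omega> \<psi> vs + ctr G k \<omega> \<psi>' vs"
  by (induction k arbitrary: \<omega> \<psi> \<psi>')
    (simp_all add: contract_add mtrace_add distrib_left distrib_right add_divide_distrib del: of_nat_Suc)

lemma ctr_mtrace_left:
  "ctr G k (\<lambda>vs. mtrace G' (\<lambda>a b. \<omega> a b vs)) \<psi> vs = mtrace G' (\<lambda>a b. ctr G k (\<omega> a b) \<psi> vs)"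
proof (induction k arbitrary: \<omega> \<psi>)
  case (Suc k)
  show ?case
    unfolding ctr.simps contract_mtrace Suc mtrace_mult by (subst mtrace_swap) (rule refl)
qed (simp add: mtrace_mult_right)

lemma ctr_mtrace_right:
  "ctr G k \<omega> (\<lambda>vs. mtrace G' (\<lambda>a b. \<psi> a b vs)) vs = mtrace G' (\<lambda>a b. ctr G k \<omega> (\<psi> a b) vs)"
proof (induction k arbitrary: \<omega> \<psi>)
  case (Suc k)
  show ?case
    unfolding ctr.simps contract_mtrace Suc mtrace_mult by (subst mtrace_swap) (rule refl)
qed (simp add: mtrace_mult)

lemma alt_form_ctr: "alt_form (k + q) \<psi> \<Longrightarrow> alt_form q (ctr G k \<omega> \<psi>)"
proof (induction k arbitrary: \<omega> \<psi>)
  case 0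
  then show ?case by (simp add: alt_form_scaled)
next
  case (Suc k)
  have "alt_form q (ctr G k (contract u \<omega>) (contract w \<psi>))" for u w
    using Suc.prems by (intro Suc.IH) (simp add: alt_form_contract_Suc)
  then show ?case
    unfolding ctr.simps by (intro alt_form_scaled alt_form_mtrace)
qed

lemma ctr_degree_less: "alt_form p \<psi> \<Longrightarrow> p < k \<Longrightarrow> ctr G k \<omega> \<psi> = (\<lambda>vs. 0)"
proof (induction k arbitrary: p \<omega> \<psi>)
  case (Suc k)
  have "ctr G k (contract u \<omega>) (contract w \<psi>) = (\<lambda>vs. 0)" for u w
  proof (cases p)
    case 0
    then show ?thesis using Suc.prems(1) by (simp add: contract_0form)
  next
    case (Suc m)
    then show ?thesis
      using Suc.prems by (intro Suc.IH[of m]) (simp_all add: alt_form_contract_Suc)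
  qed
  then show ?case by simp
qed simp

text \<open>The argument \<open>v\<close> has to pass the \<open>k\<close> contracted slots of
  \<psi>.\<close>

lemma contract_ctr:
  "alt_form p \<psi> \<Longrightarrow> contract v (ctr G k \<omega> \<psi>) = (\<lambda>vs. (- 1) ^ k * ctr G k \<omega> (contract v \<psi>) vs)"
proof (induction k arbitrary: p \<omega> \<psi>)
  case 0
  then show ?case by (simp add: contract_mult)
next
  case (Suc k)
  have "contract v (ctr G k (contract u \<omega>) (contract w \<psi>)) =
      (\<lambda>vs. (- 1) ^ Suc k * ctr G k (contract u \<omega>) (contract w (contract v \<psi>)) vs)" for u w
    unfolding Suc.IH[OF alt_form_contract[OF Suc.prems]] contract_contract[OF Suc.prems, of v w]
      ctr_minus_right by simp
  then show ?case
    unfolding ctr.simps contract_mult contract_mtrace mtrace_mult by (simp only: mult.left_commute mtrace_mult)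
qed

lemma linear_ctr_left:
  assumes "\<And>vs. linear (\<lambda>u. F u vs)"
  shows "linear (\<lambda>u. ctr G k (F u) \<psi> vs)"
  using assms
proof (induction k arbitrary: F \<psi>)
  case 0
  have "linear (\<lambda>u. \<psi> vs * F u [])" using 0 by (rule linear_cmult)
  then show ?case by (simp add: mult.commute)
next
  case (Suc k)
  show ?case
    unfolding ctr.simps by (intro linear_cmult linear_mtrace Suc.IH) (simp add: contract_def Suc.prems)
qed

lemma linear_ctr_right:
  assumes "\<And>vs. linear (\<lambda>u. F u vs)"
  shows "linear (\<lambda>u. ctr G k \<omega> (F u) vs)"
  using assms
proof (induction k arbitrary: F \<omega>)
  case 0
  then show ?case by (simp add: linear_cmult)
next
  case (Suc k)
  show ?case
    unfolding ctr.simps by (intro linear_cmult linear_mtrace Suc.IH) (simp add: contract_def Suc.prems)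
qed

lemma ctr_sym:
  assumes "gram G"
  shows "ctr G p \<omega> \<psi> [] = ctr G p \<psi> \<omega> []"
proof (induction p arbitrary: \<omega> \<psi>)
  case (Suc p)
  have "mtrace G (\<lambda>u w. ctr G p (contract u \<omega>) (contract w \<psi>) []) =
      mtrace G (\<lambda>u w. ctr G p (contract w \<psi>) (contract u \<omega>) [])"
    by (simp add: Suc.IH[of "contract _ \<omega>"])
  also have "\<dots> = mtrace G (\<lambda>u w. ctr G p (contract u \<psi>) (contract w \<omega>) [])"
    by (rule mtrace_commute[OF assms])
  finally show ?case by simp
qed simp

section \<open>Inner products and adjoints as iterated contractions\<close>

lemma form_inner_Suc:
  "form_inner G (Suc p) \<omega> \<psi> =
     1 / of_nat (Suc p) * mtrace G (\<lambda>u w. form_inner G p (contract u \<omega>) (contract w \<psi>))"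
proof -
  have comp: "component \<omega> (i # is) = component (contract (axis i 1) \<omega>) is" for \<omega> :: "'a aform" and i "is"
    by (simp add: component_def contract_def)
  have "form_inner G (Suc p) \<omega> \<psi> = (\<Sum>i\<in>UNIV. \<Sum>is\<in>idx p. \<Sum>j\<in>UNIV. \<Sum>js\<in>idx p.
      of_real (matrix_inv G $ i $ j) * (of_real (\<Prod>k<p. matrix_inv G $ (is ! k) $ (js ! k)) *
        component (contract (axis i 1) \<omega>) is * component (contract (axis j 1) \<psi>) js)) / fact (Suc p)"
    unfolding form_inner_def sum_idx_Suc comp prod.lessThan_Suc_shift
    by (simp add: mult_ac del: prod.lessThan_Suc)
  also have "(\<Sum>i\<in>UNIV. \<Sum>is\<in>idx p. \<Sum>j\<in>UNIV. \<Sum>js\<in>idx p.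
      of_real (matrix_inv G $ i $ j) * (of_real (\<Prod>k<p. matrix_inv G $ (is ! k) $ (js ! k)) *
        component (contract (axis i 1) \<omega>) is * component (contract (axis j 1) \<psi>) js)) =
      mtrace G (\<lambda>u w. \<Sum>is\<in>idx p. \<Sum>js\<in>idx p. of_real (\<Prod>k<p. matrix_inv G $ (is ! k) $ (js ! k)) *
        component (contract u \<omega>) is * component (contract w \<psi>) js)"
    unfolding mtrace_def scaleR_conv_of_real sum_distrib_left
    by (intro sum.cong refl sum.swap)
  also have "mtrace G (\<lambda>u w. \<Sum>is\<in>idx p. \<Sum>js\<in>idx p. of_real (\<Prod>k<p. matrix_inv G $ (is ! k) $ (js ! k)) *
        component (contract u \<omega>) is * component (contract w \<psi>) js) / fact (Suc p) =
      1 / of_nat (Suc p) * mtrace G (\<lambda>u w. form_inner G p (contract u \<omega>) (contract w \<psi>))"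
    unfolding form_inner_def divide_inverse mtrace_mult_right fact_Suc by (simp add: mult_ac del: of_nat_Suc)
  finally show ?thesis .
qed

lemma form_inner_eq: "form_inner G p \<omega> \<psi> = ctr G p \<omega> \<psi> []"
proof (induction p arbitrary: \<omega> \<psi>)
  case 0
  then show ?case by (simp add: form_inner_def component_def)
next
  case (Suc p)
  then show ?case unfolding form_inner_Suc by simp
qed

text \<open>Contraction with \<omega> is adjoint to wedging with \<omega>, by induction on the total
  degree. A contraction of the wedge product falls on either factor; the two cases contribute
  \<open>k\<close> and \<open>q\<close> copies of the same value, and the prefactor 1/(k + q) turns
  them into one.\<close>

lemma ctr_wedge:
  assumes "alt_form k \<omega>" "alt_form q \<phi>" "alt_form (k + q) \<psi>"
  shows "ctr G (k + q) (wedge k q \<omega> \<phi>) \<psi> vs = ctr G q \<phi> (ctr G k \<omega> \<psi>) vs"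
  using assms
proof (induction "k + q" arbitrary: k q \<omega> \<phi> \<psi>)
  case 0
  then show ?case by (simp add: wedge_alternator)
next
  case (Suc m)
  note \<omega> = Suc.prems(1) and \<phi> = Suc.prems(2) and \<psi> = Suc.prems(3)
  have 1: "mtrace G (\<lambda>u w. ctr G m (wedge (k - 1) q (contract u \<omega>) \<phi>) (contract w \<psi>) vs) =
      of_nat k * ctr G q \<phi> (ctr G k \<omega> \<psi>) vs"
  proof (cases k)
    case 0
    then show ?thesis using \<omega> by (simp add: contract_0form)
  next
    case (Suc k')
    have "ctr G m (wedge (k - 1) q (contract u \<omega>) \<phi>) (contract w \<psi>) vs =
        ctr G q \<phi> (ctr G k' (contract u \<omega>) (contract w \<psi>)) vs" for u w
      using Suc.hyps(1)[of k' q "contract u \<omega>" \<phi> "contract w \<psi>"] Suc.hyps(2) Suc.prems Suc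
      by (simp add: alt_form_contract_Suc)
    then have "mtrace G (\<lambda>u w. ctr G m (wedge (k - 1) q (contract u \<omega>) \<phi>) (contract w \<psi>) vs) =
        ctr G q \<phi> (\<lambda>vs. mtrace G (\<lambda>u w. ctr G k' (contract u \<omega>) (contract w \<psi>) vs)) vs"
      by (simp add: ctr_mtrace_right)
    also have "(\<lambda>vs. mtrace G (\<lambda>u w. ctr G k' (contract u \<omega>) (contract w \<psi>) vs)) =
        (\<lambda>vs. of_nat k * ctr G k \<omega> \<psi> vs)"
      using Suc by (simp add: divide_simps del: of_nat_Suc)
    finally show ?thesis by (simp add: ctr_mult_right)
  qed
  have 2: "mtrace G (\<lambda>u w. ctr G m (wedge k (q - 1) \<omega> (contract u \<phi>)) (contract w \<psi>) vs) =
      (- 1) ^ k * (of_nat q * ctr G q \<phi> (ctr G k \<omega> \<psi>) vs)"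
  proof (cases q)
    case 0
    then show ?thesis using \<phi> by (simp add: contract_0form)
  next
    case (Suc q')
    \<comment> \<open>The sign (-1)^k for passing the contracted slots appears here; it cancels the
      sign of the Leibniz rule when the two cases are added.\<close>
    have "ctr G m (wedge k (q - 1) \<omega> (contract u \<phi>)) (contract w \<psi>) vs =
        (- 1) ^ k * ctr G q' (contract u \<phi>) (contract w (ctr G k \<omega> \<psi>)) vs" for u w
    proof -
      have "ctr G m (wedge k (q - 1) \<omega> (contract u \<phi>)) (contract w \<psi>) vs =
          ctr G q' (contract u \<phi>) (ctr G k \<omega> (contract w \<psi>)) vs"
        using Suc.hyps(1)[of k q' \<omega> "contract u \<phi>" "contract w \<psi>"] Suc.hyps(2) Suc.prems Suc
        by (simp add: alt_form_contract_Suc)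
      then show ?thesis
        unfolding contract_ctr[OF \<psi>] ctr_mult_right by (simp flip: power_mult_distrib mult.assoc)
    qed
    then have "mtrace G (\<lambda>u w. ctr G m (wedge k (q - 1) \<omega> (contract u \<phi>)) (contract w \<psi>) vs) =
        (- 1) ^ k * mtrace G (\<lambda>u w. ctr G q' (contract u \<phi>) (contract w (ctr G k \<omega> \<psi>)) vs)"
      by (simp add: mtrace_mult)
    then show ?thesis using Suc by (simp add: divide_simps del: of_nat_Suc)
  qed
  have "ctr G (k + q) (wedge k q \<omega> \<phi>) \<psi> vs = 1 / of_nat (Suc m) *
     (mtrace G (\<lambda>u w. ctr G m (wedge (k - 1) q (contract u \<omega>) \<phi>) (contract w \<psi>) vs) +
      (- 1) ^ k * mtrace G (\<lambda>u w. ctr G m (wedge k (q - 1) \<omega> (contract u \<phi>)) (contract w \<psi>) vs))"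
    unfolding Suc.hyps(2)[symmetric] ctr.simps contract_wedge[OF \<omega> \<phi>] ctr_add_left ctr_mult_left
      mtrace_add mtrace_mult ..
  also have "\<dots> = 1 / of_nat (k + q) * (of_nat (k + q) * ctr G q \<phi> (ctr G k \<omega> \<psi>) vs)"
    unfolding 1 2 Suc.hyps(2) by (simp add: distrib_right flip: mult.assoc power_mult_distrib)
  also have "\<dots> = ctr G q \<phi> (ctr G k \<omega> \<psi>) vs"
    unfolding Suc.hyps(2)[symmetric] by (simp del: of_nat_Suc)
  finally show ?case .
qed

lemma alt_form_lower [simp]: "alt_form (Suc 0) (lower G v)"
proof (rule alt_formI)
  show "lower G v vs = 0" if "length vs \<noteq> Suc 0" for vs
    using that by (auto simp: lower_def split: list.split)
  have "linear (\<lambda>u. complex_of_real (bil G v u))"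
    using linear_compose[OF linear_bil_right bounded_linear.linear[OF bounded_linear_of_real]]
    by (simp add: o_def)
  then show "multilinear_list (Suc 0) (lower G v)"
    by (simp add: multilinear_list_def lower_def)
qed auto

lemma lower_single: "lower G v [u] = of_real (bil G v u)"
  by (simp add: lower_def)

lemma wedge_lower:
  "alt_form q \<psi> \<Longrightarrow> wedge 1 q (lower G v) \<psi> vs = esum (\<lambda>u ws. bil G v u *\<^sub>R \<psi> ws) vs"
  using wedge_1form[of "lower G v" q \<psi> vs] by (simp add: lower_single scaleR_conv_of_real)

lemma ctr_lower:
  assumes "gram G" "alt_form p \<psi>"
  shows "ctr G 1 (lower G v) \<psi> = contract v \<psi>"
proof
  fix vs
  have "ctr G 1 (lower G v) \<psi> vs = mtrace G (\<lambda>u w. bil G u v *\<^sub>R contract w \<psi> vs)"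
    by (simp add: contract_def lower_single scaleR_conv_of_real gram_sym[OF assms(1), of v])
  then show "ctr G 1 (lower G v) \<psi> vs = contract v \<psi> vs"
    by (simp add: mtrace_reproduce[OF assms(1) contract_linear[OF assms(2)]])
qed

text \<open>Testing against \<alpha>_v \<and> \<phi> moves \<open>v\<close> into \<psi> by
  adjointness, so all contractions of \<psi> vanish by induction. This avoids choosing a basis of
  forms.\<close>

lemma form_inner_nondegenerate:
  assumes "gram G" "alt_form p \<psi>" "\<And>\<phi>. alt_form p \<phi> \<Longrightarrow> form_inner G p \<phi> \<psi> = 0"
  shows "\<psi> = (\<lambda>vs. 0)"
  using assms(2,3)
proof (induction p arbitrary: \<psi>)
  case 0
  have "alt_form 0 (\<lambda>vs :: (real ^ 'a) list. if vs = [] then 1 else 0)"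
    by (rule alt_formI) (auto simp: multilinear_list_def)
  from 0(2)[OF this] have "\<psi> [] = 0" by (simp add: form_inner_eq)
  then show ?case using alt_form_length[OF 0(1)] by (metis length_0_conv)
next
  case (Suc p)
  have "contract v \<psi> = (\<lambda>vs. 0)" for v
  proof (rule Suc.IH)
    show "alt_form p (contract v \<psi>)" by (rule alt_form_contract_Suc[OF Suc.prems(1)])
    fix \<phi> :: "'a aform" assume \<phi>: "alt_form p \<phi>"
    have "form_inner G p \<phi> (contract v \<psi>) = form_inner G (Suc p) (wedge 1 p (lower G v) \<phi>) \<psi>"
      using ctr_wedge[of 1 "lower G v" p \<phi> \<psi> G "[]"] \<phi> Suc.prems(1) ctr_lower[OF assms(1) Suc.prems(1)]
      by (simp add: form_inner_eq del: ctr.simps)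
    also have "\<dots> = 0"
      using alt_form_wedge[of 1 "lower G v" p \<phi>] \<phi> by (intro Suc.prems(2)) simp
    finally show "form_inner G p \<phi> (contract v \<psi>) = 0" .
  qed
  then have "\<psi> (v # vs) = 0" for v vs by (simp add: contract_def fun_eq_iff)
  moreover have "\<psi> [] = 0" using alt_form_length[OF Suc.prems(1)] by simp
  ultimately show ?case by (metis list.exhaust)
qed

lemma ctr_diff_right: "ctr G k \<omega> (\<lambda>vs. \<psi> vs - \<psi>' vs) vs = ctr G k \<omega> \<psi> vs - ctr G k \<omega> \<psi>' vs"
  using ctr_add_right[of G k \<omega> \<psi> "\<lambda>vs. - \<psi>' vs" vs] by (simp add: ctr_minus_right)

text \<open>Nondegeneracy gives uniqueness, so that an adjoint can be computed by exhibiting a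
  candidate.\<close>

lemma the_adjoint:
  assumes "gram G" "alt_form p \<psi>" "\<And>\<phi>. alt_form p \<phi> \<Longrightarrow> form_inner G p \<phi> \<psi> = F \<phi>"
  shows "(THE \<psi>. alt_form p \<psi> \<and> (\<forall>\<phi>. alt_form p \<phi> \<longrightarrow> form_inner G p \<phi> \<psi> = F \<phi>)) = \<psi>"
proof (rule the_equality)
  fix \<psi>' assume *: "alt_form p \<psi>' \<and> (\<forall>\<phi>. alt_form p \<phi> \<longrightarrow> form_inner G p \<phi> \<psi>' = F \<phi>)"
  have "(\<lambda>vs. \<psi>' vs - \<psi> vs) = (\<lambda>vs. 0)"
    using * assms by (intro form_inner_nondegenerate[OF assms(1)] alt_form_diff)
      (auto simp: form_inner_eq ctr_diff_right)
  then show "\<psi>' = \<psi>" by (simp add: fun_eq_iff)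
qed (use assms in auto)

lemma vee_eq:
  assumes "gram G" "alt_form k \<omega>" "alt_form q \<psi>"
  shows "vee G k q \<omega> \<psi> = ctr G k \<omega> \<psi>"
proof (cases "q < k")
  case True
  then show ?thesis using assms by (simp add: vee_def ctr_degree_less)
next
  case False
  then have q: "k + (q - k) = q" by simp
  have "alt_form (q - k) (ctr G k \<omega> \<psi>)" using assms(3) by (intro alt_form_ctr) (simp add: q)
  then have "(THE \<psi>'. alt_form (q - k) \<psi>' \<and> (\<forall>\<phi>. alt_form (q - k) \<phi> \<longrightarrow>
      form_inner G (q - k) \<phi> \<psi>' = form_inner G q (wedge k (q - k) \<omega> \<phi>) \<psi>)) = ctr G k \<omega> \<psi>"
    using ctr_wedge[OF assms(2) _, of "q - k" _ \<psi> G "[]"] assms(3)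
    by (intro the_adjoint[OF assms(1)]) (simp_all add: form_inner_eq q)
  then show ?thesis using False by (simp add: vee_def)
qed

text \<open>The factor p/(p! l!) equals 1/(l! (p - 1)!), the normalisation of a wedge product of
  degrees \<open>l\<close> and \<open>p - 1\<close>, and the sum over basis forms is an
  alternation.\<close>

lemma int_form_eq:
  assumes G: "gram G" and \<xi>: "alt_form (Suc l) \<xi>" and \<omega>: "alt_form p \<omega>"
  shows "int_form G (Suc l) p \<xi> \<omega> =
    (\<lambda>vs. mtrace G (\<lambda>u w. wedge l (p - 1) (contract u \<xi>) (contract w \<omega>) vs))"
proof
  fix vs
  show "int_form G (Suc l) p \<xi> \<omega> vs = mtrace G (\<lambda>u w. wedge l (p - 1) (contract u \<xi>) (contract w \<omega>) vs)"
  proof (cases p)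
    case 0
    then show ?thesis using \<omega> by (simp add: int_form_def contract_0form)
  next
    case (Suc m)
    define f where "f ws = mtrace G (\<lambda>u w. contract u \<xi> (take l ws) * contract w \<omega> (drop l ws))" for ws
    have "multilinear_list (l + m) f"
      using multilinear_list_take_drop[OF alt_form_contract_Suc[OF \<xi>] alt_form_contract_Suc[OF \<omega>[unfolded Suc]]]
      unfolding f_def multilinear_list_def by (intro allI impI linear_mtrace) blast
    note expand = sum_basis_form[OF this]
    \<comment> \<open>In the definition the first index of the inverse metric belongs to \<omega>
      and the second to \<xi>; \<open>f\<close> has them the other way round, which the symmetry of
      the trace repairs.\<close>
    have f_comm: "f ws = mtrace G (\<lambda>u w. contract w \<xi> (take l ws) * contract u \<omega> (drop l ws))" for ws
      unfolding f_def by (rule mtrace_commute[OF G, symmetric])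
    have coeff: "(\<Sum>k\<in>UNIV. \<Sum>j\<in>UNIV. of_real (matrix_inv G $ k $ j) * component \<xi> (j # take l is) *
        component \<omega> (k # drop l is)) = f (map (\<lambda>i. axis i 1) is)" for "is"
      unfolding f_comm
      by (simp add: mtrace_def component_def contract_def take_map drop_map scaleR_conv_of_real mult.assoc)
    have "int_form G (Suc l) p \<xi> \<omega> vs =
        of_nat p / (fact p * fact l) * (\<Sum>is\<in>idx (l + m). f (map (\<lambda>i. axis i 1) is) * basis_form is vs)"
      unfolding int_form_def using coeff by (simp add: Suc add.commute)
    also have "of_nat p / (fact p * fact l) = (1 / (fact l * fact m) :: complex)"
      using Suc_mult_divide_fact[of m "1 :: complex" "fact l"] by (simp add: Suc mult.commute)
    also have "1 / (fact l * fact m) * (\<Sum>is\<in>idx (l + m). f (map (\<lambda>i. axis i 1) is) * basis_form is vs) =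
        mtrace G (\<lambda>u w. wedge l (p - 1) (contract u \<xi>) (contract w \<omega>) vs)"
    proof (cases "length vs = l + m")
      case True
      have "alternator vs f = mtrace G (\<lambda>u w. alternator vs
          (\<lambda>ws. contract u \<xi> (take l ws) * contract w \<omega> (drop l ws)))"
        unfolding f_def mtrace_def alternator_sum alternator_scaleR ..
      then show ?thesis
        unfolding expand[OF True] using True by (simp add: wedge_alternator Suc divide_inverse mtrace_mult mtrace_mult_right mult.commute)
    next
      case False
      then have "basis_form is vs = 0" if "is \<in> idx (l + m)" for "is"
        using that by (simp add: basis_form_def idx_def)
      then show ?thesis using False by (simp add: wedge_alternator Suc)
    qed
    finally show ?thesis .
  qed
qed

text \<open>With a metric, e^i \<and> T(e_i) becomes g^{ij} \<alpha>_{e_i} \<and> T(e_j), a trace of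
  wedge products, to which the results on alternation and on adjoints apply.\<close>

lemma esum_eq_mtrace_wedge:
  assumes "gram G" "\<And>vs. linear (\<lambda>u. T u vs)" "\<And>u. alt_form m (T u)"
  shows "esum T = (\<lambda>vs. mtrace G (\<lambda>u w. wedge 1 m (lower G u) (T w) vs))"
proof
  fix vs
  have "mtrace G (\<lambda>u w. wedge 1 m (lower G u) (T w) vs) =
      esum (\<lambda>v ws. mtrace G (\<lambda>u w. bil G u v *\<^sub>R T w ws)) vs"
    by (simp add: esum_mtrace wedge_lower[OF assms(3)] del: One_nat_def)
  then show "esum T vs = mtrace G (\<lambda>u w. wedge 1 m (lower G u) (T w) vs)"
    by (simp add: mtrace_reproduce[OF assms(1,2)])
qed

text \<open>The alternating sum is independent of any metric, so the Euclidean one may be used to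
  write it as a trace of wedge products.\<close>

lemma alt_form_esum:
  fixes T :: "real ^ 'n \<Rightarrow> 'n::finite aform"
  assumes "\<And>vs. linear (\<lambda>u. T u vs)" "\<And>u. alt_form m (T u)"
  shows "alt_form (Suc m) (esum T)"
  unfolding esum_eq_mtrace_wedge[OF gram_mat_1 assms]
  using alt_form_wedge[OF alt_form_lower assms(2)] by (intro alt_form_mtrace) simp

text \<open>Term by term in g^{ij} (i_{e_i} \<xi>) \<and> i_{e_j}: the adjoint of wedging with
  i_{e_i} \<xi> is contraction with it, the adjoint of i_{e_j} is wedging with \<alpha>_{e_j}, and
  the inverse metric turns the latter into the dual basis.\<close>

lemma int_form_adj_eq:
  assumes G: "gram G" and \<xi>: "alt_form (Suc (Suc l)) \<xi>" and \<omega>: "alt_form r \<omega>"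
  shows "int_form_adj G (Suc (Suc l)) r \<xi> \<omega> = esum (\<lambda>u. ctr G (Suc l) (contract u \<xi>) \<omega>)"
proof (cases "r < Suc l")
  case True
  then have "ctr G (Suc l) (contract u \<xi>) \<omega> = (\<lambda>vs. 0)" for u
    by (intro ctr_degree_less[OF \<omega>])
  then have zero: "esum (\<lambda>u. ctr G (Suc l) (contract u \<xi>) \<omega>) = (\<lambda>vs. 0)"
    by (intro ext) (simp del: ctr.simps)
  show ?thesis
  proof (cases "r < l")
    case True
    then show ?thesis unfolding zero by (simp add: int_form_adj_def)
  next
    case False
    \<comment> \<open>Borderline degree: the adjoint is a 0-form here, but \<open>int_form\<close>
      vanishes on 0-forms, so the description picks zero, as the formula does.\<close>
    with True have r: "r = l" by simp
    have "int_form G (Suc (Suc l)) 0 \<xi> \<phi> = (\<lambda>vs. 0)" for \<phi>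
      by (simp add: int_form_def fun_eq_iff)
    then have "(THE \<psi>. alt_form 0 \<psi> \<and> (\<forall>\<phi>. alt_form 0 \<phi> \<longrightarrow>
        form_inner G 0 \<phi> \<psi> = form_inner G r (int_form G (Suc (Suc l)) 0 \<xi> \<phi>) \<omega>)) = (\<lambda>vs. 0)"
      by (intro the_adjoint[OF G]) (simp_all add: form_inner_eq del: ctr.simps)
    then show ?thesis unfolding zero by (simp add: int_form_adj_def r)
  qed
next
  case False
  then obtain m where r: "r = Suc l + m" using le_Suc_ex[of "Suc l" r] by auto
  define V where "V u = ctr G (Suc l) (contract u \<xi>) \<omega>" for u
  have V: "alt_form m (V u)" for u
    unfolding V_def using \<omega> by (intro alt_form_ctr) (simp add: r)
  have lin: "linear (\<lambda>u. V u vs)" for vs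
    unfolding V_def by (intro linear_ctr_left contract_linear[OF \<xi>])
  have "form_inner G (Suc m) \<phi> (esum V) = form_inner G r (int_form G (Suc (Suc l)) (Suc m) \<xi> \<phi>) \<omega>"
    if \<phi>: "alt_form (Suc m) \<phi>" for \<phi>
  proof -
    have "ctr G (Suc m) \<phi> (wedge 1 m (lower G u) (V w)) [] =
        ctr G r (wedge (Suc l) m (contract w \<xi>) (contract u \<phi>)) \<omega> []" for u w
    proof -
      have "ctr G (Suc m) \<phi> (wedge 1 m (lower G u) (V w)) [] = ctr G m (V w) (contract u \<phi>) []"
        using ctr_wedge[of 1 "lower G u" m "V w" \<phi> G "[]"] V \<phi> ctr_lower[OF G \<phi>]
        by (subst ctr_sym[OF G]) (simp del: ctr.simps)
      also have "\<dots> = ctr G m (contract u \<phi>) (ctr G (Suc l) (contract w \<xi>) \<omega>) []"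
        unfolding V_def by (rule ctr_sym[OF G])
      also have "\<dots> = ctr G r (wedge (Suc l) m (contract w \<xi>) (contract u \<phi>)) \<omega> []"
        unfolding r using \<omega> unfolding r
        by (intro ctr_wedge[symmetric] alt_form_contract_Suc \<xi> \<phi>)
      finally show ?thesis .
    qed
    then have "form_inner G (Suc m) \<phi> (esum V) =
        mtrace G (\<lambda>u w. ctr G r (wedge (Suc l) m (contract w \<xi>) (contract u \<phi>)) \<omega> [])"
      unfolding form_inner_eq esum_eq_mtrace_wedge[OF G lin V] ctr_mtrace_right by simp
    also have "\<dots> = mtrace G (\<lambda>u w. ctr G r (wedge (Suc l) m (contract u \<xi>) (contract w \<phi>)) \<omega> [])"
      by (rule mtrace_commute[OF G])
    also have "\<dots> = form_inner G r (int_form G (Suc (Suc l)) (Suc m) \<xi> \<phi>) \<omega>"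
      unfolding form_inner_eq int_form_eq[OF G \<xi> \<phi>] ctr_mtrace_left by simp
    finally show ?thesis .
  qed
  then have "(THE \<psi>. alt_form (Suc m) \<psi> \<and> (\<forall>\<phi>. alt_form (Suc m) \<phi> \<longrightarrow>
      form_inner G (Suc m) \<phi> \<psi> = form_inner G r (int_form G (Suc (Suc l)) (Suc m) \<xi> \<phi>) \<omega>)) = esum V"
    by (intro the_adjoint[OF G] alt_form_esum[OF lin V])
  moreover have "r + 2 - Suc (Suc l) = Suc m" using r by simp
  moreover have "\<not> r + 2 < Suc (Suc l)" using r by simp
  ultimately show ?thesis unfolding int_form_adj_def V_def[abs_def] by (simp del: ctr.simps)
qed

section \<open>Identities for a 3-form\<close>

lemma int_form_2_eq:
  assumes "gram G" "alt_form 2 \<omega>" "alt_form p \<psi>"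
  shows "int_form G 2 p \<omega> \<psi> = (\<lambda>vs. mtrace G (\<lambda>u w. wedge 1 (p - 1) (contract u \<omega>) (contract w \<psi>) vs))"
  using int_form_eq[of G 1 \<omega> p \<psi>] assms by (simp add: numeral_2_eq_2)

lemma int_form_3_eq:
  assumes "gram G" "alt_form 3 H" "alt_form p \<psi>"
  shows "int_form G 3 p H \<psi> = (\<lambda>vs. mtrace G (\<lambda>u w. wedge 2 (p - 1) (contract u H) (contract w \<psi>) vs))"
  using int_form_eq[of G 2 H p \<psi>] assms by (simp add: eval_nat_numeral)

lemma int_form_adj_3_eq:
  assumes "gram G" "alt_form 3 H" "alt_form p \<psi>"
  shows "int_form_adj G 3 p H \<psi> = esum (\<lambda>u. ctr G 2 (contract u H) \<psi>)"
  using int_form_adj_eq[of G 1 H p \<psi>] assms by (simp add: eval_nat_numeral del: ctr.simps)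

lemma alt_form_contract_3: "alt_form 3 H \<Longrightarrow> alt_form 2 (contract u H)"
  using alt_form_contract[of 3 H u] by simp

lemma alt_form_contract_2: "alt_form 2 \<omega> \<Longrightarrow> alt_form 1 (contract u \<omega>)"
  using alt_form_contract[of 2 \<omega> u] by simp

lemma int_form_2_esum:
  assumes "gram G" "alt_form 2 \<omega>" "alt_form p \<psi>"
  shows "int_form G 2 p \<omega> \<psi> vs = esum (\<lambda>x ws. mtrace G (\<lambda>u w. \<omega> [u, x] * \<psi> (w # ws))) vs"
  unfolding int_form_2_eq[OF assms] esum_mtrace
    wedge_1form[OF alt_form_contract_2[OF assms(2)] alt_form_contract[OF assms(3)]]
  by (simp add: contract_def)

lemma ctr_2: "ctr G 2 \<omega> \<psi> vs =
    1 / 2 * mtrace G (\<lambda>u u'. mtrace G (\<lambda>w w'. \<omega> [u, w] * \<psi> (u' # w' # vs)))"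
  by (simp add: numeral_2_eq_2 contract_def)

lemma wedge_2form:
  assumes "alt_form 2 \<omega>" "alt_form q \<psi>"
  shows "2 * wedge 2 q \<omega> \<psi> vs = esum (\<lambda>x. esum (\<lambda>y ws. \<omega> [x, y] * \<psi> ws)) vs"
proof -
  have "wedge (2 - 1) q (contract x \<omega>) \<psi> = esum (\<lambda>y ws. \<omega> [x, y] * \<psi> ws)" for x
    using wedge_1form[OF alt_form_contract_2[OF assms(1)] assms(2)] by (auto simp: contract_def)
  then show ?thesis
    using esum_wedge_contract[OF assms, of vs] by simp
qed

text \<open>Exchanging the two contractions of \<open>H\<close> gives the minus sign, and counting
  the degree of the 2-form i_a H gives the 2.\<close>

lemma esum_int_form_2:
  assumes G: "gram G" and H: "alt_form 3 H" and \<psi>: "alt_form p \<psi>"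
  shows "esum (\<lambda>u. int_form G 2 p (contract u H) \<psi>) vs = - 2 * int_form G 3 p H \<psi> vs"
proof -
  have "esum (\<lambda>u. wedge 1 (p - 1) (contract a (contract u H)) (contract b \<psi>)) vs =
      - 2 * wedge 2 (p - 1) (contract a H) (contract b \<psi>) vs" for a b
    using esum_wedge_contract[OF alt_form_contract_3[OF H] alt_form_contract[OF \<psi>], of a b vs]
    unfolding contract_contract[OF H, of a] wedge_minus_left esum_minus by simp
  then show ?thesis
    unfolding int_form_2_eq[OF G alt_form_contract_3[OF H] \<psi>] int_form_3_eq[OF G H \<psi>] esum_mtrace
    by (simp add: mtrace_mult mtrace_minus)
qed

text \<open>If \<open>w\<close> becomes an argument of \<open>H\<close>, the trace over
  \<open>u\<close> and \<open>w\<close> vanishes by antisymmetry. Otherwise \<open>w\<close> goes to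
  \<psi>, and two slots of \<open>H\<close> are contracted with two slots of \<psi>; the factor 2
  compensates the 1/2! in \<open>ctr\<close>.\<close>

lemma mtrace_int_form_2:
  assumes G: "gram G" and H: "alt_form 3 H" and \<psi>: "alt_form p \<psi>"
  shows "mtrace G (\<lambda>u w. int_form G 2 p (contract u H) \<psi> (w # vs)) = 2 * int_form_adj G 3 p H \<psi> vs"
proof -
  have H_swap: "H [u, x, y] = - H [u, y, x]" "H [u, x, y] = - H [x, u, y]" for u x y
    using alt_form_swap[OF H, of "[u]" x y "[]"] alt_form_swap[OF H, of "[]" u x "[y]"] by simp_all
  have "mtrace G (\<lambda>u w. int_form G 2 p (contract u H) \<psi> (w # vs)) =
      mtrace G (\<lambda>u w. mtrace G (\<lambda>a b. H [u, a, w] * \<psi> (b # vs))) -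
      esum (\<lambda>x ws. mtrace G (\<lambda>u w. mtrace G (\<lambda>a b. H [u, a, x] * \<psi> (b # w # ws)))) vs"
    unfolding int_form_2_esum[OF G alt_form_contract_3[OF H] \<psi>] esum_Cons mtrace_diff esum_mtrace
    by (simp add: contract_def)
  also have "mtrace G (\<lambda>u w. mtrace G (\<lambda>a b. H [u, a, w] * \<psi> (b # vs))) = 0"
  proof (subst mtrace_swap)
    have "mtrace G (\<lambda>u w. H [u, a, w] * \<psi> (b # vs)) = 0" for a b
      using H_swap by (intro mtrace_antisym[OF G]) (metis add.inverse_inverse mult_minus_left)
    then show "mtrace G (\<lambda>a b. mtrace G (\<lambda>u w. H [u, a, w] * \<psi> (b # vs))) = 0" by simp
  qed
  also have "(\<lambda>x ws. mtrace G (\<lambda>u w. mtrace G (\<lambda>a b. H [u, a, x] * \<psi> (b # w # ws)))) =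
      (\<lambda>x ws. - (2 * ctr G 2 (contract x H) \<psi> ws))"
  proof (intro ext)
    fix x ws
    have "H [u, a, x] * \<psi> (b # w # ws) = - (contract x H [u, a] * \<psi> (w # b # ws))" for u a b w
    proof -
      have "H [u, a, x] = H [x, u, a]" using H_swap by (metis add.inverse_inverse)
      moreover have "\<psi> (b # w # ws) = - \<psi> (w # b # ws)" by (rule alt_form_Cons_Cons[OF \<psi>])
      ultimately show ?thesis by (simp add: contract_def)
    qed
    then show "mtrace G (\<lambda>u w. mtrace G (\<lambda>a b. H [u, a, x] * \<psi> (b # w # ws))) =
        - (2 * ctr G 2 (contract x H) \<psi> ws)"
      by (simp add: ctr_2 mtrace_minus)
  qed
  finally show ?thesis
    unfolding int_form_adj_3_eq[OF G H \<psi>] by (simp add: esum_minus esum_mult)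
qed

text \<open>Passing \<open>w\<close> through two contracted slots costs no sign, and the 3 undoes
  the factor 1/3 in the outermost step of \<open>ctr\<close>.\<close>

lemma mtrace_ctr_2:
  assumes H: "alt_form 3 H" and \<psi>: "alt_form p \<psi>"
  shows "mtrace G (\<lambda>u w. ctr G 2 (contract u H) \<psi> (w # vs)) = 3 * ctr G 3 H \<psi> vs"
proof -
  have "ctr G 2 (contract u H) \<psi> (w # vs) = ctr G 2 (contract u H) (contract w \<psi>) vs" for u w
    using contract_ctr[OF \<psi>, of w G 2 "contract u H"] by (simp add: contract_def fun_eq_iff)
  then show ?thesis
    using ctr.simps(2)[of G 2 H \<psi>] by (simp add: numeral_3_eq_3 numeral_2_eq_2 del: ctr.simps)
qed

lemma esum_wedge_2:
  assumes H: "alt_form 3 H" and \<psi>: "alt_form q \<psi>"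
  shows "esum (\<lambda>u. wedge 2 q (contract u H) \<psi>) vs = 3 * wedge 3 q H \<psi> vs"
  using esum_wedge_contract[OF assms, of vs] by simp

text \<open>The Leibniz term in which \<open>w\<close> enters i_u H is antisymmetric in
  \<open>u\<close> and \<open>w\<close>, hence traceless; the other term is \<open>int_form\<close>
  in its trace form.\<close>

lemma mtrace_wedge_2:
  assumes G: "gram G" and H: "alt_form 3 H" and \<psi>: "alt_form q \<psi>"
  shows "mtrace G (\<lambda>u w. wedge 2 q (contract u H) \<psi> (w # vs)) = int_form G 3 q H \<psi> vs"
proof -
  have "wedge 1 q (contract w (contract u H)) \<psi> vs = - wedge 1 q (contract u (contract w H)) \<psi> vs" for u w
    using contract_contract[OF H, of w u] by (simp add: wedge_minus_left)
  then have "mtrace G (\<lambda>u w. wedge 1 q (contract w (contract u H)) \<psi> vs) = 0"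
    by (intro mtrace_antisym[OF G])
  then show ?thesis
    unfolding int_form_3_eq[OF G H \<psi>] wedge_Cons[OF alt_form_contract_3[OF H] \<psi>]
    by (simp add: mtrace_add)
qed

text \<open>A family of the form \<open>D\<^sub>u = i\<^sub>u A + \<alpha>\<^sub>u \<and> B\<close> determines \<open>A\<close> and \<open>B\<close> through its alternation and
  its trace. If \<open>p = n + 1\<close>, then \<open>\<alpha>\<^sub>u \<and> B\<close> vanishes for degree reasons.\<close>

lemma twistor_decomposition:
  fixes G :: "real ^ 'n ^ 'n" and A B :: "'n::finite aform"
  assumes G: "gram G" and A: "alt_form (Suc p) A" and B: "alt_form (p - 1) B" and p0: "p = 0 \<Longrightarrow> B = (\<lambda>vs. 0)"
    and D: "\<And>u vs. D u vs = A (u # vs) + esum (\<lambda>x ws. bil G u x *\<^sub>R B ws) vs"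
  shows "D u vs = 1 / (of_nat p + 1) * esum D (u # vs) +
    1 / (of_nat CARD('n) - of_nat p + 1) *
      wedge 1 (p - 1) (lower G u) (\<lambda>ws. mtrace G (\<lambda>a b. D a (b # ws))) vs"
proof -
  have contract_eq: "(\<lambda>u. contract u C) = (\<lambda>u ws. C (u # ws))" for C :: "'n aform"
    by (intro ext) (simp add: contract_def)
  have "esum D ws = of_nat (length ws) * A ws" for ws
  proof -
    have "esum D ws = esum (\<lambda>u ws. A (u # ws)) ws + esum (\<lambda>u. esum (\<lambda>x ws. bil G u x *\<^sub>R B ws)) ws"
      unfolding esum_add[symmetric] by (intro esum_cong D)
    then show ?thesis
      using esum_contract[OF A, of ws] unfolding contract_eq
      by (simp add: esum_symmetric gram_sym[OF G])
  qed
  then have esum_D: "esum D (u # vs) = (of_nat p + 1) * A (u # vs)"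
    using alt_form_length[OF A, of "u # vs"] by (cases "length vs = p") auto
  \<comment> \<open>\<open>A\<close> drops out by antisymmetry. In \<alpha>_a \<and> B the trace
    pairs \<open>b\<close> with \<alpha>_a once, which gives \<open>n\<close>, and otherwise
    contracts \<open>B\<close> and restores its argument, which gives -(p - 1).\<close>
  have trace_D: "mtrace G (\<lambda>a b. D a (b # ws)) = (of_nat CARD('n) - of_nat p + 1) * B ws" for ws
  proof -
    have "mtrace G (\<lambda>a b. A (a # b # ws)) = 0"
      by (intro mtrace_antisym[OF G] alt_form_Cons_Cons[OF A])
    moreover have "mtrace G (\<lambda>a b. bil G a b *\<^sub>R B ws) = of_nat CARD('n) * B ws"
      using mtrace_linear[of "\<lambda>r. r *\<^sub>R B ws" G "bil G"] mtrace_bil[OF G]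
      by (simp add: linear_iff scaleR_conv_of_real distrib_right)
    moreover have "mtrace G (\<lambda>a b. esum (\<lambda>x xs. bil G a x *\<^sub>R B (b # xs)) ws) = of_nat (p - 1) * B ws"
    proof -
      have "mtrace G (\<lambda>a b. bil G a x *\<^sub>R contract b B xs) = contract x B xs" for x xs
        by (rule mtrace_reproduce[OF G contract_linear[OF B]])
      then have "mtrace G (\<lambda>a b. esum (\<lambda>x xs. bil G a x *\<^sub>R B (b # xs)) ws) = esum (\<lambda>x. contract x B) ws"
        unfolding esum_mtrace[symmetric] contract_eq by (simp add: contract_def)
      then show ?thesis
        using alt_form_length[OF B, of ws] esum_contract[OF B, of ws] by (cases "length ws = p - 1") auto
    qed
    ultimately have "mtrace G (\<lambda>a b. D a (b # ws)) = of_nat CARD('n) * B ws - of_nat (p - 1) * B ws"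
      by (simp add: D esum_Cons mtrace_add mtrace_diff)
    \<comment> \<open>For \<open>p = 0\<close> the truncated \<open>p - 1\<close> would give
      \<open>n\<close> instead of \<open>n + 1\<close>; \<open>B\<close> is zero there.\<close>
    then show ?thesis
      using p0 by (cases p) (simp_all add: algebra_simps)
  qed
  have "wedge 1 (p - 1) (lower G u) (\<lambda>ws. mtrace G (\<lambda>a b. D a (b # ws))) vs =
      (of_nat CARD('n) - of_nat p + 1) * wedge 1 (p - 1) (lower G u) B vs"
    unfolding trace_D wedge_mult_right ..
  \<comment> \<open>For \<open>p = n + 1\<close> the coefficient is zero and division by it returns
    0, so the term to be recovered must itself vanish: its degree exceeds \<open>n\<close>.\<close>
  moreover have "wedge 1 (p - 1) (lower G u) B = (\<lambda>vs. 0)"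
    if "of_nat CARD('n) - of_nat p + (1 :: complex) = 0"
  proof -
    have "of_nat p = (of_nat (Suc CARD('n)) :: complex)" using that by (simp add: algebra_simps)
    then have p: "p = Suc CARD('n)" unfolding of_nat_eq_iff .
    have "alt_form (1 + (p - 1)) (wedge 1 (p - 1) (lower G u) B)"
      using B by (intro alt_form_wedge) simp_all
    then show ?thesis by (rule alt_form_degree_gt) (simp add: p)
  qed
  ultimately have "1 / (of_nat CARD('n) - of_nat p + 1) *
      wedge 1 (p - 1) (lower G u) (\<lambda>ws. mtrace G (\<lambda>a b. D a (b # ws))) vs =
      wedge 1 (p - 1) (lower G u) B vs"
    by (cases "of_nat CARD('n) - of_nat p + (1 :: complex) = 0") auto
  moreover have "1 / (of_nat p + 1) * esum D (u # vs) = A (u # vs)"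
    unfolding esum_D using of_nat_neq_0[of p, where 'a = complex] by (simp add: add.commute)
  ultimately show ?thesis
    unfolding D wedge_lower[OF B] by simp
qed

section \<open>Antisymmetrised Clifford products\<close>

lemma nth_insert_at: "j \<le> length ws \<Longrightarrow> insert_at j v ws ! j = v"
  by (simp add: insert_at_def nth_append)

lemma omit_insert_at: "j \<le> length ws \<Longrightarrow> omit j (insert_at j v ws) = ws"
  by (simp add: omit_def insert_at_def)

lemma omit_append: "i < length xs \<Longrightarrow> omit i (xs @ ys) = omit i xs @ ys"
  by (simp add: omit_def)

text \<open>Antisymmetrised products depend on bilinearity and the Clifford relation alone, so they
  are studied for an abstract action; the Gram matrix and the Hermitian pairing join in
  \<open>spinor_pairing\<close>.\<close>

locale clifford_action =
  fixes q :: "'v::real_vector \<Rightarrow> 'v \<Rightarrow> real" and cl :: "'v \<Rightarrow> 's::real_vector \<Rightarrow> 's"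
  assumes linear_vector: "linear (\<lambda>v. cl v \<psi>)"
    and linear_spinor: "linear (cl v)"
    and clifford: "cl u (cl v \<psi>) + cl v (cl u \<psi>) = (2 * q u v) *\<^sub>R \<psi>"
begin

lemma linear_foldr: "linear (foldr cl ws)"
proof (induction ws)
  case (Cons w ws)
  then show ?case using linear_compose[OF Cons linear_spinor[of w]] by (simp add: o_def)
qed (simp add: linear_iff)

text \<open>Each factor \<open>w\<close> that \<open>v\<close> moves past reverses the sign and
  leaves the scalar 2 q(v, w) behind.\<close>

lemma graded_commutator:
  "cl v (foldr cl ws \<psi>) = (- 1) ^ length ws *\<^sub>R foldr cl ws (cl v \<psi>) +
     2 *\<^sub>R esum (\<lambda>u us. q v u *\<^sub>R foldr cl us \<psi>) ws"
proof (induction ws)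
  case (Cons w ws)
  have "cl v (cl w (foldr cl ws \<psi>)) = (2 * q v w) *\<^sub>R foldr cl ws \<psi> - cl w (cl v (foldr cl ws \<psi>))"
    using clifford[of v w "foldr cl ws \<psi>"] by (simp add: algebra_simps)
  also have "cl w (cl v (foldr cl ws \<psi>)) = (- 1) ^ length ws *\<^sub>R cl w (foldr cl ws (cl v \<psi>)) +
      2 *\<^sub>R esum (\<lambda>u us. q v u *\<^sub>R cl w (foldr cl us \<psi>)) ws"
    unfolding Cons.IH
    by (simp add: linear_add[OF linear_spinor] linear_cmul[OF linear_spinor] esum_linear[OF linear_spinor])
  finally show ?case by (simp add: esum_Cons scaleR_diff_right)
qed simp

text \<open>The same computation stopped after \<open>j\<close> factors: moving \<open>v\<close>
  from the front to position \<open>j\<close> collects the scalars met on the way.\<close>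

lemma foldr_insert_at:
  assumes "j \<le> length ws"
  shows "(- 1) ^ j *\<^sub>R foldr cl (insert_at j v ws) \<psi> = cl v (foldr cl ws \<psi>) -
     2 *\<^sub>R (\<Sum>i<j. (- 1) ^ i *\<^sub>R q v (ws ! i) *\<^sub>R foldr cl (omit i ws) \<psi>)"
proof -
  let ?xs = "take j ws" and ?ys = "drop j ws"
  have "cl v (foldr cl ws \<psi>) = cl v (foldr cl (?xs @ ?ys) \<psi>)"
    by (simp only: append_take_drop_id)
  also have "\<dots> = (- 1) ^ j *\<^sub>R foldr cl (insert_at j v ws) \<psi> +
      2 *\<^sub>R esum (\<lambda>u us. q v u *\<^sub>R foldr cl (us @ ?ys) \<psi>) ?xs"
    unfolding foldr_append graded_commutator[of v ?xs "foldr cl ?ys \<psi>"] insert_at_def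
    using assms by (simp add: min_def)
  also have "esum (\<lambda>u us. q v u *\<^sub>R foldr cl (us @ ?ys) \<psi>) ?xs =
      (\<Sum>i<j. (- 1) ^ i *\<^sub>R q v (ws ! i) *\<^sub>R foldr cl (omit i ws) \<psi>)"
    unfolding esum_def
  proof (rule sum.cong)
    fix i assume i: "i \<in> {..<j}"
    then have "omit i ?xs @ ?ys = omit i ws"
      using omit_append[of i ?xs ?ys] assms by simp
    then show "(- 1) ^ i *\<^sub>R q v (?xs ! i) *\<^sub>R foldr cl (omit i ?xs @ ?ys) \<psi> =
      (- 1) ^ i *\<^sub>R q v (ws ! i) *\<^sub>R foldr cl (omit i ws) \<psi>"
      using i by (simp only: nth_take lessThan_iff)
  qed (use assms in simp)
  finally show ?thesis by simp
qed

text \<open>The cycle of \<open>i\<close> turns slot \<open>i\<close> into slot 0, and its sign is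
  the prefactor; hence the result does not depend on \<open>i\<close>.\<close>

lemma alternator_omit:
  assumes "i < length vs"
  shows "(- 1) ^ i *\<^sub>R alternator vs (\<lambda>ws. q v (ws ! i) *\<^sub>R foldr cl (omit i ws) \<psi>) =
    esum (\<lambda>u ws. q v u *\<^sub>R alternator ws (\<lambda>us. foldr cl us \<psi>)) vs"
proof -
  have perm: "cycle_fun i permutes {..<length vs}"
    using cycle_fun_permutes by (rule permutes_subset) (use assms in auto)
  have "alternator vs (\<lambda>ws. q v (hd ws) *\<^sub>R foldr cl (tl ws) \<psi>) =
      alternator vs (\<lambda>ws. q v (permute_list (cycle_fun i) ws ! i) *\<^sub>R
        foldr cl (omit i (permute_list (cycle_fun i) ws)) \<psi>)"
  proof (rule alternator_cong)
    fix ws :: "'v list" assume "length ws = length vs"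
    with assms obtain x xs where ws: "ws = x # xs" and "i \<le> length xs" by (cases ws) auto
    then show "q v (hd ws) *\<^sub>R foldr cl (tl ws) \<psi> = q v (permute_list (cycle_fun i) ws ! i) *\<^sub>R
        foldr cl (omit i (permute_list (cycle_fun i) ws)) \<psi>"
      by (simp add: permute_list_cycle_fun nth_insert_at omit_insert_at)
  qed
  also have "\<dots> = (- 1) ^ i *\<^sub>R alternator vs (\<lambda>ws. q v (ws ! i) *\<^sub>R foldr cl (omit i ws) \<psi>)"
    using alternator_permuted_arg[OF perm, of "\<lambda>ws. q v (ws ! i) *\<^sub>R foldr cl (omit i ws) \<psi>"]
    by (simp add: sign_cycle_fun)
  finally show ?thesis
    using alternator_hd_tl[of vs "q v" "\<lambda>us. foldr cl us \<psi>"] assms by force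
qed

text \<open>The image of the wedge product of the vectors under the quantisation map from the
  exterior to the Clifford algebra, applied to \<psi>.\<close>

definition alt_prod :: "'v list \<Rightarrow> 's \<Rightarrow> 's" where
  "alt_prod vs \<psi> = (1 / fact (length vs)) *\<^sub>R alternator vs (\<lambda>ws. foldr cl ws \<psi>)"

text \<open>Each of the \<open>p + 1\<close> positions of \<open>v\<close> contributes the product
  with \<open>v\<close> in front, and position \<open>j\<close> subtracts \<open>j\<close> equal
  corrections of weight 2; the sum of 2 j over \<open>j \<le> p\<close> is p (p + 1).\<close>

lemma alternator_foldr_Cons:
  fixes vs :: "'v list" and p :: nat
  defines "p \<equiv> length vs"
  shows "alternator (v # vs) (\<lambda>ws. foldr cl ws \<psi>) = real (Suc p) *\<^sub>R cl v (alternator vs (\<lambda>ws. foldr cl ws \<psi>)) -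
    (real p * real (Suc p)) *\<^sub>R esum (\<lambda>u ws. q v u *\<^sub>R alternator ws (\<lambda>us. foldr cl us \<psi>)) vs"
    (is "_ = _ - _ *\<^sub>R ?B")
proof -
  let ?C = "\<lambda>ws. foldr cl ws \<psi>"
  have summand: "(- 1) ^ j *\<^sub>R alternator vs (\<lambda>ws. ?C (insert_at j v ws)) =
      cl v (alternator vs ?C) - (2 * real j) *\<^sub>R ?B" if "j \<le> p" for j
  proof -
    have "(- 1) ^ j *\<^sub>R alternator vs (\<lambda>ws. ?C (insert_at j v ws)) =
        alternator vs (\<lambda>ws. cl v (?C ws) - 2 *\<^sub>R (\<Sum>i<j. (- 1) ^ i *\<^sub>R q v (ws ! i) *\<^sub>R ?C (omit i ws)))"
      unfolding alternator_scaleR[symmetric]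
      using that by (intro alternator_cong foldr_insert_at) (simp add: p_def)
    also have "\<dots> = cl v (alternator vs ?C) -
        2 *\<^sub>R (\<Sum>i<j. (- 1) ^ i *\<^sub>R alternator vs (\<lambda>ws. q v (ws ! i) *\<^sub>R ?C (omit i ws)))"
      by (simp only: alternator_diff alternator_scaleR alternator_sum alternator_linear[OF linear_spinor])
    also have "(\<Sum>i<j. (- 1) ^ i *\<^sub>R alternator vs (\<lambda>ws. q v (ws ! i) *\<^sub>R ?C (omit i ws))) = (\<Sum>i<j. ?B)"
      using that by (intro sum.cong refl alternator_omit) (simp add: p_def)
    finally show ?thesis by (simp add: scaleR_conv_of_real sum_constant_scaleR)
  qed
  have gauss: "(\<Sum>j\<le>p. 2 * real j) = real p * real (Suc p)"
    by (induction p) (auto simp: algebra_simps)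
  have "alternator (v # vs) ?C = (\<Sum>j\<le>p. cl v (alternator vs ?C) - (2 * real j) *\<^sub>R ?B)"
    unfolding alternator_Cons p_def[symmetric] by (intro sum.cong refl summand) simp
  also have "\<dots> = real (Suc p) *\<^sub>R cl v (alternator vs ?C) - (\<Sum>j\<le>p. 2 * real j) *\<^sub>R ?B"
    by (simp only: sum_subtractf scaleR_sum_left sum_constant_scaleR card_atMost)
  finally show ?thesis unfolding gauss .
qed

text \<open>The length turns (p - 1)! into p!; on the empty list both sides vanish, as there is
  nothing to remove.\<close>

lemma esum_alt_prod:
  "real (length vs) *\<^sub>R esum (\<lambda>u ws. q v u *\<^sub>R alternator ws (\<lambda>us. foldr cl us \<psi>)) vs =
     fact (length vs) *\<^sub>R esum (\<lambda>u ws. q v u *\<^sub>R alt_prod ws \<psi>) vs"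
proof (cases vs)
  case (Cons x xs)
  show ?thesis
    unfolding esum_scaleR[symmetric]
  proof (rule esum_cong)
    fix u and ws :: "'v list" assume "Suc (length ws) = length vs"
    then have len: "length vs = Suc (length ws)" by simp
    show "real (length vs) *\<^sub>R q v u *\<^sub>R alternator ws (\<lambda>us. foldr cl us \<psi>) =
        fact (length vs) *\<^sub>R q v u *\<^sub>R alt_prod ws \<psi>"
      unfolding len fact_Suc alt_prod_def by (simp add: mult.commute)
  qed
qed simp

text \<open>The rule v a = v \<and> a + i_v a of the Clifford algebra.\<close>

lemma cl_alt_prod:
  "cl v (alt_prod vs \<psi>) = alt_prod (v # vs) \<psi> + esum (\<lambda>u ws. q v u *\<^sub>R alt_prod ws \<psi>) vs"
proof -
  let ?p = "length vs" and ?C = "\<lambda>ws. foldr cl ws \<psi>"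
  have "alternator (v # vs) ?C = real (Suc ?p) *\<^sub>R fact ?p *\<^sub>R
      (cl v (alt_prod vs \<psi>) - esum (\<lambda>u ws. q v u *\<^sub>R alt_prod ws \<psi>) vs)"
  proof -
    have "fact ?p *\<^sub>R cl v (alt_prod vs \<psi>) = cl v (alternator vs ?C)"
      by (simp add: alt_prod_def linear_cmul[OF linear_spinor])
    then show ?thesis
      unfolding alternator_foldr_Cons scaleR_diff_right esum_alt_prod[symmetric]
      by (simp add: mult.commute)
  qed
  then have "alt_prod (v # vs) \<psi> = cl v (alt_prod vs \<psi>) - esum (\<lambda>u ws. q v u *\<^sub>R alt_prod ws \<psi>) vs"
    unfolding alt_prod_def[of "v # vs"] length_Cons fact_Suc by (simp del: of_nat_Suc)
  then show ?thesis by simp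
qed

text \<open>The mirror rule a v = (-1)^p (v \<and> a - i_v a). The alternated graded commutator
  expresses v a through a v with twice the contraction; subtracting this from the left rule leaves
  the contraction with coefficient -1.\<close>

lemma alt_prod_cl:
  "alt_prod vs (cl v \<psi>) = (- 1) ^ length vs *\<^sub>R
     (alt_prod (v # vs) \<psi> - esum (\<lambda>u ws. q v u *\<^sub>R alt_prod ws \<psi>) vs)"
proof -
  let ?p = "length vs" and ?C = "\<lambda>ws. foldr cl ws \<psi>"
  let ?E = "esum (\<lambda>u ws. q v u *\<^sub>R alt_prod ws \<psi>) vs"
  have "cl v (alternator vs ?C) = alternator vs (\<lambda>ws. cl v (?C ws))"
    by (rule alternator_linear[OF linear_spinor])
  also have "\<dots> = alternator vs (\<lambda>ws. (- 1) ^ ?p *\<^sub>R foldr cl ws (cl v \<psi>) +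
      2 *\<^sub>R (\<Sum>i<?p. (- 1) ^ i *\<^sub>R q v (ws ! i) *\<^sub>R ?C (omit i ws)))"
    by (intro alternator_cong) (simp only: graded_commutator esum_def)
  also have "\<dots> = (- 1) ^ ?p *\<^sub>R alternator vs (\<lambda>ws. foldr cl ws (cl v \<psi>)) +
      2 *\<^sub>R (\<Sum>i<?p. (- 1) ^ i *\<^sub>R alternator vs (\<lambda>ws. q v (ws ! i) *\<^sub>R ?C (omit i ws)))"
    by (simp only: alternator_add alternator_scaleR alternator_sum)
  also have "(\<Sum>i<?p. (- 1) ^ i *\<^sub>R alternator vs (\<lambda>ws. q v (ws ! i) *\<^sub>R ?C (omit i ws))) = fact ?p *\<^sub>R ?E"
    by (simp add: alternator_omit sum_constant_scaleR esum_alt_prod)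
  finally have "fact ?p *\<^sub>R cl v (alt_prod vs \<psi>) =
      fact ?p *\<^sub>R ((- 1) ^ ?p *\<^sub>R alt_prod vs (cl v \<psi>) + 2 *\<^sub>R ?E)"
    by (simp add: alt_prod_def linear_cmul[OF linear_spinor] scaleR_add_right mult.commute)
  then have "cl v (alt_prod vs \<psi>) = (- 1) ^ ?p *\<^sub>R alt_prod vs (cl v \<psi>) + 2 *\<^sub>R ?E" by simp
  then have "(- 1) ^ ?p *\<^sub>R alt_prod vs (cl v \<psi>) = alt_prod (v # vs) \<psi> - ?E"
    unfolding cl_alt_prod by (simp add: scaleR_2 algebra_simps)
  then have "(- 1) ^ ?p *\<^sub>R (- 1) ^ ?p *\<^sub>R alt_prod vs (cl v \<psi>) = (- 1) ^ ?p *\<^sub>R (alt_prod (v # vs) \<psi> - ?E)"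
    by simp
  then show ?thesis by (simp flip: power_mult_distrib)
qed

lemma multilinear_foldr: "multilinear_list p (\<lambda>ws. foldr cl ws \<psi>)"
  unfolding multilinear_list_def
proof (intro allI impI)
  fix xs ys :: "'v list"
  show "linear (\<lambda>v. foldr cl (xs @ v # ys) \<psi>)"
    using linear_compose[OF linear_vector[of "foldr cl ys \<psi>"] linear_foldr[of xs]] by (simp add: o_def)
qed

end

section \<open>Bilinears at a point\<close>

text \<open>The full contraction \<omega>^{ij} F(e_i, e_j), without a factor 1/2, as in the Clifford
  action of 2-forms.\<close>

definition tr2 :: "real ^ 'n ^ 'n \<Rightarrow> 'n::finite aform \<Rightarrow> (real ^ 'n \<Rightarrow> real ^ 'n \<Rightarrow> complex) \<Rightarrow> complex" where
  "tr2 G \<omega> F = mtrace G (\<lambda>u u'. mtrace G (\<lambda>w w'. \<omega> [u, w] * F u' w'))"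

lemma tr2_add: "tr2 G \<omega> (\<lambda>a b. F a b + F' a b) = tr2 G \<omega> F + tr2 G \<omega> F'"
  by (simp add: tr2_def distrib_left mtrace_add)

lemma tr2_diff: "tr2 G \<omega> (\<lambda>a b. F a b - F' a b) = tr2 G \<omega> F - tr2 G \<omega> F'"
  by (simp add: tr2_def right_diff_distrib mtrace_diff)

lemma tr2_minus: "tr2 G \<omega> (\<lambda>a b. - F a b) = - tr2 G \<omega> F"
  by (simp add: tr2_def mtrace_minus)

lemma tr2_esum: "tr2 G \<omega> (\<lambda>a b. esum (\<lambda>u. T u a b) vs) = esum (\<lambda>u ws. tr2 G \<omega> (\<lambda>a b. T u a b ws)) vs"
  by (simp add: tr2_def esum_mtrace esum_mult)

lemma tr2_flip:
  assumes "alt_form 2 \<omega>"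
  shows "tr2 G \<omega> (\<lambda>a b. F b a) = - tr2 G \<omega> F"
proof -
  have sw: "\<omega> [u, w] * z = - (\<omega> [w, u] * z)" for u w z
    using alt_form_swap[OF assms, of "[]" u w "[]"] by simp
  have "tr2 G \<omega> (\<lambda>a b. F b a) = mtrace G (\<lambda>w w'. mtrace G (\<lambda>u u'. \<omega> [u, w] * F w' u'))"
    unfolding tr2_def by (rule mtrace_swap)
  also have "\<dots> = mtrace G (\<lambda>w w'. mtrace G (\<lambda>u u'. - (\<omega> [w, u] * F w' u')))"
    by (intro arg_cong[where f = "mtrace G"] ext sw)
  also have "\<dots> = - tr2 G \<omega> F"
    by (simp add: tr2_def mtrace_minus)
  finally show ?thesis .
qed

lemma tr2_symmetric:
  assumes "alt_form 2 \<omega>" "\<And>a b. F a b = F b a"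
  shows "tr2 G \<omega> F = 0"
proof -
  have "(\<lambda>a b. F b a) = F" by (intro ext assms(2))
  then have "tr2 G \<omega> F = - tr2 G \<omega> F" using tr2_flip[OF assms(1), of G F] by simp
  then show ?thesis by simp
qed

lemma linear_form_2: "alt_form p \<omega> \<Longrightarrow> linear (\<lambda>w. \<omega> [u, w] * c)"
  using linear_cmult[OF linear_alt_form[of p \<omega> "[u]" "[]"], of c] by (simp add: mult.commute)

text \<open>The metric in the second slot is absorbed by the reproducing identity, which puts
  \<open>x\<close> into \<omega>.\<close>

lemma tr2_bil:
  assumes "gram G" "alt_form 2 \<omega>"
  shows "tr2 G \<omega> (\<lambda>a b. bil G b x *\<^sub>R F a) = mtrace G (\<lambda>u w. \<omega> [u, x] * F w)"
proof -
  have "mtrace G (\<lambda>w w'. \<omega> [u, w] * (bil G w' x *\<^sub>R z)) = \<omega> [u, x] * z" for u z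
    using mtrace_reproduce'[OF assms(1) linear_form_2[OF assms(2), of u z], of x] by simp
  then show ?thesis by (simp add: tr2_def)
qed

lemma tr2_bil_bil:
  assumes "gram G" "alt_form 2 \<omega>"
  shows "tr2 G \<omega> (\<lambda>a b. bil G b x *\<^sub>R bil G a y *\<^sub>R c) = - (\<omega> [x, y] * c)"
proof -
  have "mtrace G (\<lambda>u w. bil G w y *\<^sub>R (\<omega> [x, u] * c)) = \<omega> [x, y] * c"
    by (rule mtrace_reproduce'[OF assms(1) linear_form_2[OF assms(2)]])
  moreover have "\<omega> [u, x] * (bil G w y *\<^sub>R c) = - (bil G w y *\<^sub>R (\<omega> [x, u] * c))" for u w
    using alt_form_swap[OF assms(2), of "[]" u x "[]"] by simp
  ultimately show ?thesis
    unfolding tr2_bil[OF assms] by (simp add: mtrace_minus)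
qed

lemma tr2_frame:
  fixes E :: "'n::finite \<Rightarrow> real ^ 'n"
  assumes G: "gram G" and E: "\<And>i j. bil G (E i) (E j) = (if i = j then 1 else 0)" and \<omega>: "alt_form 2 \<omega>"
    and F: "\<And>a. linear (\<lambda>b. F a b)" "\<And>b. linear (\<lambda>a. F a b)"
  shows "tr2 G \<omega> F = (\<Sum>i\<in>UNIV. \<Sum>j\<in>UNIV. \<omega> [E i, E j] * F (E i) (E j))"
proof -
  have lin1: "linear (\<lambda>w. \<omega> [u, w] * z)" "linear (\<lambda>w. \<omega> [w, u] * z)" for u z
    using linear_form_2[OF \<omega>] linear_cmult[OF linear_alt_form[OF \<omega>, of "[]" "[u]"], of z]
    by (simp_all add: mult.commute)
  have inner: "mtrace G (\<lambda>w w'. \<omega> [u, w] * F u' w') = (\<Sum>j\<in>UNIV. \<omega> [u, E j] * F u' (E j))" for u u'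
    by (rule mtrace_orthonormal[OF G E]) (intro linear_cmult F lin1)+
  show ?thesis
    unfolding tr2_def inner
    by (rule mtrace_orthonormal[OF G E]) (intro linear_compose_sum ballI linear_cmult F lin1)+
qed

section \<open>The Hermitian pairing and left and right actions of 2-forms\<close>

lemma herm_add_right: "herm u (v + w) = herm u v + herm u w"
  by (simp add: herm_def distrib_left sum.distrib)

lemma herm_add_left: "herm (u + v) w = herm u w + herm v w"
  by (simp add: herm_def distrib_right sum.distrib)

lemma herm_scale_right: "herm u (a *s v) = a * herm u v"
  by (simp add: herm_def sum_distrib_left mult.left_commute)

lemma herm_scale_left: "herm (a *s u) v = cnj a * herm u v"
  by (simp add: herm_def sum_distrib_left mult.assoc)

lemma scaleR_eq_scale: "r *\<^sub>R v = complex_of_real r *s (v :: complex ^ 's)"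
  unfolding vec_eq_iff vector_scaleR_component vector_smult_component by (auto intro: scaleR_conv_of_real)

lemma linear_herm_right: "linear (herm u)"
  by (simp add: linear_iff herm_add_right scaleR_eq_scale herm_scale_right scaleR_conv_of_real)

lemma linear_herm_left: "linear (\<lambda>u. herm u v)"
  by (simp add: linear_iff herm_add_left scaleR_eq_scale herm_scale_left scaleR_conv_of_real)

lemma linear_scale_spinor: "linear ((*s) a :: complex ^ 's \<Rightarrow> complex ^ 's)"
  by (simp add: linear_iff vector_add_ldistrib vector_smult_assoc scaleR_eq_scale mult.commute)

lemma sum_esum_short: "length vs < 2 \<Longrightarrow> esum (\<lambda>x. esum (T x)) vs = 0"
  by (cases vs) (auto simp: esum_Cons)

text \<open>The spinor fibre at one point in one trivialisation. The orthonormal frame is a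
  parameter because the Clifford action of forms is defined by sums over it.\<close>

locale spinor_pairing = clifford_action "bil G" cl
  for G :: "real ^ 'n ^ 'n::finite" and cl :: "real ^ 'n \<Rightarrow> complex ^ 's \<Rightarrow> complex ^ 's::finite" +
  fixes E :: "'n \<Rightarrow> real ^ 'n"
  assumes gram: "gram G"
    and cl_sym: "herm (cl v \<theta>) \<psi> = herm \<theta> (cl v \<psi>)"
    and cl_scale: "cl v (a *s \<psi>) = a *s cl v \<psi>"
    and frame: "bil G (E i) (E j) = (if i = j then 1 else 0)"
begin

definition pform :: "complex ^ 's \<Rightarrow> complex ^ 's \<Rightarrow> 'n aform" where
  "pform \<theta> \<psi> vs = herm \<theta> (alt_prod vs \<psi>)"

text \<open>\<open>pform\<close> accepts lists of every length, which suits the recursion on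
  arguments; the cut-off to one degree makes it a form in the sense of
  \<open>alt_form\<close>.\<close>

definition kform :: "nat \<Rightarrow> complex ^ 's \<Rightarrow> complex ^ 's \<Rightarrow> 'n aform" where
  "kform m \<theta> \<psi> vs = (if length vs = m then pform \<theta> \<psi> vs else 0)"

lemma alt_form_kform: "alt_form m (kform m \<theta> \<psi>)"
proof -
  have "multilinear_list m (\<lambda>ws. herm \<theta> (foldr cl ws \<psi>))"
    using multilinear_foldr[of m \<psi>] unfolding multilinear_list_def
    by (auto intro: linear_compose[OF _ linear_herm_right, unfolded o_def])
  then have "alt_form m (\<lambda>vs. (1 / fact m) *\<^sub>R
      (if length vs = m then alternator vs (\<lambda>ws. herm \<theta> (foldr cl ws \<psi>)) else 0))"
    by (intro alt_form_scaleR alt_form_alternator)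
  also have "(\<lambda>vs. (1 / fact m) *\<^sub>R
      (if length vs = m then alternator vs (\<lambda>ws. herm \<theta> (foldr cl ws \<psi>)) else 0)) = kform m \<theta> \<psi>"
    by (auto simp: kform_def pform_def alt_prod_def linear_cmul[OF linear_herm_right]
        alternator_linear[OF linear_herm_right])
  finally show ?thesis .
qed

lemma herm_cl_alt_prod:
  "herm \<theta> (cl a (alt_prod vs \<psi>)) = pform \<theta> \<psi> (a # vs) + esum (\<lambda>u ws. bil G a u *\<^sub>R pform \<theta> \<psi> ws) vs"
  unfolding cl_alt_prod pform_def herm_add_right esum_linear[OF linear_herm_right]
  by (simp add: linear_cmul[OF linear_herm_right])

lemma pform_cl:
  "pform \<theta> (cl a \<psi>) vs =
     (- 1) ^ length vs * (pform \<theta> \<psi> (a # vs) - esum (\<lambda>u ws. bil G a u *\<^sub>R pform \<theta> \<psi> ws) vs)"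
  unfolding alt_prod_cl pform_def linear_cmul[OF linear_herm_right] linear_diff[OF linear_herm_right]
    esum_linear[OF linear_herm_right]
  by (simp add: scaleR_conv_of_real)

lemma alt_prod_linear: "linear (alt_prod vs)"
  unfolding alt_prod_def[abs_def]
  by (intro linear_compose_scale_right linear_alternator linear_foldr)

lemma foldr_scale: "foldr cl ws (a *s \<psi>) = a *s foldr cl ws \<psi>"
  by (induction ws) (simp_all add: cl_scale)

lemma alt_prod_scale: "alt_prod vs (a *s \<psi>) = a *s alt_prod vs \<psi>"
  unfolding alt_prod_def foldr_scale
  by (simp add: alternator_linear[OF linear_scale_spinor] linear_cmul[OF linear_scale_spinor])

text \<open>Two vector multiplications give terms with both vectors added as arguments, one added
  and one contracted, both contracted, and the scalar g(a, b). Contracted with \<omega>, the first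
  three yield degrees \<open>p + 2\<close>, \<open>p\<close> and \<open>p - 2\<close> of the
  pairing, and the symmetric scalar vanishes. On the right, each multiplication has a relative minus
  sign between adding and contracting, so the mixed terms change sign against the left
  action.\<close>

lemma tr2_left:
  assumes \<omega>: "alt_form 2 \<omega>" and len: "length vs = p"
  shows "tr2 G \<omega> (\<lambda>a b. herm \<theta> (cl a (cl b (alt_prod vs \<psi>)))) =
    2 * ctr G 2 \<omega> (kform (p + 2) \<theta> \<psi>) vs + 2 * int_form G 2 p \<omega> (kform p \<theta> \<psi>) vs -
    2 * wedge 2 (p - 2) \<omega> (if p < 2 then \<lambda>vs. 0 else kform (p - 2) \<theta> \<psi>) vs"
    and tr2_right: "tr2 G \<omega> (\<lambda>a b. herm \<theta> (alt_prod vs (cl a (cl b \<psi>)))) =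
    2 * ctr G 2 \<omega> (kform (p + 2) \<theta> \<psi>) vs - 2 * int_form G 2 p \<omega> (kform p \<theta> \<psi>) vs -
    2 * wedge 2 (p - 2) \<omega> (if p < 2 then \<lambda>vs. 0 else kform (p - 2) \<theta> \<psi>) vs"
proof -
  let ?f = "pform \<theta> \<psi>"
  have C: "2 * ctr G 2 \<omega> (kform (p + 2) \<theta> \<psi>) vs = tr2 G \<omega> (\<lambda>a b. ?f (a # b # vs))"
    by (simp add: ctr_2 tr2_def kform_def len)
  have I: "int_form G 2 p \<omega> (kform p \<theta> \<psi>) vs = esum (\<lambda>u ws. tr2 G \<omega> (\<lambda>a b. bil G b u *\<^sub>R ?f (a # ws))) vs"
    unfolding int_form_2_esum[OF gram \<omega> alt_form_kform] tr2_bil[OF gram \<omega>]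
    by (intro esum_cong) (simp add: kform_def len)
  have I': "esum (\<lambda>u ws. tr2 G \<omega> (\<lambda>a b. bil G a u *\<^sub>R ?f (b # ws))) vs =
      - esum (\<lambda>u ws. tr2 G \<omega> (\<lambda>a b. bil G b u *\<^sub>R ?f (a # ws))) vs"
    using tr2_flip[OF \<omega>, of G "\<lambda>a b. bil G b _ *\<^sub>R ?f (a # _)"] by (simp add: esum_minus)
  \<comment> \<open>For \<open>p < 2\<close> the truncated degree \<open>p - 2\<close> would admit a
    0-form; the zero form is substituted, in agreement with two removals from a list of length below
    2.\<close>
  have W: "2 * wedge 2 (p - 2) \<omega> (if p < 2 then \<lambda>vs. 0 else kform (p - 2) \<theta> \<psi>) vs =
      esum (\<lambda>x. esum (\<lambda>y ws. \<omega> [x, y] * ?f ws)) vs"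
  proof (cases "p < 2")
    case True
    then show ?thesis using len by (simp add: sum_esum_short)
  next
    case False
    then have "2 * wedge 2 (p - 2) \<omega> (if p < 2 then \<lambda>vs. 0 else kform (p - 2) \<theta> \<psi>) vs =
        esum (\<lambda>x. esum (\<lambda>y ws. \<omega> [x, y] * kform (p - 2) \<theta> \<psi> ws)) vs"
      using wedge_2form[OF \<omega> alt_form_kform] by simp
    also have "\<dots> = esum (\<lambda>x. esum (\<lambda>y ws. \<omega> [x, y] * ?f ws)) vs"
      by (intro esum_cong) (simp add: kform_def len[symmetric])
    finally show ?thesis .
  qed
  \<comment> \<open>The outer argument pairs with the second slot of \<omega> and the inner one with
    the first, hence the minus sign.\<close>
  have WL: "esum (\<lambda>u. esum (\<lambda>y ws. tr2 G \<omega> (\<lambda>a b. bil G b u *\<^sub>R bil G a y *\<^sub>R ?f ws))) vs =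
      - esum (\<lambda>x. esum (\<lambda>y ws. \<omega> [x, y] * ?f ws)) vs"
    unfolding tr2_bil_bil[OF gram \<omega>] by (simp add: esum_minus[abs_def] esum_minus)
  have sym: "tr2 G \<omega> (\<lambda>a b. bil G a b *\<^sub>R ?f vs) = 0" "tr2 G \<omega> (\<lambda>a b. bil G b a *\<^sub>R ?f vs) = 0"
    using gram_sym[OF gram] by (auto intro!: tr2_symmetric[OF \<omega>])
  have "herm \<theta> (cl a (cl b (alt_prod vs \<psi>))) = ?f (a # b # vs) + bil G a b *\<^sub>R ?f vs -
      esum (\<lambda>u ws. bil G a u *\<^sub>R ?f (b # ws)) vs + esum (\<lambda>u ws. bil G b u *\<^sub>R ?f (a # ws)) vs +
      esum (\<lambda>u. esum (\<lambda>y ws. bil G b u *\<^sub>R bil G a y *\<^sub>R ?f ws)) vs" for a b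
  proof -
    have "herm \<theta> (cl a (cl b (alt_prod vs \<psi>))) =
        herm \<theta> (cl a (alt_prod (b # vs) \<psi>)) +
        esum (\<lambda>u ws. bil G b u *\<^sub>R herm \<theta> (cl a (alt_prod ws \<psi>))) vs"
      unfolding cl_alt_prod[of b] linear_add[OF linear_spinor] herm_add_right
        esum_linear[OF linear_spinor] esum_linear[OF linear_herm_right]
      by (simp add: linear_cmul[OF linear_spinor] linear_cmul[OF linear_herm_right])
    also have "(\<lambda>u ws. bil G b u *\<^sub>R herm \<theta> (cl a (alt_prod ws \<psi>))) =
        (\<lambda>u ws. bil G b u *\<^sub>R ?f (a # ws) + esum (\<lambda>y ws. bil G b u *\<^sub>R bil G a y *\<^sub>R ?f ws) ws)"
      unfolding herm_cl_alt_prod scaleR_add_right esum_scaleR ..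
    finally show ?thesis by (simp add: herm_cl_alt_prod esum_Cons esum_add)
  qed
  then have "tr2 G \<omega> (\<lambda>a b. herm \<theta> (cl a (cl b (alt_prod vs \<psi>)))) =
      tr2 G \<omega> (\<lambda>a b. ?f (a # b # vs)) - esum (\<lambda>u ws. tr2 G \<omega> (\<lambda>a b. bil G a u *\<^sub>R ?f (b # ws))) vs +
      esum (\<lambda>u ws. tr2 G \<omega> (\<lambda>a b. bil G b u *\<^sub>R ?f (a # ws))) vs +
      esum (\<lambda>u. esum (\<lambda>y ws. tr2 G \<omega> (\<lambda>a b. bil G b u *\<^sub>R bil G a y *\<^sub>R ?f ws))) vs"
    by (simp only: tr2_add tr2_diff tr2_esum sym add_0_right)
  then show "tr2 G \<omega> (\<lambda>a b. herm \<theta> (cl a (cl b (alt_prod vs \<psi>)))) =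
    2 * ctr G 2 \<omega> (kform (p + 2) \<theta> \<psi>) vs + 2 * int_form G 2 p \<omega> (kform p \<theta> \<psi>) vs -
    2 * wedge 2 (p - 2) \<omega> (if p < 2 then \<lambda>vs. 0 else kform (p - 2) \<theta> \<psi>) vs"
    unfolding C I W I' WL by simp
  have "herm \<theta> (alt_prod vs (cl a (cl b \<psi>))) = - ?f (b # a # vs) + bil G b a *\<^sub>R ?f vs -
      esum (\<lambda>u ws. bil G b u *\<^sub>R ?f (a # ws)) vs + esum (\<lambda>u ws. bil G a u *\<^sub>R ?f (b # ws)) vs -
      esum (\<lambda>u. esum (\<lambda>y ws. bil G a u *\<^sub>R bil G b y *\<^sub>R ?f ws)) vs" for a b
  proof -
    let ?s = "(- 1) ^ length vs :: complex"
    have ss: "?s * (?s * z) = z" for z by (simp flip: mult.assoc power_mult_distrib)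
    have "herm \<theta> (alt_prod vs (cl a (cl b \<psi>))) =
        ?s * (pform \<theta> (cl b \<psi>) (a # vs) - esum (\<lambda>u ws. bil G a u *\<^sub>R pform \<theta> (cl b \<psi>) ws) vs)"
      by (simp add: pform_cl flip: pform_def)
    also have "pform \<theta> (cl b \<psi>) (a # vs) =
        - (?s * (?f (b # a # vs) - bil G b a *\<^sub>R ?f vs + esum (\<lambda>u ws. bil G b u *\<^sub>R ?f (a # ws)) vs))"
      by (simp add: pform_cl esum_Cons algebra_simps)
    also have "esum (\<lambda>u ws. bil G a u *\<^sub>R pform \<theta> (cl b \<psi>) ws) vs =
        esum (\<lambda>u ws. - ?s * (bil G a u *\<^sub>R ?f (b # ws) - esum (\<lambda>y ws. bil G a u *\<^sub>R bil G b y *\<^sub>R ?f ws) ws)) vs"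
    proof (rule esum_cong)
      fix u and ws :: "(real ^ 'n) list" assume "Suc (length ws) = length vs"
      \<comment> \<open>After one removal the parity of the list is reversed, so the right rule
        enters with the opposite sign.\<close>
      then have s: "(- 1) ^ length ws = - ?s" by (metis minus_minus mult_minus1 power_Suc)
      show "bil G a u *\<^sub>R pform \<theta> (cl b \<psi>) ws =
          - ?s * (bil G a u *\<^sub>R ?f (b # ws) - esum (\<lambda>y ws. bil G a u *\<^sub>R bil G b y *\<^sub>R ?f ws) ws)"
        unfolding pform_cl s esum_scaleR[where c = "bil G a u"] by (simp add: scaleR_conv_of_real algebra_simps)
    qed
    also have "\<dots> = - ?s * (esum (\<lambda>u ws. bil G a u *\<^sub>R ?f (b # ws)) vs -
        esum (\<lambda>u. esum (\<lambda>y ws. bil G a u *\<^sub>R bil G b y *\<^sub>R ?f ws)) vs)"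
      unfolding esum_mult esum_diff ..
    finally show ?thesis by (simp add: right_diff_distrib distrib_left ss)
  qed
  then have "tr2 G \<omega> (\<lambda>a b. herm \<theta> (alt_prod vs (cl a (cl b \<psi>)))) =
      - tr2 G \<omega> (\<lambda>a b. ?f (b # a # vs)) - esum (\<lambda>u ws. tr2 G \<omega> (\<lambda>a b. bil G b u *\<^sub>R ?f (a # ws))) vs +
      esum (\<lambda>u ws. tr2 G \<omega> (\<lambda>a b. bil G a u *\<^sub>R ?f (b # ws))) vs -
      esum (\<lambda>u. esum (\<lambda>y ws. tr2 G \<omega> (\<lambda>a b. bil G a u *\<^sub>R bil G b y *\<^sub>R ?f ws))) vs"
    by (simp only: tr2_add tr2_diff tr2_minus tr2_esum sym add_0_right)
  moreover have "esum (\<lambda>u. esum (\<lambda>y ws. tr2 G \<omega> (\<lambda>a b. bil G a u *\<^sub>R bil G b y *\<^sub>R ?f ws))) vs =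
      - esum (\<lambda>u. esum (\<lambda>y ws. tr2 G \<omega> (\<lambda>a b. bil G b u *\<^sub>R bil G a y *\<^sub>R ?f ws))) vs"
    using tr2_flip[OF \<omega>, of G "\<lambda>a b. bil G b _ *\<^sub>R bil G a _ *\<^sub>R ?f _"]
    by (simp add: esum_minus[abs_def] esum_minus)
  moreover have "tr2 G \<omega> (\<lambda>a b. ?f (b # a # vs)) = - tr2 G \<omega> (\<lambda>a b. ?f (a # b # vs))"
    by (rule tr2_flip[OF \<omega>])
  ultimately show "tr2 G \<omega> (\<lambda>a b. herm \<theta> (alt_prod vs (cl a (cl b \<psi>)))) =
    2 * ctr G 2 \<omega> (kform (p + 2) \<theta> \<psi>) vs - 2 * int_form G 2 p \<omega> (kform p \<theta> \<psi>) vs -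
    2 * wedge 2 (p - 2) \<omega> (if p < 2 then \<lambda>vs. 0 else kform (p - 2) \<theta> \<psi>) vs"
    unfolding C I W I' WL by simp
qed

end

lemma int_form_mult: "int_form G l p \<xi> (\<lambda>vs. a * \<psi> vs) vs = a * int_form G l p \<xi> \<psi> vs"
  by (simp add: int_form_def component_def sum_distrib_left sum_distrib_right mult_ac)

section \<open>Clifford action of forms and the twistor shape of the derivative\<close>

context spinor_pairing
begin

definition cl2f :: "'n aform \<Rightarrow> complex ^ 's \<Rightarrow> complex ^ 's" where
  "cl2f \<omega> \<psi> = (\<Sum>j\<in>UNIV. \<Sum>k\<in>UNIV. \<omega> [E j, E k] *s cl (E j) (cl (E k) \<psi>))"

definition cl3f :: "'n aform \<Rightarrow> complex ^ 's \<Rightarrow> complex ^ 's" where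
  "cl3f H \<psi> = (\<Sum>i\<in>UNIV. \<Sum>j\<in>UNIV. \<Sum>k\<in>UNIV. H [E i, E j, E k] *s cl (E i) (cl (E j) (cl (E k) \<psi>)))"

lemma linear_cl_cl: "linear (\<lambda>b. cl a (cl b \<psi>))" "linear (\<lambda>a. cl a (cl b \<psi>))"
  using linear_compose[OF linear_vector[of \<psi>] linear_spinor[of a]] linear_vector by (simp_all add: o_def)

lemma herm_cl2f_right:
  assumes "alt_form 2 \<omega>"
  shows "herm \<theta> (alt_prod vs (cl2f \<omega> \<psi>)) = tr2 G \<omega> (\<lambda>a b. herm \<theta> (alt_prod vs (cl a (cl b \<psi>))))"
proof -
  have lin: "linear (\<lambda>\<phi>. herm \<theta> (alt_prod vs \<phi>))"
    using linear_compose[OF alt_prod_linear linear_herm_right] by (simp add: o_def)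
  have "tr2 G \<omega> (\<lambda>a b. herm \<theta> (alt_prod vs (cl a (cl b \<psi>)))) =
      (\<Sum>i\<in>UNIV. \<Sum>j\<in>UNIV. \<omega> [E i, E j] * herm \<theta> (alt_prod vs (cl (E i) (cl (E j) \<psi>))))"
    using linear_compose[OF linear_cl_cl(1) lin] linear_compose[OF linear_cl_cl(2) lin]
    by (intro tr2_frame[OF gram frame assms]) (simp_all add: o_def)
  then show ?thesis
    by (simp add: cl2f_def linear_sum[OF lin] alt_prod_scale herm_scale_right)
qed

text \<open>Taking adjoints reverses the two Clifford factors, and the antisymmetry of \<omega>
  turns the reversal into a sign: a real 2-form acts by an anti-Hermitian operator.\<close>

lemma herm_cl2f_left:
  assumes \<omega>: "alt_form 2 \<omega>" and real: "\<And>u v. \<omega> [u, v] \<in> \<real>"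
  shows "herm (cl2f \<omega> \<theta>) \<phi> = - tr2 G \<omega> (\<lambda>a b. herm \<theta> (cl a (cl b \<phi>)))"
proof -
  have "herm (cl2f \<omega> \<theta>) \<phi> = (\<Sum>i\<in>UNIV. \<Sum>j\<in>UNIV. \<omega> [E i, E j] * herm \<theta> (cl (E j) (cl (E i) \<phi>)))"
    using real by (simp add: cl2f_def linear_sum[OF linear_herm_left] herm_scale_left cl_sym Reals_cnj_iff)
  also have "\<dots> = tr2 G \<omega> (\<lambda>a b. herm \<theta> (cl b (cl a \<phi>)))"
    using linear_compose[OF linear_cl_cl(1) linear_herm_right] linear_compose[OF linear_cl_cl(2) linear_herm_right]
    by (intro tr2_frame[OF gram frame \<omega>, symmetric]) (simp_all add: o_def)
  also have "\<dots> = - tr2 G \<omega> (\<lambda>a b. herm \<theta> (cl a (cl b \<phi>)))"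
    by (rule tr2_flip[OF \<omega>])
  finally show ?thesis .
qed

lemma frame_expand: "linear f \<Longrightarrow> (\<Sum>i\<in>UNIV. bil G v (E i) *\<^sub>R f (E i)) = f v"
  for f :: "real ^ 'n \<Rightarrow> 'b::real_vector"
proof -
  assume f: "linear f"
  have "mtrace G (\<lambda>u w. bil G u v *\<^sub>R f w) = (\<Sum>i\<in>UNIV. bil G (E i) v *\<^sub>R f (E i))"
  proof (rule mtrace_orthonormal[OF gram frame])
    show "linear (\<lambda>w. bil G u v *\<^sub>R f w)" for u by (intro linear_compose_scale_right f)
    show "linear (\<lambda>u. bil G u v *\<^sub>R f w)" for w
      using linear_add[OF linear_bil_left, of G] linear_cmul[OF linear_bil_left, of G]
      by (simp add: linear_iff scaleR_add_left)
  qed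
  then show ?thesis
    using mtrace_reproduce[OF gram f, of v] gram_sym[OF gram] by simp
qed

text \<open>Moving \<open>v\<close> past three frame vectors leaves three scalars with weights 2 and
  signs +, -, +; moving \<open>v\<close> to the first slot of \<open>H\<close> costs +, -, + again.
  The contributions add up to 6 times the action of i_v H, which is the 6 in
  \<open>\<kappa>\<close>.\<close>

lemma cl3f_cl:
  assumes H: "alt_form 3 H"
  shows "cl3f H (cl v \<psi>) = 6 *s cl2f (contract v H) \<psi> - cl v (cl3f H \<psi>)"
proof -
  have "cl3f H (cl v \<psi>) + cl v (cl3f H \<psi>) = (\<Sum>i\<in>UNIV. \<Sum>j\<in>UNIV. \<Sum>k\<in>UNIV. H [E i, E j, E k] *s
      (2 *\<^sub>R (bil G v (E i) *\<^sub>R cl (E j) (cl (E k) \<psi>) - bil G v (E j) *\<^sub>R cl (E i) (cl (E k) \<psi>) +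
        bil G v (E k) *\<^sub>R cl (E i) (cl (E j) \<psi>))))"
  proof -
    have "cl (E i) (cl (E j) (cl (E k) (cl v \<psi>))) + cl v (cl (E i) (cl (E j) (cl (E k) \<psi>))) =
        2 *\<^sub>R (bil G v (E i) *\<^sub>R cl (E j) (cl (E k) \<psi>) - bil G v (E j) *\<^sub>R cl (E i) (cl (E k) \<psi>) +
        bil G v (E k) *\<^sub>R cl (E i) (cl (E j) \<psi>))" for i j k
      using graded_commutator[of v "[E i, E j, E k]" \<psi>] by (simp add: esum_Cons)
    then show ?thesis
      by (simp add: cl3f_def linear_sum[OF linear_spinor] cl_scale flip: sum.distrib vector_add_ldistrib)
  qed
  also have "\<dots> = 2 *\<^sub>R ((\<Sum>j\<in>UNIV. \<Sum>k\<in>UNIV. (\<Sum>i\<in>UNIV. bil G v (E i) *\<^sub>R H [E i, E j, E k]) *s cl (E j) (cl (E k) \<psi>)) -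
      (\<Sum>i\<in>UNIV. \<Sum>k\<in>UNIV. (\<Sum>j\<in>UNIV. bil G v (E j) *\<^sub>R H [E i, E j, E k]) *s cl (E i) (cl (E k) \<psi>)) +
      (\<Sum>i\<in>UNIV. \<Sum>j\<in>UNIV. (\<Sum>k\<in>UNIV. bil G v (E k) *\<^sub>R H [E i, E j, E k]) *s cl (E i) (cl (E j) \<psi>)))"
  proof -
    have s1: "(\<Sum>i\<in>UNIV. \<Sum>j\<in>UNIV. \<Sum>k\<in>UNIV. H [E i, E j, E k] *s (bil G v (E i) *\<^sub>R cl (E j) (cl (E k) \<psi>))) =
        (\<Sum>j\<in>UNIV. \<Sum>k\<in>UNIV. \<Sum>i\<in>UNIV. H [E i, E j, E k] *s (bil G v (E i) *\<^sub>R cl (E j) (cl (E k) \<psi>)))"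
      by (subst sum.swap) (intro sum.cong refl sum.swap)
    have s2: "(\<Sum>i\<in>UNIV. \<Sum>j\<in>UNIV. \<Sum>k\<in>UNIV. H [E i, E j, E k] *s (bil G v (E j) *\<^sub>R cl (E i) (cl (E k) \<psi>))) =
        (\<Sum>i\<in>UNIV. \<Sum>k\<in>UNIV. \<Sum>j\<in>UNIV. H [E i, E j, E k] *s (bil G v (E j) *\<^sub>R cl (E i) (cl (E k) \<psi>)))"
      by (intro sum.cong refl sum.swap)
    have s3: "H [a, b, c] *s (2 *\<^sub>R (x - y + z)) = 2 *\<^sub>R (H [a, b, c] *s x - H [a, b, c] *s y + H [a, b, c] *s z)"
      for a b c x y z
      by (simp only: linear_cmul[OF linear_scale_spinor] linear_add[OF linear_scale_spinor]
          linear_diff[OF linear_scale_spinor])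
    have s4: "(\<Sum>i\<in>UNIV. r i *\<^sub>R h i) *s x = (\<Sum>i\<in>UNIV. h i *s (r i *\<^sub>R x))"
      for r :: "'n \<Rightarrow> real" and h :: "'n \<Rightarrow> complex" and x :: "complex ^ 's"
      unfolding vec_eq_iff sum_component vector_smult_component vector_scaleR_component
      by (simp add: sum_distrib_left sum_distrib_right scaleR_conv_of_real mult_ac)
    show ?thesis
      unfolding s3 s4 by (simp only: sum.distrib sum_subtractf scaleR_sum_right[symmetric] s1 s2)
  qed
  finally have sum: "cl3f H (cl v \<psi>) + cl v (cl3f H \<psi>) = \<dots>" .
  have contr: "(\<Sum>i\<in>UNIV. bil G v (E i) *\<^sub>R H [E i, b, c]) = contract v H [b, c]"
    "(\<Sum>j\<in>UNIV. bil G v (E j) *\<^sub>R H [b, E j, c]) = - contract v H [b, c]"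
    "(\<Sum>k\<in>UNIV. bil G v (E k) *\<^sub>R H [b, c, E k]) = contract v H [b, c]" for b c
    using frame_expand[OF linear_alt_form[OF H, of "[]" "[b, c]"], of v]
      frame_expand[OF linear_alt_form[OF H, of "[b]" "[c]"], of v] alt_form_front[OF H, of "[b]" v "[c]"]
      frame_expand[OF linear_alt_form[OF H, of "[b, c]" "[]"], of v] alt_form_front[OF H, of "[b, c]" v "[]"]
    by (simp_all add: contract_def)
  have "cl3f H (cl v \<psi>) + cl v (cl3f H \<psi>) = 6 *s cl2f (contract v H) \<psi>"
    unfolding sum contr cl2f_def by (simp add: vec_eq_iff sum_negf scaleR_conv_of_real)
  then show ?thesis by (simp add: algebra_simps)
qed

definition chi_form :: "complex ^ 's \<Rightarrow> nat \<Rightarrow> 'n aform" where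
  "chi_form \<epsilon> p vs = \<i> ^ (p div 2) * kform p \<epsilon> \<epsilon> vs"

lemma alt_form_chi_form: "alt_form p (chi_form \<epsilon> p)"
  unfolding chi_form_def[abs_def] by (intro alt_form_scaled alt_form_kform)

text \<open>\<delta> stands for the covariant derivative of \<epsilon> along \<open>Y\<close>. The
  first slot of the pairing contributes \<open>cnj \<kappa>\<close> times the left action of
  \<omega>, the second one -\<kappa> times the right action; so the degree-changing terms carry the
  difference and the degree-preserving one the sum. The terms in \<eta> come from the two rules for
  multiplication by a vector.\<close>

lemma herm_derivative:
  assumes \<omega>: "alt_form 2 \<omega>" and real: "\<And>u v. \<omega> [u, v] \<in> \<real>"
    and \<delta>: "\<delta> = cl Y \<eta> - \<kappa> *s cl2f \<omega> \<epsilon>" and len: "length vs = p"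
  shows "herm \<delta> (alt_prod vs \<epsilon>) + herm \<epsilon> (alt_prod vs \<delta>) =
    (cnj \<kappa> - \<kappa>) * (2 * ctr G 2 \<omega> (kform (p + 2) \<epsilon> \<epsilon>) vs -
      2 * wedge 2 (p - 2) \<omega> (if p < 2 then \<lambda>vs. 0 else kform (p - 2) \<epsilon> \<epsilon>) vs) +
    (cnj \<kappa> + \<kappa>) * (2 * int_form G 2 p \<omega> (kform p \<epsilon> \<epsilon>) vs) +
    (pform \<eta> \<epsilon> (Y # vs) + (- 1) ^ p * pform \<epsilon> \<eta> (Y # vs)) +
    esum (\<lambda>u ws. bil G Y u *\<^sub>R (pform \<eta> \<epsilon> ws - (- 1) ^ p * pform \<epsilon> \<eta> ws)) vs"
proof -
  let ?C = "ctr G 2 \<omega> (kform (p + 2) \<epsilon> \<epsilon>) vs" and ?I = "int_form G 2 p \<omega> (kform p \<epsilon> \<epsilon>) vs"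
  let ?W = "wedge 2 (p - 2) \<omega> (if p < 2 then \<lambda>vs. 0 else kform (p - 2) \<epsilon> \<epsilon>) vs"
  let ?EA = "esum (\<lambda>u ws. bil G Y u *\<^sub>R pform \<eta> \<epsilon> ws) vs"
  let ?EB = "esum (\<lambda>u ws. bil G Y u *\<^sub>R pform \<epsilon> \<eta> ws) vs"
  have "herm \<delta> (alt_prod vs \<epsilon>) = herm \<eta> (cl Y (alt_prod vs \<epsilon>)) - cnj \<kappa> * herm (cl2f \<omega> \<epsilon>) (alt_prod vs \<epsilon>)"
    unfolding \<delta> by (simp add: linear_diff[OF linear_herm_left] herm_scale_left cl_sym)
  then have e1: "herm \<delta> (alt_prod vs \<epsilon>) = pform \<eta> \<epsilon> (Y # vs) + ?EA + cnj \<kappa> * (2 * ?C + 2 * ?I - 2 * ?W)"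
    unfolding herm_cl2f_left[OF \<omega> real] tr2_left[OF \<omega> len] herm_cl_alt_prod by (simp only: mult_minus_right diff_minus_eq_add)
  have "herm \<epsilon> (alt_prod vs \<delta>) =
      herm \<epsilon> (alt_prod vs (cl Y \<eta>)) - \<kappa> * herm \<epsilon> (alt_prod vs (cl2f \<omega> \<epsilon>))"
    unfolding \<delta> by (simp add: linear_diff[OF alt_prod_linear] linear_diff[OF linear_herm_right] alt_prod_scale herm_scale_right)
  then have e2: "herm \<epsilon> (alt_prod vs \<delta>) =
      (- 1) ^ p * (pform \<epsilon> \<eta> (Y # vs) - ?EB) - \<kappa> * (2 * ?C - 2 * ?I - 2 * ?W)"
    unfolding herm_cl2f_right[OF \<omega>] tr2_right[OF \<omega> len] pform_def[symmetric, where \<psi> = "cl Y \<eta>"] pform_cl len .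
  have e3: "esum (\<lambda>u ws. bil G Y u *\<^sub>R (pform \<eta> \<epsilon> ws - (- 1) ^ p * pform \<epsilon> \<eta> ws)) vs = ?EA - (- 1) ^ p * ?EB"
    unfolding esum_mult[symmetric] esum_diff[symmetric]
    by (simp add: scaleR_diff_right mult_scaleR_right)
  show ?thesis
    unfolding e1 e2 e3 by (simp add: algebra_simps split del: if_split)
qed

text \<open>Collects the \<eta> terms in which \<open>Y\<close> is an additional argument;
  \<open>twistor_B\<close> collects those in which the metric pairs \<open>Y\<close> with an
  argument.\<close>

definition twistor_A :: "complex ^ 's \<Rightarrow> complex ^ 's \<Rightarrow> nat \<Rightarrow> 'n aform" where
  "twistor_A \<eta> \<epsilon> p = (\<lambda>vs. \<i> ^ (p div 2) * (kform (Suc p) \<eta> \<epsilon> vs + (- 1) ^ p * kform (Suc p) \<epsilon> \<eta> vs))"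

text \<open>For \<open>p = 0\<close> there is no argument to pair \<open>Y\<close> with, but the
  truncated degree \<open>p - 1\<close> would leave 0-forms; hence the case distinction.\<close>

definition twistor_B :: "complex ^ 's \<Rightarrow> complex ^ 's \<Rightarrow> nat \<Rightarrow> 'n aform" where
  "twistor_B \<eta> \<epsilon> p = (if p = 0 then \<lambda>vs. 0 else
     (\<lambda>vs. \<i> ^ (p div 2) * (kform (p - 1) \<eta> \<epsilon> vs - (- 1) ^ p * kform (p - 1) \<epsilon> \<eta> vs)))"

lemma alt_form_twistor_A: "alt_form (Suc p) (twistor_A \<eta> \<epsilon> p)"
  unfolding twistor_A_def by (intro alt_form_scaled alt_form_add alt_form_kform)

lemma alt_form_twistor_B: "alt_form (p - 1) (twistor_B \<eta> \<epsilon> p)"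
  unfolding twistor_B_def by (auto intro!: alt_form_scaled alt_form_diff alt_form_kform)

text \<open>Raising the degree by 2 multiplies i^[p/2] by i, so
  \<open>cnj \<kappa> - \<kappa> = -2 i Im \<kappa>\<close> gives a real coefficient. At
  \<open>p - 2\<close> the factor i has to be supplied instead, which costs i^2 = -1 and offsets the
  opposite sign of the wedge term; both coefficients become 4 Im \<kappa>.\<close>

lemma chi_form_twistor:
  assumes \<omega>: "alt_form 2 \<omega>" and real: "\<And>u v. \<omega> [u, v] \<in> \<real>"
    and \<delta>: "\<delta> = cl Y \<eta> - \<kappa> *s cl2f \<omega> \<epsilon>"
    and N: "\<And>vs. N vs = (if length vs = p
      then \<i> ^ (p div 2) * (herm \<delta> (alt_prod vs \<epsilon>) + herm \<epsilon> (alt_prod vs \<delta>)) else 0)"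
  shows "N vs + 4 * of_real (Im \<kappa>) * ctr G 2 \<omega> (chi_form \<epsilon> (p + 2)) vs
     - 4 * of_real (Re \<kappa>) * int_form G 2 p \<omega> (chi_form \<epsilon> p) vs
     + 4 * of_real (Im \<kappa>) * wedge 2 (p - 2) \<omega> (if p < 2 then \<lambda>vs. 0 else chi_form \<epsilon> (p - 2)) vs =
     twistor_A \<eta> \<epsilon> p (Y # vs) + esum (\<lambda>u ws. bil G Y u *\<^sub>R twistor_B \<eta> \<epsilon> p ws) vs"
proof (cases "length vs = p")
  case len: True
  let ?i = "\<i> ^ (p div 2)"
  have c: "ctr G 2 \<omega> (chi_form \<epsilon> (p + 2)) vs = \<i> * ?i * ctr G 2 \<omega> (kform (p + 2) \<epsilon> \<epsilon>) vs"
    unfolding chi_form_def[abs_def] ctr_mult_right by simp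
  have i: "int_form G 2 p \<omega> (chi_form \<epsilon> p) vs = ?i * int_form G 2 p \<omega> (kform p \<epsilon> \<epsilon>) vs"
    unfolding chi_form_def[abs_def] by (rule int_form_mult)
  have w: "\<i> * wedge 2 (p - 2) \<omega> (if p < 2 then \<lambda>vs. 0 else chi_form \<epsilon> (p - 2)) vs =
      ?i * wedge 2 (p - 2) \<omega> (if p < 2 then \<lambda>vs. 0 else kform (p - 2) \<epsilon> \<epsilon>) vs"
  proof (cases "p < 2")
    case False
    then obtain m where m: "p = m + 2" using le_Suc_ex[of 2 p] by (auto simp: add.commute)
    show ?thesis unfolding chi_form_def[abs_def] m by (simp add: wedge_mult_right)
  qed simp
  have A: "twistor_A \<eta> \<epsilon> p (Y # vs) = ?i * (pform \<eta> \<epsilon> (Y # vs) + (- 1) ^ p * pform \<epsilon> \<eta> (Y # vs))"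
    by (simp add: twistor_A_def kform_def len)
  have B: "esum (\<lambda>u ws. bil G Y u *\<^sub>R twistor_B \<eta> \<epsilon> p ws) vs =
      ?i * esum (\<lambda>u ws. bil G Y u *\<^sub>R (pform \<eta> \<epsilon> ws - (- 1) ^ p * pform \<epsilon> \<eta> ws)) vs"
    unfolding esum_mult[symmetric]
    using len by (intro esum_cong) (auto simp: twistor_B_def kform_def)
  have k1: "cnj \<kappa> - \<kappa> = - 2 * \<i> * of_real (Im \<kappa>)" and k2: "cnj \<kappa> + \<kappa> = 2 * of_real (Re \<kappa>)"
    by (simp_all add: complex_eq_iff)
  let ?c = "ctr G 2 \<omega> (kform (p + 2) \<epsilon> \<epsilon>) vs" and ?I = "int_form G 2 p \<omega> (kform p \<epsilon> \<epsilon>) vs"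
  let ?W = "wedge 2 (p - 2) \<omega> (if p < 2 then \<lambda>vs. 0 else chi_form \<epsilon> (p - 2)) vs"
  have "N vs = - 4 * \<i> * of_real (Im \<kappa>) * (?i * ?c) + 4 * \<i> * of_real (Im \<kappa>) * (\<i> * ?W)
     + 4 * of_real (Re \<kappa>) * (?i * ?I) + twistor_A \<eta> \<epsilon> p (Y # vs)
     + esum (\<lambda>u ws. bil G Y u *\<^sub>R twistor_B \<eta> \<epsilon> p ws) vs"
    unfolding w A B N herm_derivative[OF \<omega> real \<delta> len] k1 k2 using len by (simp add: algebra_simps)
  moreover have "\<i> * of_real (Im \<kappa>) * (\<i> * ?W) = - (of_real (Im \<kappa>) * ?W)"
    by (simp add: mult.left_commute flip: mult.assoc)
  ultimately show ?thesis unfolding c i by (simp add: algebra_simps)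
next
  case False
  have z: "alt_form p \<phi> \<Longrightarrow> \<phi> vs = 0" for \<phi> :: "'n aform" using False alt_form_length by blast
  have "ctr G 2 \<omega> (chi_form \<epsilon> (p + 2)) vs = 0"
    using alt_form_chi_form[of "p + 2" \<epsilon>] by (intro z alt_form_ctr) (simp add: add.commute)
  moreover have "int_form G 2 p \<omega> (chi_form \<epsilon> p) vs = 0"
    unfolding int_form_2_esum[OF gram \<omega> alt_form_chi_form]
    by (intro trans[OF esum_cong esum_zero]) (use False in \<open>simp add: chi_form_def kform_def\<close>)
  moreover have "wedge 2 (p - 2) \<omega> (if p < 2 then \<lambda>vs. 0 else chi_form \<epsilon> (p - 2)) vs = 0"
    using False by (cases "p < 2") (auto simp: wedge_alternator)
  moreover have "twistor_A \<eta> \<epsilon> p (Y # vs) = 0"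
    using False by (intro alt_form_length[OF alt_form_twistor_A]) simp
  moreover have "esum (\<lambda>u ws. bil G Y u *\<^sub>R twistor_B \<eta> \<epsilon> p ws) vs = 0"
  proof (rule trans[OF esum_cong esum_zero])
    fix u and ws :: "(real ^ 'n) list" assume l: "Suc (length ws) = length vs"
    show "bil G Y u *\<^sub>R twistor_B \<eta> \<epsilon> p ws = 0"
    proof (cases "p = 0")
      case False
      then have "length ws \<noteq> p - 1" using l \<open>length vs \<noteq> p\<close> by auto
      then show ?thesis using alt_form_length[OF alt_form_twistor_B] by simp
    qed (simp add: twistor_B_def)
  qed
  ultimately show ?thesis using False by (simp add: N)
qed

end

section \<open>Smooth functions\<close>

text \<open>Agreement on an open set determines the derivatives at its points.\<close>

lemma Ck_on_cong:
  assumes "open S"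
  shows "(\<And>x. x \<in> S \<Longrightarrow> f x = h x) \<Longrightarrow> Ck_on k S f \<Longrightarrow> Ck_on k S h"
proof (induction k arbitrary: f h)
  case 0
  then show ?case using continuous_on_cong[of S S f h] by simp
next
  case (Suc k)
  have D: "(h has_derivative frechet_derivative f (at x)) (at x)" if "x \<in> S" for x
  proof (rule has_derivative_transform_within_open[OF _ assms that Suc.prems(1)])
    show "(f has_derivative frechet_derivative f (at x)) (at x)"
      using Suc.prems(2) that by (simp flip: frechet_derivative_works)
  qed
  have eq: "frechet_derivative f (at x) v = frechet_derivative h (at x) v" if "x \<in> S" for x v
    by (simp only: frechet_derivative_at[OF D[OF that]])
  have "Ck_on k S (\<lambda>x. frechet_derivative h (at x) v)" for v
  proof (rule Suc.IH)
    show "Ck_on k S (\<lambda>x. frechet_derivative f (at x) v)" using Suc.prems(2) by simp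
  qed (rule eq)
  moreover have "h differentiable (at x)" if "x \<in> S" for x
    using D[OF that] by (rule differentiableI)
  ultimately show ?case by simp
qed

text \<open>Lets any explicitly computed derivative take the place of
  \<open>frechet_derivative\<close>.\<close>

lemma Ck_on_Suc_I:
  assumes "open S" "\<And>x. x \<in> S \<Longrightarrow> (f has_derivative f' x) (at x)" "\<And>v. Ck_on k S (\<lambda>x. f' x v)"
  shows "Ck_on (Suc k) S f"
proof -
  have "f' x v = frechet_derivative f (at x) v" if "x \<in> S" for x v
    by (simp only: frechet_derivative_at[OF assms(2)[OF that]])
  then have "Ck_on k S (\<lambda>x. frechet_derivative f (at x) v)" for v
    by (rule Ck_on_cong[OF assms(1) _ assms(3)])
  then show ?thesis using assms(2) by (auto intro: differentiableI)
qed

lemma Ck_on_Suc_has_derivative: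
  "Ck_on (Suc k) S f \<Longrightarrow> x \<in> S \<Longrightarrow> (f has_derivative frechet_derivative f (at x)) (at x)"
  using frechet_derivative_works by auto

lemma Ck_on_Suc_D: "Ck_on (Suc k) S f \<Longrightarrow> Ck_on k S f"
proof (induction k arbitrary: f)
  case 0
  then have "continuous (at x within S) f" if "x \<in> S" for x
    using that by (meson Ck_on_Suc_has_derivative continuous_at_imp_continuous_at_within has_derivative_continuous)
  then show ?case by (simp add: continuous_on_eq_continuous_within)
next
  case (Suc k)
  then show ?case by (metis Ck_on.simps(2))
qed

lemma Ck_on_const [simp]: "Ck_on k S (\<lambda>x. c)"
  by (induction k arbitrary: c) auto

lemma Ck_on_bounded_linear:
  assumes "open S" "bounded_linear h"
  shows "Ck_on k S f \<Longrightarrow> Ck_on k S (\<lambda>x. h (f x))"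
proof (induction k arbitrary: f)
  case 0
  then show ?case using assms by (simp add: bounded_linear.continuous_on)
next
  case (Suc k)
  show ?case
  proof (rule Ck_on_Suc_I[OF assms(1)])
    show "((\<lambda>x. h (f x)) has_derivative (\<lambda>v. h (frechet_derivative f (at x) v))) (at x)" if "x \<in> S" for x
      using bounded_linear.has_derivative[OF assms(2) Ck_on_Suc_has_derivative[OF Suc.prems that]] .
    show "Ck_on k S (\<lambda>x. h (frechet_derivative f (at x) v))" for v
      using Suc.prems by (intro Suc.IH) simp
  qed
qed

lemma Ck_on_add:
  assumes "open S"
  shows "Ck_on k S f \<Longrightarrow> Ck_on k S h \<Longrightarrow> Ck_on k S (\<lambda>x. f x + h x)"
proof (induction k arbitrary: f h)
  case 0
  then show ?case by (simp add: continuous_on_add)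
next
  case (Suc k)
  show ?case
  proof (rule Ck_on_Suc_I[OF assms])
    show "((\<lambda>x. f x + h x) has_derivative
        (\<lambda>v. frechet_derivative f (at x) v + frechet_derivative h (at x) v)) (at x)" if "x \<in> S" for x
      by (rule has_derivative_add[OF Ck_on_Suc_has_derivative[OF Suc.prems(1) that]
            Ck_on_Suc_has_derivative[OF Suc.prems(2) that]])
    show "Ck_on k S (\<lambda>x. frechet_derivative f (at x) v + frechet_derivative h (at x) v)" for v
      using Suc.prems by (intro Suc.IH) auto
  qed
qed

text \<open>Leibniz rule; the factor that is not differentiated has to be lowered from class k + 1
  to class k for the induction hypothesis.\<close>

lemma Ck_on_bilinear:
  assumes "open S" "bounded_bilinear bl"
  shows "Ck_on k S f \<Longrightarrow> Ck_on k S h \<Longrightarrow> Ck_on k S (\<lambda>x. bl (f x) (h x))"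
proof (induction k arbitrary: f h)
  case 0
  then show ?case using assms(2) by (simp add: bounded_bilinear.continuous_on)
next
  case (Suc k)
  show ?case
  proof (rule Ck_on_Suc_I[OF assms(1)])
    show "((\<lambda>x. bl (f x) (h x)) has_derivative
        (\<lambda>v. bl (f x) (frechet_derivative h (at x) v) + bl (frechet_derivative f (at x) v) (h x))) (at x)"
      if "x \<in> S" for x
      by (rule bounded_bilinear.FDERIV[OF assms(2) Ck_on_Suc_has_derivative[OF Suc.prems(1) that]
            Ck_on_Suc_has_derivative[OF Suc.prems(2) that]])
    show "Ck_on k S (\<lambda>x. bl (f x) (frechet_derivative h (at x) v) + bl (frechet_derivative f (at x) v) (h x))" for v
      using Suc.prems Ck_on_Suc_D[OF Suc.prems(1)] Ck_on_Suc_D[OF Suc.prems(2)]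
      by (intro Ck_on_add[OF assms(1)] Suc.IH) auto
  qed
qed

lemma Ck_on_inverse:
  fixes f :: "'a::real_normed_vector \<Rightarrow> real"
  assumes S: "open S" and nz: "\<And>x. x \<in> S \<Longrightarrow> f x \<noteq> 0"
  shows "Ck_on k S f \<Longrightarrow> Ck_on k S (\<lambda>x. inverse (f x))"
proof (induction k)
  case 0
  then show ?case using nz by (auto intro: continuous_on_inverse)
next
  case (Suc k)
  have inv: "Ck_on k S (\<lambda>x. inverse (f x))" using Suc Ck_on_Suc_D by blast
  show ?case
  proof (rule Ck_on_Suc_I[OF S])
    show "((\<lambda>x. inverse (f x)) has_derivative
        (\<lambda>v. - (inverse (f x) * frechet_derivative f (at x) v * inverse (f x)))) (at x)" if "x \<in> S" for x
      by (rule Deriv.has_derivative_inverse[OF nz[OF that] Ck_on_Suc_has_derivative[OF Suc.prems that]])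
    show "Ck_on k S (\<lambda>x. - (inverse (f x) * frechet_derivative f (at x) v * inverse (f x)))" for v
      using Suc.prems
      by (intro Ck_on_bounded_linear[OF S bounded_linear_minus[OF bounded_linear_ident]]
          Ck_on_bilinear[OF S bounded_bilinear_mult] inv) simp
  qed
qed

lemma Ck_on_subset: "T \<subseteq> S \<Longrightarrow> Ck_on k S f \<Longrightarrow> Ck_on k T f"
  by (induction k arbitrary: f) (auto intro: continuous_on_subset)

lemma Ck_on_Union: "(\<And>T. T \<in> \<S> \<Longrightarrow> open T) \<Longrightarrow> (\<And>T. T \<in> \<S> \<Longrightarrow> Ck_on k T f) \<Longrightarrow> Ck_on k (\<Union>\<S>) f"
proof (induction k arbitrary: f)
  case 0
  then show ?case by (auto intro: continuous_on_open_Union)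
next
  case (Suc k)
  then show ?case by auto
qed

section \<open>Symmetry of second derivatives\<close>

lemma has_real_derivative_line:
  fixes f :: "'a::real_normed_vector \<Rightarrow> real"
  assumes "(f has_derivative f') (at (a + s *\<^sub>R u))"
  shows "((\<lambda>s. f (a + s *\<^sub>R u)) has_real_derivative f' u) (at s)"
proof -
  have "((\<lambda>s. a + s *\<^sub>R u) has_derivative (\<lambda>h. h *\<^sub>R u)) (at s)"
    by (auto intro!: derivative_eq_intros)
  from has_derivative_compose[OF this assms]
  have "((\<lambda>s. f (a + s *\<^sub>R u)) has_derivative (\<lambda>h. f' (h *\<^sub>R u))) (at s)" .
  moreover have "(\<lambda>h. f' (h *\<^sub>R u)) = (*) (f' u)"
    by (intro ext) (simp add: linear_cmul[OF has_derivative_linear[OF assms]] mult.commute)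
  ultimately show ?thesis by (simp add: has_field_derivative_def)
qed

text \<open>The mean value theorem twice: along \<open>u\<close> for the difference in direction
  \<open>v\<close>, then along \<open>v\<close> for the derivative in direction
  \<open>u\<close>.\<close>

lemma second_difference:
  fixes f :: "'a::real_normed_vector \<Rightarrow> real"
  assumes S: "\<And>a b. 0 \<le> a \<Longrightarrow> a \<le> t \<Longrightarrow> 0 \<le> b \<Longrightarrow> b \<le> t \<Longrightarrow> x + a *\<^sub>R u + b *\<^sub>R v \<in> S"
    and f: "Ck_on 2 S f" and t: "0 < t"
  shows "\<exists>a b. 0 \<le> a \<and> a \<le> t \<and> 0 \<le> b \<and> b \<le> t \<and>
    f (x + t *\<^sub>R u + t *\<^sub>R v) - f (x + t *\<^sub>R u) - f (x + t *\<^sub>R v) + f x =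
    t * (t * frechet_derivative (\<lambda>y. frechet_derivative f (at y) u) (at (x + a *\<^sub>R u + b *\<^sub>R v)) v)"
proof -
  let ?d = "\<lambda>y. frechet_derivative f (at y) u"
  have f1: "(f has_derivative frechet_derivative f (at y)) (at y)" if "y \<in> S" for y
    using f that by (simp add: numeral_2_eq_2 flip: frechet_derivative_works)
  have f2: "(?d has_derivative frechet_derivative ?d (at y)) (at y)" if "y \<in> S" for y
    using f that by (simp add: numeral_2_eq_2 flip: frechet_derivative_works)
  have "((\<lambda>s. f (x + t *\<^sub>R v + s *\<^sub>R u) - f (x + s *\<^sub>R u)) has_real_derivative
      ?d (x + t *\<^sub>R v + s *\<^sub>R u) - ?d (x + s *\<^sub>R u)) (at s)" if "0 \<le> s" "s \<le> t" for s
    using S[of s t] S[of s 0] that t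
    by (intro DERIV_diff has_real_derivative_line f1) (simp_all add: algebra_simps)
  from MVT2[OF t this]
  obtain a where a: "0 < a" "a < t"
    "f (x + t *\<^sub>R v + t *\<^sub>R u) - f (x + t *\<^sub>R u) - (f (x + t *\<^sub>R v) - f x) =
      t * (?d (x + t *\<^sub>R v + a *\<^sub>R u) - ?d (x + a *\<^sub>R u))" by auto
  have "((\<lambda>s. ?d (x + a *\<^sub>R u + s *\<^sub>R v)) has_real_derivative
      frechet_derivative ?d (at (x + a *\<^sub>R u + s *\<^sub>R v)) v) (at s)" if "0 \<le> s" "s \<le> t" for s
    using S[of a s] that a by (intro has_real_derivative_line f2) simp
  from MVT2[OF t this]
  obtain b where b: "0 < b" "b < t"
    "?d (x + a *\<^sub>R u + t *\<^sub>R v) - ?d (x + a *\<^sub>R u) = t * frechet_derivative ?d (at (x + a *\<^sub>R u + b *\<^sub>R v)) v"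
    by auto
  have "f (x + t *\<^sub>R u + t *\<^sub>R v) - f (x + t *\<^sub>R u) - f (x + t *\<^sub>R v) + f x =
      t * (?d (x + a *\<^sub>R u + t *\<^sub>R v) - ?d (x + a *\<^sub>R u))"
    using a(3) by (simp add: algebra_simps)
  then show ?thesis unfolding b(3) using a b by (intro exI[of _ a] exI[of _ b]) auto
qed

text \<open>The second difference over a small parallelogram is symmetric in \<open>u\<close> and
  \<open>v\<close>, and it is given by either mixed derivative at some point of the parallelogram;
  continuity lets the latter shrink to \<open>x\<close>.\<close>

lemma frechet_derivative_symmetric:
  fixes f :: "'a::real_normed_vector \<Rightarrow> real"
  assumes S: "open S" "x \<in> S" and f: "Ck_on 2 S f"
  shows "frechet_derivative (\<lambda>y. frechet_derivative f (at y) u) (at x) v =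
    frechet_derivative (\<lambda>y. frechet_derivative f (at y) v) (at x) u"
proof -
  define D where "D u v y = frechet_derivative (\<lambda>y. frechet_derivative f (at y) u) (at y) v" for u v y
  have cont: "continuous_on S (D u v)" for u v
    using f unfolding D_def by (simp add: numeral_2_eq_2)
  have "\<bar>D u v x - D v u x\<bar> \<le> e" if e: "0 < e" for e
  proof -
    obtain r1 where r1: "0 < r1" "ball x r1 \<subseteq> S" using S open_contains_ball by blast
    have "\<exists>r>0. \<forall>y\<in>S. dist y x < r \<longrightarrow> dist (D u v y) (D u v x) < e / 2" for u v
      using cont[of u v] S(2) e unfolding continuous_on_iff by (meson half_gt_zero)
    then obtain r2 r3 where r2: "0 < r2" "\<And>y. y \<in> S \<Longrightarrow> dist y x < r2 \<Longrightarrow> dist (D u v y) (D u v x) < e / 2"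
      and r3: "0 < r3" "\<And>y. y \<in> S \<Longrightarrow> dist y x < r3 \<Longrightarrow> dist (D v u y) (D v u x) < e / 2"
      by metis
    define r where "r = min r1 (min r2 r3)"
    define N where "N = norm u + norm v + 1"
    \<comment> \<open>This size keeps the parallelogram within distance \<open>r / 2\<close> of
      \<open>x\<close>; the summand 1 keeps \<open>N\<close> positive.\<close>
    define t where "t = r / (2 * N)"
    have r: "0 < r" using r1 r2 r3 by (simp add: r_def)
    have pos: "0 < N" by (simp add: N_def add_nonneg_pos)
    have t: "0 < t" using r pos by (simp add: t_def)
    have near: "dist (x + a *\<^sub>R u + b *\<^sub>R v) x < r" if "0 \<le> a" "a \<le> t" "0 \<le> b" "b \<le> t" for a b
    proof -
      have "dist (x + a *\<^sub>R u + b *\<^sub>R v) x = norm (a *\<^sub>R u + b *\<^sub>R v)"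
        by (simp add: dist_norm add.assoc)
      also have "\<dots> \<le> a * norm u + b * norm v"
        using norm_triangle_ineq[of "a *\<^sub>R u" "b *\<^sub>R v"] that by simp
      also have "\<dots> \<le> t * norm u + t * norm v"
        using that by (intro add_mono mult_right_mono) auto
      also have "\<dots> \<le> t * N" using t by (simp add: N_def distrib_left)
      also have "\<dots> = r / 2" using pos by (simp add: t_def)
      finally show ?thesis using r by simp
    qed
    then have inS: "x + a *\<^sub>R u + b *\<^sub>R v \<in> S" if "0 \<le> a" "a \<le> t" "0 \<le> b" "b \<le> t" for a b
      using r1(2) that by (auto simp: r_def dist_commute subset_iff)
    obtain a b where ab: "0 \<le> a" "a \<le> t" "0 \<le> b" "b \<le> t"
      "f (x + t *\<^sub>R u + t *\<^sub>R v) - f (x + t *\<^sub>R u) - f (x + t *\<^sub>R v) + f x = t * (t * D u v (x + a *\<^sub>R u + b *\<^sub>R v))"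
      using second_difference[OF inS f t] unfolding D_def by blast
    have inS': "x + a *\<^sub>R v + b *\<^sub>R u \<in> S" if "0 \<le> a" "a \<le> t" "0 \<le> b" "b \<le> t" for a b
      using inS[of b a] that by (simp add: algebra_simps)
    obtain a' b' where ab': "0 \<le> a'" "a' \<le> t" "0 \<le> b'" "b' \<le> t"
      "f (x + t *\<^sub>R v + t *\<^sub>R u) - f (x + t *\<^sub>R v) - f (x + t *\<^sub>R u) + f x = t * (t * D v u (x + a' *\<^sub>R v + b' *\<^sub>R u))"
      using second_difference[OF inS' f t] unfolding D_def by blast
    have "t * (t * D u v (x + a *\<^sub>R u + b *\<^sub>R v)) = t * (t * D v u (x + a' *\<^sub>R v + b' *\<^sub>R u))"
      unfolding ab(5)[symmetric] ab'(5)[symmetric] by (simp add: algebra_simps)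
    then have eq: "D u v (x + a *\<^sub>R u + b *\<^sub>R v) = D v u (x + a' *\<^sub>R v + b' *\<^sub>R u)"
      using t by simp
    have "dist (D u v (x + a *\<^sub>R u + b *\<^sub>R v)) (D u v x) < e / 2"
      using near[OF ab(1-4)] by (intro r2(2) inS ab) (simp add: r_def)
    moreover have "dist (D v u (x + a' *\<^sub>R v + b' *\<^sub>R u)) (D v u x) < e / 2"
      using near[OF ab'(3,4,1,2)] by (intro r3(2) inS' ab') (simp add: r_def algebra_simps)
    ultimately show ?thesis unfolding eq dist_real_def by arith
  qed
  then have "\<bar>D u v x - D v u x\<bar> \<le> 0" by (rule field_le_epsilon[of _ 0, simplified]) simp
  then show ?thesis by (simp add: D_def)
qed

section \<open>Calculus in charts\<close>

text \<open>The topological conditions on a single chart of an atlas, isolated so that calculus can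
  be developed chart by chart.\<close>

definition regular_chart :: "('m::topological_space, 'n::finite) chart \<Rightarrow> bool" where
  "regular_chart c \<longleftrightarrow> open (fst c) \<and> open (snd c ` fst c) \<and>
     homeomorphism (fst c) (snd c ` fst c) (snd c) (inv_into (fst c) (snd c))"

lemma regular_chart_atlas: "smooth_atlas A \<Longrightarrow> c \<in> A \<Longrightarrow> regular_chart c"
  by (simp add: smooth_atlas_def regular_chart_def)

lemma in_chart_apply: "regular_chart c \<Longrightarrow> x \<in> fst c \<Longrightarrow> in_chart c f (snd c x) = f x"
  by (simp add: regular_chart_def in_chart_def homeomorphism_def)

lemma open_chart_image:
  assumes "regular_chart c" "open W"
  shows "open (snd c ` (W \<inter> fst c))"
proof -
  let ?inv = "inv_into (fst c) (snd c)"
  note hom = assms(1)[unfolded regular_chart_def homeomorphism_def]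
  have inv: "?inv (snd c x) = x" if "x \<in> fst c" for x
    using hom that by blast
  then have "snd c ` (W \<inter> fst c) = snd c ` fst c \<inter> ?inv -` W"
    by (intro equalityI subsetI) (auto simp: inv)
  moreover have "open (snd c ` fst c \<inter> ?inv -` W)"
    using hom by (intro continuous_open_preimage assms(2)) auto
  ultimately show ?thesis by simp
qed

lemma smooth_in_cong:
  assumes "regular_chart c" "open W" "smooth_in c W f" "\<And>x. x \<in> W \<inter> fst c \<Longrightarrow> f x = h x"
  shows "smooth_in c W h"
  using assms(3) unfolding smooth_in_def smooth_on_def
proof (intro allI)
  fix k assume *: "\<forall>k. Ck_on k (snd c ` (W \<inter> fst c)) (in_chart c f)"
  show "Ck_on k (snd c ` (W \<inter> fst c)) (in_chart c h)"
    by (rule Ck_on_cong[OF open_chart_image[OF assms(1,2)] _ *[rule_format]])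
      (use assms in \<open>auto simp: in_chart_apply\<close>)
qed

lemma smooth_in_subset: "smooth_in c W f \<Longrightarrow> V \<subseteq> W \<Longrightarrow> smooth_in c V f"
  unfolding smooth_in_def smooth_on_def using Ck_on_subset by (metis Int_mono image_mono order_refl)

text \<open>The neighbourhood may vary with the point, as it does for fields whose formula refers to
  a local trivialisation.\<close>

lemma smooth_in_local:
  assumes c: "regular_chart c" and "\<And>x. x \<in> fst c \<Longrightarrow> \<exists>W. open W \<and> x \<in> W \<and> smooth_in c W f"
  shows "smooth_in c UNIV f"
proof -
  let ?\<S> = "{snd c ` (W \<inter> fst c) | W. open W \<and> smooth_in c W f}"
  have "Ck_on k (\<Union>?\<S>) (in_chart c f)" for k
    using open_chart_image[OF c] by (intro Ck_on_Union) (auto simp: smooth_in_def smooth_on_def)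
  moreover have "snd c ` (UNIV \<inter> fst c) \<subseteq> \<Union>?\<S>"
  proof clarify
    fix x assume "x \<in> fst c"
    with assms(2) obtain W where "open W" "x \<in> W" "smooth_in c W f" by blast
    with \<open>x \<in> fst c\<close> show "snd c x \<in> \<Union>?\<S>" by blast
  qed
  ultimately show ?thesis unfolding smooth_in_def smooth_on_def using Ck_on_subset by blast
qed

lemma smooth_in_has_derivative:
  assumes "smooth_in c W f" "x \<in> W \<inter> fst c"
  shows "(in_chart c f has_derivative deriv_in c f x) (at (snd c x))"
proof -
  have "Ck_on (Suc 0) (snd c ` (W \<inter> fst c)) (in_chart c f)"
    using assms(1) unfolding smooth_in_def smooth_on_def by blast
  then have "(in_chart c f has_derivative frechet_derivative (in_chart c f) (at (snd c x))) (at (snd c x))"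
    by (rule Ck_on_Suc_has_derivative[OF _ imageI[OF assms(2)]])
  then show ?thesis by (simp add: deriv_in_def[abs_def])
qed

lemma deriv_in_eqI: "(in_chart c f has_derivative f') (at (snd c x)) \<Longrightarrow> deriv_in c f x = f'"
  unfolding deriv_in_def[abs_def] using frechet_derivative_at by metis

lemma linear_deriv_in: "smooth_in c W f \<Longrightarrow> x \<in> W \<inter> fst c \<Longrightarrow> linear (deriv_in c f x)"
  by (rule has_derivative_linear[OF smooth_in_has_derivative])

lemma smooth_in_deriv:
  assumes "regular_chart c" "open W" "smooth_in c W f"
  shows "smooth_in c W (\<lambda>x. deriv_in c f x v)"
  unfolding smooth_in_def smooth_on_def
proof
  fix k
  have "Ck_on (Suc k) (snd c ` (W \<inter> fst c)) (in_chart c f)"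
    using assms(3) unfolding smooth_in_def smooth_on_def by blast
  then have "Ck_on k (snd c ` (W \<inter> fst c)) (\<lambda>z. frechet_derivative (in_chart c f) (at z) v)" by simp
  then show "Ck_on k (snd c ` (W \<inter> fst c)) (in_chart c (\<lambda>x. deriv_in c f x v))"
    by (rule Ck_on_cong[OF open_chart_image[OF assms(1,2)], rotated])
      (use assms in \<open>auto simp: in_chart_apply deriv_in_def\<close>)
qed

lemma in_chart_const [simp]: "in_chart c (\<lambda>x. a) = (\<lambda>z. a)"
  by (auto simp: in_chart_def)

lemma in_chart_comp: "in_chart c (\<lambda>x. h (f x)) = (\<lambda>z. h (in_chart c f z))"
  by (auto simp: in_chart_def)

lemma in_chart_comp2: "in_chart c (\<lambda>x. h (f x) (f' x)) = (\<lambda>z. h (in_chart c f z) (in_chart c f' z))"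
  by (auto simp: in_chart_def)

lemma smooth_in_const [simp]: "smooth_in c W (\<lambda>x. a)"
  by (simp add: smooth_in_def smooth_on_def)

lemma smooth_in_bounded_linear:
  assumes "regular_chart c" "open W" "bounded_linear h" "smooth_in c W f"
  shows "smooth_in c W (\<lambda>x. h (f x))"
  using assms(4) unfolding smooth_in_def smooth_on_def in_chart_comp
  by (auto intro: Ck_on_bounded_linear[OF open_chart_image[OF assms(1,2)] assms(3)])

lemma smooth_in_add:
  assumes "regular_chart c" "open W" "smooth_in c W f" "smooth_in c W h"
  shows "smooth_in c W (\<lambda>x. f x + h x)"
  using assms(3,4) unfolding smooth_in_def smooth_on_def in_chart_comp2
  by (auto intro: Ck_on_add[OF open_chart_image[OF assms(1,2)]])

lemma smooth_in_bilinear: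
  assumes "regular_chart c" "open W" "bounded_bilinear bl" "smooth_in c W f" "smooth_in c W h"
  shows "smooth_in c W (\<lambda>x. bl (f x) (h x))"
  using assms(4,5) unfolding smooth_in_def smooth_on_def in_chart_comp2
  by (auto intro: Ck_on_bilinear[OF open_chart_image[OF assms(1,2)] assms(3)])

lemma smooth_in_inverse:
  fixes f :: "_ \<Rightarrow> real"
  assumes "regular_chart c" "open W" "\<And>x. x \<in> W \<inter> fst c \<Longrightarrow> f x \<noteq> 0" "smooth_in c W f"
  shows "smooth_in c W (\<lambda>x. inverse (f x))"
  using assms(4) unfolding smooth_in_def smooth_on_def in_chart_comp
  by (auto intro!: Ck_on_inverse[OF open_chart_image[OF assms(1,2)]] simp: in_chart_apply[OF assms(1)] assms(3))

lemma smooth_in_sum: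
  assumes "regular_chart c" "open W" "\<And>i. i \<in> S \<Longrightarrow> smooth_in c W (f i)"
  shows "smooth_in c W (\<lambda>x. \<Sum>i\<in>S. f i x)"
  using assms(3)
  by (induction S rule: infinite_finite_induct) (auto intro: smooth_in_add[OF assms(1,2)])

lemma smooth_in_prod:
  fixes f :: "_ \<Rightarrow> _ \<Rightarrow> real"
  assumes "regular_chart c" "open W" "\<And>i. i \<in> S \<Longrightarrow> smooth_in c W (f i)"
  shows "smooth_in c W (\<lambda>x. \<Prod>i\<in>S. f i x)"
  using assms(3)
  by (induction S rule: infinite_finite_induct)
    (auto intro: smooth_in_bilinear[OF assms(1,2) bounded_bilinear_mult])

section \<open>Derivative rules in a chart\<close>

abbreviation chart_derivative ::
  "('m, 'n::finite) chart \<Rightarrow> ('m \<Rightarrow> 'b::real_normed_vector) \<Rightarrow> 'm \<Rightarrow> (real ^ 'n \<Rightarrow> 'b) \<Rightarrow> bool" where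
  "chart_derivative c f x F \<equiv> (in_chart c f has_derivative F) (at (snd c x))"

lemma chart_derivative_cong:
  assumes "regular_chart c" "open W" "x \<in> W \<inter> fst c" "\<And>y. y \<in> W \<inter> fst c \<Longrightarrow> f y = h y"
    and "chart_derivative c f x F"
  shows "chart_derivative c h x F"
  by (rule has_derivative_transform_within_open[OF assms(5) open_chart_image[OF assms(1,2)] imageI[OF assms(3)]])
    (use assms in \<open>auto simp: in_chart_apply\<close>)

lemma chart_derivative_add:
  assumes "chart_derivative c f x F" "chart_derivative c h x F'"
  shows "chart_derivative c (\<lambda>y. f y + h y) x (\<lambda>u. F u + F' u)"
  unfolding in_chart_comp2 using assms by (rule has_derivative_add)

lemma chart_derivative_sum:
  assumes "\<And>i. i \<in> S \<Longrightarrow> chart_derivative c (f i) x (F i)"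
  shows "chart_derivative c (\<lambda>y. \<Sum>i\<in>S. f i y) x (\<lambda>u. \<Sum>i\<in>S. F i u)"
  using assms
  by (induction S rule: infinite_finite_induct) (auto intro!: chart_derivative_add)

lemma chart_derivative_bounded_linear:
  assumes "bounded_linear h" "chart_derivative c f x F"
  shows "chart_derivative c (\<lambda>y. h (f y)) x (\<lambda>u. h (F u))"
  unfolding in_chart_comp by (rule bounded_linear.has_derivative[OF assms])

lemma chart_derivative_bilinear:
  assumes "bounded_bilinear bl" "regular_chart c" "x \<in> fst c"
    and "chart_derivative c f x F" "chart_derivative c h x F'"
  shows "chart_derivative c (\<lambda>y. bl (f y) (h y)) x (\<lambda>u. bl (f x) (F' u) + bl (F u) (h x))"
  using bounded_bilinear.FDERIV[OF assms(1,4,5)] unfolding in_chart_comp2 in_chart_apply[OF assms(2,3)] .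

lemma chart_derivative_self:
  assumes "regular_chart c" "x \<in> fst c"
  shows "chart_derivative c (snd c) x (\<lambda>v. v)"
  by (rule has_derivative_transform_within_open[OF has_derivative_ident open_chart_image[OF assms(1) open_UNIV], of "snd c x"])
    (use assms in \<open>auto simp: in_chart_apply\<close>)

text \<open>Near \<open>x\<close> the coordinate expression of the first derivative is the
  derivative of the coordinate expression, so the symmetry carries over.\<close>

lemma deriv_in_symmetric:
  fixes f :: "_ \<Rightarrow> real"
  assumes c: "regular_chart c" and W: "open W" and x: "x \<in> W \<inter> fst c" and f: "smooth_in c W f"
  shows "deriv_in c (\<lambda>y. deriv_in c f y v) x u = deriv_in c (\<lambda>y. deriv_in c f y u) x v"
proof -
  let ?S = "snd c ` (W \<inter> fst c)" and ?F = "in_chart c f"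
  have Ck: "Ck_on 2 ?S ?F" using f by (simp add: smooth_in_def smooth_on_def)
  have "deriv_in c (\<lambda>y. deriv_in c f y v) x u =
      frechet_derivative (\<lambda>z. frechet_derivative ?F (at z) v) (at (snd c x)) u" for u v
  proof -
    have d: "(\<lambda>z. frechet_derivative ?F (at z) v) differentiable (at (snd c x))"
      using Ck x by (simp add: numeral_2_eq_2)
    have "frechet_derivative (\<lambda>z. frechet_derivative ?F (at z) v) (at (snd c x)) =
        frechet_derivative (in_chart c (\<lambda>y. deriv_in c f y v)) (at (snd c x))"
      by (rule frechet_derivative_transform_within_open[OF d open_chart_image[OF c W] imageI[OF x]])
        (use c in \<open>auto simp: in_chart_apply deriv_in_def\<close>)
    then show ?thesis by (simp add: deriv_in_def)
  qed
  then show ?thesis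
    using frechet_derivative_symmetric[OF open_chart_image[OF c W] imageI[OF x] Ck] by simp
qed

lemma linear_bil_matrix: "linear (\<lambda>G. bil G u v)"
  by (rule linearI) (simp_all add: bil_def algebra_simps sum.distrib sum_distrib_left)

lemma bounded_bilinear_matrix_vector: "bounded_bilinear ((*v) :: real ^ 'n ^ 'n \<Rightarrow> real ^ 'n \<Rightarrow> real ^ 'n)"
  unfolding bilinear_conv_bounded_bilinear[symmetric] bilinear_def
  by (auto simp: linear_iff matrix_vector_right_distrib matrix_vector_mult_add_rdistrib matrix_vector_mult_scaleR
      scaleR_matrix_vector_assoc)

lemma chart_derivative_bil:
  assumes c: "regular_chart c" "x \<in> fst c"
    and "chart_derivative c G x G'" "chart_derivative c a x a'" "chart_derivative c b x b'"
  shows "chart_derivative c (\<lambda>y. bil (G y) (a y) (b y)) x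
    (\<lambda>u. bil (G' u) (a x) (b x) + bil (G x) (a' u) (b x) + bil (G x) (a x) (b' u))"
proof -
  have "chart_derivative c (\<lambda>y. a y \<bullet> (G y *v b y)) x
      (\<lambda>u. a x \<bullet> (G x *v b' u + G' u *v b x) + a' u \<bullet> (G x *v b x))"
    by (intro chart_derivative_bilinear[OF bounded_bilinear_inner c]
        chart_derivative_bilinear[OF bounded_bilinear_matrix_vector c] assms)
  then show ?thesis by (simp add: bil_inner inner_add_right add_ac)
qed

lemma smooth_in_component:
  assumes "regular_chart c" "open W" "smooth_in c W f"
  shows "smooth_in c W (\<lambda>x. f x $ i)"
  using smooth_in_bounded_linear[OF assms(1,2) bounded_linear_vec_nth assms(3)] .

lemma smooth_in_det:
  fixes M :: "'m::topological_space \<Rightarrow> real ^ 'k ^ 'k"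
  assumes "regular_chart c" "open W" "\<And>i j. smooth_in c W (\<lambda>x. M x $ i $ j)"
  shows "smooth_in c W (\<lambda>x. det (M x))"
  unfolding det_def
  by (intro smooth_in_sum[OF assms(1,2)] smooth_in_bilinear[OF assms(1,2) bounded_bilinear_mult]
      smooth_in_prod[OF assms(1,2)] assms smooth_in_const)

text \<open>Cramer's rule writes an entry of the inverse as a quotient of determinants with
  nonvanishing denominator.\<close>

lemma smooth_in_matrix_inv:
  fixes M :: "'m::topological_space \<Rightarrow> real ^ 'k ^ 'k"
  assumes c: "regular_chart c" "open W" and M: "\<And>i j. smooth_in c W (\<lambda>x. M x $ i $ j)"
    and inv: "\<And>x. x \<in> W \<inter> fst c \<Longrightarrow> invertible (M x)"
  shows "smooth_in c W (\<lambda>x. matrix_inv (M x) $ i $ j)"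
proof -
  \<comment> \<open>\<open>M\<close> with column \<open>i\<close> replaced by the
    \<open>j\<close>-th basis vector.\<close>
  define N where "N x = (\<chi> a b. if b = i then axis j 1 $ a else M x $ a $ b)" for x
  have N: "smooth_in c W (\<lambda>x. N x $ a $ b)" for a b
    using M by (cases "b = i") (simp_all add: N_def)
  have "smooth_in c W (\<lambda>x. det (N x) * inverse (det (M x)))"
    by (intro smooth_in_bilinear[OF c bounded_bilinear_mult] smooth_in_det[OF c] smooth_in_inverse[OF c] N M)
      (use inv in \<open>simp add: invertible_det_nz\<close>)
  moreover have "det (N x) * inverse (det (M x)) = matrix_inv (M x) $ i $ j" if "x \<in> W \<inter> fst c" for x
  proof -
    have "M x *v (matrix_inv (M x) *v axis j 1) = axis j 1"
      by (simp add: matrix_vector_mul_assoc matrix_inv_works[OF inv[OF that]])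
    moreover have "det (M x) \<noteq> 0" using inv[OF that] by (simp add: invertible_det_nz)
    ultimately have "matrix_inv (M x) *v axis j 1 = (\<chi> k. det (\<chi> a b. if b = k then axis j 1 $ a else M x $ a $ b) / det (M x))"
      using cramer by blast
    then have "(matrix_inv (M x) *v axis j 1) $ i = det (N x) / det (M x)" by (simp add: N_def)
    then show ?thesis
      by (simp add: matrix_vector_mul_component inner_axis divide_inverse)
  qed
  ultimately show ?thesis by (rule smooth_in_cong[OF c])
qed

section \<open>The Levi-Civita connection\<close>

locale riemannian =
  fixes A :: "('m::{t2_space, second_countable_topology}, 'n::finite) chart set" and g :: "('m, 'n) metric"
  assumes atlas: "smooth_atlas A" and metric: "riemannian_metric A g"
begin

lemma regular: "c \<in> A \<Longrightarrow> regular_chart c"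
  using atlas by (rule regular_chart_atlas)

lemma open_domain: "c \<in> A \<Longrightarrow> open (fst c)"
  using regular by (simp add: regular_chart_def)

lemma jacobian_has_derivative:
  assumes "c \<in> A" "c' \<in> A" "x \<in> fst c \<inter> fst c'"
  shows "chart_derivative c (snd c') x (jacobian c c' x)"
  using atlas assms smooth_in_has_derivative[of c "fst c'" "snd c'" x]
  unfolding smooth_atlas_def jacobian_def by blast

lemma linear_jacobian: "c \<in> A \<Longrightarrow> c' \<in> A \<Longrightarrow> x \<in> fst c \<inter> fst c' \<Longrightarrow> linear (jacobian c c' x)"
  using jacobian_has_derivative has_derivative_linear by blast

text \<open>Chain rule through the transition map.\<close>

lemma chart_derivative_change:
  assumes A: "c \<in> A" "c' \<in> A" and x: "x \<in> fst c \<inter> fst c'" and f: "chart_derivative c' f x F"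
  shows "chart_derivative c f x (\<lambda>v. F (jacobian c c' x v))"
proof -
  have "((\<lambda>z. in_chart c' f (in_chart c (snd c') z)) has_derivative (\<lambda>v. F (jacobian c c' x v))) (at (snd c x))"
    using has_derivative_compose[OF jacobian_has_derivative[OF A x], of "in_chart c' f" F] f x
    by (simp add: in_chart_apply regular A)
  then show ?thesis
    by (rule has_derivative_transform_within_open[OF _ open_chart_image[OF regular[OF A(1)] open_domain[OF A(2)]]])
      (use x A in \<open>auto simp: in_chart_apply regular\<close>)
qed

lemma jacobian_self: "c \<in> A \<Longrightarrow> x \<in> fst c \<Longrightarrow> jacobian c c x v = v"
  unfolding jacobian_def using deriv_in_eqI[OF chart_derivative_self[OF regular]] by simp

lemma jacobian_inverse:
  assumes "c \<in> A" "c' \<in> A" "x \<in> fst c \<inter> fst c'"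
  shows "jacobian c' c x (jacobian c c' x v) = v"
proof -
  have "jacobian c c x v = jacobian c' c x (jacobian c c' x v)"
    unfolding jacobian_def[of c c]
    using deriv_in_eqI[OF chart_derivative_change[OF assms jacobian_has_derivative[of c' c x]]] assms by auto
  then show ?thesis using jacobian_self assms by simp
qed

lemma gram: "c \<in> A \<Longrightarrow> x \<in> fst c \<Longrightarrow> gram (g c x)"
  using metric unfolding riemannian_metric_def gram_def by blast

lemma isometry:
  "c \<in> A \<Longrightarrow> c' \<in> A \<Longrightarrow> x \<in> fst c \<inter> fst c' \<Longrightarrow>
     bil (g c x) u v = bil (g c' x) (jacobian c c' x u) (jacobian c c' x v)"
  using metric unfolding riemannian_metric_def by blast

lemma smooth_metric: "c \<in> A \<Longrightarrow> smooth_in c UNIV (g c)"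
  using metric unfolding riemannian_metric_def by blast

lemma smooth_inverse_metric: "c \<in> A \<Longrightarrow> smooth_in c UNIV (\<lambda>x. matrix_inv (g c x) $ i $ j)"
  by (rule smooth_in_matrix_inv)
    (auto simp: regular gram gram_invertible intro!: smooth_in_component smooth_metric)

lemma mtrace_change:
  assumes "c \<in> A" "c' \<in> A" "x \<in> fst c \<inter> fst c'"
    and "\<And>u. linear (\<lambda>w. B u w)" "\<And>w. linear (\<lambda>u. B u w)"
  shows "mtrace (g c x) (\<lambda>u w. B (jacobian c c' x u) (jacobian c c' x w)) = mtrace (g c' x) B"
  using assms by (intro mtrace_isometry gram linear_jacobian isometry) auto

definition dg :: "('m, 'n) chart \<Rightarrow> 'm \<Rightarrow> real ^ 'n \<Rightarrow> real ^ 'n \<Rightarrow> real ^ 'n \<Rightarrow> real" where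
  "dg c x u v w = bil (deriv_in c (g c) x u) v w"

lemma metric_has_derivative: "c \<in> A \<Longrightarrow> x \<in> fst c \<Longrightarrow> chart_derivative c (g c) x (deriv_in c (g c) x)"
  using smooth_in_has_derivative[OF smooth_metric] by blast

lemma dg_has_derivative:
  assumes "c \<in> A" "x \<in> fst c"
  shows "chart_derivative c (\<lambda>y. bil (g c y) v w) x (\<lambda>u. dg c x u v w)"
  using chart_derivative_bounded_linear[OF linear_conv_bounded_linear[THEN iffD1, OF linear_bil_matrix] metric_has_derivative[OF assms]]
  by (simp add: dg_def)

lemma linear_dg: "c \<in> A \<Longrightarrow> x \<in> fst c \<Longrightarrow> linear (\<lambda>u. dg c x u v w)"
  using dg_has_derivative has_derivative_linear by blast

lemma dg_sym: "c \<in> A \<Longrightarrow> x \<in> fst c \<Longrightarrow> dg c x u v w = dg c x u w v"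
proof -
  assume c: "c \<in> A" "x \<in> fst c"
  have "chart_derivative c (\<lambda>y. bil (g c y) v w) x (\<lambda>u. dg c x u w v)"
    using dg_has_derivative[OF c, of w v]
    by (rule chart_derivative_cong[OF regular[OF c(1)] open_UNIV, rotated 2])
      (use c in \<open>auto simp: gram_sym[OF gram]\<close>)
  from has_derivative_unique[OF this dg_has_derivative[OF c]] show ?thesis by metis
qed

text \<open>The Koszul formula for constant coordinate fields, whose brackets vanish. It takes the
  place of the index formula in the proofs of symmetry, metric compatibility and the law of change
  of chart.\<close>

lemma koszul:
  assumes c: "c \<in> A" "x \<in> fst c"
  shows "2 * bil (g c x) (christoffel g c x u v) w = dg c x u v w + dg c x v u w - dg c x w u v"
proof -
  \<comment> \<open>Twice the Christoffel symbol with its upper index lowered.\<close>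
  let ?T = "\<chi> m. dg c x u (axis m 1) v + dg c x v (axis m 1) u - dg c x (axis m 1) u v"
  have comp: "deriv_in c (\<lambda>y. g c y $ i $ j) x (axis k 1) = dg c x (axis k 1) (axis i 1) (axis j 1)" for i j k
    using deriv_in_eqI[OF dg_has_derivative[OF c, of "axis i 1" "axis j 1"]] by (simp add: bil_axis_axis)
  have e1: "dg c x a p q = (\<Sum>k\<in>UNIV. a $ k * dg c x (axis k 1) p q)" for a p q
    by (rule trans[OF linear_expand[OF linear_dg[OF c]]]) simp
  have e2: "dg c x a p q = (\<Sum>i\<in>UNIV. p $ i * dg c x a (axis i 1) q)" for a p q
    unfolding dg_def by (rule trans[OF linear_expand[OF linear_bil_left]]) simp
  have e3: "dg c x a p q = (\<Sum>i\<in>UNIV. q $ i * dg c x a p (axis i 1))" for a p q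
    unfolding dg_def by (rule trans[OF linear_expand[OF linear_bil_right]]) simp
  have E1: "dg c x u p v = (\<Sum>k\<in>UNIV. \<Sum>i\<in>UNIV. dg c x (axis k 1) p (axis i 1) * u $ k * v $ i)" for p
    unfolding e1[of u p v] e3[of "axis _ 1" p v] by (simp add: sum_distrib_left mult_ac)
  have E2: "dg c x v p u = (\<Sum>k\<in>UNIV. \<Sum>i\<in>UNIV. dg c x (axis i 1) p (axis k 1) * u $ k * v $ i)" for p
    unfolding e1[of v p u] e3[of "axis _ 1" p u] by (subst sum.swap) (simp add: sum_distrib_left mult_ac)
  have E3: "dg c x p u v = (\<Sum>k\<in>UNIV. \<Sum>i\<in>UNIV. dg c x p (axis k 1) (axis i 1) * u $ k * v $ i)" for p
    unfolding e2[of p u v] e3[of p "axis _ 1" v] by (simp add: sum_distrib_left mult_ac)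
  have "2 *\<^sub>R christoffel g c x u v = matrix_inv (g c x) *v ?T"
    unfolding vec_eq_iff
  proof
    fix l
    have "christoffel g c x u v $ l = (\<Sum>k\<in>UNIV. \<Sum>i\<in>UNIV. \<Sum>m\<in>UNIV. 1 / 2 * matrix_inv (g c x) $ l $ m *
        (dg c x (axis k 1) (axis m 1) (axis i 1) + dg c x (axis i 1) (axis m 1) (axis k 1) -
         dg c x (axis m 1) (axis k 1) (axis i 1)) * u $ k * v $ i)"
      by (simp add: christoffel_def comp)
    \<comment> \<open>The index contracted with the inverse metric moves outside, so that the inner
      sums become the components of \<open>?T\<close>.\<close>
    also have "\<dots> = (\<Sum>m\<in>UNIV. \<Sum>k\<in>UNIV. \<Sum>i\<in>UNIV. 1 / 2 * matrix_inv (g c x) $ l $ m *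
        (dg c x (axis k 1) (axis m 1) (axis i 1) + dg c x (axis i 1) (axis m 1) (axis k 1) -
         dg c x (axis m 1) (axis k 1) (axis i 1)) * u $ k * v $ i)"
      by (subst sum.swap[of _ UNIV UNIV], rule sum.cong[OF refl], subst sum.swap) (rule refl)
    also have "\<dots> = (\<Sum>m\<in>UNIV. 1 / 2 * (matrix_inv (g c x) $ l $ m * (?T $ m)))"
      by (simp add: E1 E2 E3 sum_distrib_left flip: sum.distrib sum_subtractf)
        (simp add: algebra_simps)
    finally show "(2 *\<^sub>R christoffel g c x u v) $ l = (matrix_inv (g c x) *v ?T) $ l"
      by (simp add: matrix_vector_mult_def sum_distrib_left)
  qed
  then have "2 * bil (g c x) (christoffel g c x u v) w = (matrix_inv (g c x) *v ?T) \<bullet> (g c x *v w)"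
    by (simp add: bil_inner flip: inner_scaleR_left)
  also have "\<dots> = bil (g c x) w (matrix_inv (g c x) *v ?T)"
    using gram_sym[OF gram[OF c]] by (simp add: bil_inner)
  also have "\<dots> = w \<bullet> ?T"
    by (simp add: bil_inner matrix_vector_mul_assoc matrix_inv_works[OF gram_invertible[OF gram[OF c]]])
  also have "\<dots> = (\<Sum>m\<in>UNIV. w $ m * dg c x u (axis m 1) v) + (\<Sum>m\<in>UNIV. w $ m * dg c x v (axis m 1) u) -
      (\<Sum>m\<in>UNIV. w $ m * dg c x (axis m 1) u v)"
    by (simp add: inner_vec_def algebra_simps sum.distrib sum_subtractf)
  also have "\<dots> = dg c x u w v + dg c x v w u - dg c x w u v"
    by (simp flip: e1 e2)
  finally show ?thesis using dg_sym[OF c] by simp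
qed

lemma christoffel_sym:
  assumes "c \<in> A" "x \<in> fst c"
  shows "christoffel g c x u v = christoffel g c x v u"
proof (rule gram_nondegenerate[OF gram[OF assms]])
  fix w
  show "bil (g c x) (christoffel g c x u v) w = bil (g c x) (christoffel g c x v u) w"
    using koszul[OF assms, of u v w] koszul[OF assms, of v u w] dg_sym[OF assms, of w u v] by linarith
qed

text \<open>In the sum of the Koszul formulas for (v, w) and (w, v), the terms that are not
  differentiated along \<open>u\<close> cancel.\<close>

lemma metric_compatible:
  "c \<in> A \<Longrightarrow> x \<in> fst c \<Longrightarrow>
     dg c x u v w = bil (g c x) (christoffel g c x u v) w + bil (g c x) v (christoffel g c x u w)"
  using koszul[of c x u v w] koszul[of c x u w v] dg_sym[of c x] gram_sym[OF gram, of c x v]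
  by simp

lemma linear_christoffel: "linear (\<lambda>u. christoffel g c x u v)" "linear (christoffel g c x u)"
proof -
  show "linear (\<lambda>u. christoffel g c x u v)"
    unfolding linear_iff vec_eq_iff vector_add_component vector_scaleR_component christoffel_def vec_lambda_beta
    by (simp only: distrib_left distrib_right sum.distrib real_scaleR_def sum_distrib_left) (simp only: mult_ac simp_thms)
  show "linear (christoffel g c x u)"
    unfolding linear_iff vec_eq_iff vector_add_component vector_scaleR_component christoffel_def vec_lambda_beta
    by (simp only: distrib_left distrib_right sum.distrib real_scaleR_def sum_distrib_left) (simp only: mult_ac simp_thms)
qed

section \<open>Change of chart for the connection\<close>

definition hess :: "('m, 'n) chart \<Rightarrow> ('m, 'n) chart \<Rightarrow> 'm \<Rightarrow> real ^ 'n \<Rightarrow> real ^ 'n \<Rightarrow> real ^ 'n" where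
  "hess c c' x u v = deriv_in c (\<lambda>y. jacobian c c' y v) x u"

lemma smooth_transition: "c \<in> A \<Longrightarrow> c' \<in> A \<Longrightarrow> smooth_in c (fst c') (snd c')"
  using atlas unfolding smooth_atlas_def by blast

lemma hess_has_derivative:
  assumes "c \<in> A" "c' \<in> A" "x \<in> fst c \<inter> fst c'"
  shows "chart_derivative c (\<lambda>y. jacobian c c' y v) x (\<lambda>u. hess c c' x u v)"
  unfolding hess_def jacobian_def using assms
  by (intro smooth_in_has_derivative[of c "fst c'"] smooth_in_deriv regular open_domain smooth_transition) auto

text \<open>The Jacobian is a first derivative of the components of the transition map, so this is
  the symmetry of their second derivatives.\<close>

lemma hess_sym:
  assumes A: "c \<in> A" "c' \<in> A" and x: "x \<in> fst c \<inter> fst c'"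
  shows "hess c c' x u v = hess c c' x v u"
  unfolding vec_eq_iff
proof
  fix i
  note c = regular[OF A(1)] open_domain[OF A(2)]
  have x': "x \<in> fst c' \<inter> fst c" using x by blast
  have comp: "jacobian c c' y v $ i = deriv_in c (\<lambda>y. snd c' y $ i) y v" if "y \<in> fst c' \<inter> fst c" for y v
    using deriv_in_eqI[OF chart_derivative_bounded_linear[OF bounded_linear_vec_nth
          jacobian_has_derivative[OF A]], of y i] that by simp
  have "hess c c' x u v $ i = deriv_in c (\<lambda>y. deriv_in c (\<lambda>y. snd c' y $ i) y v) x u" for u v
  proof -
    have "chart_derivative c (\<lambda>y. jacobian c c' y v $ i) x (\<lambda>u. hess c c' x u v $ i)"
      by (rule chart_derivative_bounded_linear[OF bounded_linear_vec_nth hess_has_derivative[OF A x]])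
    from deriv_in_eqI[OF chart_derivative_cong[OF c x' comp this]] show ?thesis by simp
  qed
  then show "hess c c' x u v $ i = hess c c' x v u $ i"
    using deriv_in_symmetric[OF c x' smooth_in_component[OF c smooth_transition[OF A]]] by simp
qed

text \<open>Differentiating the isometry property of the Jacobian adds Hessian terms to the
  derivative of the metric. In the combination of the Koszul formula, the symmetry of the Hessian
  cancels all of them except twice the one for \<open>u\<close> and \<open>v\<close>.\<close>

lemma christoffel_change:
  assumes A: "c \<in> A" "c' \<in> A" and x: "x \<in> fst c \<inter> fst c'"
  shows "jacobian c c' x (christoffel g c x u v) =
    christoffel g c' x (jacobian c c' x u) (jacobian c c' x v) + hess c c' x u v"
proof -
  let ?J = "jacobian c c' x" and ?h = "hess c c' x" and ?G = "g c' x"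
  have x1: "x \<in> fst c" and x2: "x \<in> fst c'" and x3: "x \<in> fst c' \<inter> fst c" using x by auto
  note sym = gram_sym[OF gram[OF A(2) x2]]
  have dg: "dg c x u v w = dg c' x (?J u) (?J v) (?J w) + bil ?G (?h u v) (?J w) + bil ?G (?J v) (?h u w)" for u v w
  proof -
    have "chart_derivative c (\<lambda>y. bil (g c' y) (jacobian c c' y v) (jacobian c c' y w)) x
       (\<lambda>u. bil (deriv_in c' (g c') x (?J u)) (?J v) (?J w) + bil ?G (?h u v) (?J w) + bil ?G (?J v) (?h u w))"
      by (intro chart_derivative_bil regular A x1 hess_has_derivative x
          chart_derivative_change[OF A x] metric_has_derivative x2)
    then have "chart_derivative c (\<lambda>y. bil (g c y) v w) x
       (\<lambda>u. bil (deriv_in c' (g c') x (?J u)) (?J v) (?J w) + bil ?G (?h u v) (?J w) + bil ?G (?J v) (?h u w))"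
      by (rule chart_derivative_cong[OF regular[OF A(1)] open_domain[OF A(2)] x3, rotated])
        (use isometry[OF A] in auto)
    from has_derivative_unique[OF this dg_has_derivative[OF A(1) x1]] show ?thesis
      unfolding dg_def by metis
  qed
  have hs: "?h a b = ?h b a" for a b by (rule hess_sym[OF A x])
  have "bil ?G (?J (christoffel g c x u v)) w' =
      bil ?G (christoffel g c' x (?J u) (?J v) + ?h u v) w'" for w'
  proof -
    \<comment> \<open>The Jacobian is onto, so test vectors of the form \<open>?J w\<close>
      suffice.\<close>
    obtain w where w: "w' = ?J w" using jacobian_inverse[OF A(2,1) x3, of w'] by metis
    have "2 * bil ?G (?J (christoffel g c x u v)) (?J w) = 2 * bil (g c x) (christoffel g c x u v) w"
      using isometry[OF A x] by simp
    also have "\<dots> = 2 * bil ?G (christoffel g c' x (?J u) (?J v)) (?J w) + 2 * bil ?G (?h u v) (?J w)"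
      unfolding koszul[OF A(1) x1] koszul[OF A(2) x2] dg hs[of v u] hs[of w u] hs[of w v]
      using sym[of "?h u w" "?J v"] sym[of "?h v w" "?J u"] by simp
    finally show ?thesis unfolding w by (simp add: linear_add[OF linear_bil_left])
  qed
  then show ?thesis by (rule gram_nondegenerate[OF gram[OF A(2) x2]])
qed

end

section \<open>Smooth forms\<close>

text \<open>Smoothness is tested on constant coordinate vectors; arguments that vary with the point
  are reduced to these by multilinearity.\<close>

definition smooth_form :: "('m::topological_space, 'n::finite) chart \<Rightarrow> nat \<Rightarrow> ('m \<Rightarrow> 'n aform) \<Rightarrow> bool" where
  "smooth_form c p \<omega> \<longleftrightarrow> (\<forall>x\<in>fst c. alt_form p (\<omega> x)) \<and> (\<forall>vs. smooth_in c UNIV (\<lambda>x. \<omega> x vs))"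

lemma smooth_formI:
  "(\<And>x. x \<in> fst c \<Longrightarrow> alt_form p (\<omega> x)) \<Longrightarrow> (\<And>vs. smooth_in c UNIV (\<lambda>x. \<omega> x vs)) \<Longrightarrow> smooth_form c p \<omega>"
  by (simp add: smooth_form_def)

lemma smooth_form_alt: "smooth_form c p \<omega> \<Longrightarrow> x \<in> fst c \<Longrightarrow> alt_form p (\<omega> x)"
  by (simp add: smooth_form_def)

lemma smooth_form_smooth: "smooth_form c p \<omega> \<Longrightarrow> smooth_in c UNIV (\<lambda>x. \<omega> x vs)"
  by (simp add: smooth_form_def)

lemma smooth_form_zero [simp]: "smooth_form c p (\<lambda>x vs. 0)"
  by (simp add: smooth_form_def)

lemma smooth_form_cong:
  assumes "regular_chart c" "smooth_form c p \<omega>" "\<And>x. x \<in> fst c \<Longrightarrow> \<omega> x = \<omega>' x"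
  shows "smooth_form c p \<omega>'"
proof (rule smooth_formI)
  show "smooth_in c UNIV (\<lambda>x. \<omega>' x vs)" for vs
    using smooth_in_cong[OF assms(1) open_UNIV smooth_form_smooth[OF assms(2)]] assms(3) by simp
qed (use assms smooth_form_alt in metis)

lemma smooth_form_add:
  "regular_chart c \<Longrightarrow> smooth_form c p \<omega> \<Longrightarrow> smooth_form c p \<psi> \<Longrightarrow> smooth_form c p (\<lambda>x vs. \<omega> x vs + \<psi> x vs)"
  by (simp add: smooth_form_def alt_form_add smooth_in_add)

lemma smooth_in_cmult:
  fixes f :: "_ \<Rightarrow> complex"
  shows "regular_chart c \<Longrightarrow> open W \<Longrightarrow> smooth_in c W f \<Longrightarrow> smooth_in c W (\<lambda>x. a * f x)"
  by (rule smooth_in_bounded_linear[OF _ _ bounded_linear_mult_right])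

lemma smooth_form_mult: "regular_chart c \<Longrightarrow> smooth_form c p \<omega> \<Longrightarrow> smooth_form c p (\<lambda>x vs. a * \<omega> x vs)"
  by (simp add: smooth_form_def alt_form_scaled smooth_in_cmult)

lemma smooth_form_contract: "smooth_form c p \<omega> \<Longrightarrow> smooth_form c (p - 1) (\<lambda>x. contract v (\<omega> x))"
  by (intro smooth_formI alt_form_contract) (simp_all add: smooth_form_def contract_def)

lemma smooth_form_contract_Suc: "smooth_form c (Suc p) \<omega> \<Longrightarrow> smooth_form c p (\<lambda>x. contract v (\<omega> x))"
  using smooth_form_contract[of c "Suc p"] by simp

lemma smooth_in_scaleR:
  "regular_chart c \<Longrightarrow> open W \<Longrightarrow> smooth_in c W f \<Longrightarrow> smooth_in c W h \<Longrightarrow> smooth_in c W (\<lambda>x. f x *\<^sub>R h x)"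
  by (rule smooth_in_bilinear[OF _ _ bounded_bilinear_scaleR])

lemma smooth_form_moving:
  assumes c: "regular_chart c" and \<omega>: "smooth_form c p \<omega>" and F: "smooth_in c UNIV F"
  shows "smooth_in c UNIV (\<lambda>x. \<omega> x (xs @ F x # ys))"
proof (rule smooth_in_cong[OF c open_UNIV])
  show "smooth_in c UNIV (\<lambda>x. \<Sum>i\<in>UNIV. F x $ i *\<^sub>R \<omega> x (xs @ axis i 1 # ys))"
    by (intro smooth_in_sum[OF c] smooth_in_scaleR[OF c] smooth_in_component[OF c] F smooth_form_smooth[OF \<omega>] open_UNIV)
  show "(\<Sum>i\<in>UNIV. F x $ i *\<^sub>R \<omega> x (xs @ axis i 1 # ys)) = \<omega> x (xs @ F x # ys)" if "x \<in> UNIV \<inter> fst c" for x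
    using that by (simp add: linear_expand[OF linear_alt_form[OF smooth_form_alt[OF \<omega>]], symmetric])
qed

lemma smooth_form_contract_field:
  assumes c: "regular_chart c" and \<omega>: "smooth_form c p \<omega>" and F: "smooth_in c UNIV F"
  shows "smooth_form c (p - 1) (\<lambda>x. contract (F x) (\<omega> x))"
proof (rule smooth_formI)
  show "smooth_in c UNIV (\<lambda>x. contract (F x) (\<omega> x) vs)" for vs
    unfolding contract_def using smooth_form_moving[OF assms, of "[]"] by simp
qed (intro alt_form_contract smooth_form_alt[OF \<omega>])

lemma smooth_form_wedge:
  assumes c: "regular_chart c" and \<omega>: "smooth_form c k \<omega>" and \<psi>: "smooth_form c q \<psi>"
  shows "smooth_form c (k + q) (\<lambda>x. wedge k q (\<omega> x) (\<psi> x))"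
proof (rule smooth_formI)
  show "smooth_in c UNIV (\<lambda>x. wedge k q (\<omega> x) (\<psi> x) vs)" for vs
  proof (cases "length vs = k + q")
    case True
    have "smooth_in c UNIV (\<lambda>x. inverse (fact k * fact q) * (\<Sum>\<sigma> | \<sigma> permutes {..<k + q}.
        of_int (sign \<sigma>) * (\<omega> x (take k (permute_list \<sigma> vs)) * \<psi> x (drop k (permute_list \<sigma> vs)))))"
      by (intro smooth_in_cmult[OF c] smooth_in_sum[OF c] smooth_in_bilinear[OF c _ bounded_bilinear_mult]
          smooth_form_smooth[OF \<omega>] smooth_form_smooth[OF \<psi>] open_UNIV)
    then show ?thesis using True by (simp add: wedge_def divide_inverse mult_ac)
  qed (simp add: wedge_def)
qed (use smooth_form_alt[OF \<omega>] smooth_form_alt[OF \<psi>] in \<open>auto intro: alt_form_wedge\<close>)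

lemma update_eq_omit:
  assumes "alt_form p \<omega>" "a < length vs"
  shows "\<omega> (vs[a := w]) = (- 1) ^ a * \<omega> (w # omit a vs)"
  using assms(2) alt_form_front[OF assms(1), of "take a vs" w "drop (Suc a) vs"]
  by (simp add: upd_conv_take_nth_drop omit_def)

text \<open>The derivation of the exterior algebra induced by \<open>L\<close>, written as e^i
  \<and> i_{L e_i}. This brings the Christoffel term of \<open>nabla_form\<close> into the calculus
  of alternating sums.\<close>

lemma sum_update_eq_esum:
  assumes "alt_form p \<omega>"
  shows "(\<Sum>a<length vs. \<omega> (vs[a := L (vs ! a)])) = esum (\<lambda>u. contract (L u) \<omega>) vs"
  unfolding esum_def
  by (intro sum.cong refl) (simp add: update_eq_omit[OF assms] contract_def scaleR_conv_of_real)

lemma alt_form_esum_contract: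
  assumes "alt_form p \<omega>" "linear L"
  shows "alt_form p (esum (\<lambda>u. contract (L u) \<omega>))"
proof (cases p)
  case 0
  have "(\<lambda>u. contract (L u) \<omega>) = (\<lambda>u vs. 0)" using assms(1) 0 by (simp add: contract_0form)
  then have "esum (\<lambda>u. contract (L u) \<omega>) = (\<lambda>vs. 0)" by auto
  then show ?thesis by simp
next
  case (Suc m)
  have "linear (\<lambda>u. contract (L u) \<omega> vs)" for vs
    using linear_compose[OF assms(2) contract_linear[OF assms(1), of vs]] by (simp add: o_def)
  then show ?thesis
    using assms(1) unfolding Suc by (intro alt_form_esum alt_form_contract_Suc) auto
qed

lemma deriv_in_linear_combination:
  assumes "regular_chart c" "x \<in> fst c" "smooth_in c UNIV f" "smooth_in c UNIV h"
    and "\<And>y. y \<in> fst c \<Longrightarrow> k y = r *\<^sub>R f y + h y"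
  shows "deriv_in c k x u = r *\<^sub>R deriv_in c f x u + deriv_in c h x u"
proof -
  have "chart_derivative c (\<lambda>y. r *\<^sub>R f y + h y) x (\<lambda>u. r *\<^sub>R deriv_in c f x u + deriv_in c h x u)"
    by (intro chart_derivative_add chart_derivative_bounded_linear[OF bounded_linear_scaleR_right]
        smooth_in_has_derivative[OF assms(3)] smooth_in_has_derivative[OF assms(4)]) (use assms(2) in auto)
  then have "chart_derivative c k x (\<lambda>u. r *\<^sub>R deriv_in c f x u + deriv_in c h x u)"
    by (rule chart_derivative_cong[OF assms(1) open_UNIV, rotated 2]) (use assms in auto)
  from deriv_in_eqI[OF this] show ?thesis by simp
qed

lemma deriv_in_zero:
  assumes "regular_chart c" "x \<in> fst c" "\<And>y. y \<in> fst c \<Longrightarrow> k y = 0"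
  shows "deriv_in c k x u = 0"
proof -
  have "chart_derivative c k x (\<lambda>v. 0)"
    by (rule chart_derivative_cong[OF assms(1) open_UNIV, of x "\<lambda>y. 0"]) (use assms in auto)
  from deriv_in_eqI[OF this] show ?thesis by simp
qed

lemma alt_form_deriv:
  assumes c: "regular_chart c" and x: "x \<in> fst c" and \<omega>: "smooth_form c p \<omega>"
  shows "alt_form p (\<lambda>vs. deriv_in c (\<lambda>y. \<omega> y vs) x u)"
proof (rule alt_formI)
  show "deriv_in c (\<lambda>y. \<omega> y vs) x u = 0" if "length vs \<noteq> p" for vs
    using that by (intro deriv_in_zero[OF c x] alt_form_length[OF smooth_form_alt[OF \<omega>]])
  show "deriv_in c (\<lambda>y. \<omega> y (xs @ w # ys @ w # zs)) x u = 0" for xs w ys zs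
    by (intro deriv_in_zero[OF c x] alt_form_repeated[OF smooth_form_alt[OF \<omega>]])
  have "deriv_in c (\<lambda>y. \<omega> y (xs @ (r *\<^sub>R a + b) # ys)) x u =
      r *\<^sub>R deriv_in c (\<lambda>y. \<omega> y (xs @ a # ys)) x u + deriv_in c (\<lambda>y. \<omega> y (xs @ b # ys)) x u" for xs ys a b r
    by (intro deriv_in_linear_combination[OF c x] smooth_form_smooth[OF \<omega>])
      (simp add: linear_add[OF linear_alt_form[OF smooth_form_alt[OF \<omega>]]]
        linear_cmul[OF linear_alt_form[OF smooth_form_alt[OF \<omega>]]])
  note lin = this
  have z: "deriv_in c (\<lambda>y. \<omega> y (xs @ 0 # ys)) x u = 0" for xs ys
    by (intro deriv_in_zero[OF c x] linear_0[OF linear_alt_form[OF smooth_form_alt[OF \<omega>]]])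
  show "multilinear_list p (\<lambda>vs. deriv_in c (\<lambda>y. \<omega> y vs) x u)"
    unfolding multilinear_list_def
  proof (intro allI impI linearI)
    fix xs ys a b r
    show "deriv_in c (\<lambda>y. \<omega> y (xs @ (a + b) # ys)) x u =
      deriv_in c (\<lambda>y. \<omega> y (xs @ a # ys)) x u + deriv_in c (\<lambda>y. \<omega> y (xs @ b # ys)) x u"
      using lin[of xs 1 a b ys] by simp
    show "deriv_in c (\<lambda>y. \<omega> y (xs @ (r *\<^sub>R a) # ys)) x u = r *\<^sub>R deriv_in c (\<lambda>y. \<omega> y (xs @ a # ys)) x u"
      using lin[of xs r a 0 ys] by (simp add: z)
  qed
qed

text \<open>Product rule for a form evaluated on moving vectors. The first of them is expanded in
  the constant basis, whose members join the constant prefix \<open>us\<close>; the induction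
  hypothesis then applies to the shorter list with the longer prefix.\<close>

lemma chart_derivative_moving:
  assumes c: "regular_chart c" and W: "open W" and x: "x \<in> W \<inter> fst c"
    and alt: "\<And>y. y \<in> W \<inter> fst c \<Longrightarrow> alt_form p (\<omega> y)"
    and D: "\<And>vs. chart_derivative c (\<lambda>y. \<omega> y vs) x (\<lambda>u. D u vs)" and D_alt: "\<And>u. alt_form p (D u)"
    and F: "\<And>v. chart_derivative c (F v) x (DF v)"
  shows "chart_derivative c (\<lambda>y. \<omega> y (us @ map (\<lambda>v. F v y) vs)) x
    (\<lambda>u. D u (us @ map (\<lambda>v. F v x) vs) +
      (\<Sum>j<length vs. \<omega> x (us @ (map (\<lambda>v. F v x) vs)[j := DF (vs ! j) u])))"
proof (induction vs arbitrary: us)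
  case Nil
  then show ?case using D by simp
next
  case (Cons v vs)
  let ?M = "\<lambda>y. map (\<lambda>v. F v y) vs"
  have x': "x \<in> fst c" using x by simp
  have "chart_derivative c (\<lambda>y. \<Sum>i\<in>UNIV. F v y $ i *\<^sub>R \<omega> y ((us @ [axis i 1]) @ ?M y)) x
     (\<lambda>u. \<Sum>i\<in>UNIV. F v x $ i *\<^sub>R (D u ((us @ [axis i 1]) @ ?M x) +
        (\<Sum>j<length vs. \<omega> x ((us @ [axis i 1]) @ (?M x)[j := DF (vs ! j) u]))) +
        DF v u $ i *\<^sub>R \<omega> x ((us @ [axis i 1]) @ ?M x))"
    by (intro chart_derivative_sum chart_derivative_bilinear[OF bounded_bilinear_scaleR c x'] Cons.IH
        chart_derivative_bounded_linear[OF bounded_linear_vec_nth F])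
  also have "(\<lambda>u. \<Sum>i\<in>UNIV. F v x $ i *\<^sub>R (D u ((us @ [axis i 1]) @ ?M x) +
        (\<Sum>j<length vs. \<omega> x ((us @ [axis i 1]) @ (?M x)[j := DF (vs ! j) u]))) +
        DF v u $ i *\<^sub>R \<omega> x ((us @ [axis i 1]) @ ?M x)) =
      (\<lambda>u. D u (us @ F v x # ?M x) + (\<Sum>j<length vs. \<omega> x (us @ F v x # (?M x)[j := DF (vs ! j) u])) +
        \<omega> x (us @ DF v u # ?M x))"
  proof
    fix u
    have e1: "(\<Sum>i\<in>UNIV. F v x $ i *\<^sub>R D u (us @ axis i 1 # ?M x)) = D u (us @ F v x # ?M x)"
      by (rule linear_expand[OF linear_alt_form[OF D_alt], symmetric])
    have e2: "(\<Sum>i\<in>UNIV. w $ i *\<^sub>R \<omega> x (us @ axis i 1 # zs)) = \<omega> x (us @ w # zs)" for w zs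
      by (rule linear_expand[OF linear_alt_form[OF alt[OF x]], symmetric])
    have "(\<Sum>i\<in>UNIV. F v x $ i *\<^sub>R (\<Sum>j<length vs. \<omega> x (us @ axis i 1 # (?M x)[j := DF (vs ! j) u]))) =
        (\<Sum>j<length vs. \<omega> x (us @ F v x # (?M x)[j := DF (vs ! j) u]))"
      unfolding scaleR_sum_right by (subst sum.swap) (simp only: e2)
    then show "(\<Sum>i\<in>UNIV. F v x $ i *\<^sub>R (D u ((us @ [axis i 1]) @ ?M x) +
        (\<Sum>j<length vs. \<omega> x ((us @ [axis i 1]) @ (?M x)[j := DF (vs ! j) u]))) +
        DF v u $ i *\<^sub>R \<omega> x ((us @ [axis i 1]) @ ?M x)) =
      D u (us @ F v x # ?M x) + (\<Sum>j<length vs. \<omega> x (us @ F v x # (?M x)[j := DF (vs ! j) u])) +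
        \<omega> x (us @ DF v u # ?M x)"
      by (simp add: scaleR_add_right sum.distrib e1 e2)
  qed
  finally have "chart_derivative c (\<lambda>y. \<omega> y (us @ map (\<lambda>v. F v y) (v # vs))) x
      (\<lambda>u. D u (us @ F v x # ?M x) + (\<Sum>j<length vs. \<omega> x (us @ F v x # (?M x)[j := DF (vs ! j) u])) +
        \<omega> x (us @ DF v u # ?M x))"
    by (rule chart_derivative_cong[OF c W x, rotated])
      (simp add: linear_expand[OF linear_alt_form[OF alt], symmetric])
  then show ?case
    unfolding length_Cons sum.lessThan_Suc_shift by (simp add: add_ac)
qed

lemma linear_wedge_left:
  assumes "\<And>vs. linear (\<lambda>u. F u vs)"
  shows "linear (\<lambda>u. wedge k q (F u) \<psi> vs)"
proof (rule linearI)
  have "F (a + b) = (\<lambda>vs. F a vs + F b vs)" for a b by (intro ext linear_add[OF assms])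
  then show "wedge k q (F (a + b)) \<psi> vs = wedge k q (F a) \<psi> vs + wedge k q (F b) \<psi> vs" for a b
    by (simp add: wedge_add_left)
  have "F (r *\<^sub>R a) = (\<lambda>vs. of_real r * F a vs)" for r a
    by (intro ext) (simp add: linear_cmul[OF assms] scaleR_conv_of_real)
  then show "wedge k q (F (r *\<^sub>R a)) \<psi> vs = r *\<^sub>R wedge k q (F a) \<psi> vs" for r a
    by (simp add: wedge_mult_left scaleR_conv_of_real)
qed

lemma linear_wedge_right:
  assumes "\<And>vs. linear (\<lambda>u. F u vs)"
  shows "linear (\<lambda>u. wedge k q \<omega> (F u) vs)"
proof (rule linearI)
  have "F (a + b) = (\<lambda>vs. F a vs + F b vs)" for a b by (intro ext linear_add[OF assms])
  then show "wedge k q \<omega> (F (a + b)) vs = wedge k q \<omega> (F a) vs + wedge k q \<omega> (F b) vs" for a b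
    by (simp add: wedge_add_right)
  have "F (r *\<^sub>R a) = (\<lambda>vs. of_real r * F a vs)" for r a
    by (intro ext) (simp add: linear_cmul[OF assms] scaleR_conv_of_real)
  then show "wedge k q \<omega> (F (r *\<^sub>R a)) vs = r *\<^sub>R wedge k q \<omega> (F a) vs" for r a
    by (simp add: wedge_mult_right scaleR_conv_of_real)
qed

section \<open>Pullback by linear isometries\<close>

definition pull :: "(real ^ 'n \<Rightarrow> real ^ 'n) \<Rightarrow> 'n::finite aform \<Rightarrow> 'n aform" where
  "pull J \<omega> vs = \<omega> (map J vs)"

lemma contract_pull: "contract u (pull J \<omega>) = pull J (contract (J u) \<omega>)"
  by (auto simp: contract_def pull_def)

lemma wedge_pull: "wedge k q (pull J \<omega>) (pull J \<psi>) = pull J (wedge k q \<omega> \<psi>)"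
  by (intro ext) (simp add: pull_def wedge_map pull_def[abs_def])

lemma esum_pull: "esum (\<lambda>u. pull J (T (J u))) = pull J (esum T)"
  by (intro ext) (simp add: pull_def[abs_def] esum_map)

context
  fixes G G' :: "real ^ 'n ^ 'n::finite" and J :: "real ^ 'n \<Rightarrow> real ^ 'n"
  assumes G: "gram G" and G': "gram G'" and J: "linear J" and iso: "\<And>u v. bil G u v = bil G' (J u) (J v)"
begin

text \<open>Each step of the contraction is a metric trace, which is invariant under
  isometries.\<close>

lemma ctr_pull:
  "alt_form a \<omega> \<Longrightarrow> alt_form b \<psi> \<Longrightarrow> ctr G k (pull J \<omega>) (pull J \<psi>) = pull J (ctr G' k \<omega> \<psi>)"
proof (induction k arbitrary: a b \<omega> \<psi>)
  case 0
  then show ?case by (auto simp: pull_def)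
next
  case (Suc k)
  show ?case
  proof
    fix vs
    have "mtrace G (\<lambda>u w. ctr G k (contract u (pull J \<omega>)) (contract w (pull J \<psi>)) vs) =
        mtrace G (\<lambda>u w. ctr G' k (contract (J u) \<omega>) (contract (J w) \<psi>) (map J vs))"
      by (simp only: contract_pull Suc.IH[OF alt_form_contract[OF Suc.prems(1)] alt_form_contract[OF Suc.prems(2)]])
        (simp add: pull_def)
    also have "\<dots> = mtrace G' (\<lambda>u w. ctr G' k (contract u \<omega>) (contract w \<psi>) (map J vs))"
      by (intro mtrace_isometry[OF G G' J iso] linear_ctr_left linear_ctr_right
          contract_linear[OF Suc.prems(1)] contract_linear[OF Suc.prems(2)])
    finally show "ctr G (Suc k) (pull J \<omega>) (pull J \<psi>) vs = pull J (ctr G' (Suc k) \<omega> \<psi>) vs"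
      by (simp add: pull_def del: of_nat_Suc)
  qed
qed

lemma mtrace_wedge_pull:
  assumes "alt_form a \<omega>" "alt_form b \<psi>"
  shows "(\<lambda>vs. mtrace G (\<lambda>u w. wedge k q (contract u (pull J \<omega>)) (contract w (pull J \<psi>)) vs)) =
    pull J (\<lambda>vs. mtrace G' (\<lambda>u w. wedge k q (contract u \<omega>) (contract w \<psi>) vs))"
proof
  fix vs
  have "mtrace G (\<lambda>u w. wedge k q (contract (J u) \<omega>) (contract (J w) \<psi>) (map J vs)) =
      mtrace G' (\<lambda>u w. wedge k q (contract u \<omega>) (contract w \<psi>) (map J vs))"
    by (intro mtrace_isometry[OF G G' J iso] linear_wedge_left linear_wedge_right
        contract_linear[OF assms(1)] contract_linear[OF assms(2)])
  then show "mtrace G (\<lambda>u w. wedge k q (contract u (pull J \<omega>)) (contract w (pull J \<psi>)) vs) =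
    pull J (\<lambda>vs. mtrace G' (\<lambda>u w. wedge k q (contract u \<omega>) (contract w \<psi>) vs)) vs"
    unfolding contract_pull wedge_pull by (simp add: pull_def)
qed

end

lemma smooth_in_vec:
  fixes F :: "'m::topological_space \<Rightarrow> real ^ 'k"
  assumes c: "regular_chart c" "open W" and F: "\<And>i. smooth_in c W (\<lambda>x. F x $ i)"
  shows "smooth_in c W F"
proof -
  have "smooth_in c W (\<lambda>x. \<Sum>i\<in>UNIV. F x $ i *\<^sub>R axis i 1)"
    by (intro smooth_in_sum[OF c] smooth_in_scaleR[OF c] F smooth_in_const)
  moreover have "(\<Sum>i\<in>UNIV. F x $ i *\<^sub>R axis i 1) = F x" for x
    using linear_expand[OF linear_id, of "F x"] by simp
  ultimately show ?thesis by (rule smooth_in_cong[OF c])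
qed

lemma linear_contract_linear: "alt_form p \<omega> \<Longrightarrow> linear L \<Longrightarrow> linear (\<lambda>u. contract (L u) \<omega> vs)"
  using linear_compose[OF _ contract_linear[of p \<omega> vs], of L] by (simp add: o_def)

section \<open>Operators on differential forms and their invariance under change of chart\<close>

context riemannian
begin

text \<open>Separates what has to be checked for each operator: a condition in each chart, and
  compatibility under pullback by the Jacobians.\<close>

lemma is_form_iff:
  "is_form A p \<phi> \<longleftrightarrow> (\<forall>c\<in>A. smooth_form c p (\<phi> c)) \<and>
     (\<forall>c\<in>A. \<forall>c'\<in>A. \<forall>x\<in>fst c \<inter> fst c'. \<phi> c x = pull (jacobian c c' x) (\<phi> c' x))"
  unfolding is_form_def smooth_form_def pull_def fun_eq_iff by blast

lemma is_form_smooth: "is_form A p \<phi> \<Longrightarrow> c \<in> A \<Longrightarrow> smooth_form c p (\<phi> c)"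
  unfolding is_form_iff by blast

lemma is_form_alt: "is_form A p \<phi> \<Longrightarrow> c \<in> A \<Longrightarrow> x \<in> fst c \<Longrightarrow> alt_form p (\<phi> c x)"
  by (simp add: is_form_def)

lemma is_form_change:
  "is_form A p \<phi> \<Longrightarrow> c \<in> A \<Longrightarrow> c' \<in> A \<Longrightarrow> x \<in> fst c \<inter> fst c' \<Longrightarrow> \<phi> c x = pull (jacobian c c' x) (\<phi> c' x)"
  unfolding is_form_iff by blast

lemma is_formI:
  assumes "\<And>c. c \<in> A \<Longrightarrow> smooth_form c p (\<phi> c)"
    and "\<And>c c' x. c \<in> A \<Longrightarrow> c' \<in> A \<Longrightarrow> x \<in> fst c \<Longrightarrow> x \<in> fst c' \<Longrightarrow> \<phi> c x = pull (jacobian c c' x) (\<phi> c' x)"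
  shows "is_form A p \<phi>"
  using assms unfolding is_form_iff by blast

lemma is_form_cong:
  assumes "is_form A p \<phi>" "\<And>c x. c \<in> A \<Longrightarrow> x \<in> fst c \<Longrightarrow> \<phi> c x = \<psi> c x"
  shows "is_form A p \<psi>"
proof (rule is_formI)
  show "smooth_form c p (\<psi> c)" if "c \<in> A" for c
    using smooth_form_cong[OF regular[OF that] is_form_smooth[OF assms(1) that]] assms(2) that by blast
  show "\<psi> c x = pull (jacobian c c' x) (\<psi> c' x)"
    if "c \<in> A" "c' \<in> A" "x \<in> fst c" "x \<in> fst c'" for c c' x
    using is_form_change[OF assms(1) that(1,2)] that assms(2)[of c x] assms(2)[of c' x] by simp
qed

lemma is_form_zero [simp]: "is_form A p (\<lambda>c x vs. 0)"
  by (rule is_formI) (simp_all add: pull_def fun_eq_iff)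

lemma is_form_add: "is_form A p \<phi> \<Longrightarrow> is_form A p \<psi> \<Longrightarrow> is_form A p (\<lambda>c x vs. \<phi> c x vs + \<psi> c x vs)"
proof (rule is_formI)
  fix c c' x assume *: "is_form A p \<phi>" "is_form A p \<psi>" "c \<in> A" "c' \<in> A" "x \<in> fst c" "x \<in> fst c'"
  then show "(\<lambda>vs. \<phi> c x vs + \<psi> c x vs) = pull (jacobian c c' x) (\<lambda>vs. \<phi> c' x vs + \<psi> c' x vs)"
    using is_form_change[of p \<phi> c c' x] is_form_change[of p \<psi> c c' x] by (simp add: pull_def fun_eq_iff)
qed (simp add: smooth_form_add regular is_form_smooth)

lemma is_form_mult: "is_form A p \<phi> \<Longrightarrow> is_form A p (\<lambda>c x vs. a * \<phi> c x vs)"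
proof (rule is_formI)
  fix c c' x assume *: "is_form A p \<phi>" "c \<in> A" "c' \<in> A" "x \<in> fst c" "x \<in> fst c'"
  then show "(\<lambda>vs. a * \<phi> c x vs) = pull (jacobian c c' x) (\<lambda>vs. a * \<phi> c' x vs)"
    using is_form_change[of p \<phi> c c' x] by (simp add: pull_def fun_eq_iff)
qed (simp add: smooth_form_mult regular is_form_smooth)

lemma is_form_diff: "is_form A p \<phi> \<Longrightarrow> is_form A p \<psi> \<Longrightarrow> is_form A p (\<lambda>c x vs. \<phi> c x vs - \<psi> c x vs)"
  using is_form_add[of p \<phi> "\<lambda>c x vs. (- 1) * \<psi> c x vs"] is_form_mult[of p \<psi> "- 1"] by simp

lemma vector_field_change:
  "vector_field A Y \<Longrightarrow> c \<in> A \<Longrightarrow> c' \<in> A \<Longrightarrow> x \<in> fst c \<inter> fst c' \<Longrightarrow> Y c' x = jacobian c c' x (Y c x)"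
  unfolding vector_field_on_def by blast

lemma vector_field_smooth: "vector_field A Y \<Longrightarrow> c \<in> A \<Longrightarrow> smooth_in c UNIV (Y c)"
  by (simp add: vector_field_on_def)

lemma is_form_contract:
  assumes Y: "vector_field A Y" and \<phi>: "is_form A p \<phi>"
  shows "is_form A (p - 1) (\<lambda>c x. contract (Y c x) (\<phi> c x))"
proof (rule is_formI)
  show "smooth_form c (p - 1) (\<lambda>x. contract (Y c x) (\<phi> c x))" if "c \<in> A" for c
    using that by (intro smooth_form_contract_field regular is_form_smooth[OF \<phi>] vector_field_smooth[OF Y])
  fix c c' x assume c: "c \<in> A" "c' \<in> A" "x \<in> fst c" "x \<in> fst c'"
  then have x: "x \<in> fst c \<inter> fst c'" by blast
  show "contract (Y c x) (\<phi> c x) = pull (jacobian c c' x) (contract (Y c' x) (\<phi> c' x))"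
    unfolding is_form_change[OF \<phi> c(1,2) x] vector_field_change[OF Y c(1,2) x] contract_pull ..
qed

lemma is_form_wedge:
  assumes \<omega>: "is_form A k \<omega>" and \<psi>: "is_form A q \<psi>"
  shows "is_form A (k + q) (\<lambda>c x. wedge k q (\<omega> c x) (\<psi> c x))"
proof (rule is_formI)
  show "smooth_form c (k + q) (\<lambda>x. wedge k q (\<omega> c x) (\<psi> c x))" if "c \<in> A" for c
    using that by (intro smooth_form_wedge regular is_form_smooth[OF \<omega>] is_form_smooth[OF \<psi>])
  fix c c' x assume c: "c \<in> A" "c' \<in> A" "x \<in> fst c" "x \<in> fst c'"
  then have x: "x \<in> fst c \<inter> fst c'" by blast
  show "wedge k q (\<omega> c x) (\<psi> c x) = pull (jacobian c c' x) (wedge k q (\<omega> c' x) (\<psi> c' x))"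
    unfolding is_form_change[OF \<omega> c(1,2) x] is_form_change[OF \<psi> c(1,2) x] wedge_pull ..
qed

lemma smooth_form_mtrace:
  assumes c: "c \<in> A" and B: "\<And>u w. smooth_form c p (\<lambda>x. B x u w)"
  shows "smooth_form c p (\<lambda>x vs. mtrace (g c x) (\<lambda>u w. B x u w vs))"
proof (rule smooth_formI)
  show "alt_form p (\<lambda>vs. mtrace (g c x) (\<lambda>u w. B x u w vs))" if "x \<in> fst c" for x
    using that by (intro alt_form_mtrace smooth_form_alt[OF B])
  show "smooth_in c UNIV (\<lambda>x. mtrace (g c x) (\<lambda>u w. B x u w vs))" for vs
    unfolding mtrace_def using regular[OF c]
    by (intro smooth_in_sum smooth_in_scaleR smooth_inverse_metric c smooth_form_smooth[OF B] open_UNIV)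
qed

lemma smooth_form_ctr:
  assumes "c \<in> A"
  shows "smooth_form c a \<omega> \<Longrightarrow> smooth_form c (k + q) \<psi> \<Longrightarrow> smooth_form c q (\<lambda>x. ctr (g c x) k (\<omega> x) (\<psi> x))"
proof (induction k arbitrary: a \<omega> \<psi>)
  case 0
  then show ?case
    using regular[OF assms] smooth_form_alt[OF 0(2)] smooth_form_smooth[OF 0(1)] smooth_form_smooth[OF 0(2)]
    by (intro smooth_formI) (auto intro!: alt_form_scaled smooth_in_bilinear[OF _ _ bounded_bilinear_mult])
next
  case (Suc k)
  show ?case
    unfolding ctr.simps
    using Suc.prems(2) by (intro smooth_form_mult regular smooth_form_mtrace assms
        Suc.IH[OF smooth_form_contract[OF Suc.prems(1)]] smooth_form_contract_Suc) simp
qed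

lemma is_form_ctr:
  assumes \<omega>: "is_form A a \<omega>" and \<psi>: "is_form A (k + q) \<psi>"
  shows "is_form A q (\<lambda>c x. ctr (g c x) k (\<omega> c x) (\<psi> c x))"
proof (rule is_formI)
  show "smooth_form c q (\<lambda>x. ctr (g c x) k (\<omega> c x) (\<psi> c x))" if "c \<in> A" for c
    by (rule smooth_form_ctr[OF that is_form_smooth[OF \<omega> that] is_form_smooth[OF \<psi> that]])
  fix c c' x assume c: "c \<in> A" "c' \<in> A" "x \<in> fst c" "x \<in> fst c'"
  then have x: "x \<in> fst c \<inter> fst c'" by blast
  show "ctr (g c x) k (\<omega> c x) (\<psi> c x) = pull (jacobian c c' x) (ctr (g c' x) k (\<omega> c' x) (\<psi> c' x))"
    unfolding is_form_change[OF \<omega> c(1,2) x] is_form_change[OF \<psi> c(1,2) x]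
    by (rule ctr_pull[OF gram[OF c(1,3)] gram[OF c(2,4)] linear_jacobian[OF c(1,2) x] isometry[OF c(1,2) x]
          is_form_alt[OF \<omega> c(2,4)] is_form_alt[OF \<psi> c(2,4)]])
qed

lemma smooth_form_esum:
  assumes c: "c \<in> A" and lin: "\<And>x vs. x \<in> fst c \<Longrightarrow> linear (\<lambda>u. T x u vs)"
    and T: "\<And>u. smooth_form c m (\<lambda>x. T x u)"
  shows "smooth_form c (Suc m) (\<lambda>x. esum (T x))"
proof (rule smooth_formI)
  show "alt_form (Suc m) (esum (T x))" if "x \<in> fst c" for x
    using that by (intro alt_form_esum lin smooth_form_alt[OF T])
  show "smooth_in c UNIV (\<lambda>x. esum (T x) vs)" for vs
    unfolding esum_def using regular[OF c]
    by (intro smooth_in_sum smooth_in_scaleR smooth_in_const smooth_form_smooth[OF T] open_UNIV)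
qed

lemma is_form_mtrace_wedge:
  assumes \<omega>: "is_form A (Suc k) \<omega>" and \<psi>: "is_form A (Suc q) \<psi>"
  shows "is_form A (k + q) (\<lambda>c x vs. mtrace (g c x) (\<lambda>u w. wedge k q (contract u (\<omega> c x)) (contract w (\<psi> c x)) vs))"
proof (rule is_formI)
  show "smooth_form c (k + q) (\<lambda>x vs. mtrace (g c x) (\<lambda>u w. wedge k q (contract u (\<omega> c x)) (contract w (\<psi> c x)) vs))"
    if "c \<in> A" for c
    using that
    by (intro smooth_form_mtrace smooth_form_wedge regular smooth_form_contract_Suc is_form_smooth[OF \<omega>]
        is_form_smooth[OF \<psi>])
  fix c c' x assume c: "c \<in> A" "c' \<in> A" "x \<in> fst c" "x \<in> fst c'"
  then have x: "x \<in> fst c \<inter> fst c'" by blast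
  show "(\<lambda>vs. mtrace (g c x) (\<lambda>u w. wedge k q (contract u (\<omega> c x)) (contract w (\<psi> c x)) vs)) =
    pull (jacobian c c' x) (\<lambda>vs. mtrace (g c' x) (\<lambda>u w. wedge k q (contract u (\<omega> c' x)) (contract w (\<psi> c' x)) vs))"
    unfolding is_form_change[OF \<omega> c(1,2) x] is_form_change[OF \<psi> c(1,2) x]
    by (rule mtrace_wedge_pull[OF gram[OF c(1,3)] gram[OF c(2,4)] linear_jacobian[OF c(1,2) x] isometry[OF c(1,2) x]
          is_form_alt[OF \<omega> c(2,4)] is_form_alt[OF \<psi> c(2,4)]])
qed

lemma is_form_esum_ctr:
  assumes H: "is_form A (Suc a) H" and \<psi>: "is_form A (k + q) \<psi>"
  shows "is_form A (Suc q) (\<lambda>c x. esum (\<lambda>u. ctr (g c x) k (contract u (H c x)) (\<psi> c x)))"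
proof (rule is_formI)
  show "smooth_form c (Suc q) (\<lambda>x. esum (\<lambda>u. ctr (g c x) k (contract u (H c x)) (\<psi> c x)))" if "c \<in> A" for c
    using that by (intro smooth_form_esum linear_ctr_left contract_linear[OF is_form_alt[OF H]]
        smooth_form_ctr[OF that smooth_form_contract_Suc[OF is_form_smooth[OF H that]] is_form_smooth[OF \<psi> that]])
  fix c c' x assume c: "c \<in> A" "c' \<in> A" "x \<in> fst c" "x \<in> fst c'"
  then have x: "x \<in> fst c \<inter> fst c'" by blast
  have "ctr (g c x) k (pull (jacobian c c' x) (contract u' (H c' x))) (pull (jacobian c c' x) (\<psi> c' x)) =
      pull (jacobian c c' x) (ctr (g c' x) k (contract u' (H c' x)) (\<psi> c' x))" for u'
    by (rule ctr_pull[OF gram[OF c(1,3)] gram[OF c(2,4)] linear_jacobian[OF c(1,2) x] isometry[OF c(1,2) x]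
          alt_form_contract[OF is_form_alt[OF H c(2,4)]] is_form_alt[OF \<psi> c(2,4)]])
  then show "esum (\<lambda>u. ctr (g c x) k (contract u (H c x)) (\<psi> c x)) =
      pull (jacobian c c' x) (esum (\<lambda>u. ctr (g c' x) k (contract u (H c' x)) (\<psi> c' x)))"
    unfolding is_form_change[OF H c(1,2) x] is_form_change[OF \<psi> c(1,2) x] contract_pull
    using esum_pull[of "jacobian c c' x" "\<lambda>u. ctr (g c' x) k (contract u (H c' x)) (\<psi> c' x)"] by simp
qed

section \<open>Covariant derivatives of forms\<close>

lemma smooth_christoffel: "c \<in> A \<Longrightarrow> smooth_in c UNIV (\<lambda>x. christoffel g c x u v)"
proof (rule smooth_in_vec)
  assume c: "c \<in> A"
  note r = regular[OF c] open_UNIV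
  have d: "smooth_in c UNIV (\<lambda>x. deriv_in c (\<lambda>y. g c y $ i $ j) x w)" for i j w
    by (intro smooth_in_deriv r smooth_in_component smooth_metric c)
  show "smooth_in c UNIV (\<lambda>x. christoffel g c x u v $ l)" for l
    unfolding christoffel_def vec_lambda_beta diff_conv_add_uminus
    by (intro smooth_in_sum[OF r] smooth_in_bilinear[OF r bounded_bilinear_mult] smooth_in_const
        smooth_inverse_metric c smooth_in_add[OF r] d
        smooth_in_bounded_linear[OF r bounded_linear_minus[OF bounded_linear_ident]])
qed (simp_all add: regular)

lemma nabla_form_eq:
  assumes "alt_form p (\<phi> c x)"
  shows "nabla_form g c x v \<phi> =
    (\<lambda>vs. deriv_in c (\<lambda>y. \<phi> c y vs) x v - esum (\<lambda>u. contract (christoffel g c x v u) (\<phi> c x)) vs)"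
  unfolding nabla_form_def by (intro ext) (simp add: sum_update_eq_esum[OF assms])

lemma alt_form_nabla:
  assumes c: "c \<in> A" "x \<in> fst c" and \<phi>: "smooth_form c p (\<phi> c)"
  shows "alt_form p (nabla_form g c x v \<phi>)"
  unfolding nabla_form_eq[of p \<phi> c x, OF smooth_form_alt[OF \<phi> c(2)]]
  by (intro alt_form_diff alt_form_deriv regular c \<phi> alt_form_esum_contract smooth_form_alt[OF \<phi>] linear_christoffel)

lemma linear_nabla:
  assumes c: "c \<in> A" "x \<in> fst c" and \<phi>: "smooth_form c p (\<phi> c)"
  shows "linear (\<lambda>v. nabla_form g c x v \<phi> vs)"
proof -
  note a = smooth_form_alt[OF \<phi> c(2)]
  have "linear (\<lambda>v. esum (\<lambda>u. contract (christoffel g c x v u) (\<phi> c x)) vs)"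
    unfolding esum_def
    by (intro linear_compose_sum ballI linear_compose_scale_right linear_contract_linear[OF a] linear_christoffel)
  then show ?thesis
    unfolding nabla_form_eq[of p \<phi> c x, OF a]
    by (intro linear_compose_sub linear_deriv_in[OF smooth_form_smooth[OF \<phi>]]) (use c in auto)
qed

text \<open>The direction is expanded in constant ones, for which smoothness follows from the
  formula in components.\<close>

lemma smooth_form_nabla:
  assumes c: "c \<in> A" and \<phi>: "smooth_form c p (\<phi> c)" and Y: "smooth_in c UNIV Y"
  shows "smooth_form c p (\<lambda>x. nabla_form g c x (Y x) \<phi>)"
proof (rule smooth_formI)
  note r = regular[OF c] open_UNIV
  show "alt_form p (nabla_form g c x (Y x) \<phi>)" if "x \<in> fst c" for x
    by (rule alt_form_nabla[where \<phi> = \<phi>, OF c that \<phi>])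
  have fixed: "smooth_in c UNIV (\<lambda>x. nabla_form g c x v \<phi> vs)" for v vs
  proof -
    have "smooth_in c UNIV (\<lambda>x. deriv_in c (\<lambda>y. \<phi> c y vs) x v + - (\<Sum>j<length vs.
        \<phi> c x (take j vs @ christoffel g c x v (vs ! j) # drop (Suc j) vs)))"
      by (intro smooth_in_add[OF r] smooth_in_deriv r smooth_form_smooth[OF \<phi>]
          smooth_in_bounded_linear[OF r bounded_linear_minus[OF bounded_linear_ident]]
          smooth_in_sum[OF r] smooth_form_moving[OF r(1) \<phi>] smooth_christoffel c)
    then show ?thesis by (simp add: nabla_form_def upd_conv_take_nth_drop)
  qed
  show "smooth_in c UNIV (\<lambda>x. nabla_form g c x (Y x) \<phi> vs)" for vs
  proof (rule smooth_in_cong[OF r])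
    show "smooth_in c UNIV (\<lambda>x. \<Sum>i\<in>UNIV. Y x $ i *\<^sub>R nabla_form g c x (axis i 1) \<phi> vs)"
      by (intro smooth_in_sum[OF r] smooth_in_scaleR r smooth_in_component Y fixed)
    show "(\<Sum>i\<in>UNIV. Y x $ i *\<^sub>R nabla_form g c x (axis i 1) \<phi> vs) = nabla_form g c x (Y x) \<phi> vs"
      if "x \<in> UNIV \<inter> fst c" for x
      using linear_expand[OF linear_nabla[where \<phi> = \<phi>, OF c _ \<phi>], of x "Y x" vs] that by simp
  qed
qed

text \<open>The product rule for arguments moved by the Jacobian produces a Hessian in each slot,
  and these cancel against the inhomogeneous terms in the change of the Christoffel symbols.\<close>

lemma nabla_form_change:
  assumes \<phi>: "is_form A p \<phi>" and A: "c \<in> A" "c' \<in> A" and x: "x \<in> fst c \<inter> fst c'"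
  shows "nabla_form g c x v \<phi> = pull (jacobian c c' x) (nabla_form g c' x (jacobian c c' x v) \<phi>)"
proof
  fix vs
  let ?J = "jacobian c c' x"
  have x1: "x \<in> fst c" and x2: "x \<in> fst c'" and x3: "x \<in> fst c' \<inter> fst c" using x by auto
  note c = regular[OF A(1)] open_domain[OF A(2)] and \<phi>' = is_form_smooth[OF \<phi> A(2)]
  \<comment> \<open>Constant vectors of the chart \<open>c\<close> become moving arguments in the
    chart \<open>c'\<close>.\<close>
  have "chart_derivative c (\<lambda>y. \<phi> c' y ([] @ map (\<lambda>v. jacobian c c' y v) vs)) x
    (\<lambda>u. deriv_in c' (\<lambda>y. \<phi> c' y ([] @ map (\<lambda>v. jacobian c c' x v) vs)) x (?J u) +
      (\<Sum>j<length vs. \<phi> c' x ([] @ (map (\<lambda>v. jacobian c c' x v) vs)[j := hess c c' x u (vs ! j)])))"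
    by (rule chart_derivative_moving[OF c x3, where p = p and D = "\<lambda>u vs. deriv_in c' (\<lambda>y. \<phi> c' y vs) x (?J u)"
          and DF = "\<lambda>v u. hess c c' x u v"])
      (use A x x2 in \<open>auto intro!: is_form_alt[OF \<phi>] chart_derivative_change[OF A x]
        smooth_in_has_derivative[OF smooth_form_smooth[OF \<phi>']] alt_form_deriv regular \<phi>' hess_has_derivative\<close>)
  then have "chart_derivative c (\<lambda>y. \<phi> c y vs) x
    (\<lambda>u. deriv_in c' (\<lambda>y. \<phi> c' y (map ?J vs)) x (?J u) +
      (\<Sum>j<length vs. \<phi> c' x ((map ?J vs)[j := hess c c' x u (vs ! j)])))"
    unfolding append_Nil
    by (rule chart_derivative_cong[OF c x3, rotated]) (simp add: is_form_change[OF \<phi> A] pull_def Int_commute)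
  from deriv_in_eqI[OF this]
  have d: "deriv_in c (\<lambda>y. \<phi> c y vs) x v = deriv_in c' (\<lambda>y. \<phi> c' y (map ?J vs)) x (?J v) +
      (\<Sum>j<length vs. \<phi> c' x ((map ?J vs)[j := hess c c' x v (vs ! j)]))"
    by simp
  have "\<phi> c x (vs[j := christoffel g c x v (vs ! j)]) =
      \<phi> c' x ((map ?J vs)[j := christoffel g c' x (?J v) (map ?J vs ! j)]) +
      \<phi> c' x ((map ?J vs)[j := hess c c' x v (vs ! j)])" if "j < length vs" for j
    using that linear_add[OF linear_alt_form[OF is_form_alt[OF \<phi> A(2) x2]]]
    by (simp add: is_form_change[OF \<phi> A x] pull_def map_update christoffel_change[OF A x] upd_conv_take_nth_drop
        take_map drop_map)
  then show "nabla_form g c x v \<phi> vs = pull ?J (nabla_form g c' x (?J v) \<phi>) vs"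
    unfolding nabla_form_def pull_def d by (simp add: sum.distrib)
qed

lemma is_form_nabla:
  assumes Y: "vector_field A Y" and \<phi>: "is_form A p \<phi>"
  shows "is_form A p (\<lambda>c x. nabla_form g c x (Y c x) \<phi>)"
proof (rule is_formI)
  show "smooth_form c p (\<lambda>x. nabla_form g c x (Y c x) \<phi>)" if "c \<in> A" for c
    using that by (intro smooth_form_nabla is_form_smooth[OF \<phi>] vector_field_smooth[OF Y])
  fix c c' x assume c: "c \<in> A" "c' \<in> A" "x \<in> fst c" "x \<in> fst c'"
  then have x: "x \<in> fst c \<inter> fst c'" by blast
  show "nabla_form g c x (Y c x) \<phi> = pull (jacobian c c' x) (nabla_form g c' x (Y c' x) \<phi>)"
    unfolding nabla_form_change[OF \<phi> c(1,2) x] vector_field_change[OF Y c(1,2) x] ..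
qed

text \<open>The connection is torsion-free, so its Christoffel terms are symmetric and vanish under
  alternation.\<close>

lemma ext_d_eq:
  assumes c: "c \<in> A" "x \<in> fst c" and \<phi>: "smooth_form c p (\<phi> c)"
  shows "ext_d \<phi> c x = esum (\<lambda>u. nabla_form g c x u \<phi>)"
proof
  fix vs
  have "esum (\<lambda>v. esum (\<lambda>u. contract (christoffel g c x v u) (\<phi> c x))) vs = 0"
    by (rule esum_symmetric) (simp add: christoffel_sym[OF c])
  then show "ext_d \<phi> c x vs = esum (\<lambda>u. nabla_form g c x u \<phi>) vs"
    unfolding nabla_form_eq[of p \<phi> c x, OF smooth_form_alt[OF \<phi> c(2)]] esum_diff
    by (simp add: ext_d_def) (simp add: esum_def omit_def scaleR_conv_of_real)
qed

lemma codiff_eq: "codiff g \<phi> c x vs = - mtrace (g c x) (\<lambda>u w. nabla_form g c x u \<phi> (w # vs))"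
  by (simp add: codiff_def mtrace_def scaleR_conv_of_real)

lemma is_form_ext_d:
  assumes \<phi>: "is_form A p \<phi>"
  shows "is_form A (Suc p) (ext_d \<phi>)"
proof (rule is_form_cong)
  show "is_form A (Suc p) (\<lambda>c x. esum (\<lambda>u. nabla_form g c x u \<phi>))"
  proof (rule is_formI)
    show "smooth_form c (Suc p) (\<lambda>x. esum (\<lambda>u. nabla_form g c x u \<phi>))" if "c \<in> A" for c
      using that by (intro smooth_form_esum linear_nabla[where \<phi> = \<phi>, OF that _ is_form_smooth[OF \<phi> that]]
          smooth_form_nabla is_form_smooth[OF \<phi>] smooth_in_const)
    fix c c' x assume c: "c \<in> A" "c' \<in> A" "x \<in> fst c" "x \<in> fst c'"
    then have x: "x \<in> fst c \<inter> fst c'" by blast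
    show "esum (\<lambda>u. nabla_form g c x u \<phi>) = pull (jacobian c c' x) (esum (\<lambda>u. nabla_form g c' x u \<phi>))"
      unfolding nabla_form_change[OF \<phi> c(1,2) x] by (rule esum_pull)
  qed
  show "esum (\<lambda>u. nabla_form g c x u \<phi>) = ext_d \<phi> c x" if "c \<in> A" "x \<in> fst c" for c x
    by (rule ext_d_eq[where \<phi> = \<phi>, OF that is_form_smooth[OF \<phi> that(1)], symmetric])
qed

lemma is_form_codiff:
  assumes \<phi>: "is_form A (Suc p) \<phi>"
  shows "is_form A p (codiff g \<phi>)"
proof -
  have "is_form A p (\<lambda>c x vs. mtrace (g c x) (\<lambda>u w. contract w (nabla_form g c x u \<phi>) vs))"
  proof (rule is_formI)
    show "smooth_form c p (\<lambda>x vs. mtrace (g c x) (\<lambda>u w. contract w (nabla_form g c x u \<phi>) vs))" if "c \<in> A" for c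
      using that by (intro smooth_form_mtrace smooth_form_contract_Suc smooth_form_nabla is_form_smooth[OF \<phi>] smooth_in_const)
    fix c c' x assume c: "c \<in> A" "c' \<in> A" "x \<in> fst c" "x \<in> fst c'"
    then have x: "x \<in> fst c \<inter> fst c'" by blast
    have "mtrace (g c x) (\<lambda>u w. contract (jacobian c c' x w) (nabla_form g c' x (jacobian c c' x u) \<phi>) vs) =
        mtrace (g c' x) (\<lambda>u w. contract w (nabla_form g c' x u \<phi>) vs)" for vs
    proof (rule mtrace_change[OF c(1,2) x])
      show "linear (\<lambda>w. contract w (nabla_form g c' x u \<phi>) vs)" for u
        by (rule contract_linear[OF alt_form_nabla[where \<phi> = \<phi>, OF c(2,4) is_form_smooth[OF \<phi> c(2)]]])
      show "linear (\<lambda>u. contract w (nabla_form g c' x u \<phi>) vs)" for w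
        unfolding contract_def by (rule linear_nabla[where \<phi> = \<phi>, OF c(2,4) is_form_smooth[OF \<phi> c(2)]])
    qed
    then show "(\<lambda>vs. mtrace (g c x) (\<lambda>u w. contract w (nabla_form g c x u \<phi>) vs)) =
        pull (jacobian c c' x) (\<lambda>vs. mtrace (g c' x) (\<lambda>u w. contract w (nabla_form g c' x u \<phi>) vs))"
      unfolding nabla_form_change[OF \<phi> c(1,2) x] contract_pull by (simp add: pull_def fun_eq_iff)
  qed
  then have "is_form A p (\<lambda>c x vs. (- 1) * mtrace (g c x) (\<lambda>u w. contract w (nabla_form g c x u \<phi>) vs))"
    by (rule is_form_mult)
  then show ?thesis
    by (rule is_form_cong) (simp add: codiff_eq contract_def fun_eq_iff)
qed

end

section \<open>The operators of the hierarchy\<close>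

lemma int_form_0: "int_form G l 0 \<xi> \<omega> = (\<lambda>vs. 0)"
  by (intro ext) (simp add: int_form_def)

context riemannian
begin

lemma is_form_vee:
  assumes \<omega>: "is_form A k \<omega>" and \<psi>: "is_form A (k + q) \<psi>"
  shows "is_form A q (\<lambda>c x. vee (g c x) k (k + q) (\<omega> c x) (\<psi> c x))"
  by (rule is_form_cong[OF is_form_ctr[OF assms]])
    (simp add: vee_eq[OF gram is_form_alt[OF \<omega>] is_form_alt[OF \<psi>]])

lemma is_form_int_form_2:
  assumes \<omega>: "is_form A 2 \<omega>" and \<psi>: "is_form A p \<psi>"
  shows "is_form A p (\<lambda>c x. int_form (g c x) 2 p (\<omega> c x) (\<psi> c x))"
proof (cases p)
  case 0
  then show ?thesis by (simp add: int_form_0)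
next
  case (Suc m)
  have "is_form A (1 + m) (\<lambda>c x vs. mtrace (g c x) (\<lambda>u w. wedge 1 m (contract u (\<omega> c x)) (contract w (\<psi> c x)) vs))"
    using \<omega> \<psi> by (intro is_form_mtrace_wedge) (simp_all add: Suc numeral_2_eq_2)
  then show ?thesis
    unfolding Suc plus_1_eq_Suc
    by (rule is_form_cong) (simp add: int_form_2_eq[OF gram is_form_alt[OF \<omega>] is_form_alt[OF \<psi>[unfolded Suc]]])
qed

lemma is_form_int_form_3:
  assumes \<omega>: "is_form A 3 \<omega>" and \<psi>: "is_form A p \<psi>"
  shows "is_form A (Suc p) (\<lambda>c x. int_form (g c x) 3 p (\<omega> c x) (\<psi> c x))"
proof (cases p)
  case 0
  then show ?thesis by (simp add: int_form_0)
next
  case (Suc m)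
  have "is_form A (2 + m) (\<lambda>c x vs. mtrace (g c x) (\<lambda>u w. wedge 2 m (contract u (\<omega> c x)) (contract w (\<psi> c x)) vs))"
    using \<omega> \<psi> by (intro is_form_mtrace_wedge) (simp_all add: Suc numeral_3_eq_3 numeral_2_eq_2)
  then have "is_form A (2 + m) (\<lambda>c x. int_form (g c x) 3 p (\<omega> c x) (\<psi> c x))"
    by (rule is_form_cong) (simp add: Suc int_form_3_eq[OF gram is_form_alt[OF \<omega>] is_form_alt[OF \<psi>[unfolded Suc]]])
  then show ?thesis by (simp add: Suc)
qed

lemma is_form_int_form_adj_3:
  assumes H: "is_form A 3 H" and \<psi>: "is_form A (Suc m) \<psi>"
  shows "is_form A m (\<lambda>c x. int_form_adj (g c x) 3 (Suc m) (H c x) (\<psi> c x))"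
proof (cases m)
  case 0
  \<comment> \<open>The operand is a 1-form, which contraction with a 2-form annihilates; the
    general formula would name a degree of at least 1.\<close>
  have "is_form A m (\<lambda>c x vs. 0)" by simp
  then show ?thesis
  proof (rule is_form_cong)
    fix c x assume c: "c \<in> A" "x \<in> fst c"
    have "ctr (g c x) 2 (contract u (H c x)) (\<psi> c x) = (\<lambda>vs. 0)" for u
      by (rule ctr_degree_less[OF is_form_alt[OF \<psi> c]]) (simp add: 0)
    then show "(\<lambda>vs. 0) = int_form_adj (g c x) 3 (Suc m) (H c x) (\<psi> c x)"
      unfolding int_form_adj_3_eq[OF gram[OF c] is_form_alt[OF H c] is_form_alt[OF \<psi> c]]
      by (intro ext) simp
  qed
next
  case (Suc q)
  have "is_form A (Suc q) (\<lambda>c x. esum (\<lambda>u. ctr (g c x) 2 (contract u (H c x)) (\<psi> c x)))"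
    using H \<psi> by (intro is_form_esum_ctr[of 2]) (simp_all add: Suc eval_nat_numeral)
  then show ?thesis
    unfolding Suc
    by (rule is_form_cong) (simp add: int_form_adj_3_eq[OF gram is_form_alt[OF H] is_form_alt[OF \<psi>[unfolded Suc]]])
qed

lemma is_form_minus2: "multi_form A \<phi> \<Longrightarrow> is_form A (p - 2) (minus2 \<phi> p)"
  by (simp add: multi_form_def minus2_def)

text \<open>The degree is \<open>k + p - 2\<close> and not \<open>k + (p - 2)\<close>. The two
  differ for \<open>p < 2\<close>, where the form is zero and fits every degree.\<close>

lemma is_form_wedge_minus2:
  assumes "is_form A k \<omega>" "multi_form A \<phi>" and d: "d = k + p - 2"
  shows "is_form A d (\<lambda>c x. wedge k (p - 2) (\<omega> c x) (minus2 \<phi> p c x))"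
proof (cases "p < 2")
  case True
  then show ?thesis by (simp add: minus2_def)
next
  case False
  then have "d = k + (p - 2)" using d by simp
  then show ?thesis using is_form_wedge[OF assms(1) is_form_minus2[OF assms(2)]] by simp
qed

lemma is_form_hierarchy_nabla:
  assumes H: "is_form A 3 H" and Y: "vector_field A Y" and \<phi>: "multi_form A \<phi>"
  shows "is_form A p (hierarchy_nabla g \<kappa> H Y \<phi> p)"
proof -
  have iH: "is_form A 2 (\<lambda>c x. contract (Y c x) (H c x))"
    using is_form_contract[OF Y H] by simp
  have \<phi>': "is_form A q (\<phi> q)" for q using \<phi> by (simp add: multi_form_def)
  have "is_form A p (\<lambda>c x. vee (g c x) 2 (p + 2) (contract (Y c x) (H c x)) (\<phi> (p + 2) c x))"
    using is_form_vee[OF iH, of p "\<phi> (p + 2)"] \<phi>'[of "p + 2"] by (simp add: add.commute)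
  then show ?thesis
    unfolding hierarchy_nabla_def[abs_def]
    by (intro is_form_add is_form_diff is_form_mult is_form_nabla Y \<phi>' is_form_int_form_2 iH
        is_form_wedge_minus2[OF iH \<phi>]) simp_all
qed

lemma is_form_hierarchy_P:
  assumes H: "is_form A 3 H" and \<phi>: "multi_form A \<phi>"
  shows "is_form A (Suc p) (hierarchy_P g \<kappa> H \<phi> p)"
proof -
  have \<phi>': "is_form A q (\<phi> q)" for q using \<phi> by (simp add: multi_form_def)
  have "is_form A (Suc p) (\<lambda>c x. int_form_adj (g c x) 3 (p + 2) (H c x) (\<phi> (p + 2) c x))"
    using is_form_int_form_adj_3[OF H, of "Suc p" "\<phi> (p + 2)"] \<phi>'[of "p + 2"] by simp
  moreover have "is_form A (Suc p) (\<lambda>c x. wedge 3 (p - 2) (H c x) (minus2 \<phi> p c x))"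
    by (rule is_form_wedge_minus2[OF H \<phi>]) simp
  ultimately show ?thesis
    unfolding hierarchy_P_def[abs_def]
    by (intro is_form_add is_form_mult is_form_ext_d \<phi>' is_form_int_form_3 H)
qed

lemma is_form_hierarchy_Q:
  assumes H: "is_form A 3 H" and \<phi>: "multi_form A \<phi>"
  shows "is_form A p (hierarchy_Q g \<kappa> H \<phi> (Suc p))"
proof -
  have \<phi>': "is_form A q (\<phi> q)" for q using \<phi> by (simp add: multi_form_def)
  have "is_form A p (\<lambda>c x. vee (g c x) 3 (Suc p + 2) (H c x) (\<phi> (Suc p + 2) c x))"
    using is_form_vee[OF H, of p "\<phi> (Suc p + 2)"] \<phi>'[of "Suc p + 2"] by (simp add: eval_nat_numeral)
  moreover have "is_form A p (\<lambda>c x. int_form (g c x) 3 (Suc p - 2) (H c x) (minus2 \<phi> (Suc p) c x))"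
  proof (cases p)
    \<comment> \<open>\<open>Suc p - 2\<close> truncates to 0, and the general count of degrees
      would give a 1-form; the expression itself is zero.\<close>
    case 0
    then show ?thesis by (simp add: int_form_0)
  next
    case (Suc m)
    then show ?thesis
      using is_form_int_form_3[OF H is_form_minus2[OF \<phi>, of "Suc p"]] by simp
  qed
  ultimately show ?thesis
    unfolding hierarchy_Q_def[abs_def]
    by (intro is_form_add is_form_diff is_form_mult is_form_codiff \<phi>' is_form_int_form_adj_3 H)
qed

text \<open>\<open>vee\<close> hides its linearity behind a description and \<open>int_form\<close>
  behind components; explicit contractions and traces are visibly linear in the form and in
  \<open>Y\<close>.\<close>

lemma hierarchy_nabla_eq:
  assumes H: "is_form A 3 H" and \<phi>: "multi_form A \<phi>" and c: "c \<in> A" "x \<in> fst c"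
  shows "hierarchy_nabla g \<kappa> H Y \<phi> p c x vs = nabla_form g c x (Y c x) (\<phi> p) vs
     + 4 * of_real (Im \<kappa>) * ctr (g c x) 2 (contract (Y c x) (H c x)) (\<phi> (p + 2) c x) vs
     - 4 * of_real (Re \<kappa>) * mtrace (g c x) (\<lambda>u w. wedge 1 (p - 1) (contract u (contract (Y c x) (H c x)))
         (contract w (\<phi> p c x)) vs)
     + 4 * of_real (Im \<kappa>) * wedge 2 (p - 2) (contract (Y c x) (H c x)) (minus2 \<phi> p c x) vs"
proof -
  have iH: "alt_form 2 (contract (Y c x) (H c x))"
    by (rule alt_form_contract_3[OF is_form_alt[OF H c]])
  have \<phi>': "alt_form q (\<phi> q c x)" for q using \<phi> is_form_alt c by (auto simp: multi_form_def)
  show ?thesis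
    unfolding hierarchy_nabla_def vee_eq[OF gram[OF c] iH \<phi>'] int_form_2_eq[OF gram[OF c] iH \<phi>'] ..
qed

section \<open>The left-hand side as a connection, and the abstract hierarchy equation\<close>

lemma nabla_form_add:
  assumes c: "c \<in> A" "x \<in> fst c" and \<phi>: "smooth_form c p (\<phi> c)" and \<psi>: "smooth_form c p (\<psi> c)"
  shows "nabla_form g c x v (\<lambda>c x vs. \<phi> c x vs + \<psi> c x vs) vs = nabla_form g c x v \<phi> vs + nabla_form g c x v \<psi> vs"
  using deriv_in_linear_combination[OF regular[OF c(1)] c(2) smooth_form_smooth[OF \<phi>] smooth_form_smooth[OF \<psi>],
      of "\<lambda>y. \<phi> c y vs + \<psi> c y vs" 1 vs vs v]
  by (simp add: nabla_form_def sum.distrib)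

lemma nabla_form_mult_function:
  assumes c: "c \<in> A" "x \<in> fst c" and \<phi>: "smooth_form c p (\<phi> c)" and f: "smooth_in c UNIV (f :: 'm \<Rightarrow> complex)"
  shows "nabla_form g c x v (\<lambda>c x vs. f x * \<phi> c x vs) vs =
    deriv_in c f x v * \<phi> c x vs + f x * nabla_form g c x v \<phi> vs"
proof -
  have "chart_derivative c (\<lambda>y. f y * \<phi> c y vs) x
      (\<lambda>u. f x * deriv_in c (\<lambda>y. \<phi> c y vs) x u + deriv_in c f x u * \<phi> c x vs)"
    using c by (intro chart_derivative_bilinear[OF bounded_bilinear_mult regular]
        smooth_in_has_derivative[OF f] smooth_in_has_derivative[OF smooth_form_smooth[OF \<phi>]]) auto
  from deriv_in_eqI[OF this] show ?thesis
    by (simp add: nabla_form_def right_diff_distrib sum_distrib_left)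
qed

lemma contract_combination:
  assumes "alt_form p \<omega>"
  shows "contract (r *\<^sub>R a + b) \<omega> = (\<lambda>vs. of_real r * contract a \<omega> vs + contract b \<omega> vs)"
  by (intro ext, simp only: linear_add[OF contract_linear[OF assms]] linear_cmul[OF contract_linear[OF assms]])
    (simp add: scaleR_conv_of_real)

text \<open>Only \<open>nabla_form\<close> differentiates; the terms in \<open>H\<close> are linear
  over functions, both in the form and in the vector field.\<close>

lemma form_connection_hierarchy:
  assumes H: "is_form A 3 H"
  shows "form_connection A (hierarchy_nabla g \<kappa> H)"
  unfolding form_connection_def
proof (intro conjI allI impI ballI)
  fix Y :: "('m, 'n) vfield" and \<phi> :: "('m, 'n) mform" assume Y: "vector_field A Y" and \<phi>: "multi_form A \<phi>"
  then show "multi_form A (hierarchy_nabla g \<kappa> H Y \<phi>)"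
    using is_form_hierarchy_nabla[OF H] by (simp add: multi_form_def)
next
  fix Y :: "('m, 'n) vfield" and \<phi> \<psi> :: "('m, 'n) mform" and c x p vs
  assume Y: "vector_field A Y" and \<phi>: "multi_form A \<phi>" and \<psi>: "multi_form A \<psi>" and c: "c \<in> A" "x \<in> fst c"
  have sum: "multi_form A (\<lambda>p c x vs. \<phi> p c x vs + \<psi> p c x vs)"
    using \<phi> \<psi> by (simp add: multi_form_def is_form_add)
  have m2: "minus2 (\<lambda>p c x vs. \<phi> p c x vs + \<psi> p c x vs) p c x = (\<lambda>vs. minus2 \<phi> p c x vs + minus2 \<psi> p c x vs)"
    by (simp add: minus2_def)
  have sm: "smooth_form c p (\<phi> p c)" "smooth_form c p (\<psi> p c)"
    using \<phi> \<psi> is_form_smooth c by (auto simp: multi_form_def)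
  show "hierarchy_nabla g \<kappa> H Y (\<lambda>p c x vs. \<phi> p c x vs + \<psi> p c x vs) p c x vs =
      hierarchy_nabla g \<kappa> H Y \<phi> p c x vs + hierarchy_nabla g \<kappa> H Y \<psi> p c x vs"
    unfolding hierarchy_nabla_eq[OF H sum c] hierarchy_nabla_eq[OF H \<phi> c] hierarchy_nabla_eq[OF H \<psi> c]
      nabla_form_add[where \<phi> = "\<phi> p" and \<psi> = "\<psi> p", OF c sm] m2 ctr_add_right contract_add wedge_add_right mtrace_add
    by (simp add: algebra_simps)
next
  fix Y :: "('m, 'n) vfield" and \<phi> :: "('m, 'n) mform" and f :: "'m \<Rightarrow> complex" and c x p vs
  assume Y: "vector_field A Y" and \<phi>: "multi_form A \<phi>" and f: "smooth_function A f" and c: "c \<in> A" "x \<in> fst c"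
  have sm: "smooth_form c p (\<phi> p c)" using \<phi> is_form_smooth c by (auto simp: multi_form_def)
  have alt: "alt_form q (\<phi> q c x)" for q using \<phi> is_form_alt c by (auto simp: multi_form_def)
  have fs: "smooth_in c UNIV f" using f c by (simp add: smooth_function_def)
  have m2: "minus2 (\<lambda>p c x vs. f x * \<phi> p c x vs) p c x = (\<lambda>vs. f x * minus2 \<phi> p c x vs)"
    by (simp add: minus2_def)
  have iH: "alt_form 2 (contract (Y c x) (H c x))"
    by (rule alt_form_contract_3[OF is_form_alt[OF H c]])
  show "hierarchy_nabla g \<kappa> H Y (\<lambda>p c x vs. f x * \<phi> p c x vs) p c x vs =
      deriv_in c f x (Y c x) * \<phi> p c x vs + f x * hierarchy_nabla g \<kappa> H Y \<phi> p c x vs"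
    unfolding hierarchy_nabla_def m2 nabla_form_mult_function[where \<phi> = "\<phi> p", OF c sm fs] wedge_mult_right
      int_form_mult vee_eq[OF gram[OF c] iH alt] vee_eq[OF gram[OF c] iH alt_form_scaled[OF alt]] ctr_mult_right
    by (simp add: algebra_simps)
next
  fix Y Z :: "('m, 'n) vfield" and \<phi> :: "('m, 'n) mform" and h :: "'m \<Rightarrow> real" and c x p vs
  assume Y: "vector_field A Y" and \<phi>: "multi_form A \<phi>" and c: "c \<in> A" "x \<in> fst c"
  have sm: "smooth_form c p (\<phi> p c)" using \<phi> is_form_smooth c by (auto simp: multi_form_def)
  note lin = linear_nabla[where \<phi> = "\<phi> p", OF c sm]
  have n: "nabla_form g c x (h x *\<^sub>R Y c x + Z c x) (\<phi> p) vs =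
      of_real (h x) * nabla_form g c x (Y c x) (\<phi> p) vs + nabla_form g c x (Z c x) (\<phi> p) vs"
    by (simp only: linear_add[OF lin] linear_cmul[OF lin]) (simp add: scaleR_conv_of_real)
  show "hierarchy_nabla g \<kappa> H (\<lambda>c x. h x *\<^sub>R Y c x + Z c x) \<phi> p c x vs =
      of_real (h x) * hierarchy_nabla g \<kappa> H Y \<phi> p c x vs + hierarchy_nabla g \<kappa> H Z \<phi> p c x vs"
    unfolding hierarchy_nabla_eq[OF H \<phi> c] n contract_combination[OF is_form_alt[OF H c]]
      ctr_add_left ctr_mult_left contract_add contract_mult wedge_add_left wedge_mult_left mtrace_add mtrace_mult
    by (simp add: algebra_simps)
qed

text \<open>No spinor occurs here: every multi-form whose derivative, corrected by the terms in
  \<open>H\<close>, has the shape i_u A + \<alpha>_u \<and> B satisfies the equation, since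
  \<open>hierarchy_P\<close> and \<open>hierarchy_Q\<close> are the normalised alternation and trace
  of the corrected derivative.\<close>

lemma hierarchy_equation:
  assumes H: "is_form A 3 H" and \<phi>: "multi_form A \<phi>" and c: "c \<in> A" "x \<in> fst c"
    and Af: "alt_form (Suc p) Af" and Bf: "alt_form (p - 1) Bf" and B0: "p = 0 \<Longrightarrow> Bf = (\<lambda>vs. 0)"
    and D: "\<And>u vs. nabla_form g c x u (\<phi> p) vs
     + 4 * of_real (Im \<kappa>) * ctr (g c x) 2 (contract u (H c x)) (\<phi> (p + 2) c x) vs
     - 4 * of_real (Re \<kappa>) * int_form (g c x) 2 p (contract u (H c x)) (\<phi> p c x) vs
     + 4 * of_real (Im \<kappa>) * wedge 2 (p - 2) (contract u (H c x)) (minus2 \<phi> p c x) vs =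
     Af (u # vs) + esum (\<lambda>y ws. bil (g c x) u y *\<^sub>R Bf ws) vs"
  shows "hierarchy_nabla g \<kappa> H Y \<phi> p c x vs = contract (Y c x) (hierarchy_P g \<kappa> H \<phi> p c x) vs +
     wedge 1 (p - 1) (lower (g c x) (Y c x)) (hierarchy_Q g \<kappa> H \<phi> p c x) vs"
proof -
  let ?G = "g c x" and ?H = "H c x" and ?m = "minus2 \<phi> p c x"
  note G = gram[OF c] and H3 = is_form_alt[OF H c]
  have \<phi>': "alt_form q (\<phi> q c x)" for q using \<phi> is_form_alt c by (auto simp: multi_form_def)
  have m: "alt_form (p - 2) ?m" using \<phi>'[of "p - 2"] by (simp add: minus2_def)
  have iH: "alt_form 2 (contract u ?H)" for u by (rule alt_form_contract_3[OF H3])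
  define Df where "Df u vs = nabla_form g c x u (\<phi> p) vs
     + 4 * of_real (Im \<kappa>) * ctr ?G 2 (contract u ?H) (\<phi> (p + 2) c x) vs
     - 4 * of_real (Re \<kappa>) * int_form ?G 2 p (contract u ?H) (\<phi> p c x) vs
     + 4 * of_real (Im \<kappa>) * wedge 2 (p - 2) (contract u ?H) ?m vs" for u vs
  have sm: "smooth_form c p (\<phi> p c)" using \<phi> is_form_smooth c by (auto simp: multi_form_def)
  \<comment> \<open>Coefficients: 4 stays for the adjoint, -4 times -2 gives 8, and 4 times 3 gives
    12.\<close>
  have esum_Df: "esum Df ws = ext_d (\<phi> p) c x ws
      + 4 * of_real (Im \<kappa>) * int_form_adj ?G 3 (p + 2) ?H (\<phi> (p + 2) c x) ws
      + 8 * of_real (Re \<kappa>) * int_form ?G 3 p ?H (\<phi> p c x) ws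
      + 12 * of_real (Im \<kappa>) * wedge 3 (p - 2) ?H ?m ws" for ws
  proof -
    have "esum Df ws = esum (\<lambda>u. nabla_form g c x u (\<phi> p)) ws
      + 4 * of_real (Im \<kappa>) * esum (\<lambda>u. ctr ?G 2 (contract u ?H) (\<phi> (p + 2) c x)) ws
      - 4 * of_real (Re \<kappa>) * esum (\<lambda>u. int_form ?G 2 p (contract u ?H) (\<phi> p c x)) ws
      + 4 * of_real (Im \<kappa>) * esum (\<lambda>u. wedge 2 (p - 2) (contract u ?H) ?m) ws"
      unfolding Df_def[abs_def] esum_add esum_diff esum_mult ..
    then show ?thesis
      unfolding ext_d_eq[where \<phi> = "\<phi> p", OF c sm, symmetric] esum_int_form_2[OF G H3 \<phi>']
        esum_wedge_2[OF H3 m] int_form_adj_3_eq[OF G H3 \<phi>', symmetric] by simp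
  qed
  \<comment> \<open>Coefficients: 4 times 3 gives 12, -4 times 2 gives -8, and 4 stays. The overall
    minus sign is taken out because the codifferential is minus the trace.\<close>
  have trace_Df: "mtrace ?G (\<lambda>u w. Df u (w # ws)) = - (codiff g (\<phi> p) c x ws
      - 12 * of_real (Im \<kappa>) * vee ?G 3 (p + 2) ?H (\<phi> (p + 2) c x) ws
      + 8 * of_real (Re \<kappa>) * int_form_adj ?G 3 p ?H (\<phi> p c x) ws
      - 4 * of_real (Im \<kappa>) * int_form ?G 3 (p - 2) ?H ?m ws)" for ws
  proof -
    have "mtrace ?G (\<lambda>u w. Df u (w # ws)) = mtrace ?G (\<lambda>u w. nabla_form g c x u (\<phi> p) (w # ws))
      + 4 * of_real (Im \<kappa>) * mtrace ?G (\<lambda>u w. ctr ?G 2 (contract u ?H) (\<phi> (p + 2) c x) (w # ws))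
      - 4 * of_real (Re \<kappa>) * mtrace ?G (\<lambda>u w. int_form ?G 2 p (contract u ?H) (\<phi> p c x) (w # ws))
      + 4 * of_real (Im \<kappa>) * mtrace ?G (\<lambda>u w. wedge 2 (p - 2) (contract u ?H) ?m (w # ws))"
      unfolding Df_def[abs_def] mtrace_add mtrace_diff mtrace_mult ..
    then show ?thesis
      unfolding codiff_eq mtrace_ctr_2[OF H3 \<phi>'] mtrace_int_form_2[OF G H3 \<phi>'] mtrace_wedge_2[OF G H3 m]
        vee_eq[OF G H3 \<phi>'] by simp
  qed
  have P: "1 / (of_nat p + 1) * esum Df (Y c x # vs) = contract (Y c x) (hierarchy_P g \<kappa> H \<phi> p c x) vs"
    unfolding esum_Df contract_def hierarchy_P_def ..
  have "(\<lambda>ws. 1 / (of_nat CARD('n) - of_nat p + 1) * mtrace ?G (\<lambda>u w. Df u (w # ws))) =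
      hierarchy_Q g \<kappa> H \<phi> p c x"
    unfolding trace_Df hierarchy_Q_def[abs_def] mult_minus_left mult_minus_right ..
  then have Q: "1 / (of_nat CARD('n) - of_nat p + 1) *
      wedge 1 (p - 1) (lower ?G (Y c x)) (\<lambda>ws. mtrace ?G (\<lambda>u w. Df u (w # ws))) vs =
      wedge 1 (p - 1) (lower ?G (Y c x)) (hierarchy_Q g \<kappa> H \<phi> p c x) vs"
    unfolding wedge_mult_right[symmetric] by simp
  have "hierarchy_nabla g \<kappa> H Y \<phi> p c x vs = Df (Y c x) vs"
    unfolding hierarchy_nabla_def Df_def vee_eq[OF G iH \<phi>'] ..
  also have "\<dots> = 1 / (of_nat p + 1) * esum Df (Y c x # vs) + 1 / (of_nat CARD('n) - of_nat p + 1) *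
      wedge 1 (p - 1) (lower ?G (Y c x)) (\<lambda>ws. mtrace ?G (\<lambda>u w. Df u (w # ws))) vs"
    by (rule twistor_decomposition[OF G Af Bf B0]) (simp_all only: Df_def D)
  finally show ?thesis unfolding P Q .
qed

end

section \<open>The spinor bundle\<close>

lemma matrix_scaleR_vector: "(r *\<^sub>R M) *v \<eta> = r *\<^sub>R (M *v (\<eta> :: complex ^ 's))" for M :: "complex ^ 's ^ 'k"
  by (simp add: vec_eq_iff matrix_vector_mult_def scaleR_sum_right)

lemma linear_matrix_vector: "linear ((*v) (M :: complex ^ 's ^ 'k))"
  by (simp add: linear_iff matrix_vector_right_distrib) (simp add: vec_eq_iff matrix_vector_mult_def scaleR_sum_right)

lemma linear_matrix_vector_left: "linear (\<lambda>M :: complex ^ 's ^ 'k. M *v \<eta>)"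
  by (simp add: linear_iff matrix_vector_mult_add_rdistrib matrix_scaleR_vector)

lemma cvec_vector: "cvec \<Gamma> w *v \<eta> = (\<Sum>i\<in>UNIV. w $ i *\<^sub>R (\<Gamma> i *v \<eta>))"
  by (simp add: cvec_def linear_sum[OF linear_matrix_vector_left] matrix_scaleR_vector)

lemma matrix_vector_smult: "M *v (a *s \<eta>) = a *s (M *v (\<eta> :: complex ^ 's))" for M :: "complex ^ 's ^ 'k"
  by (simp add: vec_eq_iff matrix_vector_mult_def sum_distrib_left mult_ac)

lemma bounded_bilinear_herm: "bounded_bilinear herm"
  unfolding bilinear_conv_bounded_bilinear[symmetric] bilinear_def
  using linear_herm_left linear_herm_right by blast

lemma clifford_relation:
  assumes "clifford_rep \<Gamma>"
  shows "\<Gamma> i *v (\<Gamma> j *v \<eta>) + \<Gamma> j *v (\<Gamma> i *v \<eta>) = (if i = j then 2 else 0) *\<^sub>R \<eta>"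
proof -
  have "\<Gamma> i *v (\<Gamma> j *v \<eta>) + \<Gamma> j *v (\<Gamma> i *v \<eta>) = (\<Gamma> i ** \<Gamma> j + \<Gamma> j ** \<Gamma> i) *v \<eta>"
    by (simp add: matrix_vector_mul_assoc matrix_vector_mult_add_rdistrib)
  also have "\<dots> = mat (if i = j then 2 else 0) *v \<eta>"
    using assms by (simp add: clifford_rep_def)
  also have "\<dots> = (if i = j then 2 else 0) *\<^sub>R \<eta>"
    by (simp add: vec_eq_iff matrix_vector_mult_def mat_def if_distrib[of "\<lambda>c. c * _"] scaleR_conv_of_real cong: if_cong)
  finally show ?thesis .
qed

lemma cvec_clifford:
  assumes "clifford_rep \<Gamma>"
  shows "cvec \<Gamma> u *v (cvec \<Gamma> v *v \<eta>) + cvec \<Gamma> v *v (cvec \<Gamma> u *v \<eta>) = (2 * (u \<bullet> v)) *\<^sub>R \<eta>"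
proof -
  have expand: "cvec \<Gamma> u *v (cvec \<Gamma> v *v \<eta>) = (\<Sum>i\<in>UNIV. \<Sum>j\<in>UNIV. (u $ i * v $ j) *\<^sub>R (\<Gamma> i *v (\<Gamma> j *v \<eta>)))" for u v
  proof -
    have "\<Gamma> i *v (cvec \<Gamma> v *v \<eta>) = (\<Sum>j\<in>UNIV. v $ j *\<^sub>R (\<Gamma> i *v (\<Gamma> j *v \<eta>)))" for i
      unfolding cvec_vector by (simp only: linear_sum[OF linear_matrix_vector] linear_cmul[OF linear_matrix_vector])
    then show ?thesis
      unfolding cvec_vector[of \<Gamma> u] by (simp only: scaleR_sum_right scaleR_scaleR)
  qed
  have "cvec \<Gamma> u *v (cvec \<Gamma> v *v \<eta>) + cvec \<Gamma> v *v (cvec \<Gamma> u *v \<eta>) =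
      (\<Sum>i\<in>UNIV. \<Sum>j\<in>UNIV. (u $ i * v $ j) *\<^sub>R (\<Gamma> i *v (\<Gamma> j *v \<eta>) + \<Gamma> j *v (\<Gamma> i *v \<eta>)))"
  proof -
    have "cvec \<Gamma> v *v (cvec \<Gamma> u *v \<eta>) = (\<Sum>i\<in>UNIV. \<Sum>j\<in>UNIV. (u $ i * v $ j) *\<^sub>R (\<Gamma> j *v (\<Gamma> i *v \<eta>)))"
      unfolding expand[of v u] by (subst sum.swap) (simp add: mult.commute)
    then show ?thesis
      unfolding expand[of u v] scaleR_add_right sum.distrib by simp
  qed
  also have "\<dots> = (\<Sum>i\<in>UNIV. (2 * (u $ i * v $ i)) *\<^sub>R \<eta>)"
    unfolding clifford_relation[OF assms]
    by (intro sum.cong refl) (simp add: if_distrib[of "\<lambda>c. c *\<^sub>R _"] if_distrib[of "\<lambda>c. _ *\<^sub>R c"] mult.commute cong: if_cong)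
  finally show ?thesis by (simp add: inner_vec_def sum_distrib_left scaleR_sum_left)
qed

lemma herm_cvec:
  assumes "clifford_rep \<Gamma>"
  shows "herm (cvec \<Gamma> w *v \<theta>) \<psi> = herm \<theta> (cvec \<Gamma> w *v \<psi>)"
  using assms
  by (simp add: clifford_rep_def cvec_vector linear_sum[OF linear_herm_left] linear_sum[OF linear_herm_right]
      linear_cmul[OF linear_herm_left] linear_cmul[OF linear_herm_right])

text \<open>A unit vector acts by a Hermitian involution, hence unitarily, and so do products of
  unit vectors.\<close>

lemma herm_spin_group:
  assumes rep: "clifford_rep \<Gamma>" and s: "s \<in> spin_group \<Gamma>"
  shows "herm (s *v \<theta>) (s *v \<psi>) = herm \<theta> \<psi>"
proof -
  obtain ws where s: "s = foldr (\<lambda>w M. cvec \<Gamma> w ** M) ws (mat 1)" and ws: "\<forall>w\<in>set ws. norm w = 1"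
    using s unfolding spin_group_def by blast
  have "cvec \<Gamma> w *v (cvec \<Gamma> w *v \<eta>) = \<eta>" if "norm w = 1" for w \<eta>
  proof -
    have "2 *\<^sub>R (cvec \<Gamma> w *v (cvec \<Gamma> w *v \<eta>)) = 2 *\<^sub>R \<eta>"
      using cvec_clifford[OF rep, of w w \<eta>] that by (simp add: scaleR_2 dot_square_norm)
    then show ?thesis by simp
  qed
  with ws show ?thesis
    unfolding s by (induction ws) (simp_all add: herm_cvec[OF rep] flip: matrix_vector_mul_assoc)
qed

text \<open>Updating entry \<open>\<sigma> j\<close> before the permutation is updating entry
  \<open>j\<close> after it, and \<open>\<sigma>\<close> only reorders the summation index.\<close>

lemma sum_permute_list_update:
  assumes \<sigma>: "\<sigma> permutes {..<length vs}"
  shows "(\<Sum>j<length vs. f (permute_list \<sigma> (vs[j := L (vs ! j)]))) =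
    (\<Sum>j<length vs. f ((permute_list \<sigma> vs)[j := L (permute_list \<sigma> vs ! j)]))"
proof -
  have "permute_list \<sigma> (vs[\<sigma> j := L (vs ! \<sigma> j)]) = (permute_list \<sigma> vs)[j := L (permute_list \<sigma> vs ! j)]"
    if j: "j < length vs" for j
  proof (rule nth_equalityI)
    fix i assume "i < length (permute_list \<sigma> (vs[\<sigma> j := L (vs ! \<sigma> j)]))"
    then have i: "i < length vs" by simp
    have "\<sigma> i < length vs" "\<sigma> j < length vs" "i \<noteq> j \<Longrightarrow> \<sigma> j \<noteq> \<sigma> i"
      using permutes_in_image[OF \<sigma>] i j permutes_inj[OF \<sigma>] by (auto simp: inj_def)
    then show "permute_list \<sigma> (vs[\<sigma> j := L (vs ! \<sigma> j)]) ! i =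
        (permute_list \<sigma> vs)[j := L (permute_list \<sigma> vs ! j)] ! i"
      using i j \<sigma> by (cases "i = j") (simp_all add: permute_list_nth)
  qed simp
  then have "(\<Sum>j<length vs. f ((permute_list \<sigma> vs)[j := L (permute_list \<sigma> vs ! j)])) =
      (\<Sum>j<length vs. f (permute_list \<sigma> (vs[\<sigma> j := L (vs ! \<sigma> j)])))" by simp
  also have "\<dots> = (\<Sum>j<length vs. f (permute_list \<sigma> (vs[j := L (vs ! j)])))"
    using sum.reindex_bij_betw[OF permutes_imp_bij[OF \<sigma>], of "\<lambda>j. f (permute_list \<sigma> (vs[j := L (vs ! j)]))"] by simp
  finally show ?thesis by simp
qed

locale spin_manifold = riemannian A g
  for A :: "('m::{t2_space, second_countable_topology}, 'n::finite) chart set" and g :: "('m, 'n) metric" +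
  fixes \<Gamma> :: "'n \<Rightarrow> complex ^ 's ^ 's::finite"
    and I :: "'a set" and U :: "'a \<Rightarrow> 'm set" and E :: "('a, 'm, 'n) frames"
    and t :: "'a \<Rightarrow> 'a \<Rightarrow> 'm \<Rightarrow> complex ^ 's ^ 's"
  assumes rep: "clifford_rep \<Gamma>" and spin: "spin_structure A g \<Gamma> I U E t"
begin

lemma open_U: "a \<in> I \<Longrightarrow> open (U a)"
  using spin[unfolded spin_structure_def, THEN conjunct1] by blast

lemma cover: "\<exists>a. a \<in> I \<and> x \<in> U a"
  using spin[unfolded spin_structure_def, THEN conjunct2, THEN conjunct1] by blast

lemma frame_smooth: "a \<in> I \<Longrightarrow> c \<in> A \<Longrightarrow> smooth_in c (U a) (E a i c)"
  using spin[unfolded spin_structure_def, THEN conjunct2, THEN conjunct2, THEN conjunct1] unfolding vector_field_on_def by blast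

lemma frame_change: "a \<in> I \<Longrightarrow> c \<in> A \<Longrightarrow> c' \<in> A \<Longrightarrow> x \<in> U a \<inter> fst c \<inter> fst c' \<Longrightarrow>
    E a i c' x = jacobian c c' x (E a i c x)"
  using spin[unfolded spin_structure_def, THEN conjunct2, THEN conjunct2, THEN conjunct1] unfolding vector_field_on_def by blast

lemma orthonormal: "a \<in> I \<Longrightarrow> c \<in> A \<Longrightarrow> x \<in> U a \<inter> fst c \<Longrightarrow>
    bil (g c x) (E a i c x) (E a j c x) = (if i = j then 1 else 0)"
  using spin[unfolded spin_structure_def, THEN conjunct2, THEN conjunct2, THEN conjunct2, THEN conjunct1] by blast

lemma transition_spin: "a \<in> I \<Longrightarrow> b \<in> I \<Longrightarrow> x \<in> U a \<inter> U b \<Longrightarrow> t a b x \<in> spin_group \<Gamma>"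
  using spin[unfolded spin_structure_def, THEN conjunct2, THEN conjunct2, THEN conjunct2, THEN conjunct2, THEN conjunct2, THEN conjunct1] by blast

lemma transition_intertwines: "a \<in> I \<Longrightarrow> b \<in> I \<Longrightarrow> c \<in> A \<Longrightarrow> x \<in> U a \<inter> U b \<inter> fst c \<Longrightarrow>
    cvec \<Gamma> (frame_coords g E a c x (E b j c x)) ** t a b x = t a b x ** \<Gamma> j"
  using spin[unfolded spin_structure_def, THEN conjunct2, THEN conjunct2, THEN conjunct2, THEN conjunct2, THEN conjunct2, THEN conjunct2, THEN conjunct1] by blast

lemma cl_expand: "cl g \<Gamma> E a c x v \<eta> = (\<Sum>i\<in>UNIV. bil (g c x) (E a i c x) v *\<^sub>R (\<Gamma> i *v \<eta>))"
  by (simp add: cl_def cvec_vector frame_coords_def)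

text \<open>Parseval's identity: the trace of g(p, u) g(q, v) is evaluated both in the frame and by
  the reproducing identity.\<close>

lemma frame_coords_inner:
  assumes "a \<in> I" "c \<in> A" "x \<in> U a \<inter> fst c"
  shows "frame_coords g E a c x u \<bullet> frame_coords g E a c x v = bil (g c x) u v"
proof -
  have G: "gram (g c x)" using gram assms by blast
  have "mtrace (g c x) (\<lambda>p q. bil (g c x) p u *\<^sub>R bil (g c x) q v) =
      (\<Sum>i\<in>UNIV. bil (g c x) (E a i c x) u *\<^sub>R bil (g c x) (E a i c x) v)"
  proof (rule mtrace_orthonormal[OF G])
    show "bil (g c x) (E a i c x) (E a j c x) = (if i = j then 1 else 0)" for i j
      by (rule orthonormal[OF assms])
    show "linear (\<lambda>q. bil (g c x) p u *\<^sub>R bil (g c x) q v)" for p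
      by (intro linear_compose_scale_right linear_bil_left)
    show "linear (\<lambda>p. bil (g c x) p u *\<^sub>R bil (g c x) q v)" for q
      using linear_compose_scale_right[OF linear_bil_left, of "bil (g c x) q v" "g c x" u] by (simp add: mult.commute)
  qed
  then show ?thesis
    using mtrace_reproduce[OF G linear_bil_left[of "g c x" v], of u] by (simp add: frame_coords_def inner_vec_def)
qed

lemma cl_frame:
  assumes "a \<in> I" "c \<in> A" "x \<in> U a \<inter> fst c"
  shows "cl g \<Gamma> E a c x (E a j c x) \<eta> = \<Gamma> j *v \<eta>"
  unfolding cl_expand orthonormal[OF assms] by (simp add: if_distrib[of "\<lambda>c. c *\<^sub>R _"] cong: if_cong)

text \<open>Makes the pointwise algebra available at each point, in each trivialisation around
  it.\<close>

lemma spinor_pairing_at: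
  assumes "a \<in> I" "c \<in> A" "x \<in> U a \<inter> fst c"
  shows "spinor_pairing (g c x) (cl g \<Gamma> E a c x) (\<lambda>i. E a i c x)"
proof (intro spinor_pairing.intro clifford_action.intro spinor_pairing_axioms.intro)
  show "linear (\<lambda>v. cl g \<Gamma> E a c x v \<psi>)" for \<psi>
    unfolding cl_expand
    by (rule linearI) (simp_all add: linear_add[OF linear_bil_right] linear_cmul[OF linear_bil_right]
        scaleR_add_left sum.distrib scaleR_sum_right)
  show "linear (cl g \<Gamma> E a c x v)" for v
    unfolding cl_def[abs_def] by (rule linear_matrix_vector)
  show "cl g \<Gamma> E a c x u (cl g \<Gamma> E a c x v \<psi>) + cl g \<Gamma> E a c x v (cl g \<Gamma> E a c x u \<psi>) =
      (2 * bil (g c x) u v) *\<^sub>R \<psi>" for u v \<psi>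
    unfolding cl_def cvec_clifford[OF rep] frame_coords_inner[OF assms] ..
  show "gram (g c x)" using gram assms by blast
  show "herm (cl g \<Gamma> E a c x v \<theta>) \<psi> = herm \<theta> (cl g \<Gamma> E a c x v \<psi>)" for v \<theta> \<psi>
    unfolding cl_def by (rule herm_cvec[OF rep])
  show "cl g \<Gamma> E a c x v (r *s \<psi>) = r *s cl g \<Gamma> E a c x v \<psi>" for v r \<psi>
    unfolding cl_def by (rule matrix_vector_smult)
  show "bil (g c x) (E a i c x) (E a j c x) = (if i = j then 1 else 0)" for i j
    by (rule orthonormal[OF assms])
qed

text \<open>The cocycle is assumed to intertwine the members of the frame \<open>E b\<close> with
  the generators; expansion in that frame extends this to all vectors.\<close>

lemma cl_transition:
  assumes ab: "a \<in> I" "b \<in> I" and c: "c \<in> A" and x: "x \<in> U a \<inter> U b \<inter> fst c"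
  shows "cl g \<Gamma> E a c x v (t a b x *v \<eta>) = t a b x *v cl g \<Gamma> E b c x v \<eta>"
proof -
  have xa: "x \<in> U a \<inter> fst c" and xb: "x \<in> U b \<inter> fst c" using x by auto
  interpret a: spinor_pairing "g c x" "cl g \<Gamma> E a c x" "\<lambda>i. E a i c x" by (rule spinor_pairing_at[OF ab(1) c xa])
  interpret b: spinor_pairing "g c x" "cl g \<Gamma> E b c x" "\<lambda>i. E b i c x" by (rule spinor_pairing_at[OF ab(2) c xb])
  have "cl g \<Gamma> E a c x (E b j c x) (t a b x *v \<eta>) = t a b x *v (\<Gamma> j *v \<eta>)" for j
    unfolding cl_def matrix_vector_mul_assoc transition_intertwines[OF ab c x] ..
  then have "cl g \<Gamma> E a c x v (t a b x *v \<eta>) = (\<Sum>j\<in>UNIV. bil (g c x) v (E b j c x) *\<^sub>R (t a b x *v (\<Gamma> j *v \<eta>)))"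
    using b.frame_expand[OF a.linear_vector[of "t a b x *v \<eta>"], of v] by simp
  also have "\<dots> = t a b x *v cl g \<Gamma> E b c x v \<eta>"
    unfolding cl_expand[of b] gram_sym[OF a.gram, of v]
    by (simp add: linear_sum[OF linear_matrix_vector] linear_cmul[OF linear_matrix_vector])
  finally show ?thesis .
qed

lemma foldr_cl_transition:
  assumes "a \<in> I" "b \<in> I" "c \<in> A" "x \<in> U a \<inter> U b \<inter> fst c"
  shows "foldr (cl g \<Gamma> E a c x) vs (t a b x *v \<eta>) = t a b x *v foldr (cl g \<Gamma> E b c x) vs \<eta>"
  by (induction vs) (simp_all add: cl_transition[OF assms])

lemma cl_change:
  assumes "a \<in> I" "c \<in> A" "c' \<in> A" "x \<in> U a \<inter> fst c \<inter> fst c'"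
  shows "cl g \<Gamma> E a c' x (jacobian c c' x v) = cl g \<Gamma> E a c x v"
proof
  fix \<eta>
  have "bil (g c' x) (E a i c' x) (jacobian c c' x v) = bil (g c x) (E a i c x) v" for i
    using isometry[of c c' x "E a i c x" v] assms unfolding frame_change[OF assms] by auto
  then show "cl g \<Gamma> E a c' x (jacobian c c' x v) \<eta> = cl g \<Gamma> E a c x v \<eta>"
    unfolding cl_expand by simp
qed

section \<open>Derivatives of spinors\<close>

definition conn :: "'a \<Rightarrow> ('m, 'n) chart \<Rightarrow> 'm \<Rightarrow> real ^ 'n \<Rightarrow> 'n \<Rightarrow> 'n \<Rightarrow> real" where
  "conn a c x u i j = bil (g c x) (E a i c x) (nabla_vec g c x u (E a j))"

text \<open>The connection matrix in the spin representation of so(n), from which the 1/4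
  comes.\<close>

definition conn_action :: "'a \<Rightarrow> ('m, 'n) chart \<Rightarrow> 'm \<Rightarrow> real ^ 'n \<Rightarrow> complex ^ 's \<Rightarrow> complex ^ 's" where
  "conn_action a c x u \<eta> = (\<Sum>i\<in>UNIV. \<Sum>j\<in>UNIV. (1 / 4 * conn a c x u i j) *\<^sub>R (\<Gamma> i *v (\<Gamma> j *v \<eta>)))"

lemma nabla_spin_eq: "nabla_spin g \<Gamma> E a c x u \<psi> = deriv_in c (\<psi> a) x u + conn_action a c x u (\<psi> a x)"
  by (simp add: nabla_spin_def conn_action_def conn_def)

context
  fixes a c x
  assumes a: "a \<in> I" and c: "c \<in> A" and x: "x \<in> U a \<inter> fst c"
begin

interpretation sp: spinor_pairing "g c x" "cl g \<Gamma> E a c x" "\<lambda>i. E a i c x"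
  by (rule spinor_pairing_at[OF a c x])

lemma frame_has_derivative: "chart_derivative c (E a i c) x (deriv_in c (E a i c) x)"
  by (rule smooth_in_has_derivative[OF frame_smooth[OF a c] x])

text \<open>The inner products of frame vectors are constant on \<open>U a\<close>; their derivative
  is rewritten by metric compatibility.\<close>

lemma conn_antisym: "conn a c x u i j = - conn a c x u j i"
proof -
  have x': "x \<in> fst c" using x by simp
  have "chart_derivative c (\<lambda>y. bil (g c y) (E a i c y) (E a j c y)) x
      (\<lambda>u. bil (deriv_in c (g c) x u) (E a i c x) (E a j c x) + bil (g c x) (deriv_in c (E a i c) x u) (E a j c x) +
        bil (g c x) (E a i c x) (deriv_in c (E a j c) x u))"
    by (intro chart_derivative_bil regular c x' metric_has_derivative frame_has_derivative)
  moreover have "chart_derivative c (\<lambda>y. bil (g c y) (E a i c y) (E a j c y)) x (\<lambda>u. 0)"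
    by (rule chart_derivative_cong[OF regular[OF c] open_U[OF a] x, of "\<lambda>y. if i = j then 1 else 0"])
      (simp_all add: orthonormal[OF a c])
  ultimately have "bil (deriv_in c (g c) x u) (E a i c x) (E a j c x) +
      bil (g c x) (deriv_in c (E a i c) x u) (E a j c x) + bil (g c x) (E a i c x) (deriv_in c (E a j c) x u) = 0"
    by (rule fun_cong[OF has_derivative_unique])
  then have "bil (g c x) (nabla_vec g c x u (E a i)) (E a j c x) + bil (g c x) (E a i c x) (nabla_vec g c x u (E a j)) = 0"
    using metric_compatible[OF c x', of u "E a i c x" "E a j c x"]
    by (simp add: nabla_vec_def dg_def linear_add[OF linear_bil_left] linear_add[OF linear_bil_right])
  then show ?thesis
    unfolding conn_def using gram_sym[OF sp.gram, of "E a j c x"] by simp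
qed

text \<open>The frame components of a constant coordinate vector vary through the Christoffel symbol
  and through the rotation of the frame; the derivative of E_i, expanded in the frame, expresses the
  latter by connection coefficients.\<close>

lemma frame_coord_has_derivative:
  "chart_derivative c (\<lambda>y. bil (g c y) (E a i c y) w) x
    (\<lambda>u. bil (g c x) (E a i c x) (christoffel g c x u w) - (\<Sum>j\<in>UNIV. conn a c x u i j * bil (g c x) (E a j c x) w))"
proof -
  have x': "x \<in> fst c" using x by simp
  have const: "chart_derivative c (\<lambda>y. w) x (\<lambda>u. 0)" by simp
  have eq: "bil (deriv_in c (g c) x u) (E a i c x) w + bil (g c x) (deriv_in c (E a i c) x u) w +
      bil (g c x) (E a i c x) 0 =
      bil (g c x) (E a i c x) (christoffel g c x u w) - (\<Sum>j\<in>UNIV. conn a c x u i j * bil (g c x) (E a j c x) w)" for u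
  proof -
    have "bil (g c x) w (nabla_vec g c x u (E a i)) = (\<Sum>j\<in>UNIV. bil (g c x) w (E a j c x) * conn a c x u j i)"
      unfolding conn_def using sp.frame_expand[OF linear_bil_left, of w "g c x"] by simp
    also have "\<dots> = - (\<Sum>j\<in>UNIV. conn a c x u i j * bil (g c x) (E a j c x) w)"
      unfolding sum_negf[symmetric]
      by (intro sum.cong refl) (simp add: conn_antisym[of u _ i] gram_sym[OF sp.gram, of w] mult.commute)
    finally have "bil (g c x) (nabla_vec g c x u (E a i)) w = - (\<Sum>j\<in>UNIV. conn a c x u i j * bil (g c x) (E a j c x) w)"
      using gram_sym[OF sp.gram, of w] by simp
    then show ?thesis
      using metric_compatible[OF c x', of u "E a i c x" w]
      by (simp add: nabla_vec_def dg_def linear_add[OF linear_bil_left] linear_0[OF linear_bil_right])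
  qed
  show ?thesis
    using chart_derivative_bil[OF regular[OF c] x' metric_has_derivative[OF c x'] frame_has_derivative[of i] const]
    unfolding eq .
qed

text \<open>The commutator of the spin connection with a vector is the vector rotated by the
  connection matrix. Moving the vector past two generators gives two sums of weight 1/2, which
  antisymmetry makes equal.\<close>

lemma conn_action_commutator:
  "conn_action a c x u (cl g \<Gamma> E a c x w \<eta>) = cl g \<Gamma> E a c x w (conn_action a c x u \<eta>) +
     (\<Sum>i\<in>UNIV. (\<Sum>j\<in>UNIV. conn a c x u i j * bil (g c x) (E a j c x) w) *\<^sub>R (\<Gamma> i *v \<eta>))"
proof -
  let ?cl = "cl g \<Gamma> E a c x" and ?e = "\<lambda>i. E a i c x" and ?C = "conn a c x u"
  let ?q = "\<lambda>i. bil (g c x) (?e i) w"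
  have comm: "\<Gamma> i *v (\<Gamma> j *v ?cl w \<eta>) = ?cl w (\<Gamma> i *v (\<Gamma> j *v \<eta>)) - 2 *\<^sub>R (?q i *\<^sub>R (\<Gamma> j *v \<eta>)) + 2 *\<^sub>R (?q j *\<^sub>R (\<Gamma> i *v \<eta>))" for i j
    using sp.graded_commutator[of w "[?e i, ?e j]" \<eta>]
    by (simp add: esum_Cons cl_frame[OF a c x] gram_sym[OF sp.gram, of w] scaleR_diff_right)
  have S1: "conn_action a c x u (?cl w \<eta>) = ?cl w (conn_action a c x u \<eta>) -
      (\<Sum>i\<in>UNIV. \<Sum>j\<in>UNIV. (1 / 2 * ?C i j * ?q i) *\<^sub>R (\<Gamma> j *v \<eta>)) +
      (\<Sum>i\<in>UNIV. \<Sum>j\<in>UNIV. (1 / 2 * ?C i j * ?q j) *\<^sub>R (\<Gamma> i *v \<eta>))"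
    unfolding conn_action_def comm
    by (simp add: scaleR_diff_right scaleR_add_right sum.distrib sum_subtractf linear_sum[OF sp.linear_spinor]
        linear_cmul[OF sp.linear_spinor])
  have "(\<Sum>i\<in>UNIV. \<Sum>j\<in>UNIV. (1 / 2 * ?C i j * ?q i) *\<^sub>R (\<Gamma> j *v \<eta>)) =
      - (\<Sum>i\<in>UNIV. \<Sum>j\<in>UNIV. (1 / 2 * ?C i j * ?q j) *\<^sub>R (\<Gamma> i *v \<eta>))"
    unfolding sum_negf[symmetric]
    by (subst sum.swap, intro sum.cong refl) (subst conn_antisym, simp)
  then have "conn_action a c x u (?cl w \<eta>) = ?cl w (conn_action a c x u \<eta>) +
      2 *\<^sub>R (\<Sum>i\<in>UNIV. \<Sum>j\<in>UNIV. (1 / 2 * ?C i j * ?q j) *\<^sub>R (\<Gamma> i *v \<eta>))"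
    unfolding S1 by (simp add: scaleR_2)
  then show ?thesis by (simp add: scaleR_sum_right scaleR_sum_left)
qed

text \<open>The adjoint reverses the two generators, and the coefficients are antisymmetric.\<close>

lemma herm_conn_action: "herm (conn_action a c x u \<theta>) \<psi> = - herm \<theta> (conn_action a c x u \<psi>)"
proof -
  have sym: "herm (\<Gamma> i *v (\<Gamma> j *v \<theta>)) \<psi> = herm \<theta> (\<Gamma> j *v (\<Gamma> i *v \<psi>))" for i j
    using rep by (simp add: clifford_rep_def)
  have "herm (conn_action a c x u \<theta>) \<psi> =
      (\<Sum>i\<in>UNIV. \<Sum>j\<in>UNIV. (1 / 4 * conn a c x u i j) *\<^sub>R herm \<theta> (\<Gamma> j *v (\<Gamma> i *v \<psi>)))"
    unfolding conn_action_def
    by (simp only: linear_sum[OF linear_herm_left] linear_cmul[OF linear_herm_left] sym)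
  also have "\<dots> = - (\<Sum>i\<in>UNIV. \<Sum>j\<in>UNIV. (1 / 4 * conn a c x u i j) *\<^sub>R herm \<theta> (\<Gamma> i *v (\<Gamma> j *v \<psi>)))"
    unfolding sum_negf[symmetric]
    by (subst sum.swap, intro sum.cong refl) (subst conn_antisym, simp)
  also have "\<dots> = - herm \<theta> (conn_action a c x u \<psi>)"
    unfolding conn_action_def
    by (simp only: linear_sum[OF linear_herm_right] linear_cmul[OF linear_herm_right])
  finally show ?thesis .
qed

text \<open>Clifford multiplication is parallel. Differentiating the frame components of a new
  factor gives a Christoffel term and a rotation term; the latter is a commutator with the spin
  connection, so the connection term of the inner product is carried outside the longer one.\<close>

lemma foldr_cl_has_derivative:
  assumes \<epsilon>: "smooth_in c (U a) (\<epsilon> a)"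
  shows "chart_derivative c (\<lambda>y. foldr (cl g \<Gamma> E a c y) vs (\<epsilon> a y)) x
    (\<lambda>u. (\<Sum>j<length vs. foldr (cl g \<Gamma> E a c x) (vs[j := christoffel g c x u (vs ! j)]) (\<epsilon> a x)) +
      foldr (cl g \<Gamma> E a c x) vs (nabla_spin g \<Gamma> E a c x u \<epsilon>) -
      conn_action a c x u (foldr (cl g \<Gamma> E a c x) vs (\<epsilon> a x)))"
proof (induction vs)
  case Nil
  then show ?case
    using smooth_in_has_derivative[OF \<epsilon> x] by (simp add: nabla_spin_eq)
next
  case (Cons w vs)
  let ?cl = "cl g \<Gamma> E a c x" and ?F = "\<lambda>y. foldr (cl g \<Gamma> E a c y) vs (\<epsilon> a y)"
  have x': "x \<in> fst c" using x by simp
  let ?D = "\<lambda>u. (\<Sum>j<length vs. foldr ?cl (vs[j := christoffel g c x u (vs ! j)]) (\<epsilon> a x)) +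
      foldr ?cl vs (nabla_spin g \<Gamma> E a c x u \<epsilon>) - conn_action a c x u (?F x)"
  have "chart_derivative c (\<lambda>y. \<Sum>i\<in>UNIV. bil (g c y) (E a i c y) w *\<^sub>R (\<Gamma> i *v ?F y)) x
      (\<lambda>u. \<Sum>i\<in>UNIV. bil (g c x) (E a i c x) w *\<^sub>R (\<Gamma> i *v ?D u) +
        (bil (g c x) (E a i c x) (christoffel g c x u w) -
          (\<Sum>j\<in>UNIV. conn a c x u i j * bil (g c x) (E a j c x) w)) *\<^sub>R (\<Gamma> i *v ?F x))"
    by (intro chart_derivative_sum chart_derivative_bilinear[OF bounded_bilinear_scaleR regular[OF c] x']
        frame_coord_has_derivative Cons.IH
        chart_derivative_bounded_linear[OF linear_conv_bounded_linear[THEN iffD1, OF linear_matrix_vector]])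
  moreover have "(\<Sum>i\<in>UNIV. bil (g c x) (E a i c x) w *\<^sub>R (\<Gamma> i *v ?D u) +
        (bil (g c x) (E a i c x) (christoffel g c x u w) -
          (\<Sum>j\<in>UNIV. conn a c x u i j * bil (g c x) (E a j c x) w)) *\<^sub>R (\<Gamma> i *v ?F x)) =
      (\<Sum>j<length (w # vs). foldr ?cl ((w # vs)[j := christoffel g c x u ((w # vs) ! j)]) (\<epsilon> a x)) +
      foldr ?cl (w # vs) (nabla_spin g \<Gamma> E a c x u \<epsilon>) - conn_action a c x u (foldr ?cl (w # vs) (\<epsilon> a x))" for u
  proof -
    have "(\<Sum>i\<in>UNIV. bil (g c x) (E a i c x) w *\<^sub>R (\<Gamma> i *v ?D u) +
        (bil (g c x) (E a i c x) (christoffel g c x u w) -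
          (\<Sum>j\<in>UNIV. conn a c x u i j * bil (g c x) (E a j c x) w)) *\<^sub>R (\<Gamma> i *v ?F x)) =
      ?cl w (?D u) + ?cl (christoffel g c x u w) (?F x) -
      (\<Sum>i\<in>UNIV. (\<Sum>j\<in>UNIV. conn a c x u i j * bil (g c x) (E a j c x) w) *\<^sub>R (\<Gamma> i *v ?F x))"
      unfolding cl_expand scaleR_diff_left sum.distrib sum_subtractf by (simp only: add_diff_eq)
    \<comment> \<open>The rotation of the frame is rewritten as a commutator, half of which cancels
      the connection term inside \<open>?D\<close>.\<close>
    also have "\<dots> = ?cl w (?D u) + ?cl (christoffel g c x u w) (?F x) -
      (conn_action a c x u (?cl w (?F x)) - ?cl w (conn_action a c x u (?F x)))"
      unfolding conn_action_commutator by (simp only: add_diff_cancel_left')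
    also have "?cl w (?D u) = (\<Sum>j<length vs. ?cl w (foldr ?cl (vs[j := christoffel g c x u (vs ! j)]) (\<epsilon> a x))) +
        ?cl w (foldr ?cl vs (nabla_spin g \<Gamma> E a c x u \<epsilon>)) - ?cl w (conn_action a c x u (?F x))"
      by (simp only: linear_add[OF sp.linear_spinor] linear_diff[OF sp.linear_spinor] linear_sum[OF sp.linear_spinor])
    finally show ?thesis
      unfolding length_Cons sum.lessThan_Suc_shift by (simp add: algebra_simps)
  qed
  ultimately have "chart_derivative c (\<lambda>y. \<Sum>i\<in>UNIV. bil (g c y) (E a i c y) w *\<^sub>R (\<Gamma> i *v ?F y)) x
      (\<lambda>u. (\<Sum>j<length (w # vs). foldr ?cl ((w # vs)[j := christoffel g c x u ((w # vs) ! j)]) (\<epsilon> a x)) +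
      foldr ?cl (w # vs) (nabla_spin g \<Gamma> E a c x u \<epsilon>) - conn_action a c x u (foldr ?cl (w # vs) (\<epsilon> a x)))"
    by (simp only:)
  moreover have "(\<lambda>y. foldr (cl g \<Gamma> E a c y) (w # vs) (\<epsilon> a y)) =
      (\<lambda>y. \<Sum>i\<in>UNIV. bil (g c y) (E a i c y) w *\<^sub>R (\<Gamma> i *v ?F y))"
    unfolding foldr_Cons o_def cl_expand[of a c _ w] ..
  ultimately show ?case by (simp only:)
qed

text \<open>The connection terms from the two slots of the pairing cancel because the connection
  acts by anti-Hermitian operators; plain derivatives of spinors are thereby replaced by covariant
  ones.\<close>

lemma herm_foldr_has_derivative:
  assumes \<epsilon>: "smooth_in c (U a) (\<epsilon> a)"
  shows "chart_derivative c (\<lambda>y. herm (\<epsilon> a y) (foldr (cl g \<Gamma> E a c y) vs (\<epsilon> a y))) x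
    (\<lambda>u. (\<Sum>j<length vs. herm (\<epsilon> a x) (foldr (cl g \<Gamma> E a c x) (vs[j := christoffel g c x u (vs ! j)]) (\<epsilon> a x))) +
      herm (nabla_spin g \<Gamma> E a c x u \<epsilon>) (foldr (cl g \<Gamma> E a c x) vs (\<epsilon> a x)) +
      herm (\<epsilon> a x) (foldr (cl g \<Gamma> E a c x) vs (nabla_spin g \<Gamma> E a c x u \<epsilon>)))"
proof -
  have x': "x \<in> fst c" using x by simp
  have d: "deriv_in c (\<epsilon> a) x u = nabla_spin g \<Gamma> E a c x u \<epsilon> - conn_action a c x u (\<epsilon> a x)" for u
    by (simp add: nabla_spin_eq)
  let ?cl = "cl g \<Gamma> E a c x"
  have eq: "herm (\<epsilon> a x) ((\<Sum>j<length vs. foldr ?cl (vs[j := christoffel g c x u (vs ! j)]) (\<epsilon> a x)) +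
      foldr ?cl vs (nabla_spin g \<Gamma> E a c x u \<epsilon>) - conn_action a c x u (foldr ?cl vs (\<epsilon> a x))) +
      herm (deriv_in c (\<epsilon> a) x u) (foldr ?cl vs (\<epsilon> a x)) =
    (\<Sum>j<length vs. herm (\<epsilon> a x) (foldr ?cl (vs[j := christoffel g c x u (vs ! j)]) (\<epsilon> a x))) +
      herm (nabla_spin g \<Gamma> E a c x u \<epsilon>) (foldr ?cl vs (\<epsilon> a x)) +
      herm (\<epsilon> a x) (foldr ?cl vs (nabla_spin g \<Gamma> E a c x u \<epsilon>))" for u
    unfolding d linear_diff[OF linear_herm_left] linear_diff[OF linear_herm_right] linear_add[OF linear_herm_right]
      linear_sum[OF linear_herm_right] herm_conn_action by simp
  show ?thesis
    using chart_derivative_bilinear[OF bounded_bilinear_herm regular[OF c] x' smooth_in_has_derivative[OF \<epsilon> x]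
        foldr_cl_has_derivative[where \<epsilon> = \<epsilon>, OF \<epsilon>, of vs]]
    unfolding eq .
qed

end

end

section \<open>The bilinears of a parallel spinor\<close>

locale spin_field = spin_manifold A g \<Gamma> I U E t
  for A :: "('m::{t2_space, second_countable_topology}, 'n::finite) chart set" and g :: "('m, 'n) metric"
    and \<Gamma> :: "'n \<Rightarrow> complex ^ 's ^ 's::finite"
    and I :: "'a set" and U :: "'a \<Rightarrow> 'm set" and E :: "('a, 'm, 'n) frames"
    and t :: "'a \<Rightarrow> 'a \<Rightarrow> 'm \<Rightarrow> complex ^ 's ^ 's" +
  fixes \<epsilon> :: "('a, 'm, 's) spinor"
  assumes spinor: "spinor_field A I U t \<epsilon>"
begin

abbreviation "\<chi>' \<equiv> spinor_bilinear g \<Gamma> I U E \<epsilon>"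

lemma spinor_smooth: "a \<in> I \<Longrightarrow> c \<in> A \<Longrightarrow> smooth_in c (U a) (\<epsilon> a)"
  using spinor unfolding spinor_field_def by blast

lemma spinor_transition: "a \<in> I \<Longrightarrow> b \<in> I \<Longrightarrow> x \<in> U a \<inter> U b \<Longrightarrow> \<epsilon> a x = t a b x *v \<epsilon> b x"
  using spinor unfolding spinor_field_def by blast

text \<open>The trivialisation chosen by \<open>SOME\<close> may be exchanged for any other one
  around \<open>x\<close>: the cocycle intertwines the Clifford actions and preserves the
  pairing.\<close>

lemma bilinear_value:
  assumes a: "a \<in> I" and c: "c \<in> A" and x: "x \<in> U a \<inter> fst c"
  shows "\<chi>' p c x vs = (if length vs = p then \<i> ^ (p div 2) / fact p *
     alternator vs (\<lambda>ws. herm (\<epsilon> a x) (foldr (cl g \<Gamma> E a c x) ws (\<epsilon> a x))) else 0)"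
proof -
  define b where "b = (SOME a. a \<in> I \<and> x \<in> U a)"
  have b: "b \<in> I" "x \<in> U b" using someI_ex[OF cover[of x]] by (simp_all add: b_def)
  have "herm (\<epsilon> b x) (foldr (cl g \<Gamma> E b c x) ws (\<epsilon> b x)) = herm (\<epsilon> a x) (foldr (cl g \<Gamma> E a c x) ws (\<epsilon> a x))" for ws
  proof -
    have x': "x \<in> U b \<inter> U a \<inter> fst c" "x \<in> U b \<inter> U a" using x b by auto
    show ?thesis
      unfolding spinor_transition[OF b(1) a x'(2)] foldr_cl_transition[OF b(1) a c x'(1)]
      by (rule herm_spin_group[OF rep transition_spin[OF b(1) a x'(2)]])
  qed
  then show ?thesis
    unfolding spinor_bilinear_def Let_def b_def[symmetric] by (simp add: alternator_def scaleR_conv_of_real)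
qed

lemma bilinear_eq_chi_form:
  assumes a: "a \<in> I" and c: "c \<in> A" and x: "x \<in> U a \<inter> fst c"
  shows "\<chi>' p c x = spinor_pairing.chi_form (cl g \<Gamma> E a c x) (\<epsilon> a x) p"
proof
  fix vs
  interpret sp: spinor_pairing "g c x" "cl g \<Gamma> E a c x" "\<lambda>i. E a i c x" by (rule spinor_pairing_at[OF a c x])
  show "\<chi>' p c x vs = spinor_pairing.chi_form (cl g \<Gamma> E a c x) (\<epsilon> a x) p vs"
    unfolding bilinear_value[OF assms] sp.chi_form_def sp.kform_def sp.pform_def sp.alt_prod_def
      linear_cmul[OF linear_herm_right] alternator_linear[OF linear_herm_right]
    by (auto simp: scaleR_conv_of_real)
qed

lemma smooth_foldr_cl:
  assumes a: "a \<in> I" and c: "c \<in> A"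
  shows "smooth_in c (U a) (\<lambda>y. foldr (cl g \<Gamma> E a c y) vs (\<epsilon> a y))"
proof (induction vs)
  case Nil
  then show ?case by (simp add: spinor_smooth[OF a c])
next
  case (Cons w vs)
  note r = regular[OF c] open_U[OF a]
  have "smooth_in c (U a) (\<lambda>y. bil (g c y) (E a i c y) w)" for i
    unfolding bil_inner
    by (intro smooth_in_bilinear[OF r bounded_bilinear_inner] smooth_in_bilinear[OF r bounded_bilinear_matrix_vector]
        frame_smooth a c smooth_in_subset[OF smooth_metric[OF c] subset_UNIV] smooth_in_const)
  then have "smooth_in c (U a) (\<lambda>y. \<Sum>i\<in>UNIV. bil (g c y) (E a i c y) w *\<^sub>R (\<Gamma> i *v foldr (cl g \<Gamma> E a c y) vs (\<epsilon> a y)))"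
    by (intro smooth_in_sum[OF r] smooth_in_scaleR[OF r] Cons.IH
        smooth_in_bounded_linear[OF r linear_conv_bounded_linear[THEN iffD1, OF linear_matrix_vector]])
  then show ?case unfolding foldr_Cons o_def cl_expand[of a c _ w] .
qed

text \<open>The chosen trivialisation may jump from point to point, so smoothness is checked on each
  \<open>U a\<close> after passing to a fixed one. Under a change of chart the frame components of
  the arguments are unchanged.\<close>

lemma is_form_bilinear: "is_form A p (\<chi>' p)"
proof (rule is_formI)
  fix c assume c: "c \<in> A"
  show "smooth_form c p (\<chi>' p c)"
  proof (rule smooth_formI)
    fix x assume x: "x \<in> fst c"
    obtain a where a: "a \<in> I" "x \<in> U a" using cover by blast
    then have x': "x \<in> U a \<inter> fst c" using x by simp
    interpret sp: spinor_pairing "g c x" "cl g \<Gamma> E a c x" "\<lambda>i. E a i c x" by (rule spinor_pairing_at[OF a(1) c x'])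
    show "alt_form p (\<chi>' p c x)"
      unfolding bilinear_eq_chi_form[OF a(1) c x'] by (rule sp.alt_form_chi_form)
  next
    fix vs
    show "smooth_in c UNIV (\<lambda>x. \<chi>' p c x vs)"
    proof (cases "length vs = p")
      case True
      show ?thesis
      proof (rule smooth_in_local[OF regular[OF c]])
        fix x assume "x \<in> fst c"
        obtain a where a: "a \<in> I" "x \<in> U a" using cover by blast
        note r = regular[OF c] open_U[OF a(1)]
        have "smooth_in c (U a) (\<lambda>x. \<i> ^ (p div 2) / fact p *
            alternator vs (\<lambda>ws. herm (\<epsilon> a x) (foldr (cl g \<Gamma> E a c x) ws (\<epsilon> a x))))"
          unfolding alternator_def
          by (intro smooth_in_cmult[OF r] smooth_in_sum[OF r] smooth_in_scaleR[OF r] smooth_in_const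
              smooth_in_bilinear[OF r bounded_bilinear_herm] spinor_smooth a c smooth_foldr_cl)
        then have "smooth_in c (U a) (\<lambda>x. \<chi>' p c x vs)"
          by (rule smooth_in_cong[OF r]) (simp add: bilinear_value[OF a(1) c] True)
        then show "\<exists>W. open W \<and> x \<in> W \<and> smooth_in c W (\<lambda>x. \<chi>' p c x vs)"
          using a r by blast
      qed
    next
      case False
      then have "(\<lambda>x. \<chi>' p c x vs) = (\<lambda>x. 0)" by (simp add: spinor_bilinear_def)
      then show ?thesis by simp
    qed
  qed
next
  fix c c' x assume c: "c \<in> A" "c' \<in> A" "x \<in> fst c" "x \<in> fst c'"
  obtain a where a: "a \<in> I" "x \<in> U a" using cover by blast
  have x: "x \<in> U a \<inter> fst c" "x \<in> U a \<inter> fst c'" "x \<in> U a \<inter> fst c \<inter> fst c'" using a c by auto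
  have "foldr (cl g \<Gamma> E a c' x) (map (jacobian c c' x) ws) \<eta> = foldr (cl g \<Gamma> E a c x) ws \<eta>" for ws \<eta>
    by (induction ws) (simp_all add: cl_change[OF a(1) c(1,2) x(3)])
  then show "\<chi>' p c x = pull (jacobian c c' x) (\<chi>' p c' x)"
    by (intro ext) (simp add: pull_def bilinear_value[OF a(1) c(1) x(1)] bilinear_value[OF a(1) c(2) x(2)] alternator_map)
qed

lemma multi_form_bilinear: "multi_form A \<chi>'"
  by (simp add: multi_form_def is_form_bilinear)

text \<open>The Christoffel terms in the derivative of the Clifford products are exactly those
  subtracted in \<open>nabla_form\<close>, so only the covariant derivatives of the two spinors
  remain.\<close>

lemma nabla_bilinear:
  fixes u :: "real ^ 'n"
  assumes a: "a \<in> I" and c: "c \<in> A" and x: "x \<in> U a \<inter> fst c"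
  defines "\<delta> \<equiv> nabla_spin g \<Gamma> E a c x u \<epsilon>" and "K \<equiv> clifford_action.alt_prod (cl g \<Gamma> E a c x)"
  shows "nabla_form g c x u (\<chi>' p) vs = (if length vs = p
     then \<i> ^ (p div 2) * (herm \<delta> (K vs (\<epsilon> a x)) + herm (\<epsilon> a x) (K vs \<delta>)) else 0)"
proof (cases "length vs = p")
  case len: True
  interpret sp: spinor_pairing "g c x" "cl g \<Gamma> E a c x" "\<lambda>i. E a i c x" by (rule spinor_pairing_at[OF a c x])
  let ?k = "\<i> ^ (p div 2) / fact p" and ?cl = "cl g \<Gamma> E a c x" and ?e = "\<epsilon> a x" and ?L = "christoffel g c x u"
  let ?b = "\<lambda>ws. herm ?e (foldr ?cl ws ?e)"
  note r = regular[OF c] open_U[OF a]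
  have "chart_derivative c (\<lambda>y. ?k * alternator vs (\<lambda>ws. herm (\<epsilon> a y) (foldr (cl g \<Gamma> E a c y) ws (\<epsilon> a y)))) x
    (\<lambda>u. ?k * alternator vs (\<lambda>ws. (\<Sum>j<length ws. ?b (ws[j := christoffel g c x u (ws ! j)])) +
      herm (nabla_spin g \<Gamma> E a c x u \<epsilon>) (foldr ?cl ws ?e) + herm ?e (foldr ?cl ws (nabla_spin g \<Gamma> E a c x u \<epsilon>))))"
    unfolding alternator_def
    by (intro chart_derivative_bounded_linear[OF bounded_linear_mult_right] chart_derivative_sum
        chart_derivative_bounded_linear[OF bounded_linear_scaleR_right]
        herm_foldr_has_derivative[OF a c x] spinor_smooth a c)
  then have "chart_derivative c (\<lambda>y. \<chi>' p c y vs) x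
    (\<lambda>u. ?k * alternator vs (\<lambda>ws. (\<Sum>j<length ws. ?b (ws[j := christoffel g c x u (ws ! j)])) +
      herm (nabla_spin g \<Gamma> E a c x u \<epsilon>) (foldr ?cl ws ?e) + herm ?e (foldr ?cl ws (nabla_spin g \<Gamma> E a c x u \<epsilon>))))"
    by (rule chart_derivative_cong[OF r x, rotated]) (simp add: bilinear_value[OF a c] len)
  from deriv_in_eqI[OF this]
  have d: "deriv_in c (\<lambda>y. \<chi>' p c y vs) x u = ?k * (alternator vs (\<lambda>ws. \<Sum>j<length ws. ?b (ws[j := ?L (ws ! j)])) +
      alternator vs (\<lambda>ws. herm \<delta> (foldr ?cl ws ?e)) + alternator vs (\<lambda>ws. herm ?e (foldr ?cl ws \<delta>)))"
    by (simp only: \<delta>_def alternator_add)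
  \<comment> \<open>Replacing one entry by its Christoffel image commutes with alternation, once all
    entries are summed over.\<close>
  have "alternator vs (\<lambda>ws. \<Sum>j<length ws. ?b (ws[j := ?L (ws ! j)])) =
      (\<Sum>j<length vs. alternator (vs[j := ?L (vs ! j)]) ?b)"
  proof -
    have "alternator vs (\<lambda>ws. \<Sum>j<length ws. ?b (ws[j := ?L (ws ! j)])) =
        (\<Sum>\<sigma> | \<sigma> permutes {..<length vs}. of_int (sign \<sigma>) *\<^sub>R (\<Sum>j<length vs. ?b (permute_list \<sigma> (vs[j := ?L (vs ! j)]))))"
      unfolding alternator_def
      by (intro sum.cong refl) (simp add: sum_permute_list_update[where L = ?L and f = ?b])
    also have "\<dots> = (\<Sum>j<length vs. alternator (vs[j := ?L (vs ! j)]) ?b)"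
      unfolding alternator_def scaleR_sum_right length_list_update by (rule sum.swap)
    finally show ?thesis .
  qed
  moreover have "(\<Sum>j<length vs. \<chi>' p c x (vs[j := ?L (vs ! j)])) = ?k * (\<Sum>j<length vs. alternator (vs[j := ?L (vs ! j)]) ?b)"
    by (simp add: bilinear_value[OF a c x] len sum_distrib_left)
  ultimately have "nabla_form g c x u (\<chi>' p) vs = ?k * (alternator vs (\<lambda>ws. herm \<delta> (foldr ?cl ws ?e)) +
      alternator vs (\<lambda>ws. herm ?e (foldr ?cl ws \<delta>)))"
    unfolding nabla_form_def d by (simp add: distrib_left)
  then show ?thesis
    unfolding K_def sp.alt_prod_def linear_cmul[OF linear_herm_right] alternator_linear[OF linear_herm_right]
    by (simp add: len scaleR_conv_of_real distrib_left add_divide_distrib)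
next
  case False
  then have "\<chi>' p c y ws = 0" if "length ws = length vs" for y ws
    using that by (simp add: spinor_bilinear_def)
  then have "nabla_form g c x u (\<chi>' p) vs = deriv_in c (\<lambda>y. 0) x u" by (simp add: nabla_form_def)
  also have "\<dots> = 0" using x by (intro deriv_in_zero[OF regular[OF c]]) auto
  finally show ?thesis using False by simp
qed

text \<open>At each point a trivialisation is fixed and the parallel equation is solved for the
  Levi-Civita derivative of \<epsilon>; the abstract equation then applies with the two forms built
  from \<eta>.\<close>

lemma hierarchy_bilinear:
  fixes Y :: "('m, 'n) vfield"
  assumes H: "is_real_form A 3 H"
    and parallel: "\<And>a c x v. a \<in> I \<Longrightarrow> c \<in> A \<Longrightarrow> x \<in> U a \<inter> fst c \<Longrightarrow> nabla_hat g \<Gamma> E k1 k2 H a c x v \<epsilon> = 0"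
    and \<kappa>: "\<kappa> = k2 + 6 * k1" and c: "c \<in> A" "x \<in> fst c"
  shows "hierarchy_nabla g \<kappa> H Y \<chi>' p c x vs = contract (Y c x) (hierarchy_P g \<kappa> H \<chi>' p c x) vs +
     wedge 1 (p - 1) (lower (g c x) (Y c x)) (hierarchy_Q g \<kappa> H \<chi>' p c x) vs"
proof -
  have H3: "is_form A 3 H" using H by (simp add: is_real_form_def)
  have H_real: "H c x ws \<in> \<real>" for ws using H c by (simp add: is_real_form_def)
  obtain a where a: "a \<in> I" "x \<in> U a" using cover by blast
  then have x: "x \<in> U a \<inter> fst c" using c by simp
  interpret sp: spinor_pairing "g c x" "cl g \<Gamma> E a c x" "\<lambda>i. E a i c x" by (rule spinor_pairing_at[OF a(1) c(1) x])
  note H3x = is_form_alt[OF H3 c]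
  define \<eta> where "\<eta> = k1 *s sp.cl3f (H c x) (\<epsilon> a x)"
  have cl3: "cl3 \<Gamma> E a c x (H c x) \<psi> = sp.cl3f (H c x) \<psi>" for \<psi>
    by (simp add: cl3_def sp.cl3f_def cl_frame[OF a(1) c(1) x])
  have cl2: "cl2 \<Gamma> E a c x \<omega> \<psi> = sp.cl2f \<omega> \<psi>" for \<omega> \<psi>
    by (simp add: cl2_def sp.cl2f_def cl_frame[OF a(1) c(1) x])
  have \<delta>: "nabla_spin g \<Gamma> E a c x u \<epsilon> = cl g \<Gamma> E a c x u \<eta> - \<kappa> *s sp.cl2f (contract u (H c x)) (\<epsilon> a x)" for u
  proof -
    have "nabla_spin g \<Gamma> E a c x u \<epsilon> + k1 *s (6 *s sp.cl2f (contract u (H c x)) (\<epsilon> a x) -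
        cl g \<Gamma> E a c x u (sp.cl3f (H c x) (\<epsilon> a x))) + k2 *s sp.cl2f (contract u (H c x)) (\<epsilon> a x) = 0"
      using parallel[OF a(1) c(1) x, of u] unfolding nabla_hat_def cl3 cl2 sp.cl3f_cl[OF H3x] .
    then show ?thesis
      unfolding \<eta>_def sp.cl_scale \<kappa>
      by (simp add: vec_eq_iff algebra_simps)
  qed
  have minus2: "minus2 \<chi>' p c x = (if p < 2 then \<lambda>vs. 0 else sp.chi_form (\<epsilon> a x) (p - 2))"
    by (simp add: minus2_def bilinear_eq_chi_form[OF a(1) c(1) x])
  show ?thesis
  proof (rule hierarchy_equation[OF H3 multi_form_bilinear c sp.alt_form_twistor_A sp.alt_form_twistor_B])
    show "sp.twistor_B \<eta> (\<epsilon> a x) p = (\<lambda>vs. 0)" if "p = 0"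
      using that by (simp add: sp.twistor_B_def)
    show "nabla_form g c x u (\<chi>' p) vs
     + 4 * of_real (Im \<kappa>) * ctr (g c x) 2 (contract u (H c x)) (\<chi>' (p + 2) c x) vs
     - 4 * of_real (Re \<kappa>) * int_form (g c x) 2 p (contract u (H c x)) (\<chi>' p c x) vs
     + 4 * of_real (Im \<kappa>) * wedge 2 (p - 2) (contract u (H c x)) (minus2 \<chi>' p c x) vs =
     sp.twistor_A \<eta> (\<epsilon> a x) p (u # vs) + esum (\<lambda>y ws. bil (g c x) u y *\<^sub>R sp.twistor_B \<eta> (\<epsilon> a x) p ws) vs" for u vs
      unfolding minus2 bilinear_eq_chi_form[OF a(1) c(1) x]
      by (rule sp.chi_form_twistor[OF alt_form_contract_3[OF H3x] _ \<delta>])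
        (simp_all add: contract_def H_real nabla_bilinear[OF a(1) c(1) x])
  qed
qed

end

theorem proposition5p4:
  fixes A :: "('m::{t2_space, second_countable_topology}, 'n::finite) chart set"
    and g :: "('m, 'n) metric"
    and \<Gamma> :: "'n \<Rightarrow> complex ^ 's ^ 's::finite"
    and I :: "'a set" and U :: "'a \<Rightarrow> 'm set" and E :: "('a, 'm, 'n) frames"
    and t :: "'a \<Rightarrow> 'a \<Rightarrow> 'm \<Rightarrow> complex ^ 's ^ 's"
    and H :: "('m, 'n) form" and k1 k2 \<kappa> :: complex
    and \<epsilon> :: "('a, 'm, 's) spinor" and chi :: "('m, 'n) mform"
  assumes "smooth_atlas A" and "riemannian_metric A g"
    and "clifford_rep \<Gamma>" and "spin_structure A g \<Gamma> I U E t"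
    and "is_real_form A 3 H"
    and "spinor_field A I U t \<epsilon>"
    and parallel: "\<forall>a\<in>I. \<forall>c\<in>A. \<forall>x\<in>U a \<inter> fst c. \<forall>v. nabla_hat g \<Gamma> E k1 k2 H a c x v \<epsilon> = 0"
    and chi_def: "chi = spinor_bilinear g \<Gamma> I U E \<epsilon>"
    and kappa: "\<kappa> = k2 + 6 * k1"
  shows "covariant_form_hierarchy A g H
           (hierarchy_nabla g \<kappa>) (hierarchy_P g \<kappa>) (hierarchy_Q g \<kappa>) chi
       \<and> (\<forall>p Y. vector_field A Y \<longrightarrow> (\<forall>c\<in>A. \<forall>x\<in>fst c. \<forall>vs.
            nabla_form g c x (Y c x) (chi p) vs
            + 4 * of_real (Im \<kappa>) * vee (g c x) 2 (p + 2) (contract (Y c x) (H c x)) (chi (p + 2) c x) vs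
            - 4 * of_real (Re \<kappa>) * int_form (g c x) 2 p (contract (Y c x) (H c x)) (chi p c x) vs
            + 4 * of_real (Im \<kappa>) * wedge 2 (p - 2) (contract (Y c x) (H c x)) (minus2 chi p c x) vs
            = 1 / (of_nat p + 1) * contract (Y c x) (\<lambda>ws.
                ext_d (chi p) c x ws
                + 4 * of_real (Im \<kappa>) * int_form_adj (g c x) 3 (p + 2) (H c x) (chi (p + 2) c x) ws
                + 8 * of_real (Re \<kappa>) * int_form (g c x) 3 p (H c x) (chi p c x) ws
                + 12 * of_real (Im \<kappa>) * wedge 3 (p - 2) (H c x) (minus2 chi p c x) ws) vs
            - 1 / (of_nat CARD('n) - of_nat p + 1) * wedge 1 (p - 1) (lower (g c x) (Y c x)) (\<lambda>ws.
                codiff g (chi p) c x ws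
                - 12 * of_real (Im \<kappa>) * vee (g c x) 3 (p + 2) (H c x) (chi (p + 2) c x) ws
                + 8 * of_real (Re \<kappa>) * int_form_adj (g c x) 3 p (H c x) (chi p c x) ws
                - 4 * of_real (Im \<kappa>) * int_form (g c x) 3 (p - 2) (H c x) (minus2 chi p c x) ws) vs))"
proof -
  interpret spin_field A g \<Gamma> I U E t \<epsilon>
    using assms(1-4,6)
    by (intro spin_field.intro spin_manifold.intro riemannian.intro spin_manifold_axioms.intro spin_field_axioms.intro)
  have H3: "is_form A 3 H" using assms(5) by (simp add: is_real_form_def)
  have multi: "multi_form A chi" unfolding chi_def by (rule multi_form_bilinear)
  have eq: "hierarchy_nabla g \<kappa> H Y chi p c x vs = contract (Y c x) (hierarchy_P g \<kappa> H chi p c x) vs +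
     wedge 1 (p - 1) (lower (g c x) (Y c x)) (hierarchy_Q g \<kappa> H chi p c x) vs"
    if "c \<in> A" "x \<in> fst c" for Y p c x vs
    unfolding chi_def using parallel that by (intro hierarchy_bilinear[OF assms(5) _ kappa]) auto
  \<comment> \<open>The notion of hierarchy has no \<open>Q\<close> term for \<open>p = 0\<close>,
    whereas the displayed equation keeps a wedge product of truncated degree
    \<open>0 - 1 = 0\<close>. The two agree because every ingredient of \<open>hierarchy_Q\<close>
    vanishes there.\<close>
  have deg0: "wedge 1 (0 - 1) (lower (g c x) (Y c x)) (hierarchy_Q g \<kappa> H chi 0 c x) vs = 0"
    if c: "c \<in> A" "x \<in> fst c" for Y c x vs
  proof -
    have alt: "alt_form q (chi q c x)" for q using multi is_form_alt c by (auto simp: multi_form_def)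
    have "codiff g (chi 0) c x = (\<lambda>ws. 0)"
    proof
      fix ws
      \<comment> \<open>The codifferential evaluates the derivative of a 0-form on at least one
        argument.\<close>
      have "nabla_form g c x u (chi 0) (w # ws) = 0" for u w
        using alt_form_length[OF alt_form_nabla[where \<phi> = "chi 0", OF c], of 0 "w # ws"] multi is_form_smooth c
        by (auto simp: multi_form_def)
      then show "codiff g (chi 0) c x ws = 0" by (simp add: codiff_eq)
    qed
    moreover have "vee (g c x) 3 (0 + 2) (H c x) (chi (0 + 2) c x) = (\<lambda>ws. 0)" by (simp add: vee_def)
    moreover have "int_form_adj (g c x) 3 0 (H c x) (chi 0 c x) = (\<lambda>ws. 0)" by (simp add: int_form_adj_def)
    ultimately have "hierarchy_Q g \<kappa> H chi 0 c x = (\<lambda>ws. 0)"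
      by (simp add: hierarchy_Q_def[abs_def] int_form_0)
    then show ?thesis by simp
  qed
  have "covariant_form_hierarchy A g H (hierarchy_nabla g \<kappa>) (hierarchy_P g \<kappa>) (hierarchy_Q g \<kappa>) chi"
    unfolding covariant_form_hierarchy_def
  proof (intro conjI allI impI ballI)
    fix Y p c x vs assume c: "c \<in> A" "x \<in> fst c"
    show "hierarchy_nabla g \<kappa> H Y chi p c x vs = contract (Y c x) (hierarchy_P g \<kappa> H chi p c x) vs +
        (if p = 0 then 0 else wedge 1 (p - 1) (lower (g c x) (Y c x)) (hierarchy_Q g \<kappa> H chi p c x) vs)"
      using eq[OF c, of Y p vs] deg0[OF c, of Y vs] by (cases "p = 0") auto
  qed (use multi form_connection_hierarchy[OF H3] is_form_hierarchy_P[OF H3] is_form_hierarchy_Q[OF H3] in auto)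
  moreover have "contract v (hierarchy_P g \<kappa> H chi p c x) vs = 1 / (of_nat p + 1) * contract v (\<lambda>ws.
      ext_d (chi p) c x ws
      + 4 * of_real (Im \<kappa>) * int_form_adj (g c x) 3 (p + 2) (H c x) (chi (p + 2) c x) ws
      + 8 * of_real (Re \<kappa>) * int_form (g c x) 3 p (H c x) (chi p c x) ws
      + 12 * of_real (Im \<kappa>) * wedge 3 (p - 2) (H c x) (minus2 chi p c x) ws) vs" for v p c x vs
    unfolding contract_def hierarchy_P_def ..
  moreover have "wedge 1 (p - 1) \<alpha> (hierarchy_Q g \<kappa> H chi p c x) vs =
      - (1 / (of_nat CARD('n) - of_nat p + 1) * wedge 1 (p - 1) \<alpha> (\<lambda>ws.
      codiff g (chi p) c x ws
      - 12 * of_real (Im \<kappa>) * vee (g c x) 3 (p + 2) (H c x) (chi (p + 2) c x) ws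
      + 8 * of_real (Re \<kappa>) * int_form_adj (g c x) 3 p (H c x) (chi p c x) ws
      - 4 * of_real (Im \<kappa>) * int_form (g c x) 3 (p - 2) (H c x) (minus2 chi p c x) ws) vs)" for \<alpha> p c x vs
    unfolding hierarchy_Q_def[abs_def] wedge_mult_right by (simp only: mult_minus_left)
  ultimately show ?thesis
    using eq unfolding hierarchy_nabla_def by simp
qed

end
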